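(* Let $0<\alpha<2\gamma+d$ and let $f\in A_k(\mathbb{R}^d)$ with $f\ge 0$. For $x\in\mathbb{R}^d$ put $$\Psi(x)=\int_0^{+\infty}s^{\gamma+\frac{d-\alpha}{2}-1}\int_{\mathbb{R}^d}f(y)\,\tau_x(e^{-s\|\cdot\|^2})(y)\,(1+\|y\|)^{2\gamma+d-\alpha}\,d\nu_k(y)\,ds\in[0,+\infty].$$ Then $I_\alpha^kf(x)=O(\|x\|^{\alpha-(2\gamma+d)})$ as $\|x\|\to+\infty$ if and only if $\Psi$ is bounded on $\mathbb{R}^d$.
   Context: Setting (Dunkl theory). $G\subset O(\mathbb{R}^d)$ is a finite reflection group with root system $R$, $R_+$ a positive subsystem, and $k:R\to[0,+\infty)$ a $G$-invariant multiplicity function. Put $\gamma=\sum_{\xi\in R_+}k(\xi)$, $w_k(x)=\prod_{\xi\in R_+}|\langle\xi,x\rangle|^{2k(\xi)}$, $d\nu_k(x)=w_k(x)\,dx$, $c_k=\big(\int_{\mathbb{R}^d}e^{-\|x\|^2/2}w_k(x)\,dx\big)^{-1}$, and $L^p_k(\mathbb{R}^d)=L^p(\mathbb{R}^d,d\nu_k)$. Dunkl operators: for smooth $f$, $T_jf(x)=\frac{\partial f}{\partial x_j}(x)+\sum_{\xi\in R_+}k(\xi)\,\xi_j\,\frac{f(x)-f(\rho_\xi x)}{\langle\xi,x\rangle}$, $1\le j\le d$, where $\rho_\xi$ is the reflection in the hyperplane orthogonal to $\xi$ and $\xi_j=\langle \xi,e_j\rangle$. Dunkl kernel: for $y\in\mathbb{C}^d$,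 $E_k(\cdot,y)$ is the unique analytic solution on $\mathbb{R}^d$ of $T_ju=y_ju$ ($1\le j\le d$), $u(0)=1$; it extends holomorphically to $\mathbb{C}^d\times\mathbb{C}^d$. Dunkl transform: $\mathcal{F}_k(f)(x)=c_k\int_{\mathbb{R}^d}f(y)E_k(-ix,y)\,d\nu_k(y)$ for $f\in L^1_k(\mathbb{R}^d)$. Let $A_k(\mathbb{R}^d)=\{f\in L^1_k(\mathbb{R}^d):\mathcal{F}_k(f)\in L^1_k(\mathbb{R}^d)\}$. Dunkl translation: for $x\in\mathbb{R}^d$ and $f\in\mathcal{S}(\mathbb{R}^d)$, $\tau_xf$ is the Schwartz function with $\mathcal{F}_k(\tau_xf)(\xi)=E_k(-ix,\xi)\mathcal{F}_k(f)(\xi)$ (so for $k\equiv0$, $\tau_xf(y)=f(y-x)$). In particular this defines $\tau_x(e^{-s\|\cdot\|^2})$ for $s>0$, which takes values in $[0,1]$. Riesz potential: for $0<\alpha<2\gamma+d$ and $f\in\mathcal{S}(\mathbb{R}^d)$, $$I_\alpha^kf(x)=2^{\gamma+\frac d2-\alpha}\frac{\Gamma(\gamma+\frac{d-\alpha}{2})}{\Gamma(\frac\alpha2)}\int_{\mathbb{R}^d}\frac{\tau_yf(x)}{\|y\|^{2\gamma+d-\alpha}}\,d\nu_k(y).$$ For $f\in A_k(\mathbb{R}^d)$, $I_\alpha^kf$ is understood through the representation $$I_\alpha^kf(x)=\frac{2^{\gamma+\frac d2-\alpha}}{\Gamma(\frac\alpha2)}\int_0^{+\infty}s^{\gamma+\frac{d-\alpha}{2}-1}\int_{\mathbb{R}^d}f(y)\,\tau_x(e^{-s\|\cdot\|^2})(y)\,d\nu_k(y)\,ds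 .$$ *)

theory Defs
  imports "HOL-Analysis.Analysis" "HOL-Library.Landau_Symbols"
begin

section \<open>Root systems and multiplicity functions\<close>

definition reflection :: "real^'n \<Rightarrow> real^'n \<Rightarrow> real^'n" where
  "reflection \<xi> x = x - (2 * (\<xi> \<bullet> x) / (\<xi> \<bullet> \<xi>)) *\<^sub>R \<xi>"

definition root_system :: "(real^'n) set \<Rightarrow> bool" where
  "root_system R \<longleftrightarrow> finite R \<and> 0 \<notin> R \<and>
     (\<forall>\<xi>\<in>R. R \<inter> range (\<lambda>t. t *\<^sub>R \<xi>) = {\<xi>, - \<xi>}) \<and>
     (\<forall>\<xi>\<in>R. reflection \<xi> ` R = R)"

definition positive_subsystem :: "(real^'n) set \<Rightarrow> (real^'n) set \<Rightarrow> bool" where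
  "positive_subsystem R Rp \<longleftrightarrow>
     (\<exists>\<beta>. (\<forall>\<xi>\<in>R. \<xi> \<bullet> \<beta> \<noteq> 0) \<and> Rp = {\<xi>\<in>R. \<xi> \<bullet> \<beta> > 0})"

text \<open>Reflections in roots are involutions, so closing under composition with them already gives a group.\<close>

inductive_set reflection_group :: "(real^'n) set \<Rightarrow> (real^'n \<Rightarrow> real^'n) set"
  for R :: "(real^'n) set" where
  one: "id \<in> reflection_group R"
| step: "g \<in> reflection_group R \<Longrightarrow> \<xi> \<in> R \<Longrightarrow> reflection \<xi> \<circ> g \<in> reflection_group R"

definition multiplicity_function :: "(real^'n) set \<Rightarrow> (real^'n \<Rightarrow> real) \<Rightarrow> bool" where
  "multiplicity_function R k \<longleftrightarrow>
     (\<forall>\<xi>\<in>R. k \<xi> \<ge> 0) \<and> (\<forall>g\<in>reflection_group R. \<forall>\<xi>\<in>R. k (g \<xi>) = k \<xi>)"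

definition dunkl_gamma :: "(real^'n) set \<Rightarrow> (real^'n \<Rightarrow> real) \<Rightarrow> real" where
  "dunkl_gamma Rp k = (\<Sum>\<xi>\<in>Rp. k \<xi>)"

text \<open>For \<open>k \<xi> = 0\<close> the convention \<open>0 powr 0 = 0\<close> spoils the value of the weight only
  on the null set where \<open>\<xi> \<bullet> x = 0\<close>, so it does not affect the measure.\<close>

definition dunkl_weight :: "(real^'n) set \<Rightarrow> (real^'n \<Rightarrow> real) \<Rightarrow> real^'n \<Rightarrow> real" where
  "dunkl_weight Rp k x = (\<Prod>\<xi>\<in>Rp. \<bar>\<xi> \<bullet> x\<bar> powr (2 * k \<xi>))"

definition dunkl_measure :: "(real^'n) set \<Rightarrow> (real^'n \<Rightarrow> real) \<Rightarrow> (real^'n) measure" where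
  "dunkl_measure Rp k = density lborel (\<lambda>x. ennreal (dunkl_weight Rp k x))"

definition dunkl_const :: "(real^'n) set \<Rightarrow> (real^'n \<Rightarrow> real) \<Rightarrow> real" where
  "dunkl_const Rp k = inverse (LINT x|dunkl_measure Rp k. exp (- (norm x)\<^sup>2 / 2))"


section \<open>Dunkl operators and the Dunkl kernel\<close>

definition dir_deriv :: "real^'n \<Rightarrow> (real^'n \<Rightarrow> complex) \<Rightarrow> real^'n \<Rightarrow> complex" where
  "dir_deriv v f x = vector_derivative (\<lambda>t. f (x + t *\<^sub>R v)) (at 0)"

text \<open>The difference quotient \<open>(f x - f (\<rho>\<^sub>\<xi> x)) / \<langle>\<xi>, x\<rangle>\<close> has a removable
  singularity on the hyperplane \<open>\<langle>\<xi>, x\<rangle> = 0\<close>. As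
  \<open>\<rho>\<^sub>\<xi> x = x - (2 \<langle>\<xi>, x\<rangle> / \<langle>\<xi>, \<xi>\<rangle>) \<xi>\<close>, its limit there is
  \<open>2 / \<langle>\<xi>, \<xi>\<rangle>\<close> times the derivative of \<open>f\<close> in direction \<open>\<xi>\<close>.\<close>

definition reflection_quotient :: "real^'n \<Rightarrow> (real^'n \<Rightarrow> complex) \<Rightarrow> real^'n \<Rightarrow> complex" where
  "reflection_quotient \<xi> f x =
     (if \<xi> \<bullet> x = 0 then (2 / (\<xi> \<bullet> \<xi>)) *\<^sub>R dir_deriv \<xi> f x
      else (f x - f (reflection \<xi> x)) / complex_of_real (\<xi> \<bullet> x))"

definition dunkl_op ::
  "(real^'n) set \<Rightarrow> (real^'n \<Rightarrow> real) \<Rightarrow> 'n \<Rightarrow> (real^'n \<Rightarrow> complex) \<Rightarrow> real^'n \<Rightarrow> complex" where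
  "dunkl_op Rp k j f x =
     dir_deriv (axis j 1) f x + (\<Sum>\<xi>\<in>Rp. (k \<xi> * \<xi> $ j) *\<^sub>R reflection_quotient \<xi> f x)"

text \<open>Real analyticity on the whole space: at each point, expansion into an absolutely
  convergent power series, indexed by multi-indices \<open>m\<close>.\<close>

definition analytic_real :: "(real^'n \<Rightarrow> complex) \<Rightarrow> bool" where
  "analytic_real u \<longleftrightarrow> (\<forall>a. \<exists>r>0. \<exists>c :: ('n \<Rightarrow> nat) \<Rightarrow> complex. \<forall>x\<in>ball a r.
     ((\<lambda>m. c m * complex_of_real (\<Prod>i\<in>UNIV. (x $ i - a $ i) ^ m i)) has_sum u x) UNIV)"

definition dunkl_kernel_real ::
  "(real^'n) set \<Rightarrow> (real^'n \<Rightarrow> real) \<Rightarrow> complex^'n \<Rightarrow> real^'n \<Rightarrow> complex" where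
  "dunkl_kernel_real Rp k y = (THE u. analytic_real u \<and>
     (\<forall>j x. dunkl_op Rp k j u x = y $ j * u x) \<and> u 0 = 1)"

definition complex_vec :: "real^'n \<Rightarrow> complex^'n" where
  "complex_vec x = (\<chi> j. complex_of_real (x $ j))"

text \<open>Joint holomorphy on the product: Frechet differentiable with complex-linear derivative.\<close>

definition holomorphic_pair :: "(complex^'n \<Rightarrow> complex^'n \<Rightarrow> complex) \<Rightarrow> bool" where
  "holomorphic_pair E \<longleftrightarrow> (\<forall>p. \<exists>D.
     ((\<lambda>(z, w). E z w) has_derivative D) (at p) \<and>
     (\<forall>c z w. D (c *s z, c *s w) = c * D (z, w)))"

definition dunkl_kernel ::
  "(real^'n) set \<Rightarrow> (real^'n \<Rightarrow> real) \<Rightarrow> complex^'n \<Rightarrow> complex^'n \<Rightarrow> complex" where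
  "dunkl_kernel Rp k = (THE E. holomorphic_pair E \<and>
     (\<forall>x y. E (complex_vec x) y = dunkl_kernel_real Rp k y x))"


section \<open>Dunkl transform and translation\<close>

definition dunkl_transform ::
  "(real^'n) set \<Rightarrow> (real^'n \<Rightarrow> real) \<Rightarrow> (real^'n \<Rightarrow> complex) \<Rightarrow> real^'n \<Rightarrow> complex" where
  "dunkl_transform Rp k f x = complex_of_real (dunkl_const Rp k) *
     (LINT y|dunkl_measure Rp k. f y * dunkl_kernel Rp k ((- \<i>) *s complex_vec x) (complex_vec y))"

definition dunkl_A ::
  "(real^'n) set \<Rightarrow> (real^'n \<Rightarrow> real) \<Rightarrow> (real^'n \<Rightarrow> complex) set" where
  "dunkl_A Rp k = {f. integrable (dunkl_measure Rp k) f \<and>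
     integrable (dunkl_measure Rp k) (dunkl_transform Rp k f)}"

primrec iter_partial :: "'n list \<Rightarrow> (real^'n \<Rightarrow> complex) \<Rightarrow> real^'n \<Rightarrow> complex" where
  "iter_partial [] f = f"
| "iter_partial (j # js) f = dir_deriv (axis j 1) (iter_partial js f)"

definition schwartz :: "(real^'n \<Rightarrow> complex) set" where
  "schwartz = {f. \<forall>js. (\<forall>x. iter_partial js f differentiable (at x)) \<and>
     (\<forall>N::nat. bounded (range (\<lambda>x. (1 + norm x) ^ N *\<^sub>R iter_partial js f x)))}"

definition dunkl_translation ::
  "(real^'n) set \<Rightarrow> (real^'n \<Rightarrow> real) \<Rightarrow> real^'n \<Rightarrow> (real^'n \<Rightarrow> complex) \<Rightarrow> real^'n \<Rightarrow> complex" where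
  "dunkl_translation Rp k x f = (THE h. h \<in> schwartz \<and>
     (\<forall>\<xi>. dunkl_transform Rp k h \<xi> =
        dunkl_kernel Rp k ((- \<i>) *s complex_vec x) (complex_vec \<xi>) * dunkl_transform Rp k f \<xi>))"

definition gaussian :: "real \<Rightarrow> real^'n \<Rightarrow> complex" where
  "gaussian s y = complex_of_real (exp (- s * (norm y)\<^sup>2))"


section \<open>Riesz potential\<close>

definition riesz_potential ::
  "(real^'n) set \<Rightarrow> (real^'n \<Rightarrow> real) \<Rightarrow> real \<Rightarrow> (real^'n \<Rightarrow> complex) \<Rightarrow> real^'n \<Rightarrow> complex" where
  "riesz_potential Rp k \<alpha> f x =
     complex_of_real (2 powr (dunkl_gamma Rp k + real CARD('n) / 2 - \<alpha>) / Gamma (\<alpha> / 2)) *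
     (LINT s:{0<..}|lborel. s powr (dunkl_gamma Rp k + (real CARD('n) - \<alpha>) / 2 - 1) *\<^sub>R
        (LINT y|dunkl_measure Rp k. f y * dunkl_translation Rp k x (gaussian s) y))"

text \<open>The translated Gaussian takes values in \<open>[0, 1]\<close>; \<open>Re\<close> is only a coercion.\<close>

definition riesz_Psi ::
  "(real^'n) set \<Rightarrow> (real^'n \<Rightarrow> real) \<Rightarrow> real \<Rightarrow> (real^'n \<Rightarrow> real) \<Rightarrow> real^'n \<Rightarrow> ennreal" where
  "riesz_Psi Rp k \<alpha> f x =
     (\<integral>\<^sup>+ s\<in>{0<..}. ennreal (s powr (dunkl_gamma Rp k + (real CARD('n) - \<alpha>) / 2 - 1)) *
        (\<integral>\<^sup>+ y. ennreal (f y * Re (dunkl_translation Rp k x (gaussian s) y) *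
            (1 + norm y) powr (2 * dunkl_gamma Rp k + real CARD('n) - \<alpha>)) \<partial>dunkl_measure Rp k)
      \<partial>lborel)"

end

theory Submission imports Defs "HOL-Complex_Analysis.Complex_Analysis"
begin

text \<open>The Dunkl kernel \<open>E\<close> is the series of homogeneous polynomials \<open>E\<^sub>n\<close> determined by the
  Euler-type relation \<open>(n + \<gamma>) E\<^sub>n(z, w) - \<Sum>\<^sub>\<xi> k(\<xi>) E\<^sub>n(\<rho>\<^sub>\<xi> z, w) = \<langle>z, w\<rangle> E\<^sub>n\<^sub>-\<^sub>1(z, w)\<close>,
  which is solved by averaging over the reflection group. Along rays, the functions
  \<open>t \<mapsto> E(t g z, w)\<close>, with \<open>g\<close> in the group, satisfy a linear system singular at \<open>0\<close>; energy
  estimates for it give uniqueness of the kernel, \<open>E \<ge> 0\<close> on real arguments and boundedness on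
  imaginary ones. Integration by parts for the weight, applied to Gaussian integrals of products
  of two kernels, leads to the same kind of system and identifies the translated Gaussian with the
  heat kernel \<open>exp(- s (|x|\<^sup>2 + |y|\<^sup>2)) E(2 s x, y)\<close>, which therefore lies between \<open>0\<close> and
  \<open>exp(- s (|x| - |y|)\<^sup>2)\<close>.

  Put \<open>\<kappa> = 2 \<gamma> + d - \<alpha>\<close>. Where \<open>|x|\<close> and \<open>|y|\<close> differ by a factor \<open>2\<close>, this bound makes the
  integral of the heat kernel in \<open>s\<close> at most a multiple of \<open>max(|x|, |y|) powr - \<kappa>\<close>, and such \<open>y\<close>
  contribute at most a multiple of the \<open>L\<^sup>1\<close> norm of \<open>f\<close>; elsewhere \<open>|x|\<close> and \<open>|y|\<close> are
  comparable. Hence \<open>\<Psi>\<close> and \<open>|x| powr \<kappa>\<close> times the Riesz potential control each other for large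
  \<open>x\<close>. The potential itself is bounded, since the smoothed \<open>f\<close> is at most the minimum of its
  \<open>L\<^sup>1\<close> norm and a multiple of \<open>s powr - (\<gamma> + d / 2)\<close>, the latter because the Dunkl transform
  of \<open>f\<close> is integrable.\<close>

section \<open>Reflections and the reflection group\<close>

text \<open>Contracting the Dunkl equations with \<open>x\<close> removes the difference quotients:
  the factor \<open>\<xi> \<bullet> x\<close> cancels the denominator, and what remains is an
  ordinary differential equation along the ray through \<open>x\<close>, coupled to the rays through
  its reflections. This is why the arguments run over the finite orbit of a point. In the resulting
  systems the diagonal carries \<open>n + gam\<close> (along rays, \<open>- gam / t\<close>) against
  off-diagonal weights \<open>k \<xi>\<close> with sum \<open>gam\<close>; this dominance gives
  uniqueness, preservation of positivity and bounds by the initial values. No intertwining operator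
  and no representing measure of the kernel is involved. The price is that the series is built from
  the radial relation alone, and the full Dunkl system has to be recovered from it, which is
  \<open>TE_eq_PE\<close>. The translation is given by a definite description over Schwartz
  functions. Hence neither integral of the theorem can be touched before the heat kernel is known to
  be Schwartz and the Dunkl transform to be injective on Schwartz functions.\<close>

lemma reflection_linear: "linear (reflection \<xi>)"
  unfolding reflection_def
  by (rule linearI) (auto simp: algebra_simps inner_simps add_divide_distrib)

lemma reflection_minus [simp]: "reflection (- \<xi>) = reflection \<xi>"
  by (auto simp: reflection_def fun_eq_iff)

lemma reflection_reflection [simp]: "reflection \<xi> (reflection \<xi> x) = x"
proof (cases "\<xi> = 0")
  case False
  then have "\<xi> \<bullet> \<xi> \<noteq> 0" by simp
  then show ?thesis by (simp add: reflection_def inner_simps field_simps)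
qed (simp add: reflection_def)

lemma reflection_inner: "reflection \<xi> x \<bullet> reflection \<xi> y = x \<bullet> y"
proof (cases "\<xi> = 0")
  case False
  then have "\<xi> \<bullet> \<xi> \<noteq> 0" by simp
  then show ?thesis
    by (simp add: reflection_def inner_simps inner_commute field_simps power2_eq_square)
qed (simp add: reflection_def)

lemma reflection_norm [simp]: "norm (reflection \<xi> x) = norm x"
  by (simp add: norm_eq_sqrt_inner reflection_inner)

lemma reflection_inner_left: "reflection \<xi> x \<bullet> y = x \<bullet> reflection \<xi> y"
  by (metis reflection_inner reflection_reflection)

lemma reflection_root: "\<xi> \<noteq> 0 \<Longrightarrow> reflection \<xi> \<xi> = - \<xi>"
  by (simp add: reflection_def scaleR_2)

lemma reflection_neg: "reflection \<xi> (- x) = - reflection \<xi> x"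
  using linear_neg[OF reflection_linear] by blast

text \<open>Conjugating the reflection in \<open>\<eta>\<close> by that in \<open>\<xi>\<close>
  gives the reflection in the reflected root. The identity is written without inverses, reflections
  being involutions.\<close>

lemma reflection_conjugate:
  "reflection (reflection \<xi> \<eta>) (reflection \<xi> x) = reflection \<xi> (reflection \<eta> x)"
  unfolding reflection_def[of "reflection \<xi> \<eta>"] reflection_def[of \<eta>]
  by (simp add: reflection_inner linear_diff[OF reflection_linear] linear_scale[OF reflection_linear])

section \<open>The complex bilinear form (not Hermitian, so that the kernel is holomorphic) and
  complexified maps\<close>

definition cinner :: "complex^'n \<Rightarrow> complex^'n \<Rightarrow> complex" where
  "cinner z w = (\<Sum>j\<in>UNIV. z $ j * w $ j)"

text \<open>For linear \<open>g\<close> this is the complex-linear extension. It lets the real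
  reflection group act on the complex arguments of the kernel.\<close>

definition complexify :: "(real^'n \<Rightarrow> real^'n) \<Rightarrow> complex^'n \<Rightarrow> complex^'n" where
  "complexify g z = complex_vec (g (\<chi> i. Re (z $ i))) + \<i> *s complex_vec (g (\<chi> i. Im (z $ i)))"

lemma complex_vec_nth [simp]: "complex_vec x $ i = complex_of_real (x $ i)"
  by (simp add: complex_vec_def)

lemma complex_vec_simps [simp]:
  "complex_vec 0 = 0" "complex_vec (x + y) = complex_vec x + complex_vec y"
  "complex_vec (r *\<^sub>R x) = r *\<^sub>R complex_vec x"
  "complex_vec (- x) = - complex_vec x" "complex_vec (x - y) = complex_vec x - complex_vec y"
  by (simp_all add: vec_eq_iff scaleR_conv_of_real[where 'a = complex])

lemma bounded_linear_complex_vec: "bounded_linear complex_vec"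
proof (rule linear_conv_bounded_linear[THEN iffD1], rule linearI)
qed simp_all

lemma norm_complex_vec [simp]: "norm (complex_vec x) = norm x"
  by (simp add: norm_vec_def)

lemma cinner_commute: "cinner z w = cinner w z"
  by (simp add: cinner_def mult.commute)

lemma cinner_simps [simp]:
  "cinner (z + z') w = cinner z w + cinner z' w"
  "cinner w (z + z') = cinner w z + cinner w z'"
  "cinner (a *s z) w = a * cinner z w" "cinner z (a *s w) = a * cinner z w"
  "cinner (r *\<^sub>R z) w = r *\<^sub>R cinner z w" "cinner z (r *\<^sub>R w) = r *\<^sub>R cinner z w"
  "cinner 0 w = 0" "cinner z 0 = 0"
  "cinner (- z) w = - cinner z w" "cinner z (- w) = - cinner z w"
  "cinner (z - z') w = cinner z w - cinner z' w"
  "cinner w (z - z') = cinner w z - cinner w z'"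
  by (simp_all add: cinner_def algebra_simps sum.distrib sum_distrib_left scaleR_sum_right
      sum_negf sum_subtractf)

lemma cinner_complex_vec [simp]:
  "cinner (complex_vec x) (complex_vec y) = complex_of_real (x \<bullet> y)"
  by (simp add: cinner_def inner_vec_def)

lemma norm_cinner_le: "norm (cinner z w) \<le> norm z * norm w"
proof -
  have "norm (cinner z w) \<le> (\<Sum>j\<in>UNIV. \<bar>norm (z $ j)\<bar> * \<bar>norm (w $ j)\<bar>)"
    unfolding cinner_def by (rule norm_sum[THEN order_trans]) (simp add: norm_mult)
  also have "\<dots> \<le> norm z * norm w"
    unfolding norm_vec_def by (rule L2_set_mult_ineq)
  finally show ?thesis .
qed

lemma bounded_bilinear_cinner: "bounded_bilinear cinner"
  by (rule bounded_bilinear.intro) (auto intro!: exI[of _ 1] simp: norm_cinner_le)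

lemma cinner_axis: "cinner (complex_vec (axis j 1)) w = w $ j"
proof -
  have "cinner (complex_vec (axis j 1)) w = (\<Sum>i\<in>UNIV. if i = j then w $ i else 0)"
    unfolding cinner_def by (rule sum.cong) (auto simp: axis_def)
  then show ?thesis by simp
qed

lemma scaleR_eq_smult: "r *\<^sub>R (z :: complex^'n) = complex_of_real r *s z"
  by (simp add: vec_eq_iff scaleR_conv_of_real[where 'a = complex])

lemma norm_smult_complex: "norm (a *s (z :: complex^'n)) = norm a * norm z"
  by (simp add: norm_vec_def norm_mult L2_set_right_distrib[symmetric])

lemma complexify_id [simp]: "complexify id z = z" "complexify (\<lambda>x. x) z = z"
  by (simp_all add: complexify_def vec_eq_iff complex_eq_iff)

lemma Re_complexify: "(\<chi> i. Re (complexify g z $ i)) = g (\<chi> i. Re (z $ i))"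
  and Im_complexify: "(\<chi> i. Im (complexify g z $ i)) = g (\<chi> i. Im (z $ i))"
  by (simp_all add: complexify_def vec_eq_iff)

lemma complexify_comp: "complexify (g \<circ> h) z = complexify g (complexify h z)"
  unfolding complexify_def[of "g \<circ> h"] complexify_def[of g] by (simp add: Re_complexify Im_complexify)

lemma complexify_complex_vec [simp]: "linear g \<Longrightarrow> complexify g (complex_vec x) = complex_vec (g x)"
  by (simp add: complexify_def zero_vec_def[symmetric] linear_0)

lemma complexify_add: "linear g \<Longrightarrow> complexify g (z + w) = complexify g z + complexify g w"
proof -
  assume g: "linear g"
  have 1: "(\<chi> i. Re ((z + w) $ i)) = (\<chi> i. Re (z $ i)) + (\<chi> i. Re (w $ i))"
    and 2: "(\<chi> i. Im ((z + w) $ i)) = (\<chi> i. Im (z $ i)) + (\<chi> i. Im (w $ i))"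
    by (simp_all add: vec_eq_iff)
  show ?thesis unfolding complexify_def 1 2 linear_add[OF g] by (simp add: vec_eq_iff algebra_simps)
qed

lemma complexify_smult: "linear g \<Longrightarrow> complexify g (a *s z) = a *s complexify g z"
proof -
  assume g: "linear g"
  have 1: "(\<chi> i. Re ((a *s z) $ i)) = Re a *\<^sub>R (\<chi> i. Re (z $ i)) - Im a *\<^sub>R (\<chi> i. Im (z $ i))"
    and 2: "(\<chi> i. Im ((a *s z) $ i)) = Re a *\<^sub>R (\<chi> i. Im (z $ i)) + Im a *\<^sub>R (\<chi> i. Re (z $ i))"
    by (simp_all add: vec_eq_iff)
  show ?thesis
    unfolding complexify_def 1 2 linear_add[OF g] linear_diff[OF g] linear_scale[OF g]
    by (simp add: vec_eq_iff complex_eq_iff)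
qed

lemma complexify_scaleR: "linear g \<Longrightarrow> complexify g (r *\<^sub>R z) = r *\<^sub>R complexify g z"
  by (simp add: scaleR_eq_smult complexify_smult)

lemma complexify_linear: "linear g \<Longrightarrow> linear (complexify g)"
  by (rule linearI) (simp_all add: complexify_add complexify_scaleR)

lemma norm_complexify:
  assumes "\<And>x. norm (g x) = norm x"
  shows "norm (complexify g z) = norm z"
proof -
  have *: "(norm v)\<^sup>2 = (norm (\<chi> i. Re (v $ i)))\<^sup>2 + (norm (\<chi> i. Im (v $ i)))\<^sup>2" for v :: "complex^'n"
    by (simp add: norm_vec_def L2_set_def sum_nonneg real_sqrt_pow2 sum.distrib[symmetric] cmod_power2)
  have "(norm (complexify g z))\<^sup>2 = (norm z)\<^sup>2"
    unfolding *[of "complexify g z"] *[of z] Re_complexify Im_complexify assms ..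
  then show ?thesis by (simp add: power2_eq_iff_nonneg)
qed

lemma complex_vec_decompose: "(z :: complex^'n) = complex_vec (\<chi> i. Re (z $ i)) + \<i> *s complex_vec (\<chi> i. Im (z $ i))"
  by (simp add: vec_eq_iff complex_eq_iff)

lemma cinner_complexify:
  assumes g: "linear g" "\<And>x y. g x \<bullet> g y = x \<bullet> y"
  shows "cinner (complexify g z) (complexify g w) = cinner z w"
proof -
  have "cinner (complexify g (complex_vec a + \<i> *s complex_vec b)) (complexify g (complex_vec c + \<i> *s complex_vec d))
     = cinner (complex_vec a + \<i> *s complex_vec b) (complex_vec c + \<i> *s complex_vec d)" for a b c d
    using g by (simp add: complexify_add complexify_smult)
  then show ?thesis using complex_vec_decompose[of z] complex_vec_decompose[of w] by metis
qed

section \<open>Roots, multiplicities and the finite reflection group\<close>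

locale dunkl =
  fixes R Rp :: "(real^'n) set" and k :: "real^'n \<Rightarrow> real"
  assumes R: "root_system R" and Rp: "positive_subsystem R Rp" and k: "multiplicity_function R k"
begin

abbreviation "gam \<equiv> dunkl_gamma Rp k"
abbreviation "G \<equiv> reflection_group R"

lemma finite_R [simp]: "finite R" and zero_notin_R: "0 \<notin> R"
  using R by (auto simp: root_system_def)

lemma R_nonzero: "\<xi> \<in> R \<Longrightarrow> \<xi> \<noteq> 0" "\<xi> \<in> R \<Longrightarrow> \<xi> \<bullet> \<xi> \<noteq> 0"
  using zero_notin_R by auto

lemma R_neg: "\<xi> \<in> R \<Longrightarrow> - \<xi> \<in> R"
  using R by (fastforce simp: root_system_def)

lemma R_reflection: "\<xi> \<in> R \<Longrightarrow> \<eta> \<in> R \<Longrightarrow> reflection \<xi> \<eta> \<in> R"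
  using R by (auto simp: root_system_def)

lemma Rp_R: "\<xi> \<in> Rp \<Longrightarrow> \<xi> \<in> R" and finite_Rp [simp]: "finite Rp"
  using Rp finite_subset[OF _ finite_R, of Rp] by (auto simp: positive_subsystem_def)

lemma Rp_neg: "\<xi> \<in> R \<Longrightarrow> - \<xi> \<in> Rp \<longleftrightarrow> \<xi> \<notin> Rp"
proof -
  obtain \<beta> where "\<forall>\<xi>\<in>R. \<xi> \<bullet> \<beta> \<noteq> 0" "Rp = {\<xi>\<in>R. \<xi> \<bullet> \<beta> > 0}"
    using Rp by (auto simp: positive_subsystem_def)
  then show "\<xi> \<in> R \<Longrightarrow> - \<xi> \<in> Rp \<longleftrightarrow> \<xi> \<notin> Rp"
    using R_neg by (force simp: not_less order.order_iff_strict)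
qed

lemma Rp_cases: "\<xi> \<in> R \<Longrightarrow> \<xi> \<in> Rp \<or> - \<xi> \<in> Rp"
  using Rp_neg by blast

lemma k_nonneg: "\<xi> \<in> R \<Longrightarrow> 0 \<le> k \<xi>"
  using k by (simp add: multiplicity_function_def)

lemma gam_nonneg: "0 \<le> gam"
  by (simp add: dunkl_gamma_def sum_nonneg k_nonneg Rp_R)

lemma reflection_in_G: "\<xi> \<in> R \<Longrightarrow> reflection \<xi> \<in> G"
  using reflection_group.step[OF reflection_group.one] by fastforce

lemma k_reflection: "\<xi> \<in> R \<Longrightarrow> \<eta> \<in> R \<Longrightarrow> k (reflection \<xi> \<eta>) = k \<eta>"
  using k reflection_in_G by (auto simp: multiplicity_function_def)

lemma k_neg: "\<xi> \<in> R \<Longrightarrow> k (- \<xi>) = k \<xi>"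
  using k_reflection[of \<xi> \<xi>] reflection_root R_nonzero by force

text \<open>A reflection does not preserve \<open>Rp\<close>. Correcting the sign turns it into a
  permutation of \<open>Rp\<close>, so that sums and products over \<open>Rp\<close> of even
  functions of the root are invariant under reflections.\<close>

definition flip :: "real^'n \<Rightarrow> real^'n \<Rightarrow> real^'n" where
  "flip \<xi> \<eta> = (if reflection \<xi> \<eta> \<in> Rp then reflection \<xi> \<eta> else - reflection \<xi> \<eta>)"

lemma flip_bij:
  assumes "\<xi> \<in> R" shows "bij_betw (flip \<xi>) Rp Rp"
proof (rule bij_betwI[where g = "flip \<xi>"])
  show maps: "flip \<xi> \<in> Rp \<rightarrow> Rp"
  proof (rule Pi_I)
    fix \<eta> assume "\<eta> \<in> Rp"
    then show "flip \<xi> \<eta> \<in> Rp"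
      using Rp_cases[OF R_reflection[OF assms Rp_R, of \<eta>]] by (auto simp: flip_def)
  qed
  show "flip \<xi> \<in> Rp \<rightarrow> Rp" by (rule maps)
  have *: "flip \<xi> (flip \<xi> \<eta>) = \<eta>" if "\<eta> \<in> Rp" for \<eta>
    using that Rp_neg[of \<eta>] Rp_R[of \<eta>] by (auto simp: flip_def reflection_neg)
  show "flip \<xi> (flip \<xi> \<eta>) = \<eta>" "flip \<xi> (flip \<xi> \<eta>) = \<eta>" if "\<eta> \<in> Rp" for \<eta>
    using * that by auto
qed

lemma sum_flip:
  assumes "\<xi> \<in> R" and "\<And>\<eta>. \<eta> \<in> R \<Longrightarrow> \<phi> (- \<eta>) = \<phi> \<eta>"
  shows "(\<Sum>\<eta>\<in>Rp. \<phi> (reflection \<xi> \<eta>)) = sum \<phi> Rp"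
proof -
  have "(\<Sum>\<eta>\<in>Rp. \<phi> (reflection \<xi> \<eta>)) = (\<Sum>\<eta>\<in>Rp. \<phi> (flip \<xi> \<eta>))"
    by (rule sum.cong) (auto simp: flip_def assms R_reflection Rp_R)
  then show ?thesis using sum.reindex_bij_betw[OF flip_bij[OF assms(1)], of \<phi>] by simp
qed

lemma prod_flip:
  assumes "\<xi> \<in> R" and "\<And>\<eta>. \<eta> \<in> R \<Longrightarrow> \<phi> (- \<eta>) = \<phi> \<eta>"
  shows "(\<Prod>\<eta>\<in>Rp. \<phi> (reflection \<xi> \<eta>)) = prod \<phi> Rp"
proof -
  have "(\<Prod>\<eta>\<in>Rp. \<phi> (reflection \<xi> \<eta>)) = (\<Prod>\<eta>\<in>Rp. \<phi> (flip \<xi> \<eta>))"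
    by (rule prod.cong) (auto simp: flip_def assms R_reflection Rp_R)
  then show ?thesis using prod.reindex_bij_betw[OF flip_bij[OF assms(1)], of \<phi>] by simp
qed

text \<open>\<open>G_fix\<close> says that the group acts trivially on the orthogonal complement of
  the roots; \<open>finite_G\<close> needs this to recover an element from its action on
  \<open>R\<close>.\<close>

lemma G_props:
  assumes "g \<in> G"
  shows G_linear: "linear g" and G_inner: "g x \<bullet> g y = x \<bullet> y" and G_R: "\<eta> \<in> R \<Longrightarrow> g \<eta> \<in> R"
    and G_fix: "(\<And>\<eta>. \<eta> \<in> R \<Longrightarrow> \<eta> \<bullet> x = 0) \<Longrightarrow> g x = x"
  using assms
proof (induction arbitrary: x y \<eta>)
  case (step g \<xi>)
  { case 1 show ?case by (rule linear_compose[OF step(3) reflection_linear]) }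
  { case 2 show ?case using step by (simp add: reflection_inner) }
  { case 3 then show ?case using step by (simp add: R_reflection) }
  { case 4 then show ?case using step by (simp add: reflection_def) }
qed (auto simp: linear_id)

lemma G_norm: "g \<in> G \<Longrightarrow> norm (g x) = norm x"
  by (simp add: norm_eq_sqrt_inner G_inner)

lemma complexify_G:
  assumes "g \<in> G"
  shows "complexify g (a *s z) = a *s complexify g z" "complexify g (z + w) = complexify g z + complexify g w"
    "norm (complexify g z) = norm z" "complexify g (complex_vec x) = complex_vec (g x)"
    "complexify g (r *\<^sub>R z) = r *\<^sub>R complexify g z"
  using assms by (simp_all add: G_linear complexify_smult complexify_add norm_complexify G_norm complexify_scaleR)

lemma complexify_reflection:
  "complexify (reflection \<xi>) (a *s z) = a *s complexify (reflection \<xi>) z"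
  "complexify (reflection \<xi>) (z + w) = complexify (reflection \<xi>) z + complexify (reflection \<xi>) w"
  "norm (complexify (reflection \<xi>) z) = norm z"
  "complexify (reflection \<xi>) (complex_vec x) = complex_vec (reflection \<xi> x)"
  "complexify (reflection \<xi>) (r *\<^sub>R z) = r *\<^sub>R complexify (reflection \<xi>) z"
  by (simp_all add: reflection_linear complexify_smult complexify_add norm_complexify complexify_scaleR)

lemma complexify_reflection_twice [simp]:
  "complexify (reflection \<xi>) (complexify (reflection \<xi>) z) = z"
proof -
  have "reflection \<xi> \<circ> reflection \<xi> = id" by auto
  then show ?thesis using complexify_comp[of "reflection \<xi>" "reflection \<xi>" z] by simp
qed

lemma complexify_reflection_conjugate:
  "complexify (reflection (reflection \<xi> \<eta>)) (complexify (reflection \<xi>) z)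
    = complexify (reflection \<xi>) (complexify (reflection \<eta>) z)"
proof -
  have "reflection (reflection \<xi> \<eta>) \<circ> reflection \<xi> = reflection \<xi> \<circ> reflection \<eta>"
    by (auto simp: reflection_conjugate)
  then show ?thesis by (metis complexify_comp)
qed

text \<open>An element is determined by its restriction to \<open>R\<close>: by linearity on the
  span of \<open>R\<close>, and because it is the identity on the orthogonal complement. So
  \<open>G\<close> embeds into the finite set of maps from \<open>R\<close> to
  \<open>R\<close>.\<close>

lemma finite_G [simp]: "finite G"
proof -
  have "inj_on (\<lambda>g. restrict g R) G"
  proof (rule inj_onI)
    fix g h assume g: "g \<in> G" and h: "h \<in> G" and "restrict g R = restrict h R"
    then have eq: "g \<eta> = h \<eta>" if "\<eta> \<in> R" for \<eta> using that by (metis restrict_apply')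
    show "g = h"
    proof
      fix x
      obtain a b where a: "a \<in> span R" and b: "\<And>w. w \<in> span R \<Longrightarrow> orthogonal b w" and x: "x = a + b"
        using orthogonal_subspace_decomp_exists[of R x] by metis
      have "g a = h a" by (rule linear_eq_on_span[OF G_linear[OF g] G_linear[OF h] eq a])
      moreover have "g b = b" "h b = b"
        using b by (auto intro!: G_fix g h simp: orthogonal_def inner_commute span_base)
      ultimately show "g x = h x" using x by (simp add: linear_add G_linear g h)
    qed
  qed
  moreover have "(\<lambda>g. restrict g R) ` G \<subseteq> R \<rightarrow>\<^sub>E R" using G_R by auto
  ultimately show ?thesis by (meson finite_PiE finite_R finite_subset inj_on_finite)
qed

lemma id_in_G [simp]: "id \<in> G" by (rule reflection_group.one)

lemma G_nonempty [simp]: "G \<noteq> {}" using id_in_G by blast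

lemma G_left: "\<xi> \<in> R \<Longrightarrow> g \<in> G \<Longrightarrow> reflection \<xi> \<circ> g \<in> G" by (rule reflection_group.step)

text \<open>The inductive definition multiplies by reflections on the left only, whereas the
  recursions of \<open>wt\<close> and \<open>cf\<close> multiply on the right.\<close>

lemma G_right: "\<xi> \<in> R \<Longrightarrow> g \<in> G \<Longrightarrow> g \<circ> reflection \<xi> \<in> G"
proof (rotate_tac 1, induction rule: reflection_group.induct)
  case one then show ?case by (simp add: reflection_in_G)
next
  case (step g \<eta>) then show ?case using G_left[of \<eta> "g \<circ> reflection \<xi>"] by (simp only: o_assoc)
qed

lemma sum_G_left:
  assumes "\<xi> \<in> R" shows "(\<Sum>g\<in>G. \<phi> (reflection \<xi> \<circ> g)) = sum \<phi> G"
  by (rule sum.reindex_bij_witness[where i = "\<lambda>g. reflection \<xi> \<circ> g" and j = "\<lambda>g. reflection \<xi> \<circ> g"])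
    (use assms G_left in \<open>auto simp: fun_eq_iff\<close>)

lemma sum_G_right:
  assumes "\<xi> \<in> R" shows "(\<Sum>g\<in>G. \<phi> (g \<circ> reflection \<xi>)) = sum \<phi> G"
  by (rule sum.reindex_bij_witness[where i = "\<lambda>g. g \<circ> reflection \<xi>" and j = "\<lambda>g. g \<circ> reflection \<xi>"])
    (use assms G_right in \<open>auto simp: fun_eq_iff\<close>)

text \<open>Diagonal dominance: after summing norms over the group, the right-hand side contributes
  at most \<open>gam\<close> times the total and the left-hand side \<open>a + gam\<close> times it.
  This is the uniqueness principle behind all identities between homogeneous polynomials
  below.\<close>

lemma G_system_zero:
  fixes F :: "(real^'n \<Rightarrow> real^'n) \<Rightarrow> complex"
  assumes "0 < a" and F: "\<And>g. g \<in> G \<Longrightarrow> of_real (a + gam) * F g = (\<Sum>\<xi>\<in>Rp. k \<xi> * F (reflection \<xi> \<circ> g))"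
    and "g \<in> G"
  shows "F g = 0"
proof -
  have "(a + gam) * (\<Sum>g\<in>G. norm (F g)) = (\<Sum>g\<in>G. norm (of_real (a + gam) * F g))"
    using gam_nonneg \<open>0 < a\<close> by (simp add: norm_mult sum_distrib_left del: of_real_add)
  also have "\<dots> \<le> (\<Sum>g\<in>G. \<Sum>\<xi>\<in>Rp. k \<xi> * norm (F (reflection \<xi> \<circ> g)))"
    by (auto simp: F norm_mult k_nonneg Rp_R simp del: of_real_add intro!: sum_mono sum_norm_le)
  also have "\<dots> = (\<Sum>\<xi>\<in>Rp. k \<xi> * (\<Sum>g\<in>G. norm (F (reflection \<xi> \<circ> g))))"
    by (subst sum.swap) (simp add: sum_distrib_left)
  also have "\<dots> = (\<Sum>\<xi>\<in>Rp. k \<xi> * (\<Sum>g\<in>G. norm (F g)))"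
    by (intro sum.cong refl arg_cong2[where f = "(*)"] sum_G_left) (simp add: Rp_R)
  also have "\<dots> = gam * (\<Sum>g\<in>G. norm (F g))"
    by (simp add: dunkl_gamma_def sum_distrib_right)
  finally have "a * (\<Sum>g\<in>G. norm (F g)) \<le> 0" by (simp add: algebra_simps)
  then have "(\<Sum>g\<in>G. norm (F g)) \<le> 0" using \<open>0 < a\<close> by (simp add: mult_le_0_iff)
  then have "(\<Sum>g\<in>G. norm (F g)) = 0" by (simp add: sum_nonneg order.antisym)
  then show ?thesis using \<open>g \<in> G\<close> by (simp add: sum_nonneg_eq_0_iff)
qed

section \<open>The Dunkl kernel\<close>

text \<open>In the group algebra, \<open>cf n\<close> is the Neumann series of the inverse of
  \<open>n + gam - (\<Sum>\<xi>\<in>Rp. k \<xi> \<cdot> reflection \<xi>)\<close>; \<open>wt m\<close> is the \<open>m\<close>-th power of the subtracted sum.\<close>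

primrec wt :: "nat \<Rightarrow> (real^'n \<Rightarrow> real^'n) \<Rightarrow> real" where
  "wt 0 h = (if h = id then 1 else 0)"
| "wt (Suc m) h = (\<Sum>\<xi>\<in>Rp. k \<xi> * wt m (h \<circ> reflection \<xi>))"

lemma wt_nonneg: "0 \<le> wt m h"
  by (induction m arbitrary: h) (auto intro!: sum_nonneg mult_nonneg_nonneg simp: k_nonneg Rp_R)

text \<open>Replacing each group element by 1 is multiplicative and sends every factor of the power
  to \<open>gam\<close>.\<close>

lemma wt_sum: "(\<Sum>h\<in>G. wt m h) = gam ^ m"
proof (induction m)
  case 0 show ?case by simp
next
  case (Suc m)
  have "(\<Sum>h\<in>G. wt (Suc m) h) = (\<Sum>\<xi>\<in>Rp. k \<xi> * (\<Sum>h\<in>G. wt m (h \<circ> reflection \<xi>)))"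
    by (simp, subst sum.swap) (simp add: sum_distrib_left)
  also have "\<dots> = (\<Sum>\<xi>\<in>Rp. k \<xi> * gam ^ m)"
    by (intro sum.cong refl arg_cong2[where f = "(*)"]) (simp add: sum_G_right Rp_R Suc)
  finally show ?case by (simp add: dunkl_gamma_def sum_distrib_right)
qed

lemma wt_le: "h \<in> G \<Longrightarrow> wt m h \<le> gam ^ m"
  using member_le_sum[of h G "wt m"] by (simp add: wt_nonneg wt_sum)

definition cf :: "nat \<Rightarrow> (real^'n \<Rightarrow> real^'n) \<Rightarrow> real" where
  "cf n h = (\<Sum>m. wt m h / (real n + gam) ^ Suc m)"

text \<open>Comparison with the geometric series of ratio \<open>gam / (n + gam)\<close>. The
  assumption \<open>0 < n\<close> is essential: for \<open>n = 0\<close> the element to be inverted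
  annihilates the sum of all group elements.\<close>

lemma cf_summable:
  assumes "0 < n" "h \<in> G" shows "summable (\<lambda>m. wt m h / (real n + gam) ^ Suc m)"
proof (rule summable_comparison_test')
  have pos: "0 < real n + gam" using assms gam_nonneg by linarith
  show "summable (\<lambda>m. inverse (real n + gam) * (gam / (real n + gam)) ^ m)"
    using pos assms gam_nonneg by (intro summable_mult summable_geometric) (simp add: field_simps)
  show "norm (wt m h / (real n + gam) ^ Suc m) \<le> inverse (real n + gam) * (gam / (real n + gam)) ^ m" for m
  proof -
    have "wt m h / (real n + gam) ^ Suc m \<le> gam ^ m / (real n + gam) ^ Suc m"
      using pos wt_le[OF assms(2), of m] by (intro divide_right_mono) auto
    moreover have "norm (wt m h / (real n + gam) ^ Suc m) = wt m h / (real n + gam) ^ Suc m"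
      using pos wt_nonneg[of m h] by simp
    moreover have "inverse (real n + gam) * (gam / (real n + gam)) ^ m = gam ^ m / (real n + gam) ^ Suc m"
      by (simp add: power_divide inverse_eq_divide)
    ultimately show ?thesis by simp
  qed
qed

lemma cf_nonneg: "0 < n \<Longrightarrow> h \<in> G \<Longrightarrow> 0 \<le> cf n h"
  unfolding cf_def using gam_nonneg by (intro suminf_nonneg cf_summable) (auto simp: wt_nonneg)

text \<open>The Neumann series times the element that it inverts: its head \<open>wt 0\<close> is
  the identity of the group algebra, and its tail is the series again with one more factor.\<close>

lemma cf_rec:
  assumes "0 < n" "h \<in> G"
  shows "(real n + gam) * cf n h = (if h = id then 1 else 0) + (\<Sum>\<xi>\<in>Rp. k \<xi> * cf n (h \<circ> reflection \<xi>))"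
proof -
  let ?q = "real n + gam"
  have pos: "0 < ?q" using assms gam_nonneg by linarith
  have "cf n h = wt 0 h / ?q + (\<Sum>m. wt (Suc m) h / ?q ^ Suc (Suc m))"
    unfolding cf_def using suminf_split_head[OF cf_summable[OF assms]] by simp
  also have "(\<Sum>m. wt (Suc m) h / ?q ^ Suc (Suc m))
      = (\<Sum>m. (\<Sum>\<xi>\<in>Rp. (k \<xi> / ?q) * (wt m (h \<circ> reflection \<xi>) / ?q ^ Suc m)))"
    by (rule arg_cong[where f = suminf]) (simp add: fun_eq_iff sum_divide_distrib field_simps)
  also have "\<dots> = (\<Sum>\<xi>\<in>Rp. (\<Sum>m. (k \<xi> / ?q) * (wt m (h \<circ> reflection \<xi>) / ?q ^ Suc m)))"
    by (intro suminf_sum summable_mult cf_summable G_right) (auto simp: assms Rp_R)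
  also have "\<dots> = (\<Sum>\<xi>\<in>Rp. (k \<xi> / ?q) * cf n (h \<circ> reflection \<xi>))"
    unfolding cf_def by (intro sum.cong refl suminf_mult cf_summable G_right) (auto simp: assms Rp_R)
  finally show ?thesis using pos by (simp add: sum_distrib_left distrib_left)
qed

text \<open>Setting all group elements to 1 turns the inverted element into \<open>n\<close>. Since
  the coefficients are nonnegative, averaging with \<open>cf n\<close> costs a factor
  \<open>1 / n\<close>; these factors accumulate to the factorials in all bounds that
  follow.\<close>

lemma cf_sum: assumes "0 < n" shows "(\<Sum>h\<in>G. cf n h) = 1 / real n"
proof -
  have "(real n + gam) * (\<Sum>h\<in>G. cf n h)
     = (\<Sum>h\<in>G. (if h = id then 1 else 0) + (\<Sum>\<xi>\<in>Rp. k \<xi> * cf n (h \<circ> reflection \<xi>)))"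
    by (simp add: sum_distrib_left cf_rec[OF assms])
  also have "\<dots> = 1 + (\<Sum>\<xi>\<in>Rp. k \<xi> * (\<Sum>h\<in>G. cf n (h \<circ> reflection \<xi>)))"
    by (simp add: sum.distrib, subst sum.swap) (simp add: sum_distrib_left)
  also have "(\<Sum>\<xi>\<in>Rp. k \<xi> * (\<Sum>h\<in>G. cf n (h \<circ> reflection \<xi>))) = gam * (\<Sum>h\<in>G. cf n h)"
    unfolding dunkl_gamma_def sum_distrib_right
    by (rule sum.cong[OF refl]) (simp add: sum_G_right[where \<phi> = "cf n"] Rp_R)
  finally show ?thesis using assms by (simp add: field_simps)
qed

text \<open>Degree \<open>Suc n\<close> is obtained by applying the inverse
  \<open>cf (Suc n)\<close> to \<open>cinner z w * En n z w\<close>. For \<open>k = 0\<close> only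
  the identity survives and \<open>En n z w\<close> is
  \<open>cinner z w ^ n / fact n\<close>.\<close>

primrec En :: "nat \<Rightarrow> complex^'n \<Rightarrow> complex^'n \<Rightarrow> complex" where
  "En 0 z w = 1"
| "En (Suc n) z w = (\<Sum>g\<in>G. cf (Suc n) g * (cinner (complexify g z) w * En n (complexify g z) w))"

text \<open>The degree \<open>Suc n\<close> part of the Dunkl equations contracted with
  \<open>z\<close>, where Euler's identity for homogeneous functions has replaced the gradient by
  the factor \<open>Suc n\<close>.\<close>

lemma En_Suc_euler:
  "of_real (real (Suc n) + gam) * En (Suc n) z w
    = cinner z w * En n z w + (\<Sum>\<xi>\<in>Rp. k \<xi> * En (Suc n) (complexify (reflection \<xi>) z) w)"
proof -
  define \<phi> where "\<phi> g = cinner (complexify g z) w * En n (complexify g z) w" for g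
  have right: "En (Suc n) (complexify (reflection \<xi>) z) w = (\<Sum>g\<in>G. cf (Suc n) (g \<circ> reflection \<xi>) * \<phi> g)"
    if "\<xi> \<in> Rp" for \<xi>
  proof -
    have "En (Suc n) (complexify (reflection \<xi>) z) w
       = (\<Sum>g\<in>G. cf (Suc n) (g \<circ> reflection \<xi> \<circ> reflection \<xi>) * \<phi> (g \<circ> reflection \<xi>))"
      unfolding o_assoc[symmetric]
      by (simp only: \<phi>_def complexify_comp En.simps) (simp add: o_def)
    also have "\<dots> = (\<Sum>g\<in>G. cf (Suc n) (g \<circ> reflection \<xi>) * \<phi> g)"
      by (rule sum_G_right[where \<phi> = "\<lambda>g. cf (Suc n) (g \<circ> reflection \<xi>) * \<phi> g"]) (simp add: that Rp_R)
    finally show ?thesis .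
  qed
  have "of_real (real (Suc n) + gam) * En (Suc n) z w
     = (\<Sum>g\<in>G. of_real ((real (Suc n) + gam) * cf (Suc n) g) * \<phi> g)"
    by (simp only: En.simps sum_distrib_left \<phi>_def of_real_mult mult.assoc)
  also have "\<dots> = (\<Sum>g\<in>G. (if g = id then \<phi> g else 0) + (\<Sum>\<xi>\<in>Rp. k \<xi> * (cf (Suc n) (g \<circ> reflection \<xi>) * \<phi> g)))"
    by (rule sum.cong[OF refl], subst cf_rec) (auto simp: distrib_right sum_distrib_right mult.assoc)
  also have "\<dots> = \<phi> id + (\<Sum>\<xi>\<in>Rp. k \<xi> * (\<Sum>g\<in>G. cf (Suc n) (g \<circ> reflection \<xi>) * \<phi> g))"
    by (simp add: sum.distrib, subst sum.swap) (simp add: sum_distrib_left)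
  also have "\<dots> = \<phi> id + (\<Sum>\<xi>\<in>Rp. k \<xi> * En (Suc n) (complexify (reflection \<xi>) z) w)"
    using right by (simp del: En.simps)
  finally show ?thesis by (simp add: \<phi>_def)
qed

lemma En_smult_left: "En n (a *s z) w = a ^ n * En n z w"
  by (induction n arbitrary: z) (auto simp: complexify_G sum_distrib_left mult_ac intro!: sum.cong)

lemma En_smult_right: "En n z (a *s w) = a ^ n * En n z w"
  by (induction n arbitrary: z) (auto simp: complexify_G sum_distrib_left mult_ac intro!: sum.cong)

lemma En_bound: "norm (En n z w) \<le> (norm z * norm w) ^ n / fact n"
proof (induction n arbitrary: z)
  case (Suc n)
  have "norm (En (Suc n) z w) \<le> (\<Sum>g\<in>G. cf (Suc n) g * ((norm z * norm w) * ((norm z * norm w) ^ n / fact n)))"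
    unfolding En.simps
  proof (rule sum_norm_le)
    fix g assume g: "g \<in> G"
    show "norm (cf (Suc n) g * (cinner (complexify g z) w * En n (complexify g z) w))
        \<le> cf (Suc n) g * ((norm z * norm w) * ((norm z * norm w) ^ n / fact n))"
      unfolding norm_mult norm_of_real
      using norm_cinner_le[of "complexify g z" w] Suc.IH[of "complexify g z"] g
      by (intro mult_mono) (auto simp: cf_nonneg complexify_G)
  qed
  also have "\<dots> = (norm z * norm w) ^ Suc n / fact (Suc n)"
    unfolding sum_distrib_right[symmetric] cf_sum[OF zero_less_Suc] by (simp add: field_simps)
  finally show ?case .
qed simp

text \<open>The difference of the two sides solves the homogeneous system of
  \<open>G_system_zero\<close>, because conjugation by the reflection in \<open>\<eta>\<close>
  permutes the reflections in the positive roots and preserves \<open>k\<close>.\<close>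

lemma En_reflection:
  assumes \<eta>: "\<eta> \<in> R"
  shows "En n (complexify (reflection \<eta>) z) (complexify (reflection \<eta>) w) = En n z w"
proof (induction n arbitrary: z)
  case (Suc n)
  let ?\<rho> = "\<lambda>\<xi>. complexify (reflection \<xi>)"
  define d where "d z = En (Suc n) (?\<rho> \<eta> z) (?\<rho> \<eta> w) - En (Suc n) z w" for z
  have ci: "cinner (?\<rho> \<eta> z) (?\<rho> \<eta> w) = cinner z w" for z
    by (rule cinner_complexify) (auto simp: reflection_linear reflection_inner)
  have d: "of_real (real (Suc n) + gam) * d z = (\<Sum>\<xi>\<in>Rp. k \<xi> * d (?\<rho> \<xi> z))" for z
  proof -
    have "(\<Sum>\<xi>\<in>Rp. k \<xi> * En (Suc n) (?\<rho> \<xi> (?\<rho> \<eta> z)) (?\<rho> \<eta> w))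
      = (\<Sum>\<xi>\<in>Rp. k (reflection \<eta> \<xi>) * En (Suc n) (?\<rho> (reflection \<eta> \<xi>) (?\<rho> \<eta> z)) (?\<rho> \<eta> w))"
      by (rule sum_flip[symmetric, where \<phi> = "\<lambda>\<xi>. k \<xi> * En (Suc n) (?\<rho> \<xi> (?\<rho> \<eta> z)) (?\<rho> \<eta> w)"])
        (auto simp: \<eta> k_neg)
    also have "\<dots> = (\<Sum>\<xi>\<in>Rp. k \<xi> * En (Suc n) (?\<rho> \<eta> (?\<rho> \<xi> z)) (?\<rho> \<eta> w))"
      by (intro sum.cong refl) (simp add: k_reflection \<eta> Rp_R complexify_reflection_conjugate)
    finally have "of_real (real (Suc n) + gam) * En (Suc n) (?\<rho> \<eta> z) (?\<rho> \<eta> w)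
       = cinner z w * En n z w + (\<Sum>\<xi>\<in>Rp. k \<xi> * En (Suc n) (?\<rho> \<eta> (?\<rho> \<xi> z)) (?\<rho> \<eta> w))"
      by (subst En_Suc_euler) (simp add: ci Suc.IH)
    then show ?thesis
      unfolding d_def right_diff_distrib En_Suc_euler[of n z w] sum_subtractf by simp
  qed
  \<comment> \<open>The system lives on the orbit of \<open>z\<close>; evaluation at
    \<open>id\<close> returns to \<open>z\<close>.\<close>
  have "d (complexify id z) = 0"
  proof (rule G_system_zero[where F = "\<lambda>g. d (complexify g z)" and a = "real (Suc n)"])
    show "of_real (real (Suc n) + gam) * d (complexify g z)
        = (\<Sum>\<xi>\<in>Rp. k \<xi> * d (complexify (reflection \<xi> \<circ> g) z))" for g
      unfolding complexify_comp by (rule d)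
  qed auto
  then show ?case by (simp add: d_def)
qed simp

lemma En_reflection_left:
  "\<eta> \<in> R \<Longrightarrow> En n (complexify (reflection \<eta>) z) w = En n z (complexify (reflection \<eta>) w)"
  using En_reflection[of \<eta> n z "complexify (reflection \<eta>) w"] by simp

text \<open>By \<open>En_reflection_left\<close> a reflection may be moved to the other argument, so
  the function with swapped arguments obeys the same Euler relation, and
  \<open>G_system_zero\<close> applies to the difference.\<close>

lemma En_commute: "En n z w = En n w z"
proof (induction n arbitrary: z)
  case (Suc n)
  let ?\<rho> = "\<lambda>\<xi>. complexify (reflection \<xi>)"
  define d where "d z = En (Suc n) z w - En (Suc n) w z" for z
  have d: "of_real (real (Suc n) + gam) * d z = (\<Sum>\<xi>\<in>Rp. k \<xi> * d (?\<rho> \<xi> z))" for z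
    unfolding d_def right_diff_distrib En_Suc_euler[of n z w] En_Suc_euler[of n w z] sum_subtractf Suc.IH
    by (simp add: En_reflection_left Rp_R cinner_commute[of z w] del: En.simps)
  have "d (complexify id z) = 0"
  proof (rule G_system_zero[where F = "\<lambda>g. d (complexify g z)" and a = "real (Suc n)"])
    show "of_real (real (Suc n) + gam) * d (complexify g z)
        = (\<Sum>\<xi>\<in>Rp. k \<xi> * d (complexify (reflection \<xi> \<circ> g) z))" for g
      unfolding complexify_comp by (rule d)
  qed auto
  then show ?case by (simp add: d_def)
qed simp

lemma En_real: "En n (complex_vec x) (complex_vec y) \<in> \<real>"
  by (induction n arbitrary: x) (auto intro!: sum_in_Reals Reals_mult simp: complexify_G)

end

section \<open>Termwise differentiation of series, and the squared negative part\<close>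

lemma series_has_derivative:
  fixes f :: "nat \<Rightarrow> 'a::real_normed_vector \<Rightarrow> 'b::banach"
  assumes S: "open S" "convex S"
    and der: "\<And>n x. x \<in> S \<Longrightarrow> (f n has_derivative f' n x) (at x)"
    and bound: "\<And>n x h. x \<in> S \<Longrightarrow> norm (f' n x h) \<le> M n * norm h"
    and M: "summable M" and f: "\<And>x. x \<in> S \<Longrightarrow> summable (\<lambda>n. f n x)" and x: "x \<in> S"
  shows "((\<lambda>x. \<Sum>n. f n x) has_derivative (\<lambda>h. \<Sum>n. f' n x h)) (at x)"
proof -
  have sf: "summable (\<lambda>n. norm (f' n x h))" if "x \<in> S" for x h
    by (rule summable_comparison_test'[OF summable_mult2[OF M, of "norm h"]]) (simp add: bound that)
  have "\<exists>g. \<forall>x\<in>S. (\<lambda>n. f n x) sums g x \<and> (g has_derivative (\<lambda>h. \<Sum>n. f' n x h)) (at x within S)"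
  proof (rule has_derivative_series[where f = f and f' = f' and g' = "\<lambda>x h. \<Sum>n. f' n x h", OF S(2) _ _ x summable_sums[OF f[OF x]]])
    show "(f n has_derivative f' n x) (at x within S)" if "x \<in> S" for n x
      using der[OF that] by (rule has_derivative_at_withinI)
    fix e :: real assume "0 < e"
    obtain N where N: "\<And>n. n \<ge> N \<Longrightarrow> norm (\<Sum>i. M (i + n)) < e"
      using suminf_exist_split[OF \<open>0 < e\<close> M] by auto
    show "\<forall>\<^sub>F n in sequentially. \<forall>x\<in>S. \<forall>h. norm ((\<Sum>i<n. f' i x h) - (\<Sum>n. f' n x h)) \<le> e * norm h"
      unfolding eventually_sequentially
    proof (intro exI allI impI ballI)
      fix n x h assume "N \<le> n" "x \<in> S"
      have "norm ((\<Sum>i<n. f' i x h) - (\<Sum>n. f' n x h)) = norm (\<Sum>i. f' (i + n) x h)"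
        using suminf_minus_initial_segment[OF summable_norm_cancel[OF sf[OF \<open>x \<in> S\<close>, of h]], of n]
        by (simp add: norm_minus_commute)
      also have "\<dots> \<le> (\<Sum>i. norm (f' (i + n) x h))"
        by (rule summable_norm) (use summable_ignore_initial_segment[OF sf[OF \<open>x \<in> S\<close>]] in simp)
      also have "\<dots> \<le> (\<Sum>i. M (i + n) * norm h)"
        by (intro suminf_le bound \<open>x \<in> S\<close> summable_mult2 summable_ignore_initial_segment[OF M]
            summable_ignore_initial_segment[OF sf])
      also have "\<dots> = (\<Sum>i. M (i + n)) * norm h"
        by (rule suminf_mult2[symmetric, OF summable_ignore_initial_segment[OF M]])
      also have "\<dots> \<le> e * norm h"
        using N[OF \<open>N \<le> n\<close>] by (intro mult_right_mono) auto
      finally show "norm ((\<Sum>i<n. f' i x h) - (\<Sum>n. f' n x h)) \<le> e * norm h" .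
    qed
  qed
  then obtain g where g: "\<And>x. x \<in> S \<Longrightarrow> (\<lambda>n. f n x) sums g x"
    "\<And>x. x \<in> S \<Longrightarrow> (g has_derivative (\<lambda>h. \<Sum>n. f' n x h)) (at x within S)" by blast
  have "(g has_derivative (\<lambda>h. \<Sum>n. f' n x h)) (at x)"
    using g(2)[OF x] at_within_open[OF x S(1)] by simp
  then show ?thesis
    by (rule has_derivative_transform_within_open[OF _ S(1) x]) (use g(1) sums_unique in metis)
qed

text \<open>The squared negative part is differentiable also at 0, which makes it a usable energy
  for detecting negative values in \<open>energy_nonneg\<close>.\<close>

lemma DERIV_min_zero_squared:
  "((\<lambda>x::real. (min x 0)\<^sup>2) has_real_derivative 2 * min x 0) (at x)"
proof -
  consider "x < 0" | "x > 0" | "x = 0" by linarith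
  then show ?thesis
  proof cases
    case 1
    show ?thesis
      by (rule has_field_derivative_transform_within_open[of "\<lambda>x. x\<^sup>2" _ _ "{..<0}"])
        (use 1 in \<open>auto intro!: derivative_eq_intros\<close>)
  next
    case 2
    show ?thesis
      by (rule has_field_derivative_transform_within_open[of "\<lambda>x. 0" _ _ "{0<..}"])
        (use 2 in \<open>auto intro!: derivative_eq_intros\<close>)
  next
    case 3
    have "((\<lambda>h::real. (min h 0)\<^sup>2 / h) \<longlongrightarrow> 0) (at 0)"
    proof (rule Lim_null_comparison)
      show "\<forall>\<^sub>F h in at (0::real). norm ((min h 0)\<^sup>2 / h) \<le> \<bar>h\<bar>"
        by (rule always_eventually) (auto simp: min_def power2_eq_square)
      show "((\<lambda>h::real. \<bar>h\<bar>) \<longlongrightarrow> 0) (at 0)" by (auto intro!: tendsto_eq_intros)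
    qed
    then show ?thesis using 3 by (simp add: DERIV_def)
  qed
qed

section \<open>The kernel as a convergent series, and energy estimates along rays\<close>

context dunkl
begin

text \<open>The candidate for the Dunkl kernel; the definite descriptions are resolved to it in
  \<open>dunkl_kernel_real_eq\<close> and \<open>dunkl_kernel_eq\<close>.\<close>

definition EE :: "complex^'n \<Rightarrow> complex^'n \<Rightarrow> complex" where
  "EE z w = (\<Sum>n. En n z w)"

lemma summable_power_fact: "summable (\<lambda>n. (x::real) ^ n / fact n)"
  using summable_exp[of x] by (simp add: divide_inverse mult.commute)

lemma suminf_power_fact: "(\<Sum>n. (x::real) ^ n / fact n) = exp x"
  by (simp add: exp_def divide_inverse mult.commute)

lemma En_norm_summable: "summable (\<lambda>n. norm (En n z w))"
  by (rule summable_comparison_test'[OF summable_power_fact]) (use En_bound in simp)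

lemma En_summable: "summable (\<lambda>n. En n z w)"
  using En_norm_summable by (rule summable_norm_cancel)

lemma norm_EE_le: "norm (EE z w) \<le> exp (norm z * norm w)"
proof -
  have "norm (EE z w) \<le> (\<Sum>n. norm (En n z w))"
    unfolding EE_def by (rule summable_norm[OF En_norm_summable])
  also have "\<dots> \<le> (\<Sum>n. (norm z * norm w) ^ n / fact n)"
    by (intro suminf_le En_bound En_norm_summable summable_power_fact)
  finally show ?thesis by (simp add: suminf_power_fact)
qed

lemma EE_commute: "EE z w = EE w z"
  unfolding EE_def using En_commute by metis

lemma EE_smult: "EE (a *s z) w = EE z (a *s w)"
  by (simp add: EE_def En_smult_left En_smult_right)

lemma EE_reflection: "\<xi> \<in> R \<Longrightarrow> EE (complexify (reflection \<xi>) z) w = EE z (complexify (reflection \<xi>) w)"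
  by (simp add: EE_def En_reflection_left)

lemma EE_0_left [simp]: "EE 0 w = 1"
proof -
  have "En n 0 w = (if n = 0 then 1 else 0)" for n
    using En_smult_left[of n 0 0 w] by (cases n) (auto simp del: En.simps(2))
  then have "EE 0 w = (\<Sum>n. if n = 0 then 1 else 0)" unfolding EE_def by presburger
  also have "\<dots> = 1" using suminf_finite[of "{0}" "\<lambda>n::nat. if n = 0 then 1 else (0::complex)"] by simp
  finally show ?thesis .
qed

lemma EE_0_right [simp]: "EE z 0 = 1"
  using EE_commute[of z 0] by simp

lemma EE_series: "EE (t *s z) w = (\<Sum>n. En n z w * t ^ n)"
  by (simp add: EE_def En_smult_left mult.commute)

lemma En_series_summable: "summable (\<lambda>n. En n z w * t ^ n)"
  using En_summable[of "t *s z" w] by (simp add: En_smult_left mult.commute)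

text \<open>\<open>En_Suc_euler\<close> summed against \<open>t ^ Suc n\<close>. The equation is
  stated for \<open>t * D\<close> because the system for \<open>D\<close> has the coefficient
  \<open>- gam / t\<close>, singular at the starting point \<open>t = 0\<close>.\<close>

lemma EE_ray:
  obtains D where "((\<lambda>t. EE (t *s z) w) has_field_derivative D) (at t)"
    "t * D = (t * cinner z w - gam) * EE (t *s z) w
        + (\<Sum>\<xi>\<in>Rp. k \<xi> * EE (t *s complexify (reflection \<xi>) z) w)"
proof
  let ?\<rho> = "\<lambda>\<xi>. complexify (reflection \<xi>)"
  define D where "D = (\<Sum>n. diffs (\<lambda>n. En n z w) n * t ^ n)"
  show "((\<lambda>t. EE (t *s z) w) has_field_derivative D) (at t)"
    unfolding EE_series D_def by (rule termdiffs_strong_converges_everywhere[OF En_series_summable])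
  have sums: "(\<lambda>n. En (Suc n) z w * t ^ Suc n) sums (EE (t *s z) w - 1)" for z
    using sums_Suc_iff[THEN iffD2, of "\<lambda>n. En n z w * t ^ n" "EE (t *s z) w - 1"]
      summable_sums[OF En_series_summable[of z w t]] by (simp add: EE_series del: En.simps(2))
  have "(\<lambda>n. cinner z w * t * (En n z w * t ^ n) - gam * (En (Suc n) z w * t ^ Suc n)
         + (\<Sum>\<xi>\<in>Rp. k \<xi> * (En (Suc n) (?\<rho> \<xi> z) w * t ^ Suc n)))
     sums (cinner z w * t * EE (t *s z) w - gam * (EE (t *s z) w - 1)
         + (\<Sum>\<xi>\<in>Rp. k \<xi> * (EE (t *s ?\<rho> \<xi> z) w - 1)))"
    using summable_sums[OF En_series_summable[of z w t]] sums
    by (intro sums_add sums_diff sums_mult sums_sum) (auto simp: EE_series)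
  \<comment> \<open>The constant terms 1, removed because the sums start in degree 1, cancel since
    the weights \<open>k \<xi>\<close> add up to \<open>gam\<close>.\<close>
  also have "cinner z w * t * EE (t *s z) w - gam * (EE (t *s z) w - 1)
         + (\<Sum>\<xi>\<in>Rp. k \<xi> * (EE (t *s ?\<rho> \<xi> z) w - 1))
     = (t * cinner z w - gam) * EE (t *s z) w + (\<Sum>\<xi>\<in>Rp. k \<xi> * EE (t *s ?\<rho> \<xi> z) w)"
    by (simp add: dunkl_gamma_def algebra_simps sum_subtractf)
  also have "(\<lambda>n. cinner z w * t * (En n z w * t ^ n) - gam * (En (Suc n) z w * t ^ Suc n)
         + (\<Sum>\<xi>\<in>Rp. k \<xi> * (En (Suc n) (?\<rho> \<xi> z) w * t ^ Suc n)))
     = (\<lambda>n. t * (diffs (\<lambda>n. En n z w) n * t ^ n))"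
  proof
    fix n
    have "of_nat (Suc n) * En (Suc n) z w = cinner z w * En n z w - gam * En (Suc n) z w
        + (\<Sum>\<xi>\<in>Rp. k \<xi> * En (Suc n) (?\<rho> \<xi> z) w)"
      using En_Suc_euler[of n z w] by (simp add: algebra_simps del: En.simps)
    moreover have "cinner z w * t * (En n z w * t ^ n) - gam * (En (Suc n) z w * t ^ Suc n)
         + (\<Sum>\<xi>\<in>Rp. k \<xi> * (En (Suc n) (?\<rho> \<xi> z) w * t ^ Suc n))
       = (cinner z w * En n z w - gam * En (Suc n) z w
        + (\<Sum>\<xi>\<in>Rp. k \<xi> * En (Suc n) (?\<rho> \<xi> z) w)) * t ^ Suc n"
      unfolding distrib_right sum_distrib_right left_diff_distrib
      by (simp add: mult_ac del: En.simps)
    ultimately show "cinner z w * t * (En n z w * t ^ n) - gam * (En (Suc n) z w * t ^ Suc n)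
         + (\<Sum>\<xi>\<in>Rp. k \<xi> * (En (Suc n) (?\<rho> \<xi> z) w * t ^ Suc n)) = t * (diffs (\<lambda>n. En n z w) n * t ^ n)"
      unfolding diffs_def by (simp add: mult_ac del: En.simps of_nat_Suc)
  qed
  finally have "(\<lambda>n. t * (diffs (\<lambda>n. En n z w) n * t ^ n)) sums
      ((t * cinner z w - gam) * EE (t *s z) w + (\<Sum>\<xi>\<in>Rp. k \<xi> * EE (t *s ?\<rho> \<xi> z) w))" .
  moreover have "(\<lambda>n. t * (diffs (\<lambda>n. En n z w) n * t ^ n)) sums (t * D)"
    unfolding D_def by (intro sums_mult summable_sums termdiff_converges_all En_series_summable)
  ultimately show "t * D = (t * cinner z w - gam) * EE (t *s z) w
        + (\<Sum>\<xi>\<in>Rp. k \<xi> * EE (t *s complexify (reflection \<xi>) z) w)"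
    using sums_unique2 by blast
qed

lemma EE_ray_real:
  obtains D where "((\<lambda>t. EE (of_real t *s z) w) has_vector_derivative D) (at t)"
    "of_real t * D = (of_real t * cinner z w - gam) * EE (of_real t *s z) w
        + (\<Sum>\<xi>\<in>Rp. k \<xi> * EE (of_real t *s complexify (reflection \<xi>) z) w)"
proof -
  obtain D where D: "((\<lambda>t. EE (t *s z) w) has_field_derivative D) (at (of_real t))"
    "of_real t * D = (of_real t * cinner z w - gam) * EE (of_real t *s z) w
        + (\<Sum>\<xi>\<in>Rp. k \<xi> * EE (of_real t *s complexify (reflection \<xi>) z) w)"
    by (rule EE_ray)
  show thesis by (rule that[OF has_vector_derivative_real_field[OF D(1)] D(2)])
qed

text \<open>In both energy estimates the term \<open>- gam * F g t\<close>, which is singular after division by \<open>t\<close>,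
  absorbs the reflected terms by the following inequality.\<close>

lemma sum_G_quadratic_le:
  fixes F H :: "(real^'n \<Rightarrow> real^'n) \<Rightarrow> real"
  assumes "\<And>g \<xi>. g \<in> G \<Longrightarrow> \<xi> \<in> Rp \<Longrightarrow> 2 * C g \<xi> \<le> F g + F (reflection \<xi> \<circ> g)"
  shows "(\<Sum>g\<in>G. \<Sum>\<xi>\<in>Rp. k \<xi> * C g \<xi>) \<le> gam * sum F G"
proof -
  have "2 * (\<Sum>g\<in>G. \<Sum>\<xi>\<in>Rp. k \<xi> * C g \<xi>) \<le> (\<Sum>g\<in>G. \<Sum>\<xi>\<in>Rp. k \<xi> * (F g + F (reflection \<xi> \<circ> g)))"
    unfolding sum_distrib_left
  proof (intro sum_mono)
    fix g \<xi> assume "g \<in> G" "\<xi> \<in> Rp"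
    then have "k \<xi> * (2 * C g \<xi>) \<le> k \<xi> * (F g + F (reflection \<xi> \<circ> g))"
      by (intro mult_left_mono assms) (auto simp: k_nonneg Rp_R)
    then show "2 * (k \<xi> * C g \<xi>) \<le> k \<xi> * (F g + F (reflection \<xi> \<circ> g))" by (simp add: mult_ac)
  qed
  also have "\<dots> = (\<Sum>\<xi>\<in>Rp. k \<xi> * (sum F G + (\<Sum>g\<in>G. F (reflection \<xi> \<circ> g))))"
    by (subst sum.swap) (auto intro!: sum.cong simp: sum_distrib_left sum.distrib distrib_left)
  also have "\<dots> = (\<Sum>\<xi>\<in>Rp. k \<xi> * (2 * sum F G))"
    by (rule sum.cong[OF refl]) (simp add: sum_G_left[where \<phi> = F] Rp_R)
  also have "\<dots> = 2 * (gam * sum F G)"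
    unfolding dunkl_gamma_def sum_distrib_right[symmetric] by simp
  finally show ?thesis by simp
qed

text \<open>The sum \<open>S\<close> of squares over the orbit satisfies
  \<open>S' \<le> 2 * B * S\<close>, so \<open>S t * exp (- 2 * B * t)\<close> decreases.
  Derivatives are needed only for \<open>0 < t\<close>, where the system is regular; at 0 continuity
  is enough.\<close>

lemma energy_le:
  fixes F :: "(real^'n \<Rightarrow> real^'n) \<Rightarrow> real \<Rightarrow> complex" and d :: "(real^'n \<Rightarrow> real^'n) \<Rightarrow> complex"
  assumes cont: "\<And>g. g \<in> G \<Longrightarrow> continuous_on {0..T} (F g)"
    and der: "\<And>g t. g \<in> G \<Longrightarrow> 0 < t \<Longrightarrow> t < T \<Longrightarrow> \<exists>D. (F g has_vector_derivative D) (at t) \<and>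
      of_real t * D = (of_real t * d g - gam) * F g t + (\<Sum>\<xi>\<in>Rp. k \<xi> * F (reflection \<xi> \<circ> g) t)"
    and d: "\<And>g. g \<in> G \<Longrightarrow> Re (d g) \<le> B" and "0 \<le> T"
  shows "(\<Sum>g\<in>G. (norm (F g T))\<^sup>2) \<le> (\<Sum>g\<in>G. (norm (F g 0))\<^sup>2) * exp (2 * B * T)"
proof -
  define S where "S t = (\<Sum>g\<in>G. F g t \<bullet> F g t)" for t
  have "S T * exp (- 2 * B * T) \<le> S 0 * exp (- 2 * B * 0)"
  proof (rule DERIV_nonpos_imp_decreasing_open[OF \<open>0 \<le> T\<close>])
    show "continuous_on {0..T} (\<lambda>t. S t * exp (- 2 * B * t))"
      unfolding S_def by (intro continuous_intros cont)
    fix t assume t: "0 < t" "t < T"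
    have "\<forall>g\<in>G. \<exists>D. (F g has_vector_derivative D) (at t) \<and>
      of_real t * D = (of_real t * d g - gam) * F g t + (\<Sum>\<xi>\<in>Rp. k \<xi> * F (reflection \<xi> \<circ> g) t)"
      using der[OF _ t] by (rule ballI)
    from bchoice[OF this] obtain D where D': "\<forall>g\<in>G. (F g has_vector_derivative D g) (at t) \<and>
      of_real t * D g = (of_real t * d g - gam) * F g t + (\<Sum>\<xi>\<in>Rp. k \<xi> * F (reflection \<xi> \<circ> g) t)" ..
    note D = D'[THEN bspec, THEN conjunct1] D'[THEN bspec, THEN conjunct2]
    define S' where "S' = (\<Sum>g\<in>G. 2 * (F g t \<bullet> D g))"
    have "(S has_real_derivative S') (at t)"
      unfolding S_def S'_def has_real_derivative_iff_has_vector_derivative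
    proof (rule has_vector_derivative_sum)
      fix g assume "g \<in> G"
      from bounded_bilinear.has_vector_derivative[OF bounded_bilinear_inner D(1)[OF this] D(1)[OF this]]
      show "((\<lambda>t. F g t \<bullet> F g t) has_vector_derivative 2 * (F g t \<bullet> D g)) (at t)"
        by (simp add: inner_commute)
    qed
    then have der: "((\<lambda>t. S t * exp (- 2 * B * t)) has_real_derivative
        (S' - 2 * B * S t) * exp (- 2 * B * t)) (at t)"
      by (auto intro!: derivative_eq_intros simp: algebra_simps)
    have inner_mult: "z \<bullet> (c * z) = Re c * (z \<bullet> z)" for c z :: complex
      by (simp add: inner_complex_def algebra_simps)
    have "t * S' = 2 * (\<Sum>g\<in>G. F g t \<bullet> (of_real t * D g))"
      by (simp add: S'_def sum_distrib_left inner_complex_def algebra_simps)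
    also have "\<dots> = 2 * (\<Sum>g\<in>G. (t * Re (d g) - gam) * (F g t \<bullet> F g t)
         + (\<Sum>\<xi>\<in>Rp. k \<xi> * (F g t \<bullet> F (reflection \<xi> \<circ> g) t)))"
    proof -
      have "F g t \<bullet> (of_real t * D g) = (t * Re (d g) - gam) * (F g t \<bullet> F g t)
         + (\<Sum>\<xi>\<in>Rp. k \<xi> * (F g t \<bullet> F (reflection \<xi> \<circ> g) t))" if "g \<in> G" for g
      proof -
        have "of_real (k \<xi>) * F (reflection \<xi> \<circ> g) t = k \<xi> *\<^sub>R F (reflection \<xi> \<circ> g) t" for \<xi>
          by (simp add: scaleR_conv_of_real)
        then show ?thesis unfolding D(2)[OF that]
          by (simp add: inner_add_right inner_sum_right inner_mult)
      qed
      then show ?thesis by simp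
    qed
    also have "\<dots> \<le> 2 * ((\<Sum>g\<in>G. (t * B - gam) * (F g t \<bullet> F g t)) + gam * (\<Sum>g\<in>G. F g t \<bullet> F g t))"
    proof -
      have "(\<Sum>g\<in>G. \<Sum>\<xi>\<in>Rp. k \<xi> * (F g t \<bullet> F (reflection \<xi> \<circ> g) t)) \<le> gam * (\<Sum>g\<in>G. F g t \<bullet> F g t)"
      proof (rule sum_G_quadratic_le)
        fix g \<xi>
        show "2 * (F g t \<bullet> F (reflection \<xi> \<circ> g) t) \<le> F g t \<bullet> F g t + F (reflection \<xi> \<circ> g) t \<bullet> F (reflection \<xi> \<circ> g) t"
          using inner_ge_zero[of "F g t - F (reflection \<xi> \<circ> g) t"] by (simp add: inner_diff inner_commute)
      qed
      moreover have "(\<Sum>g\<in>G. (t * Re (d g) - gam) * (F g t \<bullet> F g t)) \<le> (\<Sum>g\<in>G. (t * B - gam) * (F g t \<bullet> F g t))"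
        using t d by (intro sum_mono mult_right_mono) auto
      ultimately show ?thesis by (simp add: sum.distrib)
    qed
    also have "\<dots> = t * (2 * B * S t)"
      unfolding S_def sum_distrib_left[symmetric] by (simp add: algebra_simps)
    finally have "S' \<le> 2 * B * S t" using t by simp
    then show "\<exists>y. ((\<lambda>t. S t * exp (- 2 * B * t)) has_real_derivative y) (at t) \<and> y \<le> 0"
      using der by (auto intro!: exI simp: mult_le_0_iff)
  qed
  then have "S T \<le> S 0 * exp (2 * B * T)"
    by (simp add: exp_minus field_simps)
  then show ?thesis by (simp add: S_def power2_norm_eq_inner)
qed

text \<open>Uniqueness for the singular system among solutions continuous at 0. As the group is
  finite, some \<open>B\<close> bounds all \<open>Re (d g)\<close>.\<close>

lemma energy_zero:
  fixes F :: "(real^'n \<Rightarrow> real^'n) \<Rightarrow> real \<Rightarrow> complex" and d :: "(real^'n \<Rightarrow> real^'n) \<Rightarrow> complex"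
  assumes "\<And>g. g \<in> G \<Longrightarrow> continuous_on {0..T} (F g)"
    and "\<And>g t. g \<in> G \<Longrightarrow> 0 < t \<Longrightarrow> t < T \<Longrightarrow> \<exists>D. (F g has_vector_derivative D) (at t) \<and>
      of_real t * D = (of_real t * d g - gam) * F g t + (\<Sum>\<xi>\<in>Rp. k \<xi> * F (reflection \<xi> \<circ> g) t)"
    and "\<And>g. g \<in> G \<Longrightarrow> F g 0 = 0" and "0 \<le> T" and "g \<in> G"
  shows "F g T = 0"
proof -
  have "(\<Sum>g\<in>G. (norm (F g T))\<^sup>2) \<le> (\<Sum>g\<in>G. (norm (F g 0))\<^sup>2) * exp (2 * Max ((\<lambda>g. Re (d g)) ` G) * T)"
    by (rule energy_le[where d = d, OF assms(1,2) _ assms(4)]) auto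
  also have "\<dots> = 0" by (simp add: assms)
  finally have "(\<Sum>g\<in>G. (norm (F g T))\<^sup>2) = 0" by (simp add: order.antisym sum_nonneg)
  then show ?thesis using \<open>g \<in> G\<close> by (simp add: sum_nonneg_eq_0_iff)
qed

text \<open>The argument of \<open>energy_le\<close> with the squares of the negative parts as
  energy: this energy vanishes at 0 and hence stays 0.\<close>

lemma energy_nonneg:
  fixes F :: "(real^'n \<Rightarrow> real^'n) \<Rightarrow> real \<Rightarrow> real"
  assumes cont: "\<And>g. g \<in> G \<Longrightarrow> continuous_on {0..T} (F g)"
    and der: "\<And>g t. g \<in> G \<Longrightarrow> 0 < t \<Longrightarrow> t < T \<Longrightarrow> \<exists>D. (F g has_real_derivative D) (at t) \<and>
      t * D = (t * d g - gam) * F g t + (\<Sum>\<xi>\<in>Rp. k \<xi> * F (reflection \<xi> \<circ> g) t)"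
    and F0: "\<And>g. g \<in> G \<Longrightarrow> 0 \<le> F g 0" and T: "0 \<le> T" and g: "g \<in> G"
  shows "0 \<le> F g T"
proof -
  define B where "B = Max (d ` G)"
  have B: "d g \<le> B" if "g \<in> G" for g unfolding B_def using that by simp
  define S where "S t = (\<Sum>g\<in>G. (min (F g t) 0)\<^sup>2)" for t
  have "S T * exp (- 2 * B * T) \<le> S 0 * exp (- 2 * B * 0)"
  proof (rule DERIV_nonpos_imp_decreasing_open[OF T])
    show "continuous_on {0..T} (\<lambda>t. S t * exp (- 2 * B * t))"
      unfolding S_def by (intro continuous_intros cont)
    fix t assume t: "0 < t" "t < T"
    have "\<forall>g\<in>G. \<exists>D. (F g has_real_derivative D) (at t) \<and>
      t * D = (t * d g - gam) * F g t + (\<Sum>\<xi>\<in>Rp. k \<xi> * F (reflection \<xi> \<circ> g) t)"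
      using der[OF _ t] by (rule ballI)
    from bchoice[OF this] obtain D where D': "\<forall>g\<in>G. (F g has_real_derivative D g) (at t) \<and>
      t * D g = (t * d g - gam) * F g t + (\<Sum>\<xi>\<in>Rp. k \<xi> * F (reflection \<xi> \<circ> g) t)" ..
    note D = D'[THEN bspec, THEN conjunct1] D'[THEN bspec, THEN conjunct2]
    define m where "m g = min (F g t) 0" for g
    define S' where "S' = (\<Sum>g\<in>G. 2 * m g * D g)"
    have "(S has_real_derivative S') (at t)"
      unfolding S_def S'_def m_def
      by (intro DERIV_sum DERIV_chain2[OF DERIV_min_zero_squared] D)
    then have der: "((\<lambda>t. S t * exp (- 2 * B * t)) has_real_derivative
        (S' - 2 * B * S t) * exp (- 2 * B * t)) (at t)"
      by (auto intro!: derivative_eq_intros simp: algebra_simps)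
    have m: "m g * F g t = (m g)\<^sup>2" "m g \<le> 0" "m g \<le> F g t" for g
      by (auto simp: m_def min_def power2_eq_square)
    have "t * S' = 2 * (\<Sum>g\<in>G. m g * (t * D g))"
      by (simp add: S'_def sum_distrib_left algebra_simps)
    also have "\<dots> = 2 * (\<Sum>g\<in>G. (t * d g - gam) * (m g)\<^sup>2
         + (\<Sum>\<xi>\<in>Rp. k \<xi> * (m g * F (reflection \<xi> \<circ> g) t)))"
    proof -
      have "m g * (t * D g) = (t * d g - gam) * (m g)\<^sup>2
         + (\<Sum>\<xi>\<in>Rp. k \<xi> * (m g * F (reflection \<xi> \<circ> g) t))" if "g \<in> G" for g
        unfolding D(2)[OF that] m(1)[of g, symmetric]
        by (simp add: algebra_simps sum_distrib_left)
      then show ?thesis by simp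
    qed
    also have "\<dots> \<le> 2 * ((\<Sum>g\<in>G. (t * B - gam) * (m g)\<^sup>2) + gam * (\<Sum>g\<in>G. (m g)\<^sup>2))"
    proof -
      have "(\<Sum>g\<in>G. \<Sum>\<xi>\<in>Rp. k \<xi> * (m g * F (reflection \<xi> \<circ> g) t)) \<le> gam * (\<Sum>g\<in>G. (m g)\<^sup>2)"
      proof (rule sum_G_quadratic_le)
        fix g \<xi>
        \<comment> \<open>Since \<open>m g\<close> is nonpositive, passing to the negative part of
          the reflected value can only enlarge the product: positive reflected values help.\<close>
        have "m g * F (reflection \<xi> \<circ> g) t \<le> m g * m (reflection \<xi> \<circ> g)"
          using m by (intro mult_left_mono_neg)
        also have "2 * (m g * m (reflection \<xi> \<circ> g)) \<le> (m g)\<^sup>2 + (m (reflection \<xi> \<circ> g))\<^sup>2"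
          using sum_squares_bound[of "m g" "m (reflection \<xi> \<circ> g)"] by simp
        finally show "2 * (m g * F (reflection \<xi> \<circ> g) t) \<le> (m g)\<^sup>2 + (m (reflection \<xi> \<circ> g))\<^sup>2" by simp
      qed
      moreover have "(\<Sum>g\<in>G. (t * d g - gam) * (m g)\<^sup>2) \<le> (\<Sum>g\<in>G. (t * B - gam) * (m g)\<^sup>2)"
        using t B by (intro sum_mono mult_right_mono) auto
      ultimately show ?thesis by (simp add: sum.distrib)
    qed
    also have "\<dots> = t * (2 * B * S t)"
      unfolding S_def m_def sum_distrib_left[symmetric] by (simp add: algebra_simps)
    finally have "S' \<le> 2 * B * S t" using t by simp
    then show "\<exists>y. ((\<lambda>t. S t * exp (- 2 * B * t)) has_real_derivative y) (at t) \<and> y \<le> 0"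
      using der by (auto intro!: exI simp: mult_le_0_iff)
  qed
  moreover have "S 0 = 0"
    unfolding S_def by (rule sum.neutral) (use F0 in \<open>simp add: min_absorb2\<close>)
  ultimately have "S T \<le> 0" by (simp add: mult_le_0_iff)
  then have "S T = 0" by (simp add: S_def order.antisym sum_nonneg)
  then have "(min (F g T) 0)\<^sup>2 = 0" using g by (simp add: S_def sum_nonneg_eq_0_iff)
  then show ?thesis by (simp add: min_def split: if_splits)
qed

lemma complexify_comp_reflection:
  "g \<in> G \<Longrightarrow> complexify (reflection \<xi> \<circ> g) z = complexify (reflection \<xi>) (complexify g z)"
  by (rule complexify_comp)

lemma continuous_EE_ray: "continuous_on A (\<lambda>t. EE (of_real t *s z) w)"
  by (rule continuous_at_imp_continuous_on)
    (metis EE_ray_real has_vector_derivative_continuous)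

lemma EE_real: "EE (complex_vec x) (complex_vec y) = of_real (Re (EE (complex_vec x) (complex_vec y)))"
proof -
  have "Im (EE (complex_vec x) (complex_vec y)) = (\<Sum>n. Im (En n (complex_vec x) (complex_vec y)))"
    unfolding EE_def by (rule bounded_linear.suminf[OF bounded_linear_Im En_summable])
  also have "\<dots> = 0" using En_real complex_is_Real_iff by simp
  finally show ?thesis by (simp add: complex_eq_iff)
qed

text \<open>All orbit values start at 1 at the origin, and \<open>energy_nonneg\<close> carries the
  sign along the rays. Nonnegativity of \<open>k\<close> is decisive: it makes the coupling between
  the rays cooperative.\<close>

lemma EE_nonneg: "0 \<le> Re (EE (complex_vec x) (complex_vec y))"
proof -
  define F where "F g t = Re (EE (of_real t *s complexify g (complex_vec x)) (complex_vec y))" for g t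
  have "0 \<le> F id 1"
  proof (rule energy_nonneg[where d = "\<lambda>g. g x \<bullet> y" and F = F])
    fix g assume g: "g \<in> G"
    show "continuous_on {0..1} (F g)" unfolding F_def
      by (intro continuous_intros continuous_EE_ray)
    show "0 \<le> F g 0" by (simp add: F_def)
    fix t :: real
    obtain D where D: "((\<lambda>t. EE (of_real t *s complexify g (complex_vec x)) (complex_vec y)) has_vector_derivative D) (at t)"
     "of_real t * D = (of_real t * cinner (complexify g (complex_vec x)) (complex_vec y) - gam) * EE (of_real t *s complexify g (complex_vec x)) (complex_vec y)
        + (\<Sum>\<xi>\<in>Rp. k \<xi> * EE (of_real t *s complexify (reflection \<xi>) (complexify g (complex_vec x))) (complex_vec y))"
      by (rule EE_ray_real)
    have "(F g has_real_derivative Re D) (at t)"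
      unfolding F_def has_real_derivative_iff_has_vector_derivative
      by (rule bounded_linear.has_vector_derivative[OF bounded_linear_Re D(1)])
    moreover have "t * Re D = (t * (g x \<bullet> y) - gam) * F g t + (\<Sum>\<xi>\<in>Rp. k \<xi> * F (reflection \<xi> \<circ> g) t)"
      using arg_cong[OF D(2), of Re] g
      by (simp add: F_def complexify_comp_reflection complexify_G)
    ultimately show "\<exists>D. (F g has_real_derivative D) (at t) \<and> t * D =
        (t * (g x \<bullet> y) - gam) * F g t + (\<Sum>\<xi>\<in>Rp. k \<xi> * F (reflection \<xi> \<circ> g) t)" by blast
  qed auto
  then show ?thesis by (simp add: F_def)
qed

text \<open>For an imaginary first argument the coefficients \<open>d g\<close> have real part 0, so
  the energy does not grow. It starts at \<open>card G\<close>, one unit for each group element, and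
  this produces the constant.\<close>

lemma norm_EE_imag_le: "norm (EE (\<i> *s complex_vec x) (complex_vec y)) \<le> sqrt (card G)"
proof -
  define F where "F g t = EE (of_real t *s complexify g (\<i> *s complex_vec x)) (complex_vec y)" for g t
  have "(\<Sum>g\<in>G. (norm (F g 1))\<^sup>2) \<le> (\<Sum>g\<in>G. (norm (F g 0))\<^sup>2) * exp (2 * 0 * 1)"
  proof (rule energy_le[where d = "\<lambda>g. cinner (complexify g (\<i> *s complex_vec x)) (complex_vec y)" and F = F])
    fix g assume g: "g \<in> G"
    show "continuous_on {0..1} (F g)" unfolding F_def by (rule continuous_EE_ray)
    show "Re (cinner (complexify g (\<i> *s complex_vec x)) (complex_vec y)) \<le> 0"
      using g by (simp add: complexify_G)
    fix t :: real
    show "\<exists>D. (F g has_vector_derivative D) (at t) \<and> of_real t * D =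
        (of_real t * cinner (complexify g (\<i> *s complex_vec x)) (complex_vec y) - gam) * F g t + (\<Sum>\<xi>\<in>Rp. k \<xi> * F (reflection \<xi> \<circ> g) t)"
      using EE_ray_real[of "complexify g (\<i> *s complex_vec x)" "complex_vec y" t] g
      unfolding F_def by (metis (mono_tags, lifting) complexify_comp_reflection sum.cong)
  qed simp
  also have "\<dots> = card G" by (simp add: F_def)
  finally have "(\<Sum>g\<in>G. (norm (F g 1))\<^sup>2) \<le> card G" .
  moreover have "(norm (F id 1))\<^sup>2 \<le> (\<Sum>g\<in>G. (norm (F g 1))\<^sup>2)"
    by (rule member_le_sum[OF id_in_G]) auto
  ultimately have "(norm (F id 1))\<^sup>2 \<le> card G" by linarith
  then show ?thesis by (simp add: F_def real_le_rsqrt)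
qed

text \<open>\<open>DE n z w a b\<close> is the derivative of \<open>(z, w) \<mapsto> En n z w\<close> in direction \<open>(a, b)\<close>.\<close>

primrec DE :: "nat \<Rightarrow> complex^'n \<Rightarrow> complex^'n \<Rightarrow> complex^'n \<Rightarrow> complex^'n \<Rightarrow> complex" where
  "DE 0 z w a b = 0"
| "DE (Suc n) z w a b = (\<Sum>g\<in>G. cf (Suc n) g *
     ((cinner (complexify g a) w + cinner (complexify g z) b) * En n (complexify g z) w
      + cinner (complexify g z) w * DE n (complexify g z) w (complexify g a) b))"

lemma complexify_bounded_linear: "g \<in> G \<Longrightarrow> bounded_linear (complexify g)"
  by (simp add: G_linear complexify_linear linear_conv_bounded_linear[symmetric])

lemma En_has_derivative:
  "((\<lambda>p. En n (fst p) (snd p)) has_derivative (\<lambda>q. DE n z w (fst q) (snd q))) (at (z, w))"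
proof (induction n arbitrary: z w)
  case (Suc n)
  have "((\<lambda>p. cf (Suc n) g * (cinner (complexify g (fst p)) (snd p) * En n (complexify g (fst p)) (snd p)))
    has_derivative (\<lambda>q. cf (Suc n) g *
     ((cinner (complexify g (fst q)) w + cinner (complexify g z) (snd q)) * En n (complexify g z) w
      + cinner (complexify g z) w * DE n (complexify g z) w (complexify g (fst q)) (snd q)))) (at (z, w))"
    if g: "g \<in> G" for g
  proof -
    have 1: "((\<lambda>p. complexify g (fst p)) has_derivative (\<lambda>q. complexify g (fst q))) (at p)" for p :: "(complex^'n) \<times> (complex^'n)"
      by (rule bounded_linear_imp_has_derivative)
        (rule bounded_linear_compose[OF complexify_bounded_linear[OF g] bounded_linear_fst])
    have 2: "((\<lambda>p. snd p) has_derivative (\<lambda>q. snd q)) (at p)" for p :: "(complex^'n) \<times> (complex^'n)"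
      by (rule bounded_linear_imp_has_derivative[OF bounded_linear_snd])
    have 3: "((\<lambda>p. En n (complexify g (fst p)) (snd p)) has_derivative
        (\<lambda>q. DE n (complexify g z) w (complexify g (fst q)) (snd q))) (at (z, w))"
      using has_derivative_compose[OF has_derivative_Pair[OF 1 2], of "\<lambda>p. En n (fst p) (snd p)"
          "\<lambda>q. DE n (complexify g z) w (fst q) (snd q)"] Suc.IH[of "complexify g z" w]
      by simp
    have 4: "((\<lambda>p. cinner (complexify g (fst p)) (snd p)) has_derivative
        (\<lambda>q. cinner (complexify g z) (snd q) + cinner (complexify g (fst q)) w)) (at (z, w))"
      using bounded_bilinear.FDERIV[OF bounded_bilinear_cinner 1 2] by fastforce
    show ?thesis
      by (rule has_derivative_eq_rhs[OF has_derivative_mult_right[OF has_derivative_mult[OF 4 3]]])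
        (simp add: fun_eq_iff algebra_simps)
  qed
  then show ?case unfolding En.simps DE.simps by (rule has_derivative_sum)
qed simp

lemma DE_bound:
  "norm (DE (Suc n) z w a b) \<le> (norm a * norm w + norm z * norm b) * ((norm z * norm w) ^ n / fact n)"
proof (induction n arbitrary: z a)
  case 0
  have "norm (DE (Suc 0) z w a b) \<le> (\<Sum>g\<in>G. cf (Suc 0) g * (norm a * norm w + norm z * norm b))"
    unfolding DE.simps
  proof (rule sum_norm_le)
    fix g assume g: "g \<in> G"
    have "norm (cinner (complexify g a) w + cinner (complexify g z) b) \<le> norm a * norm w + norm z * norm b"
      using norm_cinner_le[of "complexify g a" w] norm_cinner_le[of "complexify g z" b] g
      by (intro norm_triangle_mono) (auto simp: complexify_G)
    then show "norm (of_real (cf (Suc 0) g) * ((cinner (complexify g a) w + cinner (complexify g z) b) * En 0 (complexify g z) w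
      + cinner (complexify g z) w * 0)) \<le> cf (Suc 0) g * (norm a * norm w + norm z * norm b)"
      using g by (auto simp: norm_mult cf_nonneg intro!: mult_left_mono)
  qed
  also have "\<dots> = norm a * norm w + norm z * norm b"
    unfolding sum_distrib_right[symmetric] cf_sum[OF zero_less_Suc] by simp
  finally show ?case by simp
next
  case (Suc n)
  let ?A = "norm a * norm w + norm z * norm b" and ?q = "norm z * norm w"
  have "norm (DE (Suc (Suc n)) z w a b) \<le> (\<Sum>g\<in>G. cf (Suc (Suc n)) g *
      (?A * (?q ^ Suc n / fact (Suc n)) + ?q * (?A * (?q ^ n / fact n))))"
    unfolding DE.simps(2)[of "Suc n"]
  proof (rule sum_norm_le)
    fix g assume g: "g \<in> G"
    have "norm (cinner (complexify g a) w + cinner (complexify g z) b) \<le> ?A"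
      using norm_cinner_le[of "complexify g a" w] norm_cinner_le[of "complexify g z" b] g
      by (intro norm_triangle_mono) (auto simp: complexify_G)
    then have "norm ((cinner (complexify g a) w + cinner (complexify g z) b) * En (Suc n) (complexify g z) w)
        \<le> ?A * (?q ^ Suc n / fact (Suc n))"
      unfolding norm_mult using En_bound[of "Suc n" "complexify g z" w] g
      by (intro mult_mono) (auto simp: complexify_G simp del: En.simps fact_Suc)
    moreover have "norm (cinner (complexify g z) w * DE (Suc n) (complexify g z) w (complexify g a) b)
        \<le> ?q * (?A * (?q ^ n / fact n))"
      unfolding norm_mult using Suc.IH[of "complexify g z" "complexify g a"] norm_cinner_le[of "complexify g z" w] g
      by (intro mult_mono) (auto simp: complexify_G simp del: DE.simps)
    ultimately have "norm ((cinner (complexify g a) w + cinner (complexify g z) b) * En (Suc n) (complexify g z) w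
      + cinner (complexify g z) w * DE (Suc n) (complexify g z) w (complexify g a) b)
        \<le> ?A * (?q ^ Suc n / fact (Suc n)) + ?q * (?A * (?q ^ n / fact n))"
      by (rule norm_triangle_mono)
    then show "norm (of_real (cf (Suc (Suc n)) g) * ((cinner (complexify g a) w + cinner (complexify g z) b) * En (Suc n) (complexify g z) w
      + cinner (complexify g z) w * DE (Suc n) (complexify g z) w (complexify g a) b))
       \<le> cf (Suc (Suc n)) g * (?A * (?q ^ Suc n / fact (Suc n)) + ?q * (?A * (?q ^ n / fact n)))"
      unfolding norm_mult norm_of_real using cf_nonneg[OF _ g, of "Suc (Suc n)"]
      by (intro mult_mono) auto
  qed
  also have "\<dots> = ?A * ?q ^ Suc n * ((1 / fact (Suc n) + 1 / fact n) / real (Suc (Suc n)))"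
  proof -
    have "1 / N * (A * (q * p / f1) + q * (A * (p / f2))) = A * (q * p) * ((1 / f1 + 1 / f2) / N)"
      for N A q p f1 f2 :: real by (simp add: divide_inverse algebra_simps)
    then show ?thesis unfolding sum_distrib_right[symmetric] cf_sum[OF zero_less_Suc] power_Suc .
  qed
  \<comment> \<open>\<open>1 / (n + 1)! + 1 / n!\<close> equals \<open>(n + 2) / (n + 1)!\<close>:
    the two contributions of the product rule are absorbed exactly by the factor that
    \<open>cf_sum\<close> provides.\<close>
  also have "(1 / fact (Suc n) + 1 / fact n) / real (Suc (Suc n)) = 1 / fact (Suc n)"
    by (simp add: divide_simps)
  finally show ?case by simp
qed

text \<open>The complex homogeneity that \<open>holomorphic_pair\<close> demands of the real
  derivative.\<close>

lemma DE_smult: "DE n z w (c *s a) (c *s b) = c * DE n z w a b"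
  by (induction n arbitrary: z a)
    (auto simp: complexify_G sum_distrib_left algebra_simps intro!: sum.cong)

lemma DE_summable: "summable (\<lambda>n. norm (DE n z w a b))"
proof (subst summable_Suc_iff[symmetric], rule summable_comparison_test')
  show "summable (\<lambda>n. (norm a * norm w + norm z * norm b) * ((norm z * norm w) ^ n / fact n))"
    by (intro summable_mult summable_power_fact)
  show "norm (norm (DE (Suc n) z w a b)) \<le> (norm a * norm w + norm z * norm b) * ((norm z * norm w) ^ n / fact n)" for n
    using DE_bound by simp
qed

lemma EE_has_derivative:
  "((\<lambda>p. EE (fst p) (snd p)) has_derivative (\<lambda>q. \<Sum>n. DE n z w (fst q) (snd q))) (at (z, w))"
  unfolding EE_def
proof (rule series_has_derivative[where S = "ball 0 (norm (z, w) + 1)"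
      and f' = "\<lambda>n p q. DE n (fst p) (snd p) (fst q) (snd q)" and x = "(z, w)", unfolded fst_conv snd_conv])
  define r where "r = norm (z, w) + 1"
  \<comment> \<open>\<open>DE_bound\<close> with both arguments of norm at most \<open>r\<close>;
    the term for 0 vanishes together with \<open>DE 0\<close>.\<close>
  define M where "M n = (case n of 0 \<Rightarrow> 0 | Suc n \<Rightarrow> 2 * r * ((r * r) ^ n / fact n))" for n
  show "summable M"
    unfolding M_def by (subst summable_Suc_iff[symmetric]) (simp add: summable_mult[OF summable_power_fact, of "2 * r" "r * r", simplified])
  show "((\<lambda>p. En n (fst p) (snd p)) has_derivative (\<lambda>q. DE n (fst x) (snd x) (fst q) (snd q))) (at x)" for n x
    using En_has_derivative[of n "fst x" "snd x"] by simp
  fix x :: "(complex^'n) \<times> (complex^'n)"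
  show "summable (\<lambda>n. En n (fst x) (snd x))" by (rule En_summable)
  fix n h
  assume "x \<in> ball 0 (norm (z, w) + 1)"
  then have x: "norm x < norm (z, w) + 1" by simp
  have r: "norm (fst x) \<le> r" "norm (snd x) \<le> r" "0 \<le> r"
    using x norm_fst_le[of "fst x" "snd x"] norm_snd_le[of "snd x" "fst x"] norm_ge_zero[of x]
    unfolding r_def prod.collapse by linarith+
  show "norm (DE n (fst x) (snd x) (fst h) (snd h)) \<le> M n * norm h"
  proof (cases n)
    case (Suc m)
    have "norm (DE n (fst x) (snd x) (fst h) (snd h)) \<le>
      (norm (fst h) * norm (snd x) + norm (fst x) * norm (snd h)) * ((norm (fst x) * norm (snd x)) ^ m / fact m)"
      unfolding Suc by (rule DE_bound)
    also have "\<dots> \<le> (norm h * r + r * norm h) * ((r * r) ^ m / fact m)"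
      using r norm_fst_le[of "fst h" "snd h", unfolded prod.collapse] norm_snd_le[of "snd h" "fst h", unfolded prod.collapse]
      by (intro mult_mono add_mono divide_right_mono power_mono) auto
    finally show ?thesis by (simp add: M_def Suc algebra_simps)
  qed (simp add: M_def)
qed simp_all

lemma holomorphic_pair_EE: "holomorphic_pair EE"
  unfolding holomorphic_pair_def
proof
  fix p :: "(complex^'n) \<times> (complex^'n)"
  show "\<exists>D. ((\<lambda>(z, w). EE z w) has_derivative D) (at p) \<and> (\<forall>c z w. D (c *s z, c *s w) = c * D (z, w))"
    using EE_has_derivative[of "fst p" "snd p"]
    by (intro exI[of _ "\<lambda>q. \<Sum>n. DE n (fst p) (snd p) (fst q) (snd q)"])
      (auto simp: case_prod_unfold DE_smult suminf_mult summable_norm_cancel[OF DE_summable])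
qed

lemma continuous_EE:
  assumes "continuous_on A f" "continuous_on A g"
  shows "continuous_on A (\<lambda>x. EE (f x) (g x))"
proof -
  have "continuous_on UNIV (\<lambda>p. EE (fst p) (snd p))"
  proof (intro continuous_at_imp_continuous_on ballI)
    show "isCont (\<lambda>p. EE (fst p) (snd p)) p" for p
      using has_derivative_continuous[OF EE_has_derivative, of "fst p" "snd p"] by simp
  qed
  then have "continuous_on A (\<lambda>x. EE (fst (f x, g x)) (snd (f x, g x)))"
    by (rule continuous_on_compose2) (auto intro!: continuous_intros assms)
  then show ?thesis by simp
qed

end

lemma dir_deriv_eq:
  assumes "(f has_derivative f') (at x)" shows "dir_deriv v f x = f' v"
proof -
  have "((\<lambda>t. x + t *\<^sub>R v) has_derivative (\<lambda>t. t *\<^sub>R v)) (at 0)"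
    by (auto intro!: derivative_eq_intros)
  then have "((\<lambda>t. f (x + t *\<^sub>R v)) has_derivative (\<lambda>t. f' (t *\<^sub>R v))) (at 0)"
    by (rule has_derivative_compose) (use assms in simp)
  then have "((\<lambda>t. f (x + t *\<^sub>R v)) has_vector_derivative f' v) (at 0)"
    using linear_scale[OF has_derivative_linear[OF assms]] by (simp add: has_vector_derivative_def)
  then show ?thesis unfolding dir_deriv_def by (rule vector_derivative_at)
qed

section \<open>Iterated real derivatives of the kernel\<close>

context dunkl
begin

text \<open>\<open>DL n w as y\<close> is the iterated directional derivative of \<open>x \<mapsto> En n (complex_vec x) w\<close>
  at \<open>y\<close> along the directions \<open>as\<close>.\<close>

primrec DL :: "nat \<Rightarrow> complex^'n \<Rightarrow> (real^'n) list \<Rightarrow> real^'n \<Rightarrow> complex" where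
  "DL 0 w as y = (if as = [] then 1 else 0)"
| "DL (Suc n) w as y = (\<Sum>g\<in>G. cf (Suc n) g *
     (cinner (complex_vec (g y)) w * DL n w (map g as) (g y)
      + (\<Sum>i<length as. cinner (complex_vec (g (as ! i))) w * DL n w (map g (take i as @ drop (Suc i) as)) (g y))))"

lemma DL_Nil: "DL n w [] y = En n (complex_vec y) w"
  by (induction n arbitrary: y) (auto simp: complexify_G intro!: sum.cong)

lemma G_bounded_linear: "g \<in> G \<Longrightarrow> bounded_linear g"
  by (simp add: G_linear linear_conv_bounded_linear[symmetric])

lemma cinner_complex_vec_bounded_linear: "bounded_linear (\<lambda>y. cinner (complex_vec y) w)"
  by (rule bounded_linear_compose[OF bounded_bilinear.bounded_linear_left[OF bounded_bilinear_cinner]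
      bounded_linear_complex_vec])

text \<open>The recursion of \<open>DL\<close> is the Leibniz rule for a linear factor times
  \<open>En n\<close>: at most one direction can hit the linear factor, whence the sum over the list
  with one entry deleted. A further derivative just puts its direction in front of the list.\<close>

lemma DL_has_derivative: "(DL n w as has_derivative (\<lambda>h. DL n w (h # as) y)) (at y)"
proof (induction n arbitrary: as y)
  case 0
  then show ?case by (simp add: DL.simps[abs_def])
next
  case (Suc n)
  have D: "((\<lambda>y. DL n w bs (g y)) has_derivative (\<lambda>h. DL n w (g h # bs) (g y))) (at y)" if "g \<in> G" for g bs
    using has_derivative_compose[OF bounded_linear_imp_has_derivative[OF G_bounded_linear[OF that]] Suc.IH] .
  have C: "((\<lambda>y. cinner (complex_vec (g y)) w) has_derivative (\<lambda>h. cinner (complex_vec (g h)) w)) (at y)" if "g \<in> G" for g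
    by (rule bounded_linear_imp_has_derivative)
      (rule bounded_linear_compose[OF cinner_complex_vec_bounded_linear G_bounded_linear[OF that]])
  have "((\<lambda>y. cf (Suc n) g *
     (cinner (complex_vec (g y)) w * DL n w (map g as) (g y)
      + (\<Sum>i<length as. cinner (complex_vec (g (as ! i))) w * DL n w (map g (take i as @ drop (Suc i) as)) (g y))))
   has_derivative (\<lambda>h. cf (Suc n) g *
     (cinner (complex_vec (g y)) w * DL n w (map g (h # as)) (g y)
      + (\<Sum>i<length (h # as). cinner (complex_vec (g ((h # as) ! i))) w *
           DL n w (map g (take i (h # as) @ drop (Suc i) (h # as))) (g y))))) (at y)" if g: "g \<in> G" for g
  proof (rule has_derivative_eq_rhs[OF has_derivative_mult_right[OF has_derivative_add[OF
          has_derivative_mult[OF C[OF g] D[OF g]] has_derivative_sum[OF has_derivative_mult_right[OF D[OF g]]]]]])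
  qed (simp add: fun_eq_iff sum.lessThan_Suc_shift algebra_simps del: sum.lessThan_Suc)
  from has_derivative_sum[OF this] show ?case unfolding DL.simps[abs_def] .
qed

text \<open>There are \<open>length as\<close> ways for a direction to hit the linear factor, each
  contributing \<open>norm w\<close> where the undifferentiated factor contributes
  \<open>norm w * norm y\<close>. This is the origin of \<open>norm y + length as\<close>.\<close>

lemma DL_bound:
  "norm (DL n w as y) \<le> prod_list (map norm as) * ((norm w * (norm y + length as)) ^ n / fact n)"
proof (induction n arbitrary: as y)
  case 0
  have "0 \<le> prod_list (map norm as)" by (induction as) auto
  then show ?case by simp
next
  case (Suc n)
  let ?A = "prod_list (map norm as)" and ?Y = "norm w * (norm y + length as)"
  have A0: "0 \<le> prod_list (map norm bs)" for bs :: "(real^'n) list" by (induction bs) auto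
  have "norm (DL (Suc n) w as y) \<le> (\<Sum>g\<in>G. cf (Suc n) g * (?A * (?Y * (?Y ^ n / fact n))))"
    unfolding DL.simps
  proof (rule sum_norm_le)
    fix g assume g: "g \<in> G"
    have mg: "map norm (map g bs) = map norm bs" for bs using g by (simp add: G_norm)
    have c: "norm (cinner (complex_vec (g v)) w) \<le> norm v * norm w" for v
      using norm_cinner_le[of "complex_vec (g v)" w] g by (simp add: G_norm)
    have 1: "norm (cinner (complex_vec (g y)) w * DL n w (map g as) (g y)) \<le> (norm y * norm w) * (?A * (?Y ^ n / fact n))"
      using Suc.IH[of "map g as" "g y"] unfolding norm_mult mg
      by (intro mult_mono c) (auto simp: G_norm g)
    have 2: "norm (cinner (complex_vec (g (as ! i))) w * DL n w (map g (take i as @ drop (Suc i) as)) (g y))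
        \<le> norm w * (?A * (?Y ^ n / fact n))" if i: "i < length as" for i
    proof -
      have split: "?A = norm (as ! i) * prod_list (map norm (take i as @ drop (Suc i) as))"
        by (subst id_take_nth_drop[OF i]) simp
      have "norm (DL n w (map g (take i as @ drop (Suc i) as)) (g y))
        \<le> prod_list (map norm (take i as @ drop (Suc i) as)) * ((norm w * (norm y + (length as - 1))) ^ n / fact n)"
        using Suc.IH[of "map g (take i as @ drop (Suc i) as)" "g y"] i unfolding mg
        by (simp add: G_norm g of_nat_diff min_def)
      also have "\<dots> \<le> prod_list (map norm (take i as @ drop (Suc i) as)) * (?Y ^ n / fact n)"
        using A0 i by (intro mult_left_mono divide_right_mono power_mono) (auto simp: of_nat_diff)
      finally have "norm (cinner (complex_vec (g (as ! i))) w * DL n w (map g (take i as @ drop (Suc i) as)) (g y))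
        \<le> (norm (as ! i) * norm w) * (prod_list (map norm (take i as @ drop (Suc i) as)) * (?Y ^ n / fact n))"
        unfolding norm_mult by (intro mult_mono c) auto
      then show ?thesis unfolding split by (simp add: mult_ac)
    qed
    have "norm (cinner (complex_vec (g y)) w * DL n w (map g as) (g y)
      + (\<Sum>i<length as. cinner (complex_vec (g (as ! i))) w * DL n w (map g (take i as @ drop (Suc i) as)) (g y)))
      \<le> (norm y * norm w) * (?A * (?Y ^ n / fact n)) + (\<Sum>i<length as. norm w * (?A * (?Y ^ n / fact n)))"
      by (intro norm_triangle_mono 1 sum_norm_le 2) simp
    also have "\<dots> = ?A * (?Y * (?Y ^ n / fact n))" by (simp add: divide_inverse algebra_simps)
    finally show "norm (of_real (cf (Suc n) g) * (cinner (complex_vec (g y)) w * DL n w (map g as) (g y)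
      + (\<Sum>i<length as. cinner (complex_vec (g (as ! i))) w * DL n w (map g (take i as @ drop (Suc i) as)) (g y))))
      \<le> cf (Suc n) g * (?A * (?Y * (?Y ^ n / fact n)))"
      unfolding norm_mult norm_of_real using cf_nonneg[OF _ g, of "Suc n"] by (intro mult_mono) auto
  qed
  also have "\<dots> = ?A * (?Y ^ Suc n / fact (Suc n))"
    unfolding sum_distrib_right[symmetric] cf_sum[OF zero_less_Suc] by simp
  finally show ?case .
qed

definition DLE :: "complex^'n \<Rightarrow> (real^'n) list \<Rightarrow> real^'n \<Rightarrow> complex" where
  "DLE w as y = (\<Sum>n. DL n w as y)"

lemma DL_norm_summable: "summable (\<lambda>n. norm (DL n w as y))"
  by (rule summable_comparison_test'[OF summable_mult[OF summable_power_fact]]) (use DL_bound in simp)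

lemma DL_summable: "summable (\<lambda>n. DL n w as y)"
  using DL_norm_summable by (rule summable_norm_cancel)

lemma DLE_bound: "norm (DLE w as y) \<le> prod_list (map norm as) * exp (norm w * (norm y + length as))"
proof -
  have "norm (DLE w as y) \<le> (\<Sum>n. norm (DL n w as y))"
    unfolding DLE_def by (rule summable_norm[OF DL_norm_summable])
  also have "\<dots> \<le> (\<Sum>n. prod_list (map norm as) * ((norm w * (norm y + length as)) ^ n / fact n))"
    by (intro suminf_le DL_bound DL_norm_summable summable_mult summable_power_fact)
  finally show ?thesis unfolding suminf_mult[OF summable_power_fact] suminf_power_fact .
qed

lemma DLE_Nil: "DLE w [] y = EE (complex_vec y) w"
  by (simp add: DLE_def DL_Nil EE_def)

lemma DLE_has_derivative: "(DLE w as has_derivative (\<lambda>h. DLE w (h # as) y)) (at y)"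
  unfolding DLE_def[abs_def]
proof (rule series_has_derivative[where S = "ball 0 (norm y + 1)" and x = y
      and f = "\<lambda>n y. DL n w as y" and f' = "\<lambda>n y h. DL n w (h # as) y"])
  define r where "r = norm w * ((norm y + 1) + length as + 1)"
  show "summable (\<lambda>n. prod_list (map norm as) * (r ^ n / fact n))"
    by (intro summable_mult summable_power_fact)
  show "((\<lambda>y. DL n w as y) has_derivative (\<lambda>h. DL n w (h # as) x)) (at x)" for n x
    by (rule DL_has_derivative)
  show "summable (\<lambda>n. DL n w as x)" for x by (rule DL_summable)
  fix n and x h :: "real^'n" assume x: "x \<in> ball 0 (norm y + 1)"
  have A0: "0 \<le> prod_list (map norm bs)" for bs :: "(real^'n) list" by (induction bs) auto
  have "norm (DL n w (h # as) x) \<le> prod_list (map norm (h # as)) * ((norm w * (norm x + length (h # as))) ^ n / fact n)"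
    by (rule DL_bound)
  also have "\<dots> \<le> prod_list (map norm (h # as)) * (r ^ n / fact n)"
    using x A0[of as] unfolding r_def by (intro mult_left_mono divide_right_mono power_mono) auto
  finally show "norm (DL n w (h # as) x) \<le> prod_list (map norm as) * (r ^ n / fact n) * norm h"
    by (simp add: mult_ac)
qed auto

section \<open>The Dunkl operators applied to the kernel\<close>

lemma EE_has_derivative_real:
  "((\<lambda>y. EE (complex_vec y) w) has_derivative (\<lambda>h. DLE w [h] y)) (at y)"
  using DLE_has_derivative[of w "[]" y] by (simp add: DLE_Nil[abs_def])

text \<open>\<open>RQ \<xi> n w\<close> is the reflection quotient of \<open>En n\<close> and \<open>TE n w v\<close> its Dunkl derivative in
  direction \<open>v\<close>. Both \<open>TE\<close> and the eigenvalue side \<open>PE\<close> satisfy the same recursive system over the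
  group, which determines its solution.\<close>

definition RQ :: "real^'n \<Rightarrow> nat \<Rightarrow> complex^'n \<Rightarrow> real^'n \<Rightarrow> complex" where
  "RQ \<xi> n w x = (if \<xi> \<bullet> x = 0 then of_real (2 / (\<xi> \<bullet> \<xi>)) * DL n w [\<xi>] x
     else (En n (complex_vec x) w - En n (complex_vec (reflection \<xi> x)) w) / of_real (\<xi> \<bullet> x))"

definition TE :: "nat \<Rightarrow> complex^'n \<Rightarrow> real^'n \<Rightarrow> real^'n \<Rightarrow> complex" where
  "TE n w v x = DL n w [v] x + (\<Sum>\<xi>\<in>Rp. of_real (k \<xi> * (\<xi> \<bullet> v)) * RQ \<xi> n w x)"

lemma DL_linear: "linear (\<lambda>h. DL n w [h] x)"
  using has_derivative_linear[OF DL_has_derivative[of n w "[]" x]] .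

lemma En_Suc_euler_real:
  "of_real (real (Suc n) + gam) * En (Suc n) (complex_vec x) w - (\<Sum>\<xi>\<in>Rp. k \<xi> * En (Suc n) (complex_vec (reflection \<xi> x)) w)
    = cinner (complex_vec x) w * En n (complex_vec x) w"
  using En_Suc_euler[of n "complex_vec x" w] by (simp add: complexify_reflection del: En.simps of_nat_Suc)

text \<open>Both sides of \<open>En_Suc_euler_real\<close>, differentiated in direction
  \<open>v\<close>. In a reflected term the chain rule reflects the direction as well.\<close>

lemma DL_euler:
  "of_real (real (Suc n) + gam) * DL (Suc n) w [v] x - (\<Sum>\<xi>\<in>Rp. k \<xi> * DL (Suc n) w [reflection \<xi> v] (reflection \<xi> x))
    = cinner (complex_vec v) w * En n (complex_vec x) w + cinner (complex_vec x) w * DL n w [v] x"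
proof -
  have D: "((\<lambda>y. En m (complex_vec y) w) has_derivative (\<lambda>h. DL m w [h] x)) (at x)" for m x
    using DL_has_derivative[of m w "[]" x] by (simp add: DL_Nil[abs_def])
  have D': "((\<lambda>y. En m (complex_vec (reflection \<xi> y)) w) has_derivative
      (\<lambda>h. DL m w [reflection \<xi> h] (reflection \<xi> x))) (at x)" for m x \<xi>
    by (rule has_derivative_compose[OF linear_imp_has_derivative[OF reflection_linear] D])
  have C: "((\<lambda>y. cinner (complex_vec y) w) has_derivative (\<lambda>h. cinner (complex_vec h) w)) (at x)"
    by (rule bounded_linear_imp_has_derivative[OF cinner_complex_vec_bounded_linear])
  have "(\<lambda>h. of_real (real (Suc n) + gam) * DL (Suc n) w [h] x - (\<Sum>\<xi>\<in>Rp. k \<xi> * DL (Suc n) w [reflection \<xi> h] (reflection \<xi> x)))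
     = (\<lambda>h. cinner (complex_vec x) w * DL n w [h] x + cinner (complex_vec h) w * En n (complex_vec x) w)"
  proof (rule has_derivative_unique)
    show "((\<lambda>y. cinner (complex_vec y) w * En n (complex_vec y) w) has_derivative
       (\<lambda>h. cinner (complex_vec x) w * DL n w [h] x + cinner (complex_vec h) w * En n (complex_vec x) w)) (at x)"
      by (rule has_derivative_mult[OF C D])
    show "((\<lambda>y. cinner (complex_vec y) w * En n (complex_vec y) w) has_derivative
       (\<lambda>h. of_real (real (Suc n) + gam) * DL (Suc n) w [h] x - (\<Sum>\<xi>\<in>Rp. k \<xi> * DL (Suc n) w [reflection \<xi> h] (reflection \<xi> x)))) (at x)"
      unfolding En_Suc_euler_real[symmetric]
      by (intro has_derivative_diff has_derivative_mult_right has_derivative_sum D D')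
  qed
  then show ?thesis by (metis (no_types) add.commute)
qed

lemma cinner_reflection_real:
  "cinner (complex_vec (reflection \<eta> x)) w = cinner (complex_vec x) w - of_real (2 * (\<eta> \<bullet> x) / (\<eta> \<bullet> \<eta>)) * cinner (complex_vec \<eta>) w"
  by (simp add: reflection_def scaleR_conv_of_real[where 'a = complex])

text \<open>The quotient operation applied to \<open>En_Suc_euler_real\<close>. By
  \<open>reflection_conjugate\<close>, composing with the reflection in \<open>\<xi>\<close> turns
  the quotient for \<open>\<eta>\<close> into the one for the reflected root at the reflected point.
  The last term is the quotient falling on the linear factor.\<close>

lemma RQ_euler:
  assumes "\<eta> \<in> R"
  shows "of_real (real (Suc n) + gam) * RQ \<eta> (Suc n) w x - (\<Sum>\<xi>\<in>Rp. k \<xi> * RQ (reflection \<xi> \<eta>) (Suc n) w (reflection \<xi> x))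
    = cinner (complex_vec x) w * RQ \<eta> n w x
      + of_real (2 / (\<eta> \<bullet> \<eta>)) * cinner (complex_vec \<eta>) w * En n (complex_vec (reflection \<eta> x)) w"
proof (cases "\<eta> \<bullet> x = 0")
  case True
  then have "reflection \<eta> x = x" by (simp add: reflection_def)
  moreover have "of_real (real (Suc n) + gam) * RQ \<eta> (Suc n) w x - (\<Sum>\<xi>\<in>Rp. k \<xi> * RQ (reflection \<xi> \<eta>) (Suc n) w (reflection \<xi> x))
      = of_real (2 / (\<eta> \<bullet> \<eta>)) * (of_real (real (Suc n) + gam) * DL (Suc n) w [\<eta>] x
         - (\<Sum>\<xi>\<in>Rp. k \<xi> * DL (Suc n) w [reflection \<xi> \<eta>] (reflection \<xi> x)))"
    by (simp add: RQ_def reflection_inner True right_diff_distrib sum_distrib_left mult_ac del: DL.simps of_nat_Suc)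
  ultimately show ?thesis unfolding DL_euler by (simp add: RQ_def True algebra_simps)
next
  case False
  let ?e = "\<lambda>x. En (Suc n) (complex_vec x) w" and ?N = "of_real (real (Suc n) + gam) :: complex"
  have "?N * RQ \<eta> (Suc n) w x - (\<Sum>\<xi>\<in>Rp. k \<xi> * RQ (reflection \<xi> \<eta>) (Suc n) w (reflection \<xi> x))
      = ?N * ((?e x - ?e (reflection \<eta> x)) / of_real (\<eta> \<bullet> x))
        - (\<Sum>\<xi>\<in>Rp. k \<xi> * ((?e (reflection \<xi> x) - ?e (reflection \<xi> (reflection \<eta> x))) / of_real (\<eta> \<bullet> x)))"
    by (simp add: RQ_def reflection_inner False reflection_conjugate del: En.simps of_nat_Suc)
  also have "\<dots> = ((?N * ?e x - (\<Sum>\<xi>\<in>Rp. k \<xi> * ?e (reflection \<xi> x)))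
      - (?N * ?e (reflection \<eta> x) - (\<Sum>\<xi>\<in>Rp. k \<xi> * ?e (reflection \<xi> (reflection \<eta> x))))) / of_real (\<eta> \<bullet> x)"
    by (simp add: diff_divide_distrib right_diff_distrib sum_subtractf sum_divide_distrib del: En.simps of_nat_Suc)
  also have "\<dots> = (cinner (complex_vec x) w * En n (complex_vec x) w
      - cinner (complex_vec (reflection \<eta> x)) w * En n (complex_vec (reflection \<eta> x)) w) / of_real (\<eta> \<bullet> x)"
    unfolding En_Suc_euler_real ..
  also have "\<dots> = cinner (complex_vec x) w * RQ \<eta> n w x
      + of_real (2 / (\<eta> \<bullet> \<eta>)) * cinner (complex_vec \<eta>) w * En n (complex_vec (reflection \<eta> x)) w"
    unfolding cinner_reflection_real using False R_nonzero(2)[OF assms]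
    by (simp add: RQ_def field_simps)
  finally show ?thesis .
qed

lemma RQ_neg: "RQ (- \<xi>) n w x = - RQ \<xi> n w x"
  using linear_neg[OF DL_linear, of n w \<xi> x]
  by (simp add: RQ_def minus_divide_right[symmetric])

lemma TE_euler:
  "of_real (real (Suc n) + gam) * TE (Suc n) w v x - (\<Sum>\<xi>\<in>Rp. k \<xi> * TE (Suc n) w (reflection \<xi> v) (reflection \<xi> x))
    = cinner (complex_vec v) w * En n (complex_vec x) w + cinner (complex_vec x) w * TE n w v x
      + (\<Sum>\<eta>\<in>Rp. of_real (k \<eta> * (2 * (\<eta> \<bullet> v) / (\<eta> \<bullet> \<eta>))) * cinner (complex_vec \<eta>) w * En n (complex_vec (reflection \<eta> x)) w)"
proof -
  let ?N = "of_real (real (Suc n) + gam) :: complex"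
  \<comment> \<open>Both \<open>RQ\<close> and the inner product are odd in the root, so the summand
    is even and \<open>sum_flip\<close> applies.\<close>
  have flip: "(\<Sum>\<eta>\<in>Rp. of_real (k \<eta> * (\<eta> \<bullet> reflection \<xi> v)) * RQ \<eta> (Suc n) w (reflection \<xi> x))
     = (\<Sum>\<eta>\<in>Rp. of_real (k \<eta> * (\<eta> \<bullet> v)) * RQ (reflection \<xi> \<eta>) (Suc n) w (reflection \<xi> x))" if "\<xi> \<in> Rp" for \<xi>
  proof -
    have "(\<Sum>\<eta>\<in>Rp. of_real (k \<eta> * (\<eta> \<bullet> reflection \<xi> v)) * RQ \<eta> (Suc n) w (reflection \<xi> x))
      = (\<Sum>\<eta>\<in>Rp. of_real (k (reflection \<xi> \<eta>) * (reflection \<xi> \<eta> \<bullet> reflection \<xi> v)) * RQ (reflection \<xi> \<eta>) (Suc n) w (reflection \<xi> x))"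
      by (rule sum_flip[symmetric, where \<phi> = "\<lambda>\<eta>. of_real (k \<eta> * (\<eta> \<bullet> reflection \<xi> v)) * RQ \<eta> (Suc n) w (reflection \<xi> x)"])
        (auto simp: that Rp_R k_neg RQ_neg)
    also have "\<dots> = (\<Sum>\<eta>\<in>Rp. of_real (k \<eta> * (\<eta> \<bullet> v)) * RQ (reflection \<xi> \<eta>) (Suc n) w (reflection \<xi> x))"
      by (rule sum.cong[OF refl]) (simp add: reflection_inner k_reflection Rp_R that)
    finally show ?thesis .
  qed
  have "(\<Sum>\<xi>\<in>Rp. k \<xi> * TE (Suc n) w (reflection \<xi> v) (reflection \<xi> x))
     = (\<Sum>\<xi>\<in>Rp. k \<xi> * DL (Suc n) w [reflection \<xi> v] (reflection \<xi> x))
      + (\<Sum>\<xi>\<in>Rp. \<Sum>\<eta>\<in>Rp. k \<xi> * (of_real (k \<eta> * (\<eta> \<bullet> v)) * RQ (reflection \<xi> \<eta>) (Suc n) w (reflection \<xi> x)))"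
    unfolding TE_def by (simp add: flip distrib_left sum.distrib sum_distrib_left del: DL.simps of_real_mult)
  also have "(\<Sum>\<xi>\<in>Rp. \<Sum>\<eta>\<in>Rp. k \<xi> * (of_real (k \<eta> * (\<eta> \<bullet> v)) * RQ (reflection \<xi> \<eta>) (Suc n) w (reflection \<xi> x)))
     = (\<Sum>\<eta>\<in>Rp. of_real (k \<eta> * (\<eta> \<bullet> v)) * (\<Sum>\<xi>\<in>Rp. k \<xi> * RQ (reflection \<xi> \<eta>) (Suc n) w (reflection \<xi> x)))"
    by (subst sum.swap) (simp add: sum_distrib_left mult_ac)
  finally have "?N * TE (Suc n) w v x - (\<Sum>\<xi>\<in>Rp. k \<xi> * TE (Suc n) w (reflection \<xi> v) (reflection \<xi> x))
     = (?N * DL (Suc n) w [v] x - (\<Sum>\<xi>\<in>Rp. k \<xi> * DL (Suc n) w [reflection \<xi> v] (reflection \<xi> x)))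
      + (\<Sum>\<eta>\<in>Rp. of_real (k \<eta> * (\<eta> \<bullet> v)) * (?N * RQ \<eta> (Suc n) w x
            - (\<Sum>\<xi>\<in>Rp. k \<xi> * RQ (reflection \<xi> \<eta>) (Suc n) w (reflection \<xi> x))))"
    unfolding TE_def distrib_left right_diff_distrib sum_subtractf sum_distrib_left[of ?N]
    by (simp add: mult_ac del: DL.simps of_nat_Suc)
  also have "(\<Sum>\<eta>\<in>Rp. of_real (k \<eta> * (\<eta> \<bullet> v)) * (?N * RQ \<eta> (Suc n) w x
            - (\<Sum>\<xi>\<in>Rp. k \<xi> * RQ (reflection \<xi> \<eta>) (Suc n) w (reflection \<xi> x))))
    = (\<Sum>\<eta>\<in>Rp. of_real (k \<eta> * (\<eta> \<bullet> v)) * (cinner (complex_vec x) w * RQ \<eta> n w x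
      + of_real (2 / (\<eta> \<bullet> \<eta>)) * cinner (complex_vec \<eta>) w * En n (complex_vec (reflection \<eta> x)) w))"
    by (rule sum.cong[OF refl]) (simp only: RQ_euler Rp_R)
  finally show ?thesis
    unfolding DL_euler TE_def by (simp add: distrib_left sum.distrib sum_distrib_left mult_ac)
qed

definition PE :: "nat \<Rightarrow> complex^'n \<Rightarrow> real^'n \<Rightarrow> real^'n \<Rightarrow> complex" where
  "PE n w v x = (case n of 0 \<Rightarrow> 0 | Suc m \<Rightarrow> cinner (complex_vec v) w * En m (complex_vec x) w)"

lemma PE_euler:
  "of_real (real (Suc n) + gam) * PE (Suc n) w v x - (\<Sum>\<xi>\<in>Rp. k \<xi> * PE (Suc n) w (reflection \<xi> v) (reflection \<xi> x))
    = cinner (complex_vec v) w * En n (complex_vec x) w + cinner (complex_vec x) w * PE n w v x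
      + (\<Sum>\<eta>\<in>Rp. of_real (k \<eta> * (2 * (\<eta> \<bullet> v) / (\<eta> \<bullet> \<eta>))) * cinner (complex_vec \<eta>) w * En n (complex_vec (reflection \<eta> x)) w)"
proof -
  let ?e = "\<lambda>x. En n (complex_vec x) w"
  \<comment> \<open>\<open>En_Suc_euler_real\<close> one degree lower; in degree 0 both sides vanish
    because the weights add up to \<open>gam\<close>.\<close>
  have e: "cinner (complex_vec v) w * (of_real (real n + gam) * ?e x - (\<Sum>\<xi>\<in>Rp. k \<xi> * ?e (reflection \<xi> x)))
      = cinner (complex_vec x) w * PE n w v x"
  proof (cases n)
    case 0 then show ?thesis by (simp add: PE_def dunkl_gamma_def)
  next
    case (Suc m)
    show ?thesis unfolding Suc En_Suc_euler_real by (simp add: PE_def mult_ac)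
  qed
  have "(\<Sum>\<xi>\<in>Rp. k \<xi> * PE (Suc n) w (reflection \<xi> v) (reflection \<xi> x))
    = (\<Sum>\<xi>\<in>Rp. cinner (complex_vec v) w * (k \<xi> * ?e (reflection \<xi> x))
       - of_real (k \<xi> * (2 * (\<xi> \<bullet> v) / (\<xi> \<bullet> \<xi>))) * cinner (complex_vec \<xi>) w * ?e (reflection \<xi> x))"
    unfolding PE_def nat.case cinner_reflection_real by (simp add: algebra_simps)
  also have "\<dots> = cinner (complex_vec v) w * (\<Sum>\<xi>\<in>Rp. k \<xi> * ?e (reflection \<xi> x))
    - (\<Sum>\<xi>\<in>Rp. of_real (k \<xi> * (2 * (\<xi> \<bullet> v) / (\<xi> \<bullet> \<xi>))) * cinner (complex_vec \<xi>) w * ?e (reflection \<xi> x))"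
    by (simp add: sum_subtractf sum_distrib_left)
  finally show ?thesis
    unfolding e[symmetric] by (simp add: PE_def algebra_simps)
qed

lemma TE_eq_PE: "TE n w v x = PE n w v x"
proof (induction n arbitrary: v x)
  case 0
  show ?case by (auto simp: TE_def PE_def RQ_def intro!: sum.neutral)
next
  case (Suc n)
  define d where "d v x = TE (Suc n) w v x - PE (Suc n) w v x" for v x
  have d: "of_real (real (Suc n) + gam) * d v x = (\<Sum>\<xi>\<in>Rp. k \<xi> * d (reflection \<xi> v) (reflection \<xi> x))" for v x
    using TE_euler[of n w v x] PE_euler[of n w v x] Suc.IH
    unfolding d_def right_diff_distrib sum_subtractf by (simp add: algebra_simps)
  have "d (id v) (id x) = 0"
    by (rule G_system_zero[where F = "\<lambda>g. d (g v) (g x)" and a = "real (Suc n)", OF _ _ id_in_G])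
      (auto simp: d[symmetric] simp del: of_nat_Suc of_real_add)
  then show ?case by (simp add: d_def)
qed

lemma RQ_has_sum:
  "(\<lambda>n. RQ \<xi> n w x) sums reflection_quotient \<xi> (\<lambda>y. EE (complex_vec y) w) x"
proof (cases "\<xi> \<bullet> x = 0")
  case True
  have "(\<lambda>n. of_real (2 / (\<xi> \<bullet> \<xi>)) * DL n w [\<xi>] x) sums (of_real (2 / (\<xi> \<bullet> \<xi>)) * DLE w [\<xi>] x)"
    unfolding DLE_def by (intro sums_mult summable_sums DL_summable)
  then show ?thesis
    using True by (simp add: RQ_def reflection_quotient_def dir_deriv_eq[OF EE_has_derivative_real] scaleR_conv_of_real)
next
  case False
  have "(\<lambda>n. (En n (complex_vec x) w - En n (complex_vec (reflection \<xi> x)) w) / of_real (\<xi> \<bullet> x)) sums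
     ((EE (complex_vec x) w - EE (complex_vec (reflection \<xi> x)) w) / of_real (\<xi> \<bullet> x))"
    unfolding EE_def by (intro sums_divide sums_diff summable_sums En_summable)
  then show ?thesis using False by (simp add: RQ_def reflection_quotient_def)
qed

lemma EE_dunkl_direction:
  "DLE w [v] x + (\<Sum>\<xi>\<in>Rp. of_real (k \<xi> * (\<xi> \<bullet> v)) * reflection_quotient \<xi> (\<lambda>y. EE (complex_vec y) w) x)
    = cinner (complex_vec v) w * EE (complex_vec x) w"
proof -
  have "(\<lambda>n. TE n w v x) sums (DLE w [v] x + (\<Sum>\<xi>\<in>Rp. of_real (k \<xi> * (\<xi> \<bullet> v)) * reflection_quotient \<xi> (\<lambda>y. EE (complex_vec y) w) x))"
    unfolding TE_def DLE_def by (intro sums_add sums_sum sums_mult RQ_has_sum summable_sums DL_summable)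
  moreover have "(\<lambda>n. PE (Suc n) w v x) sums (cinner (complex_vec v) w * EE (complex_vec x) w)"
    unfolding PE_def EE_def nat.case by (intro sums_mult summable_sums En_summable)
  then have "(\<lambda>n. TE n w v x) sums (cinner (complex_vec v) w * EE (complex_vec x) w)"
    unfolding TE_eq_PE by (subst (asm) sums_Suc_iff) (simp add: PE_def)
  ultimately show ?thesis using sums_unique2 by blast
qed

lemma dunkl_op_EE: "dunkl_op Rp k j (\<lambda>y. EE (complex_vec y) w) x = w $ j * EE (complex_vec x) w"
  using EE_dunkl_direction[of w "axis j 1" x]
  by (simp add: dunkl_op_def dir_deriv_eq[OF EE_has_derivative_real] cinner_axis inner_axis scaleR_conv_of_real)

end

section \<open>Power series in several real variables\<close>

lemma has_sum_finite_sum: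
  fixes f :: "'i \<Rightarrow> 'a \<Rightarrow> 'b::topological_comm_monoid_add"
  assumes "finite I" "\<And>i. i \<in> I \<Longrightarrow> (f i has_sum s i) A"
  shows "((\<lambda>x. \<Sum>i\<in>I. f i x) has_sum (\<Sum>i\<in>I. s i)) A"
  using assms by (induction rule: finite_induct) (auto intro: has_sum_add)

text \<open>Absolutely convergent power series on the closed unit polydisc, together with a bound
  for the \<open>\<ell>\<^sup>1\<close> norm of the coefficients.\<close>

definition monomial :: "real^'n \<Rightarrow> ('n \<Rightarrow> nat) \<Rightarrow> complex" where
  "monomial h m = complex_of_real (\<Prod>i\<in>UNIV. (h $ i) ^ m i)"

definition power_series_bound :: "real \<Rightarrow> (real^'n \<Rightarrow> complex) \<Rightarrow> (('n \<Rightarrow> nat) \<Rightarrow> complex) \<Rightarrow> bool" where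
  "power_series_bound B \<phi> c \<longleftrightarrow> (\<forall>F. finite F \<longrightarrow> (\<Sum>m\<in>F. norm (c m)) \<le> B) \<and>
     (\<forall>h. (\<forall>i. \<bar>h $ i\<bar> \<le> 1) \<longrightarrow> ((\<lambda>m. c m * monomial h m) has_sum \<phi> h) UNIV)"

text \<open>Multiplication by the coordinate \<open>h $ i\<close>, seen on the coefficients.\<close>

definition shift_coeff :: "'n \<Rightarrow> (('n \<Rightarrow> nat) \<Rightarrow> complex) \<Rightarrow> ('n \<Rightarrow> nat) \<Rightarrow> complex" where
  "shift_coeff i c m = (if m i = 0 then 0 else c (m(i := m i - 1)))"

lemma norm_monomial_le: "(\<And>i. \<bar>h $ i\<bar> \<le> 1) \<Longrightarrow> norm (monomial h m) \<le> 1"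
  unfolding monomial_def norm_of_real abs_prod power_abs by (rule prod_le_1) (auto simp: power_le_one)

lemma monomial_shift: "monomial h (m(i := Suc (m i))) = of_real (h $ i) * monomial h m"
proof -
  have "(\<Prod>j\<in>UNIV - {i}. (h $ j) ^ (m(i := Suc (m i))) j) = (\<Prod>j\<in>UNIV - {i}. (h $ j) ^ m j)"
    by (rule prod.cong) auto
  then show ?thesis
    unfolding monomial_def by (subst (1 2) prod.remove[of _ i]) auto
qed

lemma power_series_bound_const: "power_series_bound (norm a) (\<lambda>_. a) (\<lambda>m. if m = (\<lambda>_. 0) then a else 0)"
  unfolding power_series_bound_def
proof (intro conjI allI impI)
  fix F :: "('n \<Rightarrow> nat) set" assume "finite F"
  have "(\<Sum>m\<in>F. norm (if m = (\<lambda>_. 0) then a else 0)) = (\<Sum>m\<in>F. if m = (\<lambda>_. 0) then norm a else 0)"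
    by (rule sum.cong) auto
  then show "(\<Sum>m\<in>F. norm (if m = (\<lambda>_. 0) then a else 0)) \<le> norm a"
    using \<open>finite F\<close> by (simp add: sum.delta)
next
  fix h :: "real^'n"
  show "((\<lambda>m. (if m = (\<lambda>_. 0) then a else 0) * monomial h m) has_sum a) UNIV"
    by (rule has_sum_finite_neutralI[of "{\<lambda>_. 0}"]) (auto simp: monomial_def)
qed

text \<open>Raising one exponent is injective on multi-indices; it relabels the coefficients and
  leaves the sum of their norms unchanged.\<close>

lemma power_series_bound_shift:
  fixes i :: "'n::finite" and \<phi> :: "real^'n \<Rightarrow> complex"
  assumes "power_series_bound B \<phi> c"
  shows "power_series_bound B (\<lambda>h. of_real (h $ i) * \<phi> h) (shift_coeff i c)"
proof -
  let ?s = "\<lambda>m. m(i := Suc (m i))"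
  have inj: "inj ?s"
  proof (rule inj_onI)
    fix m m' :: "'n \<Rightarrow> nat" assume eq: "m(i := Suc (m i)) = m'(i := Suc (m' i))"
    show "m = m'"
    proof
      fix j show "m j = m' j" using fun_cong[OF eq, of j] by (cases "j = i") auto
    qed
  qed
  have sh: "shift_coeff i c (?s m) = c m" for m by (simp add: shift_coeff_def)
  have notin: "shift_coeff i c m = 0" if "m \<notin> range ?s" for m
  proof (rule ccontr)
    assume "shift_coeff i c m \<noteq> 0"
    then have "m = ?s (m(i := m i - 1))" by (auto simp: shift_coeff_def split: if_splits)
    then show False using that by blast
  qed
  show ?thesis
    unfolding power_series_bound_def
  proof (intro conjI allI impI)
    fix F :: "('n \<Rightarrow> nat) set" assume "finite F"
    have "(\<Sum>m\<in>F. norm (shift_coeff i c m)) = (\<Sum>m\<in>F \<inter> range ?s. norm (shift_coeff i c m))"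
      by (rule sum.mono_neutral_right) (use \<open>finite F\<close> notin in auto)
    also have "F \<inter> range ?s = ?s ` (?s -` F)" by auto
    also have "(\<Sum>m\<in>?s ` (?s -` F). norm (shift_coeff i c m)) = (\<Sum>m\<in>?s -` F. norm (c m))"
      by (subst sum.reindex) (use inj in \<open>auto simp: sh intro: inj_on_subset\<close>)
    also have "\<dots> \<le> B"
      using assms finite_vimageI[OF \<open>finite F\<close> inj] by (simp add: power_series_bound_def)
    finally show "(\<Sum>m\<in>F. norm (shift_coeff i c m)) \<le> B" .
  next
    fix h :: "real^'n" assume h: "\<forall>i. \<bar>h $ i\<bar> \<le> 1"
    have "((\<lambda>m. of_real (h $ i) * (c m * monomial h m)) has_sum (of_real (h $ i) * \<phi> h)) UNIV"
      using assms h unfolding power_series_bound_def by (intro has_sum_cmult_right) blast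
    also have "(\<lambda>m. of_real (h $ i) * (c m * monomial h m)) = (\<lambda>m. shift_coeff i c m * monomial h m) \<circ> ?s"
      by (auto simp: sh monomial_shift)
    finally have "((\<lambda>m. shift_coeff i c m * monomial h m) has_sum (of_real (h $ i) * \<phi> h)) (range ?s)"
      by (rule has_sum_reindex[OF inj, THEN iffD2])
    then show "((\<lambda>m. shift_coeff i c m * monomial h m) has_sum (of_real (h $ i) * \<phi> h)) UNIV"
      by (rule has_sum_cong_neutral[THEN iffD1, rotated -1]) (auto simp: notin)
  qed
qed

lemma power_series_bound_sum:
  fixes \<phi> :: "'i \<Rightarrow> real^'n \<Rightarrow> complex"
  assumes "finite I" "\<And>i. i \<in> I \<Longrightarrow> power_series_bound (B i) (\<phi> i) (c i)"
  shows "power_series_bound (\<Sum>i\<in>I. norm (b i) * B i) (\<lambda>h. \<Sum>i\<in>I. b i * \<phi> i h) (\<lambda>m. \<Sum>i\<in>I. b i * c i m)"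
  unfolding power_series_bound_def
proof (intro conjI allI impI)
  fix F :: "('n \<Rightarrow> nat) set" assume F: "finite F"
  have "(\<Sum>m\<in>F. norm (\<Sum>i\<in>I. b i * c i m)) \<le> (\<Sum>m\<in>F. \<Sum>i\<in>I. norm (b i) * norm (c i m))"
    by (intro sum_mono norm_sum[THEN order_trans]) (simp add: norm_mult)
  also have "\<dots> = (\<Sum>i\<in>I. norm (b i) * (\<Sum>m\<in>F. norm (c i m)))"
    by (subst sum.swap) (simp add: sum_distrib_left)
  also have "\<dots> \<le> (\<Sum>i\<in>I. norm (b i) * B i)"
    using assms F by (intro sum_mono mult_left_mono) (auto simp: power_series_bound_def)
  finally show "(\<Sum>m\<in>F. norm (\<Sum>i\<in>I. b i * c i m)) \<le> (\<Sum>i\<in>I. norm (b i) * B i)" .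
next
  fix h :: "real^'n" assume "\<forall>i. \<bar>h $ i\<bar> \<le> 1"
  then have "((\<lambda>m. \<Sum>i\<in>I. b i * (c i m * monomial h m)) has_sum (\<Sum>i\<in>I. b i * \<phi> i h)) UNIV"
    using assms by (intro has_sum_finite_sum has_sum_cmult_right) (auto simp: power_series_bound_def)
  then show "((\<lambda>m. (\<Sum>i\<in>I. b i * c i m) * monomial h m) has_sum (\<Sum>i\<in>I. b i * \<phi> i h)) UNIV"
    by (simp add: sum_distrib_right mult.assoc)
qed

lemma power_series_bound_add:
  fixes \<phi> \<phi>' :: "real^'n \<Rightarrow> complex"
  assumes "power_series_bound B \<phi> c" "power_series_bound B' \<phi>' c'"
  shows "power_series_bound (B + B') (\<lambda>h. \<phi> h + \<phi>' h) (\<lambda>m. c m + c' m)"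
  unfolding power_series_bound_def
proof (intro conjI allI impI)
  fix F :: "('n \<Rightarrow> nat) set" assume F: "finite F"
  have "(\<Sum>m\<in>F. norm (c m + c' m)) \<le> (\<Sum>m\<in>F. norm (c m)) + (\<Sum>m\<in>F. norm (c' m))"
    unfolding sum.distrib[symmetric] by (intro sum_mono norm_triangle_ineq)
  also have "\<dots> \<le> B + B'" using assms F by (intro add_mono) (auto simp: power_series_bound_def)
  finally show "(\<Sum>m\<in>F. norm (c m + c' m)) \<le> B + B'" .
next
  fix h :: "real^'n" assume "\<forall>i. \<bar>h $ i\<bar> \<le> 1"
  then show "((\<lambda>m. (c m + c' m) * monomial h m) has_sum (\<phi> h + \<phi>' h)) UNIV"
    using assms unfolding power_series_bound_def distrib_right by (intro has_sum_add) blast+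
qed

lemma power_series_bound_mono: "power_series_bound B \<phi> c \<Longrightarrow> B \<le> B' \<Longrightarrow> power_series_bound B' \<phi> c"
  unfolding power_series_bound_def by force

text \<open>The kernel polynomials are built by multiplication with linear forms. Recentred at a
  point these become affine, and each multiplication costs the sum of the moduli of the affine
  coefficients.\<close>

lemma power_series_bound_affine:
  assumes "power_series_bound B \<phi> c" and "norm a + (\<Sum>i\<in>UNIV. norm (b i)) \<le> L" and "0 \<le> B"
  shows "power_series_bound (L * B) (\<lambda>h. (a + (\<Sum>i\<in>UNIV. of_real (h $ i) * b i)) * \<phi> h)
    (\<lambda>m. a * c m + (\<Sum>i\<in>UNIV. b i * shift_coeff i c m))"
proof -
  have "power_series_bound (norm a * B + (\<Sum>i\<in>UNIV. norm (b i) * B))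
     (\<lambda>h. a * \<phi> h + (\<Sum>i\<in>UNIV. b i * (of_real (h $ i) * \<phi> h)))
     (\<lambda>m. a * c m + (\<Sum>i\<in>UNIV. b i * shift_coeff i c m))"
    using power_series_bound_sum[of "{()}" "\<lambda>_. B" "\<lambda>_. \<phi>" "\<lambda>_. c" "\<lambda>_. a"] assms(1)
    by (intro power_series_bound_add power_series_bound_sum power_series_bound_shift) auto
  moreover have "(\<lambda>h. a * \<phi> h + (\<Sum>i\<in>UNIV. b i * (of_real (h $ i) * \<phi> h)))
      = (\<lambda>h. (a + (\<Sum>i\<in>UNIV. of_real (h $ i) * b i)) * \<phi> h)"
    by (simp add: fun_eq_iff distrib_right sum_distrib_right mult.assoc mult.left_commute[of _ "b _"])
  moreover have "norm a * B + (\<Sum>i\<in>UNIV. norm (b i) * B) \<le> L * B"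
    using mult_right_mono[OF assms(2,3)] by (simp add: distrib_right sum_distrib_right)
  ultimately show ?thesis using power_series_bound_mono by fastforce
qed

text \<open>As \<open>B n\<close> bounds the coefficient norms of the \<open>n\<close>-th series,
  the family over all pairs of a degree and a multi-index is absolutely summable and may be summed
  in the other order.\<close>

lemma power_series_bound_suminf:
  fixes \<phi> :: "nat \<Rightarrow> real^'n \<Rightarrow> complex"
  assumes ps: "\<And>n. power_series_bound (B n) (\<phi> n) (c n)" and B: "summable B"
  shows "\<exists>c'. power_series_bound (\<Sum>n. B n) (\<lambda>h. \<Sum>n. \<phi> n h) c'"
proof
  have bd: "(\<Sum>m\<in>F. norm (c n m)) \<le> B n" if "finite F" for F n
    using ps that by (simp add: power_series_bound_def)
  have B0: "0 \<le> B n" for n using bd[of "{}" n] by simp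
  have sm: "summable (\<lambda>n. norm (c n m))" for m
    by (rule summable_comparison_test'[OF B]) (use bd[of "{m}"] in simp)
  show "power_series_bound (\<Sum>n. B n) (\<lambda>h. \<Sum>n. \<phi> n h) (\<lambda>m. \<Sum>n. c n m)"
    unfolding power_series_bound_def
  proof (intro conjI allI impI)
    fix F :: "('n \<Rightarrow> nat) set" assume F: "finite F"
    have "(\<Sum>m\<in>F. norm (\<Sum>n. c n m)) \<le> (\<Sum>m\<in>F. \<Sum>n. norm (c n m))"
      by (intro sum_mono summable_norm sm)
    also have "\<dots> = (\<Sum>n. \<Sum>m\<in>F. norm (c n m))"
      by (intro suminf_sum[symmetric] sm)
    also have "\<dots> \<le> (\<Sum>n. B n)"
      by (intro suminf_le bd F B summable_sum sm)
    finally show "(\<Sum>m\<in>F. norm (\<Sum>n. c n m)) \<le> (\<Sum>n. B n)" .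
  next
    fix h :: "real^'n" assume h: "\<forall>i. \<bar>h $ i\<bar> \<le> 1"
    let ?f = "\<lambda>(n, m). c n m * monomial h m"
    have le: "norm (c n m * monomial h m) \<le> norm (c n m)" for n m
      using norm_monomial_le[of h m] h by (simp add: norm_mult mult_left_le)
    have "(\<lambda>x. norm (?f x)) summable_on (UNIV \<times> UNIV)"
    proof (rule nonneg_bdd_above_summable_on)
      show "bdd_above (sum (\<lambda>x. norm (?f x)) ` {F. F \<subseteq> UNIV \<times> UNIV \<and> finite F})"
      proof (rule bdd_aboveI2)
        fix F :: "(nat \<times> ('n \<Rightarrow> nat)) set" assume "F \<in> {F. F \<subseteq> UNIV \<times> UNIV \<and> finite F}"
        then have F: "finite F" by simp
        have "(\<Sum>x\<in>F. norm (?f x)) \<le> (\<Sum>x\<in>fst ` F \<times> snd ` F. norm (?f x))"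
          by (intro sum_mono2) (use F in \<open>auto intro: rev_image_eqI\<close>)
        also have "\<dots> \<le> (\<Sum>(n, m)\<in>fst ` F \<times> snd ` F. norm (c n m))"
          using le by (intro sum_mono) auto
        also have "\<dots> = (\<Sum>n\<in>fst ` F. \<Sum>m\<in>snd ` F. norm (c n m))"
          by (simp add: sum.cartesian_product)
        also have "\<dots> \<le> (\<Sum>n\<in>fst ` F. B n)" using F by (intro sum_mono bd) auto
        also have "\<dots> \<le> (\<Sum>n. B n)" using F B0 by (intro sum_le_suminf B) auto
        finally show "(\<Sum>x\<in>F. norm (?f x)) \<le> (\<Sum>n. B n)" .
      qed
    qed auto
    then have "?f summable_on (UNIV \<times> UNIV)" by (rule abs_summable_summable)
    then obtain s where s: "(?f has_sum s) (UNIV \<times> UNIV)" by (auto simp: summable_on_def)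
    have "((\<lambda>n. \<phi> n h) has_sum s) UNIV"
      by (rule has_sum_SigmaD[OF s]) (use ps h in \<open>auto simp: power_series_bound_def\<close>)
    then have "(\<Sum>n. \<phi> n h) = s" using has_sum_imp_sums sums_unique by blast
    moreover have "((\<lambda>(m, n). ?f (n, m)) has_sum s) (UNIV \<times> UNIV)"
      using s by (subst (asm) has_sum_swap)
    then have "((\<lambda>m. (\<Sum>n. c n m) * monomial h m) has_sum s) UNIV"
    proof (rule has_sum_SigmaD)
      fix m
      have "(\<lambda>n. c n m * monomial h m) sums ((\<Sum>n. c n m) * monomial h m)"
        by (intro sums_mult2 summable_sums summable_norm_cancel[OF sm])
      moreover have "summable (\<lambda>n. norm (c n m * monomial h m))"
        by (rule summable_comparison_test'[OF sm]) (use le in simp)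
      ultimately show "((\<lambda>n. case (m, n) of (m, n) \<Rightarrow> ?f (n, m)) has_sum ((\<Sum>n. c n m) * monomial h m)) UNIV"
        by (simp add: norm_summable_imp_has_sum)
    qed
    ultimately show "((\<lambda>m. (\<Sum>n. c n m) * monomial h m) has_sum (\<Sum>n. \<phi> n h)) UNIV" by simp
  qed
qed

lemma monomial_diff: "monomial (x - a) m = complex_of_real (\<Prod>i\<in>UNIV. (x $ i - a $ i) ^ m i)"
  by (simp add: monomial_def)

text \<open>An eigenfunction in the sense of \<open>dunkl_kernel_real\<close> is only known to be
  analytic, but the ray equation needs its derivative. The linear part of the expansion is that
  derivative, the terms of degree at least 2 being quadratically small.\<close>

lemma analytic_real_differentiable:
  fixes u :: "real^'n \<Rightarrow> complex"
  assumes "analytic_real u"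
  shows "u differentiable (at a)"
proof -
  obtain r c where r: "0 < r" and c: "\<And>x. x \<in> ball a r \<Longrightarrow>
     ((\<lambda>m. c m * complex_of_real (\<Prod>i\<in>UNIV. (x $ i - a $ i) ^ m i)) has_sum u x) UNIV"
    using assms[unfolded analytic_real_def, rule_format, of a] by (elim exE conjE) (rule that, auto)
  have u: "((\<lambda>m. c m * monomial h m) has_sum u (a + h)) UNIV" if "norm h < r" for h
    using c[of "a + h"] that by (simp add: monomial_def dist_norm)
  define N where "N = real CARD('n)"
  have N: "0 < N" by (simp add: N_def)
  \<comment> \<open>The vector with all coordinates \<open>\<rho>\<close> lies in the ball of
    convergence, and there each monomial is a power of \<open>\<rho>\<close>. Absolute convergence
    at this one point controls all coefficients at once.\<close>
  define \<rho> where "\<rho> = r / (2 * N)"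
  have \<rho>: "0 < \<rho>" using r N by (simp add: \<rho>_def)
  have "norm (\<chi> i::'n. \<rho>) \<le> N * \<rho>"
    using norm_le_l1_cart[of "\<chi> i::'n. \<rho>"] \<rho> by (simp add: N_def)
  also have "\<dots> < r" using r N by (simp add: \<rho>_def)
  finally have "(\<lambda>m. c m * monomial (\<chi> i. \<rho>) m) summable_on UNIV" using u by (auto simp: summable_on_def)
  then have abs: "(\<lambda>m. norm (c m * monomial (\<chi> i. \<rho>) m)) summable_on UNIV"
    by (rule summable_on_iff_abs_summable_on_complex[THEN iffD1])
  define deg where "deg m = (\<Sum>i\<in>UNIV. m i)" for m :: "'n \<Rightarrow> nat"
  have mon\<rho>: "norm (monomial (\<chi> i. \<rho>) m) = \<rho> ^ deg m" for m
    unfolding monomial_def norm_of_real abs_prod power_abs deg_def power_sum using \<rho> by simp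
  define K where "K = (\<Sum>\<^sub>\<infinity>m. norm (c m) * \<rho> ^ deg m)"
  have K: "((\<lambda>m. norm (c m) * \<rho> ^ deg m) has_sum K) UNIV"
    using abs unfolding K_def norm_mult mon\<rho> by (rule has_sum_infsum)
  have K0: "0 \<le> K" using K by (rule has_sum_nonneg) (use \<rho> in auto)
  have mon: "norm (monomial h m) \<le> norm h ^ deg m" for h m
    unfolding monomial_def norm_of_real abs_prod power_abs deg_def power_sum
    by (intro prod_mono) (auto intro!: power_mono component_le_norm_cart)
  define E where "E = range (\<lambda>i::'n. (\<lambda>j. if j = i then 1 else (0::nat)))"
  define Z where "Z = (\<lambda>_::'n. 0::nat)"
  define D where "D h = (\<Sum>i\<in>UNIV. c (\<lambda>j. if j = i then 1 else 0) * of_real (h $ i))" for h :: "real^'n"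
  have finE: "finite (insert Z E)" by (simp add: E_def)
  have deg2: "2 \<le> deg m" if "m \<notin> insert Z E" for m
  proof (rule ccontr)
    assume "\<not> 2 \<le> deg m"
    then consider "deg m = 0" | "deg m = 1" by linarith
    then show False
    proof cases
      case 1 then show False using that by (auto simp: deg_def Z_def)
    next
      case 2
      then obtain i where i: "m i = 1" "\<And>j. j \<noteq> i \<Longrightarrow> m j = 0"
        unfolding deg_def sum_eq_1_iff[OF finite_class.finite_UNIV] by (metis UNIV_I)
      then have "m = (\<lambda>j. if j = i then 1 else 0)" by auto
      then show False using that by (auto simp: E_def)
    qed
  qed
  have sumE: "(\<Sum>m\<in>insert Z E. c m * monomial h m) = c Z + D h" for h
  proof -
    have inj: "inj (\<lambda>i::'n. (\<lambda>j. if j = i then 1 else (0::nat)))"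
    proof (rule injI)
      fix i i' :: 'n assume eq: "(\<lambda>j. if j = i then 1 else (0::nat)) = (\<lambda>j. if j = i' then 1 else 0)"
      show "i = i'" using fun_cong[OF eq, of i] by (simp split: if_splits)
    qed
    have mon_e: "monomial h (\<lambda>j. if j = i then 1 else 0) = of_real (h $ i)" for i
    proof -
      have "(\<Prod>j\<in>UNIV. (h $ j) ^ (if j = i then 1 else 0)) = (\<Prod>j\<in>UNIV. if j = i then h $ j else 1)"
        by (rule prod.cong) auto
      then show ?thesis by (simp add: monomial_def)
    qed
    have "Z \<notin> E"
    proof
      assume "Z \<in> E"
      then obtain i where "Z = (\<lambda>j. if j = i then 1 else 0)" by (auto simp: E_def)
      from fun_cong[OF this, of i] show False by (simp add: Z_def)
    qed
    then have "(\<Sum>m\<in>insert Z E. c m * monomial h m) = c Z * monomial h Z + (\<Sum>m\<in>E. c m * monomial h m)"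
      using finE by simp
    also have "(\<Sum>m\<in>E. c m * monomial h m) = D h"
      unfolding E_def D_def by (subst sum.reindex[OF inj]) (simp add: mon_e)
    finally show ?thesis by (simp add: monomial_def Z_def)
  qed
  have est: "norm (u (a + h) - (c Z + D h)) \<le> K * (norm h / \<rho>)\<^sup>2" if h: "norm h < r" "norm h \<le> \<rho>" for h
  proof -
    have "((\<lambda>m. c m * monomial h m) has_sum (u (a + h) - (c Z + D h))) (UNIV - insert Z E)"
      unfolding sumE[symmetric] by (intro has_sum_Diff u h has_sum_finite finE subset_UNIV)
    moreover have "((\<lambda>m. (norm h / \<rho>)\<^sup>2 * (norm (c m) * \<rho> ^ deg m)) has_sum
        ((norm h / \<rho>)\<^sup>2 * (K - (\<Sum>m\<in>insert Z E. norm (c m) * \<rho> ^ deg m)))) (UNIV - insert Z E)"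
      by (intro has_sum_cmult_right has_sum_Diff K has_sum_finite finE subset_UNIV)
    ultimately have "norm (u (a + h) - (c Z + D h)) \<le> (norm h / \<rho>)\<^sup>2 * (K - (\<Sum>m\<in>insert Z E. norm (c m) * \<rho> ^ deg m))"
    proof (rule norm_infsum_le)
      fix m assume m: "m \<in> UNIV - insert Z E"
      have "norm h ^ deg m = (norm h / \<rho>) ^ deg m * \<rho> ^ deg m" using \<rho> by (simp add: power_divide)
      also have "\<dots> \<le> (norm h / \<rho>)\<^sup>2 * \<rho> ^ deg m"
        using deg2[of m] m h \<rho> by (intro mult_right_mono power_decreasing) auto
      finally have "norm (c m) * norm (monomial h m) \<le> norm (c m) * ((norm h / \<rho>)\<^sup>2 * \<rho> ^ deg m)"
        using mon[of h m] by (intro mult_left_mono) auto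
      then show "norm (c m * monomial h m) \<le> (norm h / \<rho>)\<^sup>2 * (norm (c m) * \<rho> ^ deg m)"
        by (simp add: norm_mult mult_ac)
    qed
    also have "\<dots> \<le> (norm h / \<rho>)\<^sup>2 * K"
      using \<rho> by (intro mult_left_mono) (auto simp: sum_nonneg)
    finally show ?thesis by (simp add: mult.commute)
  qed
  have "norm (u a - (c Z + D 0)) \<le> 0" using est[of 0] r \<rho> by simp
  then have ua: "u a = c Z" by (simp add: D_def)
  have "(u has_derivative D) (at a)"
    unfolding has_derivative_at
  proof
    show "bounded_linear D"
      unfolding D_def by (intro bounded_linear_sum bounded_linear_const_mult bounded_linear_of_real[THEN bounded_linear_compose] bounded_linear_vec_nth)
    show "((\<lambda>h. norm (u (a + h) - u a - D h) / norm h) \<longlongrightarrow> 0) (at 0)"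
    proof (rule Lim_null_comparison)
      show "((\<lambda>h. K / \<rho>\<^sup>2 * norm h) \<longlongrightarrow> 0) (at (0::real^'n))"
        by (rule tendsto_mult_right_zero[OF tendsto_norm_zero[OF tendsto_ident_at]])
      show "\<forall>\<^sub>F h in at 0. norm (norm (u (a + h) - u a - D h) / norm h) \<le> K / \<rho>\<^sup>2 * norm h"
        unfolding eventually_at
      proof (intro exI[of _ "min r \<rho>"] conjI ballI impI)
        fix h :: "real^'n" assume "h \<noteq> 0 \<and> dist h 0 < min r \<rho>"
        then have h: "h \<noteq> 0" "norm h < r" "norm h \<le> \<rho>" by auto
        have "norm (u (a + h) - u a - D h) \<le> K * (norm h / \<rho>)\<^sup>2"
          using est[OF h(2,3)] by (simp add: ua diff_diff_add)
        also have "\<dots> = K / \<rho>\<^sup>2 * norm h * norm h" by (simp add: power_divide power2_eq_square)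
        finally show "norm (norm (u (a + h) - u a - D h) / norm h) \<le> K / \<rho>\<^sup>2 * norm h"
          using h \<rho> by (simp add: divide_le_eq)
      qed (use r \<rho> in auto)
    qed
  qed
  then show ?thesis by (auto simp: differentiable_def)
qed

section \<open>Analyticity and uniqueness of the Dunkl eigenfunction\<close>

context dunkl
begin

text \<open>\<open>EC w a n g\<close> is the family of Taylor coefficients of \<open>h \<mapsto> En n (complex_vec (g (a + h))) w\<close>.\<close>

primrec EC :: "complex^'n \<Rightarrow> real^'n \<Rightarrow> nat \<Rightarrow> (real^'n \<Rightarrow> real^'n) \<Rightarrow> ('n \<Rightarrow> nat) \<Rightarrow> complex" where
  "EC w a 0 g = (\<lambda>m. if m = (\<lambda>_. 0) then 1 else 0)"
| "EC w a (Suc n) g = (\<lambda>m. \<Sum>g'\<in>G. cf (Suc n) g' *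
     (cinner (complex_vec (g' (g a))) w * EC w a n (g' \<circ> g) m
      + (\<Sum>i\<in>UNIV. cinner (complex_vec (g' (g (axis i 1)))) w * shift_coeff i (EC w a n (g' \<circ> g)) m)))"

text \<open>The isometry \<open>g\<close> is there for the induction: each degree of the recursion
  of \<open>En\<close> composes the argument with one more group element.\<close>

lemma En_power_series:
  assumes "linear g" "\<And>x. norm (g x) = norm x"
  shows "power_series_bound (((norm a + CARD('n)) * norm w) ^ n / fact n)
    (\<lambda>h. En n (complex_vec (g (a + h))) w) (EC w a n g)"
  using assms
proof (induction n arbitrary: g)
  case 0
  show ?case using power_series_bound_const[of 1] by simp
next
  case (Suc n)
  let ?L = "(norm a + CARD('n)) * norm w"
  have L0: "0 \<le> ?L" by simp
  have "power_series_bound (\<Sum>g'\<in>G. norm (complex_of_real (cf (Suc n) g')) * (?L * (?L ^ n / fact n)))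
     (\<lambda>h. \<Sum>g'\<in>G. cf (Suc n) g' * ((cinner (complex_vec (g' (g a))) w + (\<Sum>i\<in>UNIV. of_real (h $ i) * cinner (complex_vec (g' (g (axis i 1)))) w))
        * En n (complex_vec ((g' \<circ> g) (a + h))) w)) (EC w a (Suc n) g)"
    unfolding EC.simps
  proof (intro power_series_bound_sum power_series_bound_affine Suc.IH finite_G)
    fix g' assume g': "g' \<in> G"
    show "linear (g' \<circ> g)" by (rule linear_compose[OF Suc.prems(1) G_linear[OF g']])
    show "norm ((g' \<circ> g) x) = norm x" for x by (simp add: G_norm g' Suc.prems)
    have c: "norm (cinner (complex_vec (g' (g x))) w) \<le> norm x * norm w" for x
      using norm_cinner_le[of "complex_vec (g' (g x))" w] by (simp add: G_norm g' Suc.prems)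
    have "(\<Sum>i\<in>(UNIV::'n set). norm (cinner (complex_vec (g' (g (axis i 1)))) w)) \<le> (\<Sum>i\<in>(UNIV::'n set). norm w)"
      using c[of "axis i 1" for i] by (intro sum_mono) (simp add: norm_axis_1)
    then show "norm (cinner (complex_vec (g' (g a))) w) + (\<Sum>i\<in>UNIV. norm (cinner (complex_vec (g' (g (axis i 1)))) w)) \<le> ?L"
      using c[of a] by (simp add: distrib_right)
  qed auto
  moreover have "(\<Sum>g'\<in>G. norm (complex_of_real (cf (Suc n) g')) * (?L * (?L ^ n / fact n))) = ?L ^ Suc n / fact (Suc n)"
  proof -
    have "(\<Sum>g'\<in>G. norm (complex_of_real (cf (Suc n) g')) * (?L * (?L ^ n / fact n)))
       = (\<Sum>g'\<in>G. cf (Suc n) g') * (?L * (?L ^ n / fact n))"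
      unfolding sum_distrib_right by (rule sum.cong) (auto simp: cf_nonneg)
    then show ?thesis unfolding cf_sum[OF zero_less_Suc] by simp
  qed
  moreover have "(\<lambda>h. \<Sum>g'\<in>G. cf (Suc n) g' * ((cinner (complex_vec (g' (g a))) w + (\<Sum>i\<in>UNIV. of_real (h $ i) * cinner (complex_vec (g' (g (axis i 1)))) w))
        * En n (complex_vec ((g' \<circ> g) (a + h))) w)) = (\<lambda>h. En (Suc n) (complex_vec (g (a + h))) w)"
  proof
    fix h
    have lin: "cinner (complex_vec (g' (g (a + h)))) w
       = cinner (complex_vec (g' (g a))) w + (\<Sum>i\<in>UNIV. of_real (h $ i) * cinner (complex_vec (g' (g (axis i 1)))) w)"
      if g': "g' \<in> G" for g'
    proof -
      have lin: "linear (\<lambda>x. cinner (complex_vec (g' (g x))) w)"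
        using bounded_linear.linear[OF cinner_complex_vec_bounded_linear] linear_compose[OF Suc.prems(1) G_linear[OF g']]
        by (metis (no_types, lifting) comp_apply linear_compose ext)
      have "h = (\<Sum>i\<in>UNIV. (h $ i) *\<^sub>R axis i 1)"
        using basis_expansion[of h] by (simp add: scalar_mult_eq_scaleR)
      then have "cinner (complex_vec (g' (g h))) w = cinner (complex_vec (g' (g (\<Sum>i\<in>UNIV. (h $ i) *\<^sub>R axis i 1)))) w"
        by simp
      also have "\<dots> = (\<Sum>i\<in>UNIV. of_real (h $ i) * cinner (complex_vec (g' (g (axis i 1)))) w)"
        unfolding linear_sum[OF lin] linear_scale[OF lin] by (simp add: scaleR_conv_of_real)
      finally show ?thesis using linear_add[OF lin, of a h] by simp
    qed
    show "(\<Sum>g'\<in>G. cf (Suc n) g' * ((cinner (complex_vec (g' (g a))) w + (\<Sum>i\<in>UNIV. of_real (h $ i) * cinner (complex_vec (g' (g (axis i 1)))) w))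
        * En n (complex_vec ((g' \<circ> g) (a + h))) w)) = En (Suc n) (complex_vec (g (a + h))) w"
      unfolding En.simps by (rule sum.cong) (auto simp: lin complexify_G)
  qed
  ultimately show ?case by simp
qed

lemma analytic_real_EE: "analytic_real (\<lambda>x. EE (complex_vec x) w)"
  unfolding analytic_real_def
proof
  fix a :: "real^'n"
  have "\<exists>c. power_series_bound (\<Sum>n. ((norm a + CARD('n)) * norm w) ^ n / fact n)
     (\<lambda>h. \<Sum>n. En n (complex_vec (id (a + h))) w) c"
    by (rule power_series_bound_suminf[OF En_power_series summable_power_fact]) (rule linear_id, simp)
  then obtain c where c: "\<And>h. (\<And>i. \<bar>h $ i\<bar> \<le> 1) \<Longrightarrow> ((\<lambda>m. c m * monomial h m) has_sum EE (complex_vec (a + h)) w) UNIV"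
    by (auto simp: power_series_bound_def EE_def)
  have "((\<lambda>m. c m * complex_of_real (\<Prod>i\<in>UNIV. (x $ i - a $ i) ^ m i)) has_sum EE (complex_vec x) w) UNIV"
    if "x \<in> ball a 1" for x
    using c[of "x - a"] that component_le_norm_cart[of "x - a"]
    by (force simp: monomial_diff dist_norm norm_minus_commute intro: order_trans[OF _ less_imp_le])
  then show "\<exists>r>0. \<exists>c. \<forall>x\<in>ball a r.
     ((\<lambda>m. c m * complex_of_real (\<Prod>i\<in>UNIV. (x $ i - a $ i) ^ m i)) has_sum EE (complex_vec x) w) UNIV"
    by (intro exI[of _ 1] exI[of _ c] conjI ballI zero_less_one)
qed

lemma dunkl_eigenfunction_euler:
  fixes u :: "real^'n \<Rightarrow> complex"
  assumes u': "(u has_derivative u') (at x)"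
    and eig: "\<And>j. dunkl_op Rp k j u x = w $ j * u x"
  shows "u' x = (cinner (complex_vec x) w - gam) * u x + (\<Sum>\<xi>\<in>Rp. k \<xi> * u (reflection \<xi> x))"
proof -
  have x: "x = (\<Sum>j\<in>UNIV. (x $ j) *\<^sub>R axis j 1)"
    using basis_expansion[of x] by (simp add: scalar_mult_eq_scaleR)
  have lin: "linear u'" using u' by (rule has_derivative_linear)
  have "(\<Sum>j\<in>UNIV. of_real (x $ j) * dunkl_op Rp k j u x)
    = (\<Sum>j\<in>UNIV. (x $ j) *\<^sub>R u' (axis j 1))
      + (\<Sum>j\<in>UNIV. \<Sum>\<xi>\<in>Rp. of_real (x $ j * (k \<xi> * \<xi> $ j)) * reflection_quotient \<xi> u x)"
    unfolding dunkl_op_def dir_deriv_eq[OF u']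
    by (simp add: distrib_left sum.distrib sum_distrib_left scaleR_conv_of_real mult.assoc)
  also have "(\<Sum>j\<in>UNIV. (x $ j) *\<^sub>R u' (axis j 1)) = u' x"
    by (subst (2) x) (simp add: linear_sum[OF lin] linear_scale[OF lin])
  also have "(\<Sum>j\<in>UNIV. \<Sum>\<xi>\<in>Rp. of_real (x $ j * (k \<xi> * \<xi> $ j)) * reflection_quotient \<xi> u x)
     = (\<Sum>\<xi>\<in>Rp. k \<xi> * (of_real (\<xi> \<bullet> x) * reflection_quotient \<xi> u x))"
    by (subst sum.swap) (simp add: inner_vec_def sum_distrib_left sum_distrib_right mult_ac)
  \<comment> \<open>On the hyperplane both sides are 0, because the reflection fixes
    \<open>x\<close> there; so the derivative in the removable singularity drops out.\<close>
  also have "\<dots> = (\<Sum>\<xi>\<in>Rp. k \<xi> * (u x - u (reflection \<xi> x)))"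
    by (rule sum.cong) (auto simp: reflection_quotient_def reflection_def)
  also have "\<dots> = gam * u x - (\<Sum>\<xi>\<in>Rp. k \<xi> * u (reflection \<xi> x))"
    by (simp add: right_diff_distrib sum_subtractf dunkl_gamma_def sum_distrib_right)
  finally have "u' x + (gam * u x - (\<Sum>\<xi>\<in>Rp. k \<xi> * u (reflection \<xi> x))) = (\<Sum>j\<in>UNIV. of_real (x $ j) * (w $ j * u x))"
    unfolding eig by simp
  moreover have "(\<Sum>j\<in>UNIV. of_real (x $ j) * (w $ j * u x)) = cinner (complex_vec x) w * u x"
    by (simp add: cinner_def sum_distrib_right mult.assoc)
  ultimately show ?thesis by (simp add: algebra_simps)
qed

text \<open>Along the rays through the orbit of \<open>x\<close> the difference to the kernel solves
  the singular system with initial value 0, so \<open>energy_zero\<close> applies. Of the Dunkl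
  equations only the radial consequence is used.\<close>

lemma dunkl_eigenfunction_unique:
  assumes "analytic_real u" "\<And>j x. dunkl_op Rp k j u x = w $ j * u x" "u 0 = 1"
  shows "u x = EE (complex_vec x) w"
proof -
  obtain u' where u': "\<And>x. (u has_derivative u' x) (at x)"
    using analytic_real_differentiable[OF assms(1)] unfolding differentiable_def by metis
  define F where "F g t = u (t *\<^sub>R g x) - EE (of_real t *s complexify g (complex_vec x)) w" for g t
  have "F id 1 = 0"
  proof (rule energy_zero[where F = F and d = "\<lambda>g. cinner (complex_vec (g x)) w", OF _ _ _ _ id_in_G])
    have contu: "continuous_on A u" for A
      using u' by (meson continuous_at_imp_continuous_on has_derivative_continuous)
    fix g assume g: "g \<in> G"
    show "continuous_on {0..1} (F g)"
      unfolding F_def by (intro continuous_intros continuous_EE_ray continuous_on_compose2[OF contu[of UNIV]]) auto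
    show "F g 0 = 0" by (simp add: F_def assms(3))
    fix t :: real assume t: "0 < t" "t < 1"
    obtain D where D: "((\<lambda>t. EE (of_real t *s complexify g (complex_vec x)) w) has_vector_derivative D) (at t)"
     "of_real t * D = (of_real t * cinner (complexify g (complex_vec x)) w - gam) * EE (of_real t *s complexify g (complex_vec x)) w
        + (\<Sum>\<xi>\<in>Rp. k \<xi> * EE (of_real t *s complexify (reflection \<xi>) (complexify g (complex_vec x))) w)"
      by (rule EE_ray_real)
    have "((\<lambda>t. t *\<^sub>R g x) has_derivative (\<lambda>s. s *\<^sub>R g x)) (at t)" by (auto intro!: derivative_eq_intros)
    then have "((\<lambda>t. u (t *\<^sub>R g x)) has_derivative (\<lambda>s. u' (t *\<^sub>R g x) (s *\<^sub>R g x))) (at t)"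
      by (rule has_derivative_compose[OF _ u'])
    then have U: "((\<lambda>t. u (t *\<^sub>R g x)) has_vector_derivative u' (t *\<^sub>R g x) (g x)) (at t)"
      by (simp add: has_vector_derivative_def linear_scale[OF has_derivative_linear[OF u']])
    have "of_real t * u' (t *\<^sub>R g x) (g x) = u' (t *\<^sub>R g x) (t *\<^sub>R g x)"
      by (simp add: linear_scale[OF has_derivative_linear[OF u']] scaleR_conv_of_real[where 'a = complex])
    also have "\<dots> = (of_real t * cinner (complex_vec (g x)) w - gam) * u (t *\<^sub>R g x)
        + (\<Sum>\<xi>\<in>Rp. k \<xi> * u (t *\<^sub>R (reflection \<xi> \<circ> g) x))"
      unfolding dunkl_eigenfunction_euler[OF u' assms(2)]
      by (simp add: linear_scale[OF reflection_linear] scaleR_conv_of_real[where 'a = complex])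
    finally have "of_real t * (u' (t *\<^sub>R g x) (g x) - D) = (of_real t * cinner (complex_vec (g x)) w - gam) * F g t
        + (\<Sum>\<xi>\<in>Rp. k \<xi> * F (reflection \<xi> \<circ> g) t)"
      unfolding right_diff_distrib D(2) F_def sum_subtractf using g
      by (simp add: complexify_comp_reflection complexify_G algebra_simps)
    then show "\<exists>D. (F g has_vector_derivative D) (at t) \<and> of_real t * D = (of_real t * cinner (complex_vec (g x)) w - gam) * F g t
        + (\<Sum>\<xi>\<in>Rp. k \<xi> * F (reflection \<xi> \<circ> g) t)"
      using has_vector_derivative_diff[OF U D(1)] unfolding F_def by blast
  qed auto
  then show ?thesis by (simp add: F_def)
qed

lemma dunkl_kernel_real_eq: "dunkl_kernel_real Rp k w = (\<lambda>x. EE (complex_vec x) w)"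
  unfolding dunkl_kernel_real_def
proof (rule the_equality)
  show "analytic_real (\<lambda>x. EE (complex_vec x) w) \<and>
     (\<forall>j x. dunkl_op Rp k j (\<lambda>x. EE (complex_vec x) w) x = w $ j * EE (complex_vec x) w) \<and>
     EE (complex_vec 0) w = 1"
    by (simp add: analytic_real_EE dunkl_op_EE)
qed (use dunkl_eigenfunction_unique in blast)

end

section \<open>Holomorphic extension and identification of the Dunkl kernel\<close>

lemma holomorphic_pair_line:
  assumes "holomorphic_pair E"
  shows "(\<lambda>\<zeta>. E (a + \<zeta> *s b) w) holomorphic_on UNIV"
  unfolding holomorphic_on_def field_differentiable_def
proof (intro ballI)
  fix \<zeta> :: complex
  obtain D where D: "((\<lambda>(z, w). E z w) has_derivative D) (at (a + \<zeta> *s b, w))"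
    "\<And>c z w. D (c *s z, c *s w) = c * D (z, w)"
    using assms unfolding holomorphic_pair_def by blast
  have "bounded_linear (\<lambda>\<zeta>. \<zeta> *s b)"
    by (rule bounded_linear_intro[where K = "norm b"])
      (auto simp: vec_eq_iff algebra_simps norm_smult_complex scaleR_conv_of_real[where 'a = complex])
  then have "((\<lambda>\<zeta>. (a + \<zeta> *s b, w)) has_derivative (\<lambda>c. (c *s b, 0))) (at \<zeta>)"
    by (auto intro!: derivative_eq_intros bounded_linear_imp_has_derivative)
  from has_derivative_compose[OF this D(1)]
  have "((\<lambda>\<zeta>. E (a + \<zeta> *s b) w) has_derivative (\<lambda>c. D (c *s b, 0))) (at \<zeta>)" by simp
  moreover have "(\<lambda>c. D (c *s b, 0)) = (*) (D (b, 0))"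
    using D(2)[of _ b 0] by (simp add: fun_eq_iff mult.commute)
  ultimately show "\<exists>f'. ((\<lambda>\<zeta>. E (a + \<zeta> *s b) w) has_field_derivative f') (at \<zeta> within UNIV)"
    unfolding has_field_derivative_def by auto
qed

text \<open>Write \<open>z = a + \<i> b\<close> with real \<open>a\<close>, \<open>b\<close>. On the
  complex line through \<open>a\<close> in direction \<open>b\<close> both functions are holomorphic
  in one variable and agree at real parameters; the identity theorem carries this to the parameter
  \<open>\<i>\<close>.\<close>

lemma holomorphic_pair_unique:
  fixes E E' :: "complex^'n \<Rightarrow> complex^'n \<Rightarrow> complex"
  assumes "holomorphic_pair E" "holomorphic_pair E'" and eq: "\<And>x w. E (complex_vec x) w = E' (complex_vec x) w"
  shows "E = E'"
proof (intro ext)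
  fix z w :: "complex^'n"
  define a b where "a = (\<chi> i. Re (z $ i))" and "b = (\<chi> i. Im (z $ i))"
  define f where "f \<zeta> = E (complex_vec a + \<zeta> *s complex_vec b) w - E' (complex_vec a + \<zeta> *s complex_vec b) w" for \<zeta>
  have "f \<i> = 0"
  proof (rule analytic_continuation[of f UNIV \<real> 0])
    show "f holomorphic_on UNIV"
      unfolding f_def by (intro holomorphic_intros holomorphic_pair_line assms)
    show "(0::complex) islimpt \<real>"
      unfolding islimpt_approachable
    proof (intro allI impI)
      fix e :: real assume "0 < e"
      then show "\<exists>x'\<in>\<real>. x' \<noteq> (0::complex) \<and> dist x' 0 < e"
        by (intro bexI[of _ "of_real (e / 2)"]) auto
    qed
    fix \<zeta> :: complex assume "\<zeta> \<in> \<real>"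
    then obtain t where "\<zeta> = of_real t" by (auto elim: Reals_cases)
    then have "complex_vec a + \<zeta> *s complex_vec b = complex_vec (a + t *\<^sub>R b)"
      by (simp add: scaleR_eq_smult)
    then show "f \<zeta> = 0" by (simp only: f_def eq diff_self)
  qed auto
  then show "E z w = E' z w"
    using complex_vec_decompose[of z] by (simp add: f_def a_def b_def)
qed

context dunkl
begin

lemma dunkl_kernel_eq: "dunkl_kernel Rp k = EE"
  unfolding dunkl_kernel_def dunkl_kernel_real_eq
proof (rule the_equality)
  fix E assume "holomorphic_pair E \<and> (\<forall>x y. E (complex_vec x) y = EE (complex_vec x) y)"
  then show "E = EE" by (intro holomorphic_pair_unique holomorphic_pair_EE) auto
qed (simp add: holomorphic_pair_EE)

end

section \<open>The Dunkl measure and integration by parts\<close>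

text \<open>Majorized by indicators of the balls of radius \<open>Suc n\<close>: their volume grows
  with exponent \<open>CARD('n)\<close>, and the extra 2 in the exponent leaves the convergent
  series of inverse squares.\<close>

lemma integrable_lborel_decay:
  "integrable lborel (\<lambda>x::real^'n. inverse ((1 + norm x) ^ (CARD('n) + 2)))"
proof (rule integrableI_bounded)
  let ?d = "CARD('n)" and ?V = "unit_ball_vol (real CARD('n))"
  let ?f = "\<lambda>(n::nat) (x::real^'n). ennreal (inverse (real (Suc n) ^ (?d + 2))) * indicator (ball 0 (real (Suc n))) x"
  have le: "ennreal (norm (inverse ((1 + norm x) ^ (?d + 2)))) \<le> (\<Sum>n. ?f n x)" for x :: "real^'n"
  proof -
    define n where "n = nat \<lfloor>norm x\<rfloor>"
    have "real n = of_int \<lfloor>norm x\<rfloor>" by (simp add: n_def)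
    then have n: "real n \<le> norm x" "norm x < real (Suc n)" by linarith+
    have "norm (inverse ((1 + norm x) ^ (?d + 2))) \<le> inverse (real (Suc n) ^ (?d + 2))"
    proof -
      have "inverse ((1 + norm x) ^ (?d + 2)) \<le> inverse (real (Suc n) ^ (?d + 2))"
        by (intro le_imp_inverse_le power_mono) (use n in auto)
      then show ?thesis by (simp del: power_Suc of_nat_Suc power_add)
    qed
    then have "ennreal (norm (inverse ((1 + norm x) ^ (?d + 2)))) \<le> ?f n x"
      using n by (simp add: ennreal_leI)
    also have "\<dots> \<le> (\<Sum>n. ?f n x)"
    proof -
      have "(\<Sum>m\<in>{n}. ?f m x) \<le> (\<Sum>n. ?f n x)" by (rule sum_le_suminf) auto
      then show ?thesis by (simp only: sum.insert finite.emptyI empty_iff not_False_eq_True sum.empty add_0_right)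
    qed
    finally show ?thesis .
  qed
  have "(\<integral>\<^sup>+x. ennreal (norm (inverse ((1 + norm (x::real^'n)) ^ (?d + 2)))) \<partial>lborel) \<le> (\<integral>\<^sup>+x. (\<Sum>n. ?f n x) \<partial>lborel)"
    by (rule nn_integral_mono) (rule le)
  also have "\<dots> = (\<Sum>n. \<integral>\<^sup>+x. ?f n x \<partial>lborel)"
    by (intro nn_integral_suminf borel_measurable_times_ennreal borel_measurable_const borel_measurable_indicator) auto
  also have "\<dots> = (\<Sum>n. ennreal (?V * inverse (real (Suc n) ^ 2)))"
  proof (rule arg_cong[where f = suminf], rule ext)
    fix n
    have "(\<integral>\<^sup>+x. ?f n x \<partial>lborel) = ennreal (inverse (real (Suc n) ^ (?d + 2))) * emeasure lborel (ball (0::real^'n) (real (Suc n)))"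
      by (rule nn_integral_cmult_indicator) simp
    also have "\<dots> = ennreal (inverse (real (Suc n) ^ (?d + 2)) * (?V * real (Suc n) ^ ?d))"
      by (subst emeasure_ball) (auto simp: ennreal_mult unit_ball_vol_nonneg)
    also have "inverse (real (Suc n) ^ (?d + 2)) * (?V * real (Suc n) ^ ?d) = ?V * inverse (real (Suc n) ^ 2)"
      by (simp add: power_add power2_eq_square field_simps del: of_nat_Suc)
    finally show "(\<integral>\<^sup>+x. ?f n x \<partial>lborel) = ennreal (?V * inverse (real (Suc n) ^ 2))" .
  qed
  also have "\<dots> < \<infinity>"
  proof -
    have "summable (\<lambda>n. ?V * inverse (real (Suc n) ^ 2))"
      using inverse_power_summable[of 2, where 'a = real] by (intro summable_mult) (subst summable_Suc_iff, simp)
    then have "(\<Sum>n. ennreal (?V * inverse (real (Suc n) ^ 2))) \<noteq> top"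
      by (rule ennreal_suminf_neq_top) simp
    then show ?thesis by (simp only: infinity_ennreal_def top.not_eq_extremum)
  qed
  finally show "(\<integral>\<^sup>+x. ennreal (norm (inverse ((1 + norm (x::real^'n)) ^ (?d + 2)))) \<partial>lborel) < \<infinity>" .
qed simp

lemma lborel_translation:
  fixes f :: "'a::euclidean_space \<Rightarrow> 'b::{banach, second_countable_topology}"
  assumes [measurable]: "f \<in> borel_measurable borel"
  shows integral_lborel_translation: "(\<integral>x. f (x + c) \<partial>lborel) = (\<integral>x. f x \<partial>lborel)"
    and integrable_lborel_translation: "integrable lborel (\<lambda>x. f (x + c)) \<longleftrightarrow> integrable lborel f"
proof -
  have "(\<integral>x. f x \<partial>distr lborel borel ((+) c)) = (\<integral>x. f (c + x) \<partial>lborel)"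
    by (rule integral_distr) auto
  then show "(\<integral>x. f (x + c) \<partial>lborel) = (\<integral>x. f x \<partial>lborel)"
    by (simp add: lborel_distr_plus add.commute)
  have "integrable (distr lborel borel ((+) c)) f \<longleftrightarrow> integrable lborel (\<lambda>x. f (c + x))"
    by (rule integrable_distr_eq) auto
  then show "integrable lborel (\<lambda>x. f (x + c)) \<longleftrightarrow> integrable lborel f"
    by (simp add: lborel_distr_plus add.commute)
qed

lemma nn_integral_lborel_translation:
  assumes [measurable]: "f \<in> borel_measurable borel"
  shows "(\<integral>\<^sup>+x. f (x + c) \<partial>lborel) = (\<integral>\<^sup>+x. f (x::'a::euclidean_space) \<partial>lborel)"
proof -
  have "(\<integral>\<^sup>+x. f x \<partial>distr lborel borel ((+) c)) = (\<integral>\<^sup>+x. f (c + x) \<partial>lborel)"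
    by (rule nn_integral_distr) auto
  then show ?thesis by (simp add: lborel_distr_plus add.commute)
qed

lemma continuous_reflection: "continuous_on A (reflection \<xi>)"
  by (intro linear_continuous_on linear_conv_bounded_linear[THEN iffD1] reflection_linear)

lemma measurable_reflection [measurable]: "reflection \<xi> \<in> borel \<rightarrow>\<^sub>M borel"
  by (intro borel_measurable_continuous_onI continuous_reflection)

text \<open>The double integral of \<open>1\<^sub>A (\<rho> x + y) 1\<^sub>B y\<close> over the unit ball \<open>B\<close>, evaluated in both orders.\<close>

lemma lborel_distr_reflection: "distr lborel borel (reflection \<xi>) = (lborel :: (real^'n) measure)"
proof (rule measure_eqI)
  fix A :: "(real^'n) set" assume "A \<in> sets (distr lborel borel (reflection \<xi>))"
  then have A [measurable]: "A \<in> sets borel" by simp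
  let ?\<rho> = "reflection \<xi>" and ?B = "ball (0::real^'n) 1"
  have B [measurable]: "?B \<in> sets borel" by simp
  have lin: "?\<rho> (x + y) = ?\<rho> x + ?\<rho> y" "?\<rho> (x - y) = ?\<rho> x - ?\<rho> y" for x y
    by (simp_all add: linear_add[OF reflection_linear] linear_diff[OF reflection_linear])
  have pre: "emeasure (distr lborel borel ?\<rho>) A = (\<integral>\<^sup>+x. indicator A (?\<rho> x) \<partial>lborel)"
  proof -
    have "emeasure (distr lborel borel ?\<rho>) A = (\<integral>\<^sup>+x. indicator A x \<partial>distr lborel borel ?\<rho>)" by simp
    also have "\<dots> = (\<integral>\<^sup>+x. indicator A (?\<rho> x) \<partial>lborel)" by (rule nn_integral_distr) auto
    finally show ?thesis .
  qed
  have "(\<integral>\<^sup>+y. (\<integral>\<^sup>+x. indicator A (?\<rho> x + y) * indicator ?B y \<partial>lborel) \<partial>lborel)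
      = (\<integral>\<^sup>+y. emeasure (distr lborel borel ?\<rho>) A * indicator ?B y \<partial>lborel)"
  proof (rule nn_integral_cong)
    fix y
    have "(\<integral>\<^sup>+x. indicator A (?\<rho> x + y) * indicator ?B y \<partial>lborel)
       = (\<integral>\<^sup>+x. indicator A (?\<rho> (x + ?\<rho> y)) \<partial>lborel) * indicator ?B y"
      by (simp add: nn_integral_multc lin)
    also have "(\<integral>\<^sup>+x. indicator A (?\<rho> (x + ?\<rho> y)) \<partial>lborel) = (\<integral>\<^sup>+x. indicator A (?\<rho> x) \<partial>lborel)"
      by (rule nn_integral_lborel_translation) measurable
    finally show "(\<integral>\<^sup>+x. indicator A (?\<rho> x + y) * indicator ?B y \<partial>lborel)
       = emeasure (distr lborel borel ?\<rho>) A * indicator ?B y" unfolding pre .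
  qed
  also have "\<dots> = emeasure (distr lborel borel ?\<rho>) A * emeasure lborel ?B"
    by (rule nn_integral_cmult_indicator) simp
  also have "(\<integral>\<^sup>+y. (\<integral>\<^sup>+x. indicator A (?\<rho> x + y) * indicator ?B y \<partial>lborel) \<partial>lborel)
      = (\<integral>\<^sup>+x. (\<integral>\<^sup>+y. indicator A (?\<rho> x + y) * indicator ?B y \<partial>lborel) \<partial>lborel)"
    by (rule lborel_pair.Fubini') measurable
  also have "\<dots> = (\<integral>\<^sup>+x. (\<integral>\<^sup>+z. indicator A z * indicator ?B (z - ?\<rho> x) \<partial>lborel) \<partial>lborel)"
  proof (rule nn_integral_cong)
    fix x
    show "(\<integral>\<^sup>+y. indicator A (?\<rho> x + y) * indicator ?B y \<partial>lborel) = (\<integral>\<^sup>+z. indicator A z * indicator ?B (z - ?\<rho> x) \<partial>lborel)"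
      using nn_integral_lborel_translation[of "\<lambda>z. indicator A z * indicator ?B (z - ?\<rho> x)" "?\<rho> x"]
      by (simp add: add.commute)
  qed
  also have "\<dots> = (\<integral>\<^sup>+z. (\<integral>\<^sup>+x. indicator A z * indicator ?B (z - ?\<rho> x) \<partial>lborel) \<partial>lborel)"
    by (rule lborel_pair.Fubini') measurable
  also have "\<dots> = (\<integral>\<^sup>+z. emeasure lborel ?B * indicator A z \<partial>lborel)"
  proof (rule nn_integral_cong)
    fix z :: "real^'n"
    have "norm (z - ?\<rho> x) = norm (x + - ?\<rho> z)" for x
      by (metis lin(2) norm_minus_commute reflection_norm reflection_reflection diff_conv_add_uminus)
    then have "(\<integral>\<^sup>+x. indicator A z * indicator ?B (z - ?\<rho> x) \<partial>lborel)
       = (\<integral>\<^sup>+x. indicator A z * indicator ?B (x + - ?\<rho> z) \<partial>lborel)"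
      by (intro nn_integral_cong) (auto simp: indicator_def)
    also have "\<dots> = indicator A z * (\<integral>\<^sup>+x. indicator ?B (x + - ?\<rho> z) \<partial>lborel)"
      by (rule nn_integral_cmult) measurable
    also have "(\<integral>\<^sup>+x. indicator ?B (x + - ?\<rho> z) \<partial>lborel) = (\<integral>\<^sup>+x. indicator ?B x \<partial>lborel)"
      by (rule nn_integral_lborel_translation) measurable
    finally show "(\<integral>\<^sup>+x. indicator A z * indicator ?B (z - ?\<rho> x) \<partial>lborel) = emeasure lborel ?B * indicator A z"
      by (simp add: mult.commute)
  qed
  also have "\<dots> = emeasure lborel ?B * emeasure lborel A"
    by (rule nn_integral_cmult_indicator) simp
  finally have "emeasure lborel A * emeasure lborel ?B = emeasure (distr lborel borel ?\<rho>) A * emeasure lborel ?B"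
    by (simp add: mult.commute)
  moreover have "emeasure lborel ?B = ennreal (unit_ball_vol (real CARD('n)))"
    by (subst emeasure_ball) auto
  then have "emeasure lborel ?B \<noteq> 0" "emeasure lborel ?B \<noteq> top"
    using less_imp_neq[OF unit_ball_vol_pos[of "real CARD('n)"]] by auto
  ultimately show "emeasure (distr lborel borel ?\<rho>) A = emeasure lborel A"
    by (metis mult_divide_eq_ennreal)
qed simp

text \<open>\<open>F (x + v) - F x\<close> is the integral of \<open>F' (x + t v)\<close> over
  \<open>0 \<le> t \<le> 1\<close>. Integrated over \<open>x\<close>, the difference gives 0 by
  translation invariance, and the double integral gives the integral of \<open>F'\<close> by Fubini.
  No decay of \<open>F\<close> beyond integrability enters.\<close>

lemma integral_dir_deriv_zero:
  fixes F :: "real^'n \<Rightarrow> complex"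
  assumes der: "\<And>x. ((\<lambda>t. F (x + t *\<^sub>R v)) has_vector_derivative F' x) (at 0)"
    and F: "integrable lborel F" and F': "integrable lborel F'" and cont: "continuous_on UNIV F'"
  shows "(\<integral>x. F' x \<partial>lborel) = 0"
proof -
  have [measurable]: "F' \<in> borel_measurable borel" "F \<in> borel_measurable borel"
    using F F' by auto
  let ?I = "\<lambda>t::real. indicator {0..1} t :: real"
  have der': "((\<lambda>t. F (x + t *\<^sub>R v)) has_vector_derivative F' (x + t *\<^sub>R v)) (at t)" for x t
  proof -
    have "((\<lambda>r. F ((x + t *\<^sub>R v) + r *\<^sub>R v)) has_vector_derivative F' (x + t *\<^sub>R v)) (at (t - t))"
      using der[of "x + t *\<^sub>R v"] by simp
    then have "(((\<lambda>r. F ((x + t *\<^sub>R v) + r *\<^sub>R v)) \<circ> (\<lambda>r. r - t)) has_vector_derivative 1 *\<^sub>R F' (x + t *\<^sub>R v)) (at t)"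
      by (intro vector_diff_chain_at) (auto intro!: derivative_eq_intros)
    then show ?thesis by (simp add: o_def algebra_simps)
  qed
  have FTC: "(\<integral>t. ?I t *\<^sub>R F' (x + t *\<^sub>R v) \<partial>lborel) = F (x + v) - F x" for x
  proof -
    have "(\<integral>t. ?I t *\<^sub>R F' (x + t *\<^sub>R v) \<partial>lborel) = F (x + 1 *\<^sub>R v) - F (x + 0 *\<^sub>R v)"
    proof (rule integral_FTC_atLeastAtMost)
      show "continuous_on {0..1} (\<lambda>t. F' (x + t *\<^sub>R v))"
        by (rule continuous_on_compose2[OF cont]) (auto intro!: continuous_intros)
    qed (auto intro: has_vector_derivative_at_within der')
    then show ?thesis by simp
  qed
  have meas: "(\<lambda>(t, x). ?I t *\<^sub>R F' (x + t *\<^sub>R v)) \<in> borel_measurable (lborel \<Otimes>\<^sub>M lborel)"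
    by measurable
  have int: "integrable (lborel \<Otimes>\<^sub>M lborel) (\<lambda>(t, x). ?I t *\<^sub>R F' (x + t *\<^sub>R v))"
  proof (rule lborel_pair.Fubini_integrable[OF meas])
    have "(\<integral>x. norm (F' (x + t *\<^sub>R v)) \<partial>lborel) = (\<integral>x. norm (F' x) \<partial>lborel)" for t
      by (rule integral_lborel_translation) measurable
    then have "(\<lambda>t. \<integral>x. norm (case (t, x) of (t, x) \<Rightarrow> ?I t *\<^sub>R F' (x + t *\<^sub>R v)) \<partial>lborel)
      = (\<lambda>t. ?I t *\<^sub>R (\<integral>x. norm (F' x) \<partial>lborel))" by (simp add: fun_eq_iff)
    moreover have "integrable lborel (\<lambda>t. ?I t *\<^sub>R (\<integral>x. norm (F' x) \<partial>lborel))"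
      by (rule integrable_indicator) simp_all
    ultimately show "integrable lborel (\<lambda>t. \<integral>x. norm (case (t, x) of (t, x) \<Rightarrow> ?I t *\<^sub>R F' (x + t *\<^sub>R v)) \<partial>lborel)"
      by simp
    show "AE t in lborel. integrable lborel (\<lambda>x. case (t, x) of (t, x) \<Rightarrow> ?I t *\<^sub>R F' (x + t *\<^sub>R v))"
      using integrable_lborel_translation[of F'] F' by (auto intro!: AE_I2)
  qed
  have "(\<integral>x. (\<integral>t. ?I t *\<^sub>R F' (x + t *\<^sub>R v) \<partial>lborel) \<partial>lborel) = (\<integral>t. (\<integral>x. ?I t *\<^sub>R F' (x + t *\<^sub>R v) \<partial>lborel) \<partial>lborel)"
    by (rule lborel_pair.Fubini_integral) (use int in simp)
  also have "\<dots> = (\<integral>t. ?I t *\<^sub>R (\<integral>x. F' x \<partial>lborel) \<partial>lborel)"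
    by (simp add: integral_lborel_translation)
  also have "\<dots> = (\<integral>x. F' x \<partial>lborel)"
    by (subst integral_scaleR_left) simp_all
  also have "(\<integral>x. (\<integral>t. ?I t *\<^sub>R F' (x + t *\<^sub>R v) \<partial>lborel) \<partial>lborel) = (\<integral>x. F (x + v) - F x \<partial>lborel)"
    by (simp add: FTC)
  also have "\<dots> = 0"
    using F by (simp add: integrable_lborel_translation integral_lborel_translation)
  finally show ?thesis by simp
qed

text \<open>The polynomial is bounded by \<open>exp (N r)\<close>, and completing the square leaves
  the maximum of the exponent.\<close>

lemma gauss_decay:
  fixes r :: real
  assumes "0 < s" "0 \<le> r"
  shows "exp (c * r - s * r\<^sup>2) * (1 + r) ^ N \<le> exp ((real N + c)\<^sup>2 / (4 * s))"
proof -
  have "(1 + r) ^ N \<le> exp r ^ N" using assms exp_ge_add_one_self[of r] by (intro power_mono) auto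
  then have "exp (c * r - s * r\<^sup>2) * (1 + r) ^ N \<le> exp (c * r - s * r\<^sup>2) * exp (real N * r)"
    by (simp add: exp_of_nat_mult[symmetric] mult.commute)
  also have "\<dots> = exp ((real N + c) * r - s * r\<^sup>2)" by (simp add: exp_add[symmetric] algebra_simps)
  also have "(real N + c) * r - s * r\<^sup>2 = (real N + c)\<^sup>2 / (4 * s) - s * (r - (real N + c) / (2 * s))\<^sup>2"
    using assms by (simp add: field_simps power2_eq_square)
  also have "\<dots> \<le> (real N + c)\<^sup>2 / (4 * s)" using assms by simp
  finally show ?thesis by simp
qed

section \<open>The weight and its smooth approximations\<close>

context dunkl
begin

abbreviation "nu \<equiv> dunkl_measure Rp k"

text \<open>Smooth for \<open>\<epsilon> > 0\<close>, unlike the weight itself, which is the case \<open>\<epsilon> = 0\<close>.\<close>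

definition weps :: "real \<Rightarrow> real^'n \<Rightarrow> real" where
  "weps \<epsilon> x = (\<Prod>\<xi>\<in>Rp. ((\<xi> \<bullet> x)\<^sup>2 + \<epsilon>) powr k \<xi>)"

lemma weps_0: "weps 0 x = dunkl_weight Rp k x"
proof -
  have "((\<xi> \<bullet> x)\<^sup>2) powr k \<xi> = \<bar>\<xi> \<bullet> x\<bar> powr (2 * k \<xi>)" for \<xi>
  proof -
    have "(\<xi> \<bullet> x)\<^sup>2 = \<bar>\<xi> \<bullet> x\<bar> powr 2" by simp
    then show ?thesis by (simp only: powr_powr)
  qed
  then show ?thesis by (simp add: weps_def dunkl_weight_def)
qed

lemma weps_nonneg: "0 \<le> weps \<epsilon> x"
  by (simp add: weps_def prod_nonneg)

lemma measurable_weps [measurable]: "weps \<epsilon> \<in> borel_measurable borel"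
  unfolding weps_def[abs_def] by measurable

lemma measurable_dunkl_weight [measurable]: "dunkl_weight Rp k \<in> borel_measurable borel"
  using measurable_weps[of 0] by (simp add: weps_0[abs_def])

lemma sets_nu [measurable_cong, simp]: "sets nu = sets borel"
  by (simp add: dunkl_measure_def)

lemma space_nu [simp]: "space nu = UNIV"
  by (simp add: dunkl_measure_def)

text \<open>Polynomial growth, uniformly in \<open>\<epsilon>\<close>; the uniformity serves the
  dominated convergence by which \<open>dunkl_integral_by_parts\<close> returns to the weight
  itself.\<close>

lemma weps_bound:
  obtains W M where "0 \<le> W" "\<And>\<epsilon> x. 0 \<le> \<epsilon> \<Longrightarrow> \<epsilon> \<le> 1 \<Longrightarrow> weps \<epsilon> x \<le> W * (1 + norm x) ^ M"
proof
  define W where "W = (\<Prod>\<xi>\<in>Rp. (norm \<xi> + 1) powr (2 * k \<xi>))"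
  define M where "M = nat \<lceil>2 * gam\<rceil>"
  show "0 \<le> W" by (simp add: W_def prod_nonneg)
  fix \<epsilon> x assume \<epsilon>: "0 \<le> \<epsilon>" "\<epsilon> \<le> (1::real)"
  have "weps \<epsilon> x \<le> (\<Prod>\<xi>\<in>Rp. (norm \<xi> + 1) powr (2 * k \<xi>) * (1 + norm x) powr (2 * k \<xi>))"
    unfolding weps_def
  proof (rule prod_mono, intro conjI)
    fix \<xi> assume \<xi>: "\<xi> \<in> Rp"
    have "(\<xi> \<bullet> x)\<^sup>2 \<le> (norm \<xi> * norm x)\<^sup>2"
      using power_mono[OF Cauchy_Schwarz_ineq2[of \<xi> x], of 2] by simp
    then have "(\<xi> \<bullet> x)\<^sup>2 + \<epsilon> \<le> (norm \<xi> * norm x)\<^sup>2 + 1" using \<epsilon> by simp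
    also have "\<dots> \<le> (norm \<xi> * norm x + 1)\<^sup>2" by (simp add: power2_sum)
    also have "\<dots> \<le> ((norm \<xi> + 1) * (1 + norm x))\<^sup>2"
      by (intro power_mono) (auto simp: algebra_simps)
    also have "\<dots> = ((norm \<xi> + 1) * (1 + norm x)) powr 2"
      by (simp add: add_nonneg_pos)
    finally have "((\<xi> \<bullet> x)\<^sup>2 + \<epsilon>) powr k \<xi> \<le> (((norm \<xi> + 1) * (1 + norm x)) powr 2) powr k \<xi>"
      using \<epsilon> \<xi> by (intro powr_mono2) (auto simp: k_nonneg Rp_R)
    then show "((\<xi> \<bullet> x)\<^sup>2 + \<epsilon>) powr k \<xi> \<le> (norm \<xi> + 1) powr (2 * k \<xi>) * (1 + norm x) powr (2 * k \<xi>)"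
      using powr_mult[of "norm \<xi> + 1" "1 + norm x" "2 * k \<xi>"] unfolding powr_powr by simp
  qed simp
  also have "\<dots> = W * (1 + norm x) powr (2 * gam)"
  proof -
    have "(1 + norm x) powr (2 * gam) = (\<Prod>\<xi>\<in>Rp. (1 + norm x) powr (2 * k \<xi>))"
      unfolding dunkl_gamma_def sum_distrib_left
      by (rule powr_sum) (use norm_ge_zero[of x] in linarith)+
    then show ?thesis by (simp add: W_def prod.distrib)
  qed
  also have "\<dots> \<le> W * (1 + norm x) powr real M"
    using \<open>0 \<le> W\<close> unfolding M_def by (intro mult_left_mono powr_mono) (auto intro: of_nat_ceiling)
  also have "\<dots> = W * (1 + norm x) ^ M" by (simp add: powr_realpow add_pos_nonneg)
  finally show "weps \<epsilon> x \<le> W * (1 + norm x) ^ M" .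
qed

lemma integrable_weps_gauss:
  fixes C :: real
  assumes "0 < s"
  obtains D where "integrable lborel D"
    "\<And>\<epsilon> y. 0 \<le> \<epsilon> \<Longrightarrow> \<epsilon> \<le> 1 \<Longrightarrow> weps \<epsilon> y * (C * exp (c * norm y - s * (norm y)\<^sup>2)) \<le> D y"
proof -
  obtain W M where W: "0 \<le> W" "\<And>\<epsilon> x. 0 \<le> \<epsilon> \<Longrightarrow> \<epsilon> \<le> 1 \<Longrightarrow> weps \<epsilon> x \<le> W * (1 + norm x) ^ M"
    using weps_bound by blast
  let ?N = "M + (CARD('n) + 2)"
  define K where "K = exp ((real ?N + c)\<^sup>2 / (4 * s))"
  define D where "D y = (W * \<bar>C\<bar> * K) * inverse ((1 + norm y) ^ (CARD('n) + 2))" for y :: "real^'n"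
  show thesis
  proof (rule that)
    show "integrable lborel D" unfolding D_def by (intro integrable_mult_right integrable_lborel_decay)
    fix \<epsilon> :: real and y :: "real^'n" assume \<epsilon>: "0 \<le> \<epsilon>" "\<epsilon> \<le> 1"
    have pos: "0 < (1 + norm y) ^ (CARD('n) + 2)" by (simp add: add_pos_nonneg)
    have "exp (c * norm y - s * (norm y)\<^sup>2) * (1 + norm y) ^ ?N \<le> K"
      unfolding K_def by (rule gauss_decay) (use assms in auto)
    then have e: "(1 + norm y) ^ M * exp (c * norm y - s * (norm y)\<^sup>2) \<le> K * inverse ((1 + norm y) ^ (CARD('n) + 2))"
      using pos by (simp add: power_add field_simps)
    have "weps \<epsilon> y * (C * exp (c * norm y - s * (norm y)\<^sup>2)) \<le> (W * (1 + norm y) ^ M) * (\<bar>C\<bar> * exp (c * norm y - s * (norm y)\<^sup>2))"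
      using W \<epsilon> weps_nonneg[of \<epsilon> y] by (intro order_trans[OF mult_left_mono mult_right_mono] mult_right_mono) auto
    also have "\<dots> = W * \<bar>C\<bar> * ((1 + norm y) ^ M * exp (c * norm y - s * (norm y)\<^sup>2))" by (simp add: mult_ac)
    also have "\<dots> \<le> W * \<bar>C\<bar> * (K * inverse ((1 + norm y) ^ (CARD('n) + 2)))"
      using W by (intro mult_left_mono e) auto
    finally show "weps \<epsilon> y * (C * exp (c * norm y - s * (norm y)\<^sup>2)) \<le> D y" by (simp add: D_def mult_ac)
  qed
qed

lemma integrable_weps_scaleR:
  fixes f :: "real^'n \<Rightarrow> complex"
  assumes "0 < s" and [measurable]: "f \<in> borel_measurable borel"
    and "\<And>y. norm (f y) \<le> C * exp (c * norm y - s * (norm y)\<^sup>2)" and \<epsilon>: "0 \<le> \<epsilon>" "\<epsilon> \<le> 1"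
  shows "integrable lborel (\<lambda>y. weps \<epsilon> y *\<^sub>R f y)"
proof -
  obtain D where D: "integrable lborel D" "\<And>\<epsilon> y. 0 \<le> \<epsilon> \<Longrightarrow> \<epsilon> \<le> 1 \<Longrightarrow> weps \<epsilon> y * (C * exp (c * norm y - s * (norm y)\<^sup>2)) \<le> D y"
    using integrable_weps_gauss[OF assms(1)] by blast
  show ?thesis
  proof (rule Bochner_Integration.integrable_bound[OF D(1)])
    show "AE y in lborel. norm (weps \<epsilon> y *\<^sub>R f y) \<le> norm (D y)"
    proof (rule AE_I2)
      fix y
      have "norm (weps \<epsilon> y *\<^sub>R f y) \<le> weps \<epsilon> y * (C * exp (c * norm y - s * (norm y)\<^sup>2))"
        using assms(3)[of y] weps_nonneg[of \<epsilon> y] by (simp add: mult_left_mono)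
      then show "norm (weps \<epsilon> y *\<^sub>R f y) \<le> norm (D y)" using D(2)[OF \<epsilon>, of y] by simp
    qed
  qed simp
qed

lemma nu_integral:
  fixes f :: "real^'n \<Rightarrow> 'b::{banach, second_countable_topology}"
  assumes [measurable]: "f \<in> borel_measurable borel"
  shows "integral\<^sup>L nu f = (\<integral>y. dunkl_weight Rp k y *\<^sub>R f y \<partial>lborel)"
    and "integrable nu f \<longleftrightarrow> integrable lborel (\<lambda>y. dunkl_weight Rp k y *\<^sub>R f y)"
  unfolding dunkl_measure_def
  by (subst integral_density integrable_density; auto simp: dunkl_weight_def prod_nonneg)+

lemma integrable_nu_gauss:
  fixes f :: "real^'n \<Rightarrow> complex"
  assumes "0 < s" and [measurable]: "f \<in> borel_measurable borel"
    and "\<And>y. norm (f y) \<le> C * exp (c * norm y - s * (norm y)\<^sup>2)"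
  shows "integrable nu f"
  using integrable_weps_scaleR[OF assms, of 0] by (simp add: nu_integral weps_0)

lemma integrable_nu_gauss_real:
  fixes f :: "real^'n \<Rightarrow> real"
  assumes "0 < s" and [measurable]: "f \<in> borel_measurable borel"
    and "\<And>y. \<bar>f y\<bar> \<le> C * exp (c * norm y - s * (norm y)\<^sup>2)"
  shows "integrable nu f"
  using integrable_Re[OF integrable_nu_gauss[of s "\<lambda>y. complex_of_real (f y)" C c]] assms by simp

lemma weps_reflection: "\<xi> \<in> R \<Longrightarrow> weps \<epsilon> (reflection \<xi> x) = weps \<epsilon> x"
proof -
  assume \<xi>: "\<xi> \<in> R"
  have "weps \<epsilon> (reflection \<xi> x) = (\<Prod>\<eta>\<in>Rp. ((reflection \<xi> \<eta> \<bullet> x)\<^sup>2 + \<epsilon>) powr k (reflection \<xi> \<eta>))"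
    unfolding weps_def by (rule prod.cong) (auto simp: reflection_inner_left k_reflection \<xi> Rp_R)
  also have "\<dots> = weps \<epsilon> x"
    unfolding weps_def by (rule prod_flip[where \<phi> = "\<lambda>\<eta>. ((\<eta> \<bullet> x)\<^sup>2 + \<epsilon>) powr k \<eta>"]) (auto simp: \<xi> k_neg)
  finally show ?thesis .
qed

lemma integral_weps_reflection:
  fixes f :: "real^'n \<Rightarrow> complex"
  assumes "\<xi> \<in> R" and [measurable]: "f \<in> borel_measurable borel"
  shows "(\<integral>y. weps \<epsilon> y *\<^sub>R f (reflection \<xi> y) \<partial>lborel) = (\<integral>y. weps \<epsilon> y *\<^sub>R f y \<partial>lborel)"
proof -
  have "(\<integral>y. weps \<epsilon> y *\<^sub>R f y \<partial>distr lborel borel (reflection \<xi>))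
      = (\<integral>y. weps \<epsilon> (reflection \<xi> y) *\<^sub>R f (reflection \<xi> y) \<partial>lborel)"
    by (rule integral_distr) auto
  then show ?thesis by (simp add: lborel_distr_reflection weps_reflection assms)
qed

lemma integral_weps_odd:
  fixes f :: "real^'n \<Rightarrow> complex"
  assumes "\<xi> \<in> R" "f \<in> borel_measurable borel" "\<And>y. f (reflection \<xi> y) = - f y"
  shows "(\<integral>y. weps \<epsilon> y *\<^sub>R f y \<partial>lborel) = 0"
  using integral_weps_reflection[OF assms(1,2), of \<epsilon>] by (simp add: assms(3))

lemma AE_off_hyperplanes: "AE x in lborel. \<forall>\<xi>\<in>Rp. \<xi> \<bullet> x \<noteq> 0"
proof (rule AE_finite_allI)
  fix \<xi> assume "\<xi> \<in> Rp"
  then have "negligible {x. \<xi> \<bullet> x = 0}" using R_nonzero Rp_R by (intro negligible_hyperplane) auto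
  then have "{x. \<xi> \<bullet> x = 0} \<in> null_sets lborel"
    by (simp add: negligible_iff_null_sets null_sets_completion_iff closed_hyperplane)
  from AE_not_in[OF this] show "AE x in lborel. \<xi> \<bullet> x \<noteq> 0" by simp
qed simp

lemma weps_exp:
  assumes "0 < \<epsilon>" shows "weps \<epsilon> x = exp (\<Sum>\<xi>\<in>Rp. k \<xi> * ln ((\<xi> \<bullet> x)\<^sup>2 + \<epsilon>))"
  unfolding weps_def exp_sum[OF finite_Rp]
proof (rule prod.cong[OF refl])
  fix \<xi>
  have "(\<xi> \<bullet> x)\<^sup>2 + \<epsilon> \<noteq> 0" using assms zero_le_power2[of "\<xi> \<bullet> x"] by linarith
  then show "((\<xi> \<bullet> x)\<^sup>2 + \<epsilon>) powr k \<xi> = exp (k \<xi> * ln ((\<xi> \<bullet> x)\<^sup>2 + \<epsilon>))" by (simp add: powr_def)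
qed

lemma weps_has_derivative:
  assumes "0 < \<epsilon>"
  shows "((\<lambda>t. weps \<epsilon> (x + t *\<^sub>R v)) has_real_derivative
    weps \<epsilon> x * (\<Sum>\<xi>\<in>Rp. 2 * k \<xi> * (\<xi> \<bullet> v) * ((\<xi> \<bullet> x) / ((\<xi> \<bullet> x)\<^sup>2 + \<epsilon>)))) (at 0)"
proof -
  have pos: "0 < (\<xi> \<bullet> y)\<^sup>2 + \<epsilon>" for \<xi> y using assms zero_le_power2[of "\<xi> \<bullet> y"] by linarith
  have 1: "((\<lambda>t. k \<xi> * ln ((\<xi> \<bullet> (x + t *\<^sub>R v))\<^sup>2 + \<epsilon>)) has_real_derivative
     2 * k \<xi> * (\<xi> \<bullet> v) * ((\<xi> \<bullet> x) / ((\<xi> \<bullet> x)\<^sup>2 + \<epsilon>))) (at 0)" for \<xi>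
    using pos[of \<xi> x] unfolding inner_add_right inner_scaleR_right
    by (auto intro!: derivative_eq_intros simp: power2_eq_square field_simps)
  have "((\<lambda>t. exp (\<Sum>\<xi>\<in>Rp. k \<xi> * ln ((\<xi> \<bullet> (x + t *\<^sub>R v))\<^sup>2 + \<epsilon>))) has_real_derivative
    exp (\<Sum>\<xi>\<in>Rp. k \<xi> * ln ((\<xi> \<bullet> (x + 0 *\<^sub>R v))\<^sup>2 + \<epsilon>)) * (\<Sum>\<xi>\<in>Rp. 2 * k \<xi> * (\<xi> \<bullet> v) * ((\<xi> \<bullet> x) / ((\<xi> \<bullet> x)\<^sup>2 + \<epsilon>)))) (at 0)"
    by (intro DERIV_fun_exp DERIV_sum 1)
  then show ?thesis by (simp add: weps_exp[OF assms])
qed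

lemma continuous_weps: "0 < \<epsilon> \<Longrightarrow> continuous_on A (weps \<epsilon>)"
proof -
  assume \<epsilon>: "0 < \<epsilon>"
  have "(\<xi> \<bullet> x)\<^sup>2 + \<epsilon> \<noteq> 0" for \<xi> x using \<epsilon> zero_le_power2[of "\<xi> \<bullet> x"] by linarith
  then show ?thesis
    unfolding weps_exp[OF \<epsilon>, abs_def] by (intro continuous_intros) auto
qed

end

section \<open>Differentiation under the integral sign\<close>

lemma has_vector_derivative_integral:
  fixes f :: "real \<Rightarrow> 'a \<Rightarrow> complex"
  assumes "0 < r" and f: "\<And>t. \<bar>t - t0\<bar> < r \<Longrightarrow> integrable M (f t)"
    and der: "\<And>t x. \<bar>t - t0\<bar> < r \<Longrightarrow> ((\<lambda>t. f t x) has_vector_derivative f' t x) (at t)"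
    and bound: "\<And>t x. \<bar>t - t0\<bar> < r \<Longrightarrow> norm (f' t x) \<le> D x"
    and D: "integrable M D" and meas: "f' t0 \<in> borel_measurable M"
  shows "((\<lambda>t. integral\<^sup>L M (f t)) has_vector_derivative integral\<^sup>L M (f' t0)) (at t0)"
proof -
  have mvt: "norm (f (t0 + h) x - f t0 x) \<le> D x * \<bar>h\<bar>" if h: "\<bar>h\<bar> < r" for h x
  proof -
    have "norm (f (t0 + h) x - f t0 x) \<le> D x * norm (t0 + h - t0)"
    proof (rule differentiable_bound[of "ball t0 r" "\<lambda>t. f t x" "\<lambda>t s. s *\<^sub>R f' t x"])
      fix t assume t: "t \<in> ball t0 r"
      then have t': "\<bar>t - t0\<bar> < r" by (simp add: dist_norm)
      show "((\<lambda>t. f t x) has_derivative (\<lambda>s. s *\<^sub>R f' t x)) (at t within ball t0 r)"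
        using der[OF t'] by (auto simp: has_vector_derivative_def intro: has_derivative_at_withinI)
      show "onorm (\<lambda>s. s *\<^sub>R f' t x) \<le> D x"
        by (rule onorm_le) (use bound[OF t', of x] in \<open>simp add: mult_left_mono mult.commute[of "D x"]\<close>)
    qed (use h \<open>0 < r\<close> in \<open>auto simp: dist_norm\<close>)
    then show ?thesis by simp
  qed
  have "((\<lambda>h. (1 / h) *\<^sub>R (integral\<^sup>L M (f (t0 + h)) - integral\<^sup>L M (f t0))) \<longlongrightarrow> integral\<^sup>L M (f' t0)) (at 0)"
    unfolding tendsto_at_iff_sequentially comp_def
  proof (intro allI impI)
    fix X :: "nat \<Rightarrow> real" assume X0: "\<forall>i. X i \<in> UNIV - {0}" and X: "X \<longlonglongrightarrow> 0"
    \<comment> \<open>\<open>Y\<close> replaces the terms of the null sequence that leave the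
      interval, so that the difference quotients are dominated for every index and not only
      eventually.\<close>
    define Y where "Y i = (if \<bar>X i\<bar> < r then X i else r / 2)" for i
    have ev: "eventually (\<lambda>i. Y i = X i) sequentially"
    proof -
      have "eventually (\<lambda>i. \<bar>X i\<bar> < r) sequentially"
        using X \<open>0 < r\<close> by (auto simp: tendsto_iff dist_norm)
      then show ?thesis by eventually_elim (simp add: Y_def)
    qed
    have Y0: "Y \<longlonglongrightarrow> 0" by (rule tendsto_cong[OF ev, THEN iffD2, OF X])
    have Y: "Y \<longlonglongrightarrow> 0" "\<And>i. Y i \<noteq> 0" "\<And>i. \<bar>Y i\<bar> < r"
      using Y0 X0 \<open>0 < r\<close> by (auto simp: Y_def)
    have fY: "integrable M (f (t0 + Y i))" "integrable M (f t0)" for i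
      using f Y(3)[of i] \<open>0 < r\<close> by auto
    have "(\<lambda>i. integral\<^sup>L M (\<lambda>x. (1 / Y i) *\<^sub>R (f (t0 + Y i) x - f t0 x))) \<longlonglongrightarrow> integral\<^sup>L M (f' t0)"
    proof (rule integral_dominated_convergence[OF meas _ D])
      show "(\<lambda>x. (1 / Y i) *\<^sub>R (f (t0 + Y i) x - f t0 x)) \<in> borel_measurable M" for i
        using fY(1)[of i] fY(2) by (intro borel_measurable_scaleR borel_measurable_diff borel_measurable_integrable) auto
      show "AE x in M. norm ((1 / Y i) *\<^sub>R (f (t0 + Y i) x - f t0 x)) \<le> D x" for i
        unfolding norm_scaleR using mvt[OF Y(3), of i] Y(2)[of i] by (intro AE_I2) (simp add: divide_le_eq)
      show "AE x in M. (\<lambda>i. (1 / Y i) *\<^sub>R (f (t0 + Y i) x - f t0 x)) \<longlonglongrightarrow> f' t0 x"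
      proof (rule AE_I2)
        fix x
        have "((\<lambda>h. (1 / h) *\<^sub>R (f (t0 + h) x - f t0 x)) \<longlongrightarrow> f' t0 x) (at 0)"
        proof -
          have "((\<lambda>h. norm (f (t0 + h) x - f t0 x - h *\<^sub>R f' t0 x) / norm h) \<longlongrightarrow> 0) (at 0)"
            using der[of t0 x] \<open>0 < r\<close> by (simp add: has_vector_derivative_def has_derivative_at)
          moreover have "norm (f (t0 + h) x - f t0 x - h *\<^sub>R f' t0 x) / norm h
              = norm ((1 / h) *\<^sub>R (f (t0 + h) x - f t0 x) - f' t0 x)" if "h \<noteq> 0" for h
          proof -
            have "(1 / h) *\<^sub>R (f (t0 + h) x - f t0 x) - f' t0 x = (1 / h) *\<^sub>R (f (t0 + h) x - f t0 x - h *\<^sub>R f' t0 x)"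
              using that by (simp add: scaleR_diff_right)
            then show ?thesis by simp
          qed
          then have "eventually (\<lambda>h. norm (f (t0 + h) x - f t0 x - h *\<^sub>R f' t0 x) / norm h
              = norm ((1 / h) *\<^sub>R (f (t0 + h) x - f t0 x) - f' t0 x)) (at 0)"
            by (auto simp: eventually_at intro!: exI[of _ 1])
          ultimately have "((\<lambda>h. norm ((1 / h) *\<^sub>R (f (t0 + h) x - f t0 x) - f' t0 x)) \<longlongrightarrow> 0) (at 0)"
            using tendsto_cong by force
          then show ?thesis by (simp add: tendsto_norm_zero_iff LIM_zero_iff)
        qed
        then show "(\<lambda>i. (1 / Y i) *\<^sub>R (f (t0 + Y i) x - f t0 x)) \<longlonglongrightarrow> f' t0 x"
          unfolding tendsto_at_iff_sequentially comp_def using Y by auto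
      qed
    qed
    then have "(\<lambda>i. (1 / Y i) *\<^sub>R (integral\<^sup>L M (f (t0 + Y i)) - integral\<^sup>L M (f t0))) \<longlonglongrightarrow> integral\<^sup>L M (f' t0)"
      using fY by simp
    moreover have "eventually (\<lambda>i. (1 / Y i) *\<^sub>R (integral\<^sup>L M (f (t0 + Y i)) - integral\<^sup>L M (f t0))
       = (1 / X i) *\<^sub>R (integral\<^sup>L M (f (t0 + X i)) - integral\<^sup>L M (f t0))) sequentially"
      using ev by eventually_elim simp
    ultimately show "(\<lambda>i. (1 / X i) *\<^sub>R (integral\<^sup>L M (f (t0 + X i)) - integral\<^sup>L M (f t0))) \<longlonglongrightarrow> integral\<^sup>L M (f' t0)"
      using tendsto_cong by fast
  qed
  then have lim: "((\<lambda>h. norm ((1 / h) *\<^sub>R (integral\<^sup>L M (f (t0 + h)) - integral\<^sup>L M (f t0)) - integral\<^sup>L M (f' t0))) \<longlongrightarrow> 0) (at 0)"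
    by (simp add: tendsto_norm_zero_iff LIM_zero_iff)
  have eq: "norm (u - v - h *\<^sub>R d) / \<bar>h\<bar> = norm ((1 / h) *\<^sub>R (u - v) - d)" if "h \<noteq> 0" for h and u v d :: complex
  proof -
    have "(1 / h) *\<^sub>R (u - v) - d = (1 / h) *\<^sub>R (u - v - h *\<^sub>R d)"
      using that by (simp add: scaleR_diff_right)
    then show ?thesis by simp
  qed
  have "((\<lambda>h. norm (integral\<^sup>L M (f (t0 + h)) - integral\<^sup>L M (f t0) - h *\<^sub>R integral\<^sup>L M (f' t0)) / norm h) \<longlongrightarrow> 0) (at 0)"
    by (rule Lim_transform_eventually[OF lim]) (auto simp: eventually_at intro!: exI[of _ 1] eq[symmetric])
  then show ?thesis
    unfolding has_vector_derivative_def has_derivative_at by (simp add: bounded_linear_scaleR_left)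
qed

section \<open>Integration by parts for the Dunkl measure\<close>

context dunkl
begin

lemma AE_nu_off_hyperplanes: "AE x in nu. \<forall>\<xi>\<in>Rp. \<xi> \<bullet> x \<noteq> 0"
  unfolding dunkl_measure_def
  by (subst AE_density) (use AE_off_hyperplanes in \<open>auto elim: eventually_mono\<close>)

text \<open>The mean value inequality on the ball of radius \<open>norm y\<close>, which is convex
  and contains \<open>y\<close> and its reflection. Their distance is
  \<open>2 / norm \<xi> * \<bar>\<xi> \<bullet> y\<bar>\<close>, which cancels the
  denominator.\<close>

lemma quotient_bound:
  fixes V :: "real^'n \<Rightarrow> complex"
  assumes V: "\<And>y. (V has_derivative V' y) (at y)" and b': "\<And>y h. norm (V' y h) \<le> C * exp (c * norm y) * norm h"
    and "0 \<le> c" and \<xi>: "\<xi> \<in> R"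
  shows "norm ((V y - V (reflection \<xi> y)) / of_real (\<xi> \<bullet> y)) \<le> 2 / norm \<xi> * C * exp (c * norm y)"
proof -
  have "0 \<le> norm (V' 0 \<xi>)" by simp
  also have "\<dots> \<le> C * norm \<xi>" using b'[of 0 \<xi>] by simp
  finally have C: "0 \<le> C" using R_nonzero[OF \<xi>] by (simp add: zero_le_mult_iff)
  have "norm (V (reflection \<xi> y) - V y) \<le> C * exp (c * norm y) * norm (reflection \<xi> y - y)"
  proof (rule differentiable_bound[of "cball 0 (norm y)" V V'])
    fix x :: "real^'n" assume x: "x \<in> cball 0 (norm y)"
    show "(V has_derivative V' x) (at x within cball 0 (norm y))"
      using V by (rule has_derivative_at_withinI)
    have "C * exp (c * norm x) \<le> C * exp (c * norm y)"
      using x C \<open>0 \<le> c\<close> by (intro mult_left_mono) (auto intro: mult_left_mono)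
    then show "onorm (V' x) \<le> C * exp (c * norm y)"
      by (intro onorm_le) (use b'[of x] in \<open>meson mult_right_mono norm_ge_zero order_trans\<close>)
  qed auto
  also have "reflection \<xi> y - y = - ((2 * (\<xi> \<bullet> y) / (\<xi> \<bullet> \<xi>)) *\<^sub>R \<xi>)" by (simp add: reflection_def)
  also have "norm (- ((2 * (\<xi> \<bullet> y) / (\<xi> \<bullet> \<xi>)) *\<^sub>R \<xi>)) = 2 / norm \<xi> * \<bar>\<xi> \<bullet> y\<bar>"
    using R_nonzero[OF \<xi>] by (simp add: abs_mult power2_norm_eq_inner[symmetric] power2_eq_square)
  finally have "norm (V y - V (reflection \<xi> y)) \<le> (2 / norm \<xi> * C * exp (c * norm y)) * \<bar>\<xi> \<bullet> y\<bar>"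
    by (simp add: norm_minus_commute mult_ac)
  then show ?thesis using C by (cases "\<xi> \<bullet> y = 0") (auto simp: norm_divide divide_le_eq)
qed

text \<open>The integrand is the Dunkl derivative of the Gaussian times \<open>V\<close>, the
  Gaussian being invariant under reflections. For \<open>\<epsilon> > 0\<close> the weight is smooth
  and \<open>integral_dir_deriv_zero\<close> applies; differentiating the weight yields
  \<open>2 k q V\<close> for each root. Here \<open>2 V\<close> is split into
  \<open>V y + V (reflection \<xi> y)\<close>, whose product with the odd function \<open>q\<close>
  integrates to 0, and the difference, which becomes the difference quotient as
  \<open>\<epsilon>\<close> tends to 0.\<close>

lemma dunkl_integral_by_parts:
  fixes V :: "real^'n \<Rightarrow> complex"
  assumes s: "0 < s" and V: "\<And>y. (V has_derivative V' y) (at y)" and cont: "continuous_on UNIV (\<lambda>y. V' y v)"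
    and b: "\<And>y. norm (V y) \<le> C * exp (c * norm y)"
    and b': "\<And>y h. norm (V' y h) \<le> C * exp (c * norm y) * norm h" and c: "0 \<le> c"
  shows "(\<integral>y. exp (- s * (norm y)\<^sup>2) *\<^sub>R (V' y v - of_real (2 * s * (y \<bullet> v)) * V y
     + (\<Sum>\<xi>\<in>Rp. of_real (k \<xi> * (\<xi> \<bullet> v)) * ((V y - V (reflection \<xi> y)) / of_real (\<xi> \<bullet> y)))) \<partial>nu) = 0"
proof -
  define g where "g y = exp (- s * (norm y)\<^sup>2)" for y :: "real^'n"
  define dq where "dq \<xi> y = (V y - V (reflection \<xi> y)) / of_real (\<xi> \<bullet> y)" for \<xi> y
  \<comment> \<open>A regularization of \<open>1 / (\<xi> \<bullet> y)\<close>: the factor that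
    differentiating \<open>weps\<close> produces for the root \<open>\<xi>\<close>.\<close>
  define q where "q \<epsilon> \<xi> y = (\<xi> \<bullet> y) / ((\<xi> \<bullet> y)\<^sup>2 + \<epsilon>)" for \<epsilon> and \<xi> y :: "real^'n"
  define K where "K y = V' y v - of_real (2 * s * (y \<bullet> v)) * V y" for y
  have contV: "continuous_on A V" for A
    using V by (meson continuous_at_imp_continuous_on has_derivative_continuous)
  have contVr: "continuous_on A (\<lambda>y. V (reflection \<xi> y))" for A \<xi>
    by (rule continuous_on_compose2[OF contV[of UNIV] continuous_reflection]) auto
  have contg: "continuous_on A g" for A unfolding g_def by (intro continuous_intros)
  have contK: "continuous_on A K" for A
    unfolding K_def by (intro continuous_intros contV continuous_on_subset[OF cont]) auto
  have [measurable]: "V \<in> borel_measurable borel" "(\<lambda>y. V' y v) \<in> borel_measurable borel"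
     "g \<in> borel_measurable borel" "K \<in> borel_measurable borel"
    by (intro borel_measurable_continuous_onI contV cont contg contK)+
  have C: "0 \<le> C" using b[of 0] norm_ge_zero[of "V 0"] by (simp del: norm_ge_zero)
  have pos: "0 < (\<xi> \<bullet> y)\<^sup>2 + \<epsilon>" if "0 < \<epsilon>" for \<xi> y :: "real^'n" and \<epsilon> :: real
    using that zero_le_power2[of "\<xi> \<bullet> y"] by linarith
  have contq: "continuous_on A (q \<epsilon> \<xi>)" if "0 < \<epsilon>" for A \<epsilon> \<xi>
    unfolding q_def by (intro continuous_intros ballI less_imp_neq[THEN not_sym] pos[OF that])
  have measq [measurable]: "q \<epsilon> \<xi> \<in> borel_measurable borel" for \<epsilon> \<xi>
    unfolding q_def[abs_def] by measurable
  have le1: "norm y \<le> exp (norm y)" for y :: "real^'n"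
    using exp_ge_add_one_self[of "norm y"] by linarith
  have exp_split: "exp ((c + 1) * norm y) = exp (c * norm y) * exp (norm y)" for y :: "real^'n"
    by (simp add: distrib_right exp_add)
  have K_bound: "norm (K y) \<le> (C * norm v * (1 + 2 * s)) * exp ((c + 1) * norm y)" for y
  proof -
    have "norm (K y) \<le> norm (V' y v) + norm (of_real (2 * s * (y \<bullet> v)) * V y)"
      unfolding K_def by (rule norm_triangle_ineq4)
    also have "\<dots> \<le> C * exp (c * norm y) * norm v + (2 * s * (norm y * norm v)) * (C * exp (c * norm y))"
    proof (intro add_mono b')
      have "\<bar>2 * s * (y \<bullet> v)\<bar> \<le> 2 * s * (norm y * norm v)"
        using s Cauchy_Schwarz_ineq2[of y v] by (simp add: abs_mult)
      then show "norm (of_real (2 * s * (y \<bullet> v)) * V y) \<le> (2 * s * (norm y * norm v)) * (C * exp (c * norm y))"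
        unfolding norm_mult norm_of_real using s by (intro mult_mono b) auto
    qed
    also have "\<dots> = C * norm v * exp (c * norm y) * (1 + 2 * s * norm y)" by (simp add: algebra_simps)
    also have "\<dots> \<le> C * norm v * exp (c * norm y) * ((1 + 2 * s) * exp (norm y))"
    proof (intro mult_left_mono)
      have "1 \<le> exp (norm y)" by simp
      then show "1 + 2 * s * norm y \<le> (1 + 2 * s) * exp (norm y)"
        using le1[of y] s by (simp add: distrib_right add_mono mult_left_mono)
    qed (use C in auto)
    also have "\<dots> = (C * norm v * (1 + 2 * s)) * exp ((c + 1) * norm y)"
      unfolding exp_split by (simp only: mult_ac)
    finally show ?thesis .
  qed
  have exp_le: "C * exp (c * norm y) \<le> C * exp ((c + 1) * norm y)" for y :: "real^'n"
    using C by (intro mult_left_mono) (auto simp: distrib_right)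
  have g_exp: "g y * (B * exp (d * norm y)) = B * exp (d * norm y - s * (norm y)\<^sup>2)" for B d y
    by (simp add: g_def exp_diff exp_minus field_simps)
  have gbound: "norm (g y *\<^sub>R X) \<le> B * exp (d * norm y - s * (norm y)\<^sup>2)"
    if "norm X \<le> B * exp (d * norm y)" for X :: complex and B d y
    unfolding g_exp[symmetric] using that by (simp add: g_def mult_left_mono)
  have q_bound: "\<bar>q \<epsilon> \<xi> y\<bar> \<le> norm \<xi> * norm y / \<epsilon>" if "0 < \<epsilon>" for \<epsilon> \<xi> y
  proof -
    have "\<bar>q \<epsilon> \<xi> y\<bar> = \<bar>\<xi> \<bullet> y\<bar> / ((\<xi> \<bullet> y)\<^sup>2 + \<epsilon>)"
      unfolding q_def abs_divide using pos[OF that, of \<xi> y] by simp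
    also have "\<dots> \<le> (norm \<xi> * norm y) / \<epsilon>"
      using that Cauchy_Schwarz_ineq2[of \<xi> y] by (intro frac_le) auto
    finally show ?thesis .
  qed
  have qV_bound: "norm (of_real (q \<epsilon> \<xi> y) * V x) \<le> (C * norm \<xi> / \<epsilon>) * exp ((c + 1) * norm y)"
    if "0 < \<epsilon>" "norm x = norm y" for \<epsilon> \<xi> y x
  proof -
    have "norm (of_real (q \<epsilon> \<xi> y) * V x) \<le> (norm \<xi> * norm y / \<epsilon>) * (C * exp (c * norm y))"
      unfolding norm_mult norm_of_real using b[of x] that by (intro mult_mono q_bound) auto
    also have "\<dots> \<le> (norm \<xi> * exp (norm y) / \<epsilon>) * (C * exp (c * norm y))"
      using that C le1[of y] by (intro mult_right_mono divide_right_mono mult_left_mono) auto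
    also have "\<dots> = (C * norm \<xi> / \<epsilon>) * exp ((c + 1) * norm y)"
      unfolding exp_split by (simp add: mult_ac)
    finally show ?thesis .
  qed
  have dq_bound: "norm (dq \<xi> y) \<le> 2 / norm \<xi> * C * exp ((c + 1) * norm y)" if "\<xi> \<in> Rp" for \<xi> y
  proof -
    have "norm (dq \<xi> y) \<le> 2 / norm \<xi> * C * exp (c * norm y)"
      unfolding dq_def by (rule quotient_bound[OF V b' c Rp_R[OF that]])
    also have "\<dots> \<le> 2 / norm \<xi> * C * exp ((c + 1) * norm y)"
      using exp_le[of y] by (simp add: divide_right_mono)
    finally show ?thesis .
  qed
  have step: "(\<integral>y. weps \<epsilon> y *\<^sub>R g y *\<^sub>R (K y + (\<Sum>\<xi>\<in>Rp. of_real (k \<xi> * (\<xi> \<bullet> v)) * (of_real (q \<epsilon> \<xi> y) * (V y - V (reflection \<xi> y))))) \<partial>lborel) = 0"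
    if \<epsilon>: "0 < \<epsilon>" "\<epsilon> \<le> 1" for \<epsilon>
  proof -
    have int: "integrable lborel (\<lambda>y. weps \<epsilon> y *\<^sub>R g y *\<^sub>R X y)"
      if "X \<in> borel_measurable borel" "\<And>y. norm (X y) \<le> B * exp (d * norm y)" for X :: "real^'n \<Rightarrow> complex" and B d
      by (rule integrable_weps_scaleR[OF s _ gbound]) (use that \<epsilon> in auto)
    define F where "F y = weps \<epsilon> y *\<^sub>R g y *\<^sub>R V y" for y
    define F' where "F' y = weps \<epsilon> y *\<^sub>R g y *\<^sub>R (K y + (\<Sum>\<xi>\<in>Rp. of_real (2 * k \<xi> * (\<xi> \<bullet> v)) * (of_real (q \<epsilon> \<xi> y) * V y)))" for y
    have aqV: "norm (a * (of_real (q \<epsilon> \<xi> y) * V x)) \<le> norm a * (C * norm \<xi> / \<epsilon>) * exp ((c + 1) * norm y)"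
      if "norm x = norm y" for a \<xi> y x
      unfolding norm_mult[of a] mult.assoc by (rule mult_left_mono[OF qV_bound[OF \<epsilon>(1) that, unfolded mult.assoc]]) simp
    have intqV1: "integrable lborel (\<lambda>y. weps \<epsilon> y *\<^sub>R g y *\<^sub>R (a * (of_real (q \<epsilon> \<xi> y) * V y)))" for a \<xi>
      by (rule int[OF _ aqV[OF refl]]) measurable
    have intqV2: "integrable lborel (\<lambda>y. weps \<epsilon> y *\<^sub>R g y *\<^sub>R (a * (of_real (q \<epsilon> \<xi> y) * V (reflection \<xi> y))))" for a \<xi>
      by (rule int[OF _ aqV[OF reflection_norm]]) measurable
    note intqV = intqV1 intqV2
    have intK: "integrable lborel (\<lambda>y. weps \<epsilon> y *\<^sub>R g y *\<^sub>R K y)"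
      by (rule int[OF _ K_bound]) simp
    have F'_eq: "F' y = weps \<epsilon> y *\<^sub>R g y *\<^sub>R K y + (\<Sum>\<xi>\<in>Rp. weps \<epsilon> y *\<^sub>R g y *\<^sub>R (of_real (2 * k \<xi> * (\<xi> \<bullet> v)) * (of_real (q \<epsilon> \<xi> y) * V y)))" for y
      by (simp add: F'_def scaleR_add_right scaleR_sum_right)
    have F'0: "(\<integral>y. F' y \<partial>lborel) = 0"
    proof (rule integral_dir_deriv_zero)
      show "integrable lborel F" unfolding F_def by (rule int[OF _ b]) simp
      show "integrable lborel F'" unfolding F'_eq by (intro Bochner_Integration.integrable_add Bochner_Integration.integrable_sum intK intqV)
      show "continuous_on UNIV F'"
        unfolding F'_def by (intro continuous_intros continuous_weps \<epsilon> contg contK contV contq)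
      show "((\<lambda>t. F (y + t *\<^sub>R v)) has_vector_derivative F' y) (at 0)" for y
      proof -
        have w: "((\<lambda>t. weps \<epsilon> (y + t *\<^sub>R v)) has_real_derivative weps \<epsilon> y * (\<Sum>\<xi>\<in>Rp. 2 * k \<xi> * (\<xi> \<bullet> v) * q \<epsilon> \<xi> y)) (at 0)"
          unfolding q_def by (rule weps_has_derivative[OF \<epsilon>(1)])
        have e: "((\<lambda>t. g (y + t *\<^sub>R v)) has_real_derivative g y * (- 2 * s * (y \<bullet> v))) (at 0)"
          unfolding g_def power2_norm_eq_inner inner_add_left inner_add_right
          by (auto intro!: derivative_eq_intros simp: inner_commute algebra_simps)
        have "((\<lambda>t. V (y + t *\<^sub>R v)) has_derivative (\<lambda>r. V' y (r *\<^sub>R v))) (at 0)"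
          by (rule has_derivative_compose[where g = V and f = "\<lambda>t. y + t *\<^sub>R v" and f' = "\<lambda>r. r *\<^sub>R v"])
            (auto intro!: derivative_eq_intros simp: V)
        then have V1: "((\<lambda>t. V (y + t *\<^sub>R v)) has_vector_derivative V' y v) (at 0)"
          by (simp add: has_vector_derivative_def linear_scale[OF has_derivative_linear[OF V]])
        have "((\<lambda>t. g (y + t *\<^sub>R v) *\<^sub>R V (y + t *\<^sub>R v)) has_vector_derivative
            g (y + 0 *\<^sub>R v) *\<^sub>R V' y v + (g y * (- 2 * s * (y \<bullet> v))) *\<^sub>R V (y + 0 *\<^sub>R v)) (at 0)"
          by (rule has_vector_derivative_scaleR[OF e V1])
        from has_vector_derivative_scaleR[OF w this]
        have "((\<lambda>t. F (y + t *\<^sub>R v)) has_vector_derivative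
            weps \<epsilon> y *\<^sub>R (g y *\<^sub>R V' y v + (g y * (- 2 * s * (y \<bullet> v))) *\<^sub>R V y)
            + (weps \<epsilon> y * (\<Sum>\<xi>\<in>Rp. 2 * k \<xi> * (\<xi> \<bullet> v) * q \<epsilon> \<xi> y)) *\<^sub>R (g y *\<^sub>R V y)) (at 0)"
          by (simp add: F_def)
        also have "weps \<epsilon> y *\<^sub>R (g y *\<^sub>R V' y v + (g y * (- 2 * s * (y \<bullet> v))) *\<^sub>R V y)
            + (weps \<epsilon> y * (\<Sum>\<xi>\<in>Rp. 2 * k \<xi> * (\<xi> \<bullet> v) * q \<epsilon> \<xi> y)) *\<^sub>R (g y *\<^sub>R V y) = F' y"
          unfolding F'_def K_def
          by (simp add: scaleR_conv_of_real algebra_simps sum_distrib_left sum_distrib_right)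
        finally show ?thesis .
      qed
    qed
    have odd: "(\<integral>y. weps \<epsilon> y *\<^sub>R (g y *\<^sub>R (a * (of_real (q \<epsilon> \<xi> y) * (V y + V (reflection \<xi> y))))) \<partial>lborel) = 0"
      if "\<xi> \<in> Rp" for \<xi> a
    proof (rule integral_weps_odd[OF Rp_R[OF that]])
      fix y
      have "\<xi> \<bullet> reflection \<xi> y = - (\<xi> \<bullet> y)"
        using reflection_inner_left[of \<xi> \<xi> y] reflection_root R_nonzero Rp_R that by force
      then have "q \<epsilon> \<xi> (reflection \<xi> y) = - q \<epsilon> \<xi> y" by (simp add: q_def)
      then show "g (reflection \<xi> y) *\<^sub>R (a * (of_real (q \<epsilon> \<xi> (reflection \<xi> y)) * (V (reflection \<xi> y) + V (reflection \<xi> (reflection \<xi> y)))))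
         = - (g y *\<^sub>R (a * (of_real (q \<epsilon> \<xi> y) * (V y + V (reflection \<xi> y)))))"
        by (simp add: g_def add.commute)
    qed measurable
    define S where "S \<xi> y = weps \<epsilon> y *\<^sub>R (g y *\<^sub>R (of_real (k \<xi> * (\<xi> \<bullet> v)) * (of_real (q \<epsilon> \<xi> y) * (V y + V (reflection \<xi> y)))))" for \<xi> y
    have S_eq: "S \<xi> y = weps \<epsilon> y *\<^sub>R g y *\<^sub>R (of_real (k \<xi> * (\<xi> \<bullet> v)) * (of_real (q \<epsilon> \<xi> y) * V y))
        + weps \<epsilon> y *\<^sub>R g y *\<^sub>R (of_real (k \<xi> * (\<xi> \<bullet> v)) * (of_real (q \<epsilon> \<xi> y) * V (reflection \<xi> y)))" for \<xi> y
      by (simp add: S_def algebra_simps)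
    have intS: "integrable lborel (S \<xi>)" for \<xi>
      unfolding S_eq[abs_def] by (intro Bochner_Integration.integrable_add intqV)
    have intF': "integrable lborel F'" unfolding F'_eq by (intro Bochner_Integration.integrable_add Bochner_Integration.integrable_sum intK intqV)
    have "(\<integral>y. F' y - (\<Sum>\<xi>\<in>Rp. S \<xi> y) \<partial>lborel) = (\<integral>y. F' y \<partial>lborel) - (\<Sum>\<xi>\<in>Rp. \<integral>y. S \<xi> y \<partial>lborel)"
      using intF' intS by (simp add: Bochner_Integration.integral_diff Bochner_Integration.integral_sum)
    also have "(\<Sum>\<xi>\<in>Rp. \<integral>y. S \<xi> y \<partial>lborel) = 0"
      unfolding S_def by (rule sum.neutral) (use odd in blast)
    finally have "(\<integral>y. F' y - (\<Sum>\<xi>\<in>Rp. S \<xi> y) \<partial>lborel) = 0" using F'0 by simp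
    moreover have "F' y - (\<Sum>\<xi>\<in>Rp. S \<xi> y) = weps \<epsilon> y *\<^sub>R g y *\<^sub>R (K y + (\<Sum>\<xi>\<in>Rp. of_real (k \<xi> * (\<xi> \<bullet> v)) * (of_real (q \<epsilon> \<xi> y) * (V y - V (reflection \<xi> y)))))" for y
    proof -
      have "(\<Sum>\<xi>\<in>Rp. of_real (2 * k \<xi> * (\<xi> \<bullet> v)) * (of_real (q \<epsilon> \<xi> y) * V y))
         - (\<Sum>\<xi>\<in>Rp. of_real (k \<xi> * (\<xi> \<bullet> v)) * (of_real (q \<epsilon> \<xi> y) * (V y + V (reflection \<xi> y))))
        = (\<Sum>\<xi>\<in>Rp. of_real (k \<xi> * (\<xi> \<bullet> v)) * (of_real (q \<epsilon> \<xi> y) * (V y - V (reflection \<xi> y))))"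
        unfolding sum_subtractf[symmetric] by (rule sum.cong) (auto simp: algebra_simps)
      moreover have "(\<Sum>\<xi>\<in>Rp. S \<xi> y) = weps \<epsilon> y *\<^sub>R g y *\<^sub>R (\<Sum>\<xi>\<in>Rp. of_real (k \<xi> * (\<xi> \<bullet> v)) * (of_real (q \<epsilon> \<xi> y) * (V y + V (reflection \<xi> y))))"
        by (simp add: S_def scaleR_sum_right)
      ultimately show ?thesis
        unfolding F'_def by (simp add: scaleR_diff_right[symmetric] add_diff_eq[symmetric] del: scaleR_scaleR)
    qed
    ultimately show ?thesis by simp
  qed
  define L where "L y = K y + (\<Sum>\<xi>\<in>Rp. of_real (k \<xi> * (\<xi> \<bullet> v)) * dq \<xi> y)" for y
  define Le where "Le \<epsilon> y = K y + (\<Sum>\<xi>\<in>Rp. of_real (k \<xi> * (\<xi> \<bullet> v)) * (of_real (q \<epsilon> \<xi> y) * (V y - V (reflection \<xi> y))))" for \<epsilon> y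
  have [measurable]: "L \<in> borel_measurable borel" "Le \<epsilon> \<in> borel_measurable borel" for \<epsilon>
    unfolding L_def[abs_def] Le_def[abs_def] dq_def by measurable
  define B where "B = C * norm v * (1 + 2 * s) + (\<Sum>\<xi>\<in>Rp. \<bar>k \<xi> * (\<xi> \<bullet> v)\<bar> * (2 / norm \<xi> * C))"
  have Le_bound: "norm (Le \<epsilon> y) \<le> B * exp ((c + 1) * norm y)" if "0 < \<epsilon>" for \<epsilon> y
  proof -
    \<comment> \<open>This bound is uniform in \<open>\<epsilon>\<close>, whereas
      \<open>q_bound\<close> degenerates: only together with the difference of values is
      \<open>q\<close> controlled, by the difference quotient.\<close>
    have "norm (of_real (q \<epsilon> \<xi> y) * (V y - V (reflection \<xi> y))) \<le> norm (dq \<xi> y)" for \<xi>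
    proof (cases "\<xi> \<bullet> y = 0")
      case True then show ?thesis by (simp add: q_def)
    next
      case False
      have "\<bar>q \<epsilon> \<xi> y\<bar> \<le> 1 / \<bar>\<xi> \<bullet> y\<bar>"
        unfolding q_def abs_divide using pos[OF that, of \<xi> y] False that
        by (simp add: field_simps power2_eq_square abs_mult_self_eq)
      then show ?thesis unfolding dq_def norm_divide norm_mult norm_of_real
        using mult_right_mono[of "\<bar>q \<epsilon> \<xi> y\<bar>" "1 / \<bar>\<xi> \<bullet> y\<bar>" "norm (V y - V (reflection \<xi> y))"] by simp
    qed
    then have "norm (of_real (k \<xi> * (\<xi> \<bullet> v)) * (of_real (q \<epsilon> \<xi> y) * (V y - V (reflection \<xi> y))))
        \<le> \<bar>k \<xi> * (\<xi> \<bullet> v)\<bar> * (2 / norm \<xi> * C * exp ((c + 1) * norm y))" if "\<xi> \<in> Rp" for \<xi>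
      unfolding norm_mult[of "of_real (k \<xi> * (\<xi> \<bullet> v))"] norm_of_real
      using dq_bound[OF that, of y] by (meson abs_ge_zero mult_left_mono order_trans)
    then have "norm (Le \<epsilon> y) \<le> (C * norm v * (1 + 2 * s)) * exp ((c + 1) * norm y)
       + (\<Sum>\<xi>\<in>Rp. \<bar>k \<xi> * (\<xi> \<bullet> v)\<bar> * (2 / norm \<xi> * C * exp ((c + 1) * norm y)))"
      unfolding Le_def by (intro norm_triangle_mono K_bound sum_norm_le) auto
    also have "\<dots> = B * exp ((c + 1) * norm y)"
      unfolding B_def distrib_right[of _ _ "exp ((c + 1) * norm y)"] sum_distrib_right by (simp only: mult.assoc)
    finally show ?thesis .
  qed
  obtain D where D: "integrable lborel D" "\<And>\<epsilon> y. 0 \<le> \<epsilon> \<Longrightarrow> \<epsilon> \<le> 1 \<Longrightarrow> weps \<epsilon> y * (B * exp ((c + 1) * norm y - s * (norm y)\<^sup>2)) \<le> D y"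
    using integrable_weps_gauss[OF s] by blast
  let ?e = "\<lambda>n. inverse (real (Suc n))"
  have e: "0 < ?e n" "?e n \<le> 1" for n by (auto simp: inverse_le_1_iff)
  have e0: "?e \<longlonglongrightarrow> 0" by (rule LIMSEQ_inverse_real_of_nat)
  have "(\<lambda>n. \<integral>y. weps (?e n) y *\<^sub>R g y *\<^sub>R Le (?e n) y \<partial>lborel) \<longlonglongrightarrow> (\<integral>y. weps 0 y *\<^sub>R g y *\<^sub>R L y \<partial>lborel)"
  proof (rule integral_dominated_convergence[OF _ _ D(1)])
    show "AE y in lborel. norm (weps (?e n) y *\<^sub>R g y *\<^sub>R Le (?e n) y) \<le> D y" for n
    proof (rule AE_I2)
      fix y
      have "norm (weps (?e n) y *\<^sub>R g y *\<^sub>R Le (?e n) y) = weps (?e n) y * norm (g y *\<^sub>R Le (?e n) y)"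
        using weps_nonneg[of "?e n" y] by (simp add: abs_mult)
      also have "\<dots> \<le> weps (?e n) y * (B * exp ((c + 1) * norm y - s * (norm y)\<^sup>2))"
        by (intro mult_left_mono gbound Le_bound e weps_nonneg)
      also have "\<dots> \<le> D y" using e[of n] by (intro D(2)) auto
      finally show "norm (weps (?e n) y *\<^sub>R g y *\<^sub>R Le (?e n) y) \<le> D y" .
    qed
    \<comment> \<open>Convergence may fail on the hyperplanes: if \<open>k \<xi> = 0\<close>, then
      \<open>weps 0\<close> contains \<open>0 powr 0 = 0\<close> there, while
      \<open>\<epsilon> powr 0 = 1\<close>.\<close>
    show "AE y in lborel. (\<lambda>n. weps (?e n) y *\<^sub>R g y *\<^sub>R Le (?e n) y) \<longlonglongrightarrow> weps 0 y *\<^sub>R g y *\<^sub>R L y"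
      using AE_off_hyperplanes
    proof eventually_elim
      case (elim y)
      have "(\<lambda>n. weps (?e n) y) \<longlonglongrightarrow> weps 0 y"
        unfolding weps_def
        by (intro tendsto_prod tendsto_powr tendsto_add tendsto_const e0) (use elim in auto)
      moreover have "(\<lambda>n. Le (?e n) y) \<longlonglongrightarrow> L y"
        unfolding Le_def L_def
      proof (intro tendsto_add tendsto_const tendsto_sum tendsto_mult)
        fix \<xi> assume "\<xi> \<in> Rp"
        then have nz: "\<xi> \<bullet> y \<noteq> 0" using elim by blast
        have "(\<lambda>n. of_real (q (?e n) \<xi> y) * (V y - V (reflection \<xi> y))) \<longlonglongrightarrow> of_real ((\<xi> \<bullet> y) / ((\<xi> \<bullet> y)\<^sup>2 + 0)) * (V y - V (reflection \<xi> y))"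
          unfolding q_def by (intro tendsto_mult tendsto_const tendsto_of_real tendsto_divide tendsto_add e0) (use nz in auto)
        also have "of_real ((\<xi> \<bullet> y) / ((\<xi> \<bullet> y)\<^sup>2 + 0)) * (V y - V (reflection \<xi> y)) = dq \<xi> y"
          using nz by (simp add: dq_def power2_eq_square)
        finally show "(\<lambda>n. of_real (q (?e n) \<xi> y) * (V y - V (reflection \<xi> y))) \<longlonglongrightarrow> dq \<xi> y" .
      qed
      ultimately show ?case by (intro tendsto_scaleR tendsto_const)
    qed
  qed measurable
  moreover have "(\<integral>y. weps (?e n) y *\<^sub>R g y *\<^sub>R Le (?e n) y \<partial>lborel) = 0" for n
    using step[OF e] unfolding Le_def .
  ultimately have "(\<lambda>n::nat. 0) \<longlonglongrightarrow> (\<integral>y. weps 0 y *\<^sub>R g y *\<^sub>R L y \<partial>lborel)" by (simp only:)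
  then have "(\<integral>y. weps 0 y *\<^sub>R g y *\<^sub>R L y \<partial>lborel) = 0" by (simp add: LIMSEQ_const_iff)
  moreover have "(\<integral>y. g y *\<^sub>R L y \<partial>nu) = (\<integral>y. weps 0 y *\<^sub>R g y *\<^sub>R L y \<partial>lborel)"
    unfolding weps_0 by (rule nu_integral(1)) measurable
  ultimately show ?thesis
    unfolding L_def K_def dq_def g_def by simp
qed

end

section \<open>Gaussian integrals and the heat kernel\<close>

text \<open>A pointwise limit of difference quotients. It supplies measurability in
  \<open>gauss_int_ray\<close>, where \<open>y\<close> is at once the point and the direction of
  differentiation.\<close>

lemma measurable_vector_derivative:
  fixes f :: "real \<Rightarrow> 'a \<Rightarrow> complex"
  assumes f: "\<And>t. f t \<in> borel_measurable M" and der: "\<And>x. ((\<lambda>t. f t x) has_vector_derivative f' x) (at t0)"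
  shows "f' \<in> borel_measurable M"
proof (rule borel_measurable_LIMSEQ_metric)
  let ?e = "\<lambda>i. inverse (real (Suc i))"
  show "(\<lambda>x. (1 / ?e i) *\<^sub>R (f (t0 + ?e i) x - f t0 x)) \<in> borel_measurable M" for i
    by (intro borel_measurable_scaleR borel_measurable_diff f) auto
  fix x
  have "((\<lambda>h. norm (f (t0 + h) x - f t0 x - h *\<^sub>R f' x) / norm h) \<longlongrightarrow> 0) (at 0)"
    using der[of x] by (simp add: has_vector_derivative_def has_derivative_at)
  from this[unfolded tendsto_at_iff_sequentially comp_def, rule_format, of ?e]
  have "(\<lambda>i. norm (f (t0 + ?e i) x - f t0 x - ?e i *\<^sub>R f' x) / norm (?e i)) \<longlonglongrightarrow> 0"
    using LIMSEQ_inverse_real_of_nat by simp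
  moreover have "norm (f (t0 + ?e i) x - f t0 x - ?e i *\<^sub>R f' x) / norm (?e i)
      = norm ((1 / ?e i) *\<^sub>R (f (t0 + ?e i) x - f t0 x) - f' x)" for i
  proof -
    have "(1 / ?e i) *\<^sub>R (f (t0 + ?e i) x - f t0 x) - f' x = (1 / ?e i) *\<^sub>R (f (t0 + ?e i) x - f t0 x - ?e i *\<^sub>R f' x)"
      by (simp add: scaleR_diff_right del: of_nat_Suc)
    then show ?thesis by (simp add: divide_inverse mult.commute)
  qed
  ultimately have "(\<lambda>i. norm ((1 / ?e i) *\<^sub>R (f (t0 + ?e i) x - f t0 x) - f' x)) \<longlonglongrightarrow> 0" by (simp only:)
  then show "(\<lambda>i. (1 / ?e i) *\<^sub>R (f (t0 + ?e i) x - f t0 x)) \<longlonglongrightarrow> f' x"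
    by (simp only: tendsto_norm_zero_iff LIM_zero_iff)
qed

section \<open>Gaussian integrals of products of two kernels\<close>

context dunkl
begin

lemma continuous_complex_vec [continuous_intros]:
  "continuous_on A f \<Longrightarrow> continuous_on A (\<lambda>x. complex_vec (f x))"
  using bounded_linear.continuous_on[OF bounded_linear_complex_vec] .

lemma continuous_smult_const: "continuous_on A (\<lambda>x. a *s complex_vec x)"
proof -
  have "linear (\<lambda>x. a *s complex_vec x)"
    by (rule linearI) (simp_all add: vec_eq_iff algebra_simps scaleR_conv_of_real[where 'a = complex])
  then show ?thesis by (intro linear_continuous_on linear_conv_bounded_linear[THEN iffD1])
qed

lemma measurable_EE [measurable]: "(\<lambda>y. EE (complex_vec y) z) \<in> borel_measurable borel"
  by (intro borel_measurable_continuous_onI continuous_EE continuous_intros)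

lemma norm_EE_real_le: "norm (EE (complex_vec y) z) \<le> exp (norm z * norm y)"
  using norm_EE_le[of "complex_vec y" z] by (simp add: mult.commute)

lemma norm_DLE_le: "norm (DLE z [h] y) \<le> exp (norm z) * exp (norm z * norm y) * norm h"
  using DLE_bound[of z "[h]" y] by (simp add: distrib_left exp_add mult_ac)

abbreviation gauss :: "real \<Rightarrow> real^'n \<Rightarrow> real" where
  "gauss s y \<equiv> exp (- s * (norm y)\<^sup>2)"

lemma gauss_mult_exp: "gauss s y * (B * exp (d * norm y)) = B * exp (d * norm y - s * (norm y)\<^sup>2)"
  by (simp add: exp_diff exp_minus field_simps)

lemma integrable_gauss_scaleR:
  fixes X :: "real^'n \<Rightarrow> complex"
  assumes "0 < s" and [measurable]: "X \<in> borel_measurable borel" and "\<And>y. norm (X y) \<le> B * exp (d * norm y)"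
  shows "integrable nu (\<lambda>y. gauss s y *\<^sub>R X y)"
proof (rule integrable_nu_gauss[OF assms(1)])
  show "norm (gauss s y *\<^sub>R X y) \<le> B * exp (d * norm y - s * (norm y)\<^sup>2)" for y
    unfolding gauss_mult_exp[symmetric] using assms(3)[of y] by (simp add: mult_left_mono)
qed measurable

text \<open>Mass, first moment and Dunkl transform of the heat kernel, as well as its representation
  by imaginary kernels, are all instances for suitable \<open>z\<close> and \<open>w\<close>; the
  second moment comes from varying \<open>s\<close>.\<close>

definition gauss_int :: "real \<Rightarrow> complex^'n \<Rightarrow> complex^'n \<Rightarrow> complex" where
  "gauss_int s z w = (\<integral>y. gauss s y *\<^sub>R (EE (complex_vec y) z * EE (complex_vec y) w) \<partial>nu)"

lemma norm_EE_mult_le: "norm (EE (complex_vec y) z * EE (complex_vec y) w) \<le> 1 * exp ((norm z + norm w) * norm y)"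
  unfolding norm_mult distrib_right exp_add mult_1 by (intro mult_mono norm_EE_real_le) auto

lemma gauss_int_integrable:
  "0 < s \<Longrightarrow> integrable nu (\<lambda>y. gauss s y *\<^sub>R (EE (complex_vec y) z * EE (complex_vec y) w))"
  by (rule integrable_gauss_scaleR[OF _ _ norm_EE_mult_le]) measurable

lemma norm_le_exp: "norm (y::real^'n) \<le> exp (norm y)"
  using exp_ge_add_one_self[of "norm y"] by linarith

lemma gauss_int_inner_integrable:
  assumes "0 < s"
  shows "integrable nu (\<lambda>y. gauss s y *\<^sub>R (of_real (y \<bullet> v) * (EE (complex_vec y) z * EE (complex_vec y) w)))"
proof (rule integrable_gauss_scaleR[OF assms])
  fix y
  have "norm (of_real (y \<bullet> v) * (EE (complex_vec y) z * EE (complex_vec y) w)) \<le> (norm y * norm v) * exp ((norm z + norm w) * norm y)"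
    unfolding norm_mult[of "of_real (y \<bullet> v)"] using norm_EE_mult_le[of y z w] Cauchy_Schwarz_ineq2[of y v]
    by (intro mult_mono) auto
  also have "\<dots> \<le> (exp (norm y) * norm v) * exp ((norm z + norm w) * norm y)"
    using norm_le_exp[of y] by (intro mult_right_mono) auto
  also have "\<dots> = norm v * exp ((norm z + norm w + 1) * norm y)"
    unfolding distrib_right[of _ 1] exp_add by simp
  finally show "norm (of_real (y \<bullet> v) * (EE (complex_vec y) z * EE (complex_vec y) w)) \<le> norm v * exp ((norm z + norm w + 1) * norm y)" .
qed measurable

text \<open>A Dunkl operator is not a derivation. For a product of two kernels the defect in the
  product rule is \<open>U\<close>, two differences divided by \<open>\<xi> \<bullet> y\<close>; all
  three factors change sign under the reflection, so \<open>U\<close> is odd and integrates to 0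
  against the Gaussian. What remains is the sum of the two eigenvalues.\<close>

lemma gauss_int_by_parts:
  assumes s: "0 < s"
  shows "of_real (2 * s) * (\<integral>y. gauss s y *\<^sub>R (of_real (y \<bullet> v) * (EE (complex_vec y) z * EE (complex_vec y) w)) \<partial>nu)
    = (cinner (complex_vec v) z + cinner (complex_vec v) w) * gauss_int s z w"
proof -
  define V where "V y = EE (complex_vec y) z * EE (complex_vec y) w" for y
  define V' where "V' y h = EE (complex_vec y) z * DLE w [h] y + DLE z [h] y * EE (complex_vec y) w" for y h
  define C where "C = exp (norm z) + exp (norm w)"
  define c where "c = norm z + norm w"
  have c0: "0 \<le> c" and C1: "1 \<le> C" by (auto simp: c_def C_def add_increasing)
  have V: "(V has_derivative V' y) (at y)" for y
    unfolding V_def V'_def by (intro has_derivative_mult EE_has_derivative_real)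
  have cont: "continuous_on UNIV (\<lambda>y. V' y v)"
  proof -
    have "continuous_on UNIV (DLE x as)" for x as
      by (meson DLE_has_derivative continuous_at_imp_continuous_on has_derivative_continuous)
    then show ?thesis unfolding V'_def by (intro continuous_intros continuous_EE)
  qed
  have b: "norm (V y) \<le> C * exp (c * norm y)" for y
    unfolding V_def c_def by (rule order_trans[OF norm_EE_mult_le mult_right_mono[OF C1]]) simp
  have b': "norm (V' y h) \<le> C * exp (c * norm y) * norm h" for y h
  proof -
    have "norm (V' y h) \<le> exp (norm z * norm y) * (exp (norm w) * exp (norm w * norm y) * norm h)
       + (exp (norm z) * exp (norm z * norm y) * norm h) * exp (norm w * norm y)"
      unfolding V'_def
      by (intro norm_triangle_mono norm_mult_ineq[THEN order_trans] mult_mono norm_EE_real_le norm_DLE_le) auto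
    also have "\<dots> = C * exp (c * norm y) * norm h"
      unfolding C_def c_def distrib_right[of "norm z"] exp_add by (simp add: algebra_simps)
    finally show ?thesis .
  qed
  define Q where "Q x \<xi> y = (EE (complex_vec y) x - EE (complex_vec (reflection \<xi> y)) x) / of_real (\<xi> \<bullet> y)" for x \<xi> y
  define U where "U \<xi> y = Q z \<xi> y * (EE (complex_vec y) w - EE (complex_vec (reflection \<xi> y)) w)" for \<xi> y
  have [measurable]: "Q x \<xi> \<in> borel_measurable borel" for x \<xi>
    unfolding Q_def[abs_def] by measurable
  have [measurable]: "U \<xi> \<in> borel_measurable borel" for \<xi>
    unfolding U_def[abs_def] by measurable
  have U_int: "integrable nu (\<lambda>y. gauss s y *\<^sub>R U \<xi> y)" if \<xi>: "\<xi> \<in> Rp" for \<xi>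
  proof (rule integrable_gauss_scaleR[OF s])
    fix y
    have 1: "norm (Q z \<xi> y) \<le> 2 / norm \<xi> * exp (norm z) * exp (norm z * norm y)"
      unfolding Q_def
      by (rule quotient_bound[OF EE_has_derivative_real]) (auto simp: Rp_R \<xi> intro: norm_DLE_le)
    have 2: "norm (EE (complex_vec y) w - EE (complex_vec (reflection \<xi> y)) w) \<le> exp (norm w * norm y) + exp (norm w * norm y)"
      using norm_EE_real_le[of y w] norm_EE_real_le[of "reflection \<xi> y" w]
      by (intro norm_triangle_ineq4[THEN order_trans] add_mono) auto
    have "norm (U \<xi> y) \<le> (2 / norm \<xi> * exp (norm z) * exp (norm z * norm y)) * (exp (norm w * norm y) + exp (norm w * norm y))"
      unfolding U_def norm_mult by (intro mult_mono 1 2) auto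
    also have "\<dots> = (4 / norm \<xi> * exp (norm z)) * exp ((norm z + norm w) * norm y)"
      unfolding distrib_right exp_add by simp
    finally show "norm (U \<xi> y) \<le> (4 / norm \<xi> * exp (norm z)) * exp ((norm z + norm w) * norm y)" .
  qed measurable
  have U_zero: "(\<integral>y. gauss s y *\<^sub>R U \<xi> y \<partial>nu) = 0" if \<xi>: "\<xi> \<in> Rp" for \<xi>
  proof -
    have "(\<integral>y. weps 0 y *\<^sub>R (gauss s y *\<^sub>R U \<xi> y) \<partial>lborel) = 0"
    proof (rule integral_weps_odd[OF Rp_R[OF \<xi>]])
      fix y
      have "\<xi> \<bullet> reflection \<xi> y = - (\<xi> \<bullet> y)"
        using reflection_inner_left[of \<xi> \<xi> y] reflection_root R_nonzero Rp_R \<xi> by force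
      then show "gauss s (reflection \<xi> y) *\<^sub>R U \<xi> (reflection \<xi> y) = - (gauss s y *\<^sub>R U \<xi> y)"
        by (simp add: U_def Q_def minus_divide_right[symmetric] divide_simps)
          (simp add: algebra_simps)
    qed measurable
    then show ?thesis unfolding weps_0 by (subst nu_integral(1)) measurable
  qed
  have "(\<integral>y. gauss s y *\<^sub>R (V' y v - of_real (2 * s * (y \<bullet> v)) * V y
     + (\<Sum>\<xi>\<in>Rp. of_real (k \<xi> * (\<xi> \<bullet> v)) * ((V y - V (reflection \<xi> y)) / of_real (\<xi> \<bullet> y)))) \<partial>nu) = 0"
    by (rule dunkl_integral_by_parts[OF s V cont b b' c0])
  also have "(\<integral>y. gauss s y *\<^sub>R (V' y v - of_real (2 * s * (y \<bullet> v)) * V y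
     + (\<Sum>\<xi>\<in>Rp. of_real (k \<xi> * (\<xi> \<bullet> v)) * ((V y - V (reflection \<xi> y)) / of_real (\<xi> \<bullet> y)))) \<partial>nu)
    = (\<integral>y. (cinner (complex_vec v) z + cinner (complex_vec v) w) * (gauss s y *\<^sub>R V y)
        - of_real (2 * s) * (gauss s y *\<^sub>R (of_real (y \<bullet> v) * V y))
        - (\<Sum>\<xi>\<in>Rp. of_real (k \<xi> * (\<xi> \<bullet> v)) * (gauss s y *\<^sub>R U \<xi> y)) \<partial>nu)"
  proof (rule integral_cong_AE)
    show "AE y in nu. gauss s y *\<^sub>R (V' y v - of_real (2 * s * (y \<bullet> v)) * V y
     + (\<Sum>\<xi>\<in>Rp. of_real (k \<xi> * (\<xi> \<bullet> v)) * ((V y - V (reflection \<xi> y)) / of_real (\<xi> \<bullet> y))))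
      = (cinner (complex_vec v) z + cinner (complex_vec v) w) * (gauss s y *\<^sub>R V y)
        - of_real (2 * s) * (gauss s y *\<^sub>R (of_real (y \<bullet> v) * V y))
        - (\<Sum>\<xi>\<in>Rp. of_real (k \<xi> * (\<xi> \<bullet> v)) * (gauss s y *\<^sub>R U \<xi> y))"
      using AE_nu_off_hyperplanes
    proof eventually_elim
      case (elim y)
      have rq: "reflection_quotient \<xi> (\<lambda>y. EE (complex_vec y) x) y = Q x \<xi> y" if "\<xi> \<in> Rp" for \<xi> x
        using elim that by (simp add: reflection_quotient_def Q_def)
      have DL: "DLE x [v] y = cinner (complex_vec v) x * EE (complex_vec y) x - (\<Sum>\<xi>\<in>Rp. of_real (k \<xi> * (\<xi> \<bullet> v)) * Q x \<xi> y)" for x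
      proof -
        have "(\<Sum>\<xi>\<in>Rp. of_real (k \<xi> * (\<xi> \<bullet> v)) * reflection_quotient \<xi> (\<lambda>y. EE (complex_vec y) x) y)
          = (\<Sum>\<xi>\<in>Rp. of_real (k \<xi> * (\<xi> \<bullet> v)) * Q x \<xi> y)"
          by (rule sum.cong) (auto simp: rq)
        then show ?thesis using EE_dunkl_direction[of x v y] by (simp add: algebra_simps)
      qed
      have q: "(V y - V (reflection \<xi> y)) / of_real (\<xi> \<bullet> y)
         = EE (complex_vec y) z * Q w \<xi> y + Q z \<xi> y * EE (complex_vec y) w - U \<xi> y" for \<xi>
      proof (cases "\<xi> \<bullet> y = 0")
        case False
        then show ?thesis unfolding V_def Q_def U_def by (simp add: field_simps)
      qed (simp add: Q_def U_def)
      have "V' y v + (\<Sum>\<xi>\<in>Rp. of_real (k \<xi> * (\<xi> \<bullet> v)) * ((V y - V (reflection \<xi> y)) / of_real (\<xi> \<bullet> y)))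
         = (cinner (complex_vec v) z + cinner (complex_vec v) w) * V y - (\<Sum>\<xi>\<in>Rp. of_real (k \<xi> * (\<xi> \<bullet> v)) * U \<xi> y)"
      proof -
        define a where "a \<xi> = complex_of_real (k \<xi> * (\<xi> \<bullet> v))" for \<xi>
        define Ez Ew where "Ez = EE (complex_vec y) z" and "Ew = EE (complex_vec y) w"
        have A: "(\<Sum>\<xi>\<in>Rp. a \<xi> * ((V y - V (reflection \<xi> y)) / of_real (\<xi> \<bullet> y)))
          = Ez * (\<Sum>\<xi>\<in>Rp. a \<xi> * Q w \<xi> y) + (\<Sum>\<xi>\<in>Rp. a \<xi> * Q z \<xi> y) * Ew - (\<Sum>\<xi>\<in>Rp. a \<xi> * U \<xi> y)"
          unfolding q Ez_def[symmetric] Ew_def[symmetric]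
          by (simp add: algebra_simps sum.distrib sum_subtractf sum_distrib_left sum_distrib_right)
        show ?thesis
          unfolding V'_def DL a_def[symmetric] A Ez_def[symmetric] Ew_def[symmetric]
          by (simp add: V_def Ez_def[symmetric] Ew_def[symmetric] algebra_simps)
      qed
      then have e2: "V' y v - of_real (2 * s * (y \<bullet> v)) * V y + (\<Sum>\<xi>\<in>Rp. of_real (k \<xi> * (\<xi> \<bullet> v)) * ((V y - V (reflection \<xi> y)) / of_real (\<xi> \<bullet> y)))
         = (cinner (complex_vec v) z + cinner (complex_vec v) w) * V y - of_real (2 * s) * (of_real (y \<bullet> v) * V y)
          - (\<Sum>\<xi>\<in>Rp. of_real (k \<xi> * (\<xi> \<bullet> v)) * U \<xi> y)"
        by (simp add: algebra_simps)
      show ?case unfolding e2 scaleR_diff_right scaleR_sum_right mult_scaleR_right ..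
    qed
    have [measurable]: "(\<lambda>y. V' y v) \<in> borel_measurable borel" "V \<in> borel_measurable borel"
      using cont by (auto simp: V_def[abs_def] intro: borel_measurable_continuous_onI)
    show "(\<lambda>y. gauss s y *\<^sub>R (V' y v - of_real (2 * s * (y \<bullet> v)) * V y
     + (\<Sum>\<xi>\<in>Rp. of_real (k \<xi> * (\<xi> \<bullet> v)) * ((V y - V (reflection \<xi> y)) / of_real (\<xi> \<bullet> y))))) \<in> borel_measurable nu"
      by measurable
    show "(\<lambda>y. (cinner (complex_vec v) z + cinner (complex_vec v) w) * (gauss s y *\<^sub>R V y)
        - of_real (2 * s) * (gauss s y *\<^sub>R (of_real (y \<bullet> v) * V y))
        - (\<Sum>\<xi>\<in>Rp. of_real (k \<xi> * (\<xi> \<bullet> v)) * (gauss s y *\<^sub>R U \<xi> y))) \<in> borel_measurable nu"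
      by measurable
  qed
  also have "\<dots> = (cinner (complex_vec v) z + cinner (complex_vec v) w) * gauss_int s z w
     - of_real (2 * s) * (\<integral>y. gauss s y *\<^sub>R (of_real (y \<bullet> v) * V y) \<partial>nu)"
  proof -
    have i1: "integrable nu (\<lambda>y. (cinner (complex_vec v) z + cinner (complex_vec v) w) * (gauss s y *\<^sub>R V y))"
      unfolding V_def by (intro integrable_mult_right gauss_int_integrable s)
    have i2: "integrable nu (\<lambda>y. of_real (2 * s) * (gauss s y *\<^sub>R (of_real (y \<bullet> v) * V y)))"
      unfolding V_def by (intro integrable_mult_right gauss_int_inner_integrable s)
    have i3: "integrable nu (\<lambda>y. of_real (k \<xi> * (\<xi> \<bullet> v)) * (gauss s y *\<^sub>R U \<xi> y))" if "\<xi> \<in> Rp" for \<xi>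
      by (intro integrable_mult_right U_int that)
    have i4: "integrable nu (\<lambda>y. \<Sum>\<xi>\<in>Rp. of_real (k \<xi> * (\<xi> \<bullet> v)) * (gauss s y *\<^sub>R U \<xi> y))"
      by (rule Bochner_Integration.integrable_sum[OF i3])
    have "(\<integral>y. (\<Sum>\<xi>\<in>Rp. of_real (k \<xi> * (\<xi> \<bullet> v)) * (gauss s y *\<^sub>R U \<xi> y)) \<partial>nu) = 0"
      by (subst Bochner_Integration.integral_sum[OF i3], assumption)
        (intro sum.neutral ballI, simp only: integral_mult_right_zero U_zero mult_zero_right)
    then show ?thesis
      by (simp only: Bochner_Integration.integral_diff[OF Bochner_Integration.integrable_diff[OF i1 i2] i4]
          Bochner_Integration.integral_diff[OF i1 i2] integral_mult_right_zero gauss_int_def V_def[symmetric] diff_zero)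
  qed
  finally show ?thesis by (simp add: V_def)
qed

lemma gauss_int_commute: "gauss_int s z w = gauss_int s w z"
  by (simp add: gauss_int_def mult.commute)

lemma EE_scale_real: "EE (complex_vec y) (of_real t *s z) = EE (complex_vec (t *\<^sub>R y)) z"
  by (simp add: EE_smult[symmetric] scaleR_eq_smult)

text \<open>Differentiating the first kernel along the ray produces a factor
  \<open>y \<bullet> x\<close>, which \<open>gauss_int_by_parts\<close> trades for multiples of
  \<open>cinner z z\<close> and \<open>cinner z w\<close>. The assumption on \<open>z\<close>
  provides the real direction \<open>x\<close> which that lemma requires.\<close>

lemma gauss_int_ray:
  assumes s: "0 < s" and z: "z = a *s complex_vec x"
  obtains D where "((\<lambda>t. gauss_int s (of_real t *s z) w) has_vector_derivative D) (at t)"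
    "of_real t * D = (of_real t * (of_real t * cinner z z + cinner z w) / of_real (2 * s) - gam) * gauss_int s (of_real t *s z) w
       + (\<Sum>\<xi>\<in>Rp. k \<xi> * gauss_int s (of_real t *s complexify (reflection \<xi>) z) w)"
proof
  define f where "f t y = gauss s y *\<^sub>R (EE (complex_vec (t *\<^sub>R y)) z * EE (complex_vec y) w)" for t y
  define f' where "f' t y = gauss s y *\<^sub>R (DLE z [y] (t *\<^sub>R y) * EE (complex_vec y) w)" for t y
  have fI: "integral\<^sup>L nu (f t) = gauss_int s (of_real t *s z) w" for t
    by (simp only: f_def[abs_def] gauss_int_def EE_scale_real)
  have fint: "integrable nu (f t)" for t
    using gauss_int_integrable[OF s, of "of_real t *s z" w] by (simp only: f_def[abs_def] EE_scale_real)
  have der: "((\<lambda>t. f t y) has_vector_derivative f' t y) (at t)" for t y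
  proof -
    have "((\<lambda>t. EE (complex_vec (t *\<^sub>R y)) z) has_derivative (\<lambda>r. DLE z [r *\<^sub>R y] (t *\<^sub>R y))) (at t)"
      by (rule has_derivative_compose[where f = "\<lambda>t. t *\<^sub>R y" and f' = "\<lambda>r. r *\<^sub>R y", OF _ EE_has_derivative_real])
        (auto intro!: derivative_eq_intros)
    then have "((\<lambda>t. EE (complex_vec (t *\<^sub>R y)) z) has_vector_derivative DLE z [y] (t *\<^sub>R y)) (at t)"
      by (simp add: has_vector_derivative_def linear_scale[OF has_derivative_linear[OF EE_has_derivative_real]])
    from has_vector_derivative_mult_left[OF this, of "EE (complex_vec y) w"]
    have "((\<lambda>t. EE (complex_vec (t *\<^sub>R y)) z * EE (complex_vec y) w) has_vector_derivative DLE z [y] (t *\<^sub>R y) * EE (complex_vec y) w) (at t)" .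
    from has_vector_derivative_scaleR[OF DERIV_const this, of "gauss s y"]
    show ?thesis by (simp add: f_def f'_def)
  qed
  have meas': "f' t \<in> borel_measurable borel" for t
  proof (rule measurable_vector_derivative[of f])
    show "f t \<in> borel_measurable borel" for t using borel_measurable_integrable[OF fint] by simp
  qed (rule der)
  \<comment> \<open>\<open>\<bar>t\<bar> + 1\<close> bounds the parameter on the unit interval
    around \<open>t\<close>; the last summand 1 absorbs the factor \<open>norm y\<close> coming from
    the direction.\<close>
  define c where "c = norm z * (\<bar>t\<bar> + 1) + norm w + 1"
  have bound: "norm (f' r y) \<le> gauss s y * (exp (norm z) * exp (c * norm y))" if "\<bar>r - t\<bar> < 1" for r y
  proof -
    have "norm (DLE z [y] (r *\<^sub>R y) * EE (complex_vec y) w)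
       \<le> (exp (norm z) * exp (norm z * norm (r *\<^sub>R y)) * norm y) * exp (norm w * norm y)"
      unfolding norm_mult by (intro mult_mono norm_DLE_le norm_EE_real_le) auto
    also have "\<dots> \<le> (exp (norm z) * exp (norm z * ((\<bar>t\<bar> + 1) * norm y)) * exp (norm y)) * exp (norm w * norm y)"
    proof -
      have "\<bar>r\<bar> \<le> \<bar>t\<bar> + 1" using that by linarith
      then have "norm z * norm (r *\<^sub>R y) \<le> norm z * ((\<bar>t\<bar> + 1) * norm y)"
        by (simp add: mult_left_mono mult_right_mono)
      then show ?thesis using norm_le_exp[of y] by (intro mult_mono mult_right_mono) auto
    qed
    also have "\<dots> = exp (norm z) * exp (c * norm y)"
      unfolding c_def distrib_right[of "norm z * (\<bar>t\<bar> + 1) + norm w"] distrib_right[of "norm z * (\<bar>t\<bar> + 1)"] exp_add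
      by (simp add: mult_ac)
    finally show ?thesis unfolding f'_def by (simp add: mult_left_mono)
  qed
  define D where "D = integral\<^sup>L nu (f' t)"
  have Dint: "integrable nu (\<lambda>y. gauss s y * (exp (norm z) * exp (c * norm y)))"
  proof (rule integrable_nu_gauss_real[OF s])
    show "\<bar>gauss s y * (exp (norm z) * exp (c * norm y))\<bar> \<le> exp (norm z) * exp (c * norm y - s * (norm y)\<^sup>2)" for y
      using gauss_mult_exp[of s y "exp (norm z)" c] by simp
  qed measurable
  show "((\<lambda>t. gauss_int s (of_real t *s z) w) has_vector_derivative D) (at t)"
    unfolding D_def fI[symmetric]
    by (rule has_vector_derivative_integral[OF zero_less_one fint der bound Dint]) (use meas' in auto)
  have Ext: "EE (complex_vec (reflection \<xi> (t *\<^sub>R y))) z = EE (complex_vec y) (of_real t *s complexify (reflection \<xi>) z)" if "\<xi> \<in> Rp" for \<xi> y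
  proof -
    have "EE (complex_vec (reflection \<xi> (t *\<^sub>R y))) z = EE (complexify (reflection \<xi>) (complex_vec (t *\<^sub>R y))) z"
      by (simp only: complexify_reflection)
    also have "\<dots> = EE (complex_vec (t *\<^sub>R y)) (complexify (reflection \<xi>) z)"
      by (rule EE_reflection[OF Rp_R[OF that]])
    finally show ?thesis by (simp only: EE_scale_real)
  qed
  have pt: "of_real t * f' t y = (of_real t * a) * (gauss s y *\<^sub>R (of_real (y \<bullet> x) * (EE (complex_vec y) (of_real t *s z) * EE (complex_vec y) w)))
      - gam * (gauss s y *\<^sub>R (EE (complex_vec y) (of_real t *s z) * EE (complex_vec y) w))
      + (\<Sum>\<xi>\<in>Rp. k \<xi> * (gauss s y *\<^sub>R (EE (complex_vec y) (of_real t *s complexify (reflection \<xi>) z) * EE (complex_vec y) w)))" for y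
  proof -
    have "of_real t * DLE z [y] (t *\<^sub>R y) = DLE z [t *\<^sub>R y] (t *\<^sub>R y)"
      using linear_scale[OF has_derivative_linear[OF EE_has_derivative_real]] by (simp add: scaleR_conv_of_real)
    also have "\<dots> = (cinner (complex_vec (t *\<^sub>R y)) z - gam) * EE (complex_vec (t *\<^sub>R y)) z + (\<Sum>\<xi>\<in>Rp. k \<xi> * EE (complex_vec (reflection \<xi> (t *\<^sub>R y))) z)"
      by (rule dunkl_eigenfunction_euler[OF EE_has_derivative_real dunkl_op_EE])
    also have "\<dots> = (of_real t * a * of_real (y \<bullet> x) - gam) * EE (complex_vec y) (of_real t *s z)
        + (\<Sum>\<xi>\<in>Rp. k \<xi> * EE (complex_vec y) (of_real t *s complexify (reflection \<xi>) z))"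
    proof -
      have c: "cinner (complex_vec (t *\<^sub>R y)) z = of_real t * a * of_real (y \<bullet> x)"
        by (simp add: z scaleR_conv_of_real[where 'a = complex])
      have "(\<Sum>\<xi>\<in>Rp. k \<xi> * EE (complex_vec (reflection \<xi> (t *\<^sub>R y))) z)
         = (\<Sum>\<xi>\<in>Rp. k \<xi> * EE (complex_vec y) (of_real t *s complexify (reflection \<xi>) z))"
        by (rule sum.cong[OF refl]) (simp only: Ext)
      then show ?thesis unfolding c EE_scale_real by (simp only:)
    qed
    finally have e: "of_real t * DLE z [y] (t *\<^sub>R y) = (of_real t * a * of_real (y \<bullet> x) - gam) * EE (complex_vec y) (of_real t *s z)
        + (\<Sum>\<xi>\<in>Rp. k \<xi> * EE (complex_vec y) (of_real t *s complexify (reflection \<xi>) z))" .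
    have "of_real t * f' t y = gauss s y *\<^sub>R ((of_real t * DLE z [y] (t *\<^sub>R y)) * EE (complex_vec y) w)"
      by (simp add: f'_def mult_ac)
    then show ?thesis unfolding e
      by (simp add: algebra_simps scaleR_sum_right sum_distrib_left sum_distrib_right)
  qed
  have i1: "integrable nu (\<lambda>y. (of_real t * a) * (gauss s y *\<^sub>R (of_real (y \<bullet> x) * (EE (complex_vec y) (of_real t *s z) * EE (complex_vec y) w))))"
    by (intro integrable_mult_right gauss_int_inner_integrable s)
  have i2: "integrable nu (\<lambda>y. complex_of_real gam * (gauss s y *\<^sub>R (EE (complex_vec y) (of_real t *s z) * EE (complex_vec y) w)))"
    by (intro integrable_mult_right gauss_int_integrable s)
  have i3: "integrable nu (\<lambda>y. complex_of_real (k \<xi>) * (gauss s y *\<^sub>R (EE (complex_vec y) (of_real t *s complexify (reflection \<xi>) z) * EE (complex_vec y) w)))" for \<xi>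
    by (intro integrable_mult_right gauss_int_integrable s)
  have "of_real t * D = (\<integral>y. of_real t * f' t y \<partial>nu)" by (simp add: D_def)
  also have "\<dots> = of_real t * a * (\<integral>y. gauss s y *\<^sub>R (of_real (y \<bullet> x) * (EE (complex_vec y) (of_real t *s z) * EE (complex_vec y) w)) \<partial>nu)
      - gam * gauss_int s (of_real t *s z) w
      + (\<Sum>\<xi>\<in>Rp. k \<xi> * gauss_int s (of_real t *s complexify (reflection \<xi>) z) w)"
    unfolding pt
    by (simp only: Bochner_Integration.integral_add[OF Bochner_Integration.integrable_diff[OF i1 i2] Bochner_Integration.integrable_sum[OF i3]]
        Bochner_Integration.integral_diff[OF i1 i2] Bochner_Integration.integral_sum[OF i3] integral_mult_right_zero gauss_int_def)
  also have "(\<integral>y. gauss s y *\<^sub>R (of_real (y \<bullet> x) * (EE (complex_vec y) (of_real t *s z) * EE (complex_vec y) w)) \<partial>nu)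
     = (cinner (complex_vec x) (of_real t *s z) + cinner (complex_vec x) w) * gauss_int s (of_real t *s z) w / of_real (2 * s)"
    using gauss_int_by_parts[OF s, of x "of_real t *s z" w] s by (simp add: field_simps)
  also have "of_real t * a * ((cinner (complex_vec x) (of_real t *s z) + cinner (complex_vec x) w) * gauss_int s (of_real t *s z) w / of_real (2 * s))
     = of_real t * (of_real t * cinner z z + cinner z w) / of_real (2 * s) * gauss_int s (of_real t *s z) w"
    by (simp add: z algebra_simps)
  finally show "of_real t * D = (of_real t * (of_real t * cinner z z + cinner z w) / of_real (2 * s) - gam) * gauss_int s (of_real t *s z) w
       + (\<Sum>\<xi>\<in>Rp. k \<xi> * gauss_int s (of_real t *s complexify (reflection \<xi>) z) w)"
    by (simp add: algebra_simps)
qed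

text \<open>Divided by \<open>exp (t\<^sup>2 q)\<close>, the Gaussian integral obeys the same
  singular system as the kernel with second argument \<open>w / (2 s)\<close>, because the
  derivative of the exponential removes the \<open>cinner z z\<close> term. The values at
  \<open>t = 0\<close> agree after multiplication by \<open>gauss_int s 0 w\<close>, and
  \<open>energy_zero\<close> concludes.\<close>

lemma gauss_int_step:
  assumes s: "0 < s" and z: "z = a *s complex_vec x"
  shows "gauss_int s z w = exp (cinner z z / of_real (4 * s)) * gauss_int s 0 w * EE z (of_real (1 / (2 * s)) *s w)"
proof -
  let ?w = "of_real (1 / (2 * s)) *s w"
  define q where "q = cinner z z / of_real (4 * s)"
  define F where "F g t = gauss_int s (of_real t *s complexify g z) w * exp (- (of_real (t * t) * q))
      - gauss_int s 0 w * EE (of_real t *s complexify g z) ?w" for g t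
  have dF: "\<exists>D. (F g has_vector_derivative D) (at t) \<and>
      of_real t * D = (of_real t * (cinner (complexify g z) w / of_real (2 * s)) - gam) * F g t + (\<Sum>\<xi>\<in>Rp. k \<xi> * F (reflection \<xi> \<circ> g) t)"
    if g: "g \<in> G" for g t
  proof -
    have gz: "complexify g z = a *s complex_vec (g x)" using g by (simp add: z complexify_G)
    obtain D1 where D1: "((\<lambda>t. gauss_int s (of_real t *s complexify g z) w) has_vector_derivative D1) (at t)"
      "of_real t * D1 = (of_real t * (of_real t * cinner (complexify g z) (complexify g z) + cinner (complexify g z) w) / of_real (2 * s) - gam) * gauss_int s (of_real t *s complexify g z) w
       + (\<Sum>\<xi>\<in>Rp. k \<xi> * gauss_int s (of_real t *s complexify (reflection \<xi>) (complexify g z)) w)"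
      by (rule gauss_int_ray[OF s gz])
    obtain D2 where D2: "((\<lambda>t. EE (of_real t *s complexify g z) ?w) has_vector_derivative D2) (at t)"
     "of_real t * D2 = (of_real t * cinner (complexify g z) ?w - gam) * EE (of_real t *s complexify g z) ?w
        + (\<Sum>\<xi>\<in>Rp. k \<xi> * EE (of_real t *s complexify (reflection \<xi>) (complexify g z)) ?w)"
      by (rule EE_ray_real)
    define e where "e t = exp (- (of_real (t * t) * q))" for t :: real
    have e: "(e has_vector_derivative - (2 * of_real t * q) * e t) (at t)"
    proof -
      have "((\<lambda>u. exp (- (u * u * q))) has_field_derivative - (2 * of_real t * q) * e t) (at (of_real t))"
        by (auto intro!: derivative_eq_intros simp: e_def algebra_simps)
      from has_vector_derivative_real_field[OF this] show ?thesis by (simp add: e_def[abs_def])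
    qed
    have "(F g has_vector_derivative (gauss_int s (of_real t *s complexify g z) w * (- (2 * of_real t * q) * e t) + D1 * e t)
        - gauss_int s 0 w * D2) (at t)"
      unfolding F_def[abs_def] e_def[symmetric]
      by (intro has_vector_derivative_diff has_vector_derivative_mult has_vector_derivative_mult_right D1 D2 e)
    moreover have "of_real t * ((gauss_int s (of_real t *s complexify g z) w * (- (2 * of_real t * q) * e t) + D1 * e t)
        - gauss_int s 0 w * D2) = (of_real t * (cinner (complexify g z) w / of_real (2 * s)) - gam) * F g t + (\<Sum>\<xi>\<in>Rp. k \<xi> * F (reflection \<xi> \<circ> g) t)"
    proof -
      have gg: "cinner (complexify g z) (complexify g z) = of_real (4 * s) * q"
        using s g by (simp add: cinner_complexify G_linear G_inner q_def)
      have "of_real t * ((gauss_int s (of_real t *s complexify g z) w * (- (2 * of_real t * q) * e t) + D1 * e t) - gauss_int s 0 w * D2)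
        = - (2 * of_real t * of_real t * q) * gauss_int s (of_real t *s complexify g z) w * e t + (of_real t * D1) * e t - gauss_int s 0 w * (of_real t * D2)"
        by (simp add: algebra_simps)
      also have "\<dots> = (of_real t * (cinner (complexify g z) w / of_real (2 * s)) - gam) * F g t
        + ((\<Sum>\<xi>\<in>Rp. k \<xi> * gauss_int s (of_real t *s complexify (reflection \<xi>) (complexify g z)) w) * e t
         - gauss_int s 0 w * (\<Sum>\<xi>\<in>Rp. k \<xi> * EE (of_real t *s complexify (reflection \<xi>) (complexify g z)) ?w))"
        unfolding D1(2) D2(2) gg F_def e_def[symmetric] using s
        by (simp add: field_simps)
      also have "(\<Sum>\<xi>\<in>Rp. k \<xi> * gauss_int s (of_real t *s complexify (reflection \<xi>) (complexify g z)) w) * e t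
         - gauss_int s 0 w * (\<Sum>\<xi>\<in>Rp. k \<xi> * EE (of_real t *s complexify (reflection \<xi>) (complexify g z)) ?w)
         = (\<Sum>\<xi>\<in>Rp. k \<xi> * F (reflection \<xi> \<circ> g) t)"
        unfolding F_def complexify_comp_reflection[OF g] e_def[symmetric] sum_distrib_left sum_distrib_right sum_subtractf[symmetric]
        by (rule sum.cong) (auto simp: algebra_simps)
      finally show ?thesis .
    qed
    ultimately show ?thesis by blast
  qed
  have "F id 1 = 0"
  proof (rule energy_zero[where F = F and d = "\<lambda>g. cinner (complexify g z) w / of_real (2 * s)", OF _ _ _ _ id_in_G])
    show "continuous_on {0..1} (F g)" if "g \<in> G" for g
      using dF[OF that] has_vector_derivative_continuous continuous_at_imp_continuous_on by blast
    show "F g 0 = 0" if "g \<in> G" for g by (simp add: F_def)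
  qed (use dF in auto)
  then have "gauss_int s z w * exp (- q) = gauss_int s 0 w * EE z ?w" by (simp add: F_def)
  then have "gauss_int s z w * (exp (- q) * exp q) = exp q * gauss_int s 0 w * EE z ?w" by (simp add: mult_ac)
  then show ?thesis by (simp add: q_def exp_minus)
qed

section \<open>The mass of the Gaussian and the heat kernel\<close>

definition ZZ :: "real \<Rightarrow> real" where "ZZ s = (\<integral>y. gauss s y \<partial>nu)"

lemma gauss_int_0: "gauss_int s 0 0 = of_real (ZZ s)"
  by (simp add: gauss_int_def ZZ_def scaleR_conv_of_real)

text \<open>\<open>gauss_int_step\<close> in the first argument and then, by symmetry of
  \<open>gauss_int\<close>, in the second with the first at 0.\<close>

lemma gauss_int_eq:
  assumes s: "0 < s"
  shows "gauss_int s (a *s complex_vec x) (b *s complex_vec v)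
    = of_real (ZZ s) * exp ((a\<^sup>2 * of_real (x \<bullet> x) + b\<^sup>2 * of_real (v \<bullet> v)) / of_real (4 * s))
      * EE (a *s complex_vec x) (of_real (1 / (2 * s)) *s (b *s complex_vec v))"
proof -
  have "gauss_int s 0 (b *s complex_vec v) = exp (cinner (b *s complex_vec v) (b *s complex_vec v) / of_real (4 * s)) * of_real (ZZ s)"
    using gauss_int_step[OF s refl, of b v 0] by (simp add: gauss_int_commute[of s 0] gauss_int_0)
  then show ?thesis
    unfolding gauss_int_step[OF s refl, of a x]
    by (simp add: power2_eq_square add_divide_distrib exp_add mult_ac)
qed

lemma integrable_gauss: "0 < s \<Longrightarrow> integrable nu (gauss s)"
  by (rule integrable_nu_gauss_real[where C = 1 and c = 0]) auto

lemma dunkl_weight_scale: "0 < c \<Longrightarrow> dunkl_weight Rp k (c *\<^sub>R y) = c powr (2 * gam) * dunkl_weight Rp k y"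
proof -
  assume c: "0 < c"
  have "dunkl_weight Rp k (c *\<^sub>R y) = (\<Prod>\<xi>\<in>Rp. c powr (2 * k \<xi>) * \<bar>\<xi> \<bullet> y\<bar> powr (2 * k \<xi>))"
    unfolding dunkl_weight_def using c by (intro prod.cong) (auto simp: abs_mult powr_mult)
  also have "\<dots> = (\<Prod>\<xi>\<in>Rp. c powr (2 * k \<xi>)) * dunkl_weight Rp k y"
    by (simp add: prod.distrib dunkl_weight_def)
  also have "(\<Prod>\<xi>\<in>Rp. c powr (2 * k \<xi>)) = c powr (2 * gam)"
    unfolding dunkl_gamma_def sum_distrib_left by (rule powr_sum[symmetric]) (use c in auto)
  finally show ?thesis .
qed

lemma ZZ_scale:
  assumes "0 < s" shows "ZZ s = s powr (- (gam + real CARD('n) / 2)) * ZZ 1"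
proof -
  \<comment> \<open>Dilation by \<open>c\<close> turns \<open>gauss s\<close> into
    \<open>gauss 1\<close>. The Jacobian contributes the exponent \<open>CARD('n)\<close> and the
    homogeneous weight the exponent \<open>2 * gam\<close>.\<close>
  define c where "c = s powr (-1/2)"
  have c: "0 < c" using assms by (simp add: c_def)
  have "c\<^sup>2 = c powr 2" using c by simp
  also have "\<dots> = inverse s" unfolding c_def powr_powr using assms by (simp add: powr_minus)
  finally have c2: "s * c\<^sup>2 = 1" using assms by simp
  have "ZZ s = (\<integral>y. dunkl_weight Rp k y *\<^sub>R gauss s y \<partial>lborel)"
    unfolding ZZ_def by (rule nu_integral) measurable
  also have "\<dots> = (\<integral>y. dunkl_weight Rp k y *\<^sub>R gauss s y \<partial>density (distr lborel borel (\<lambda>x. 0 + c *\<^sub>R x)) (\<lambda>_. ennreal (\<bar>c\<bar> ^ CARD('n))))"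
    using lborel_affine[of c "0 :: real^'n"] c by simp
  also have "\<dots> = (\<integral>y. (\<bar>c\<bar> ^ CARD('n)) *\<^sub>R (dunkl_weight Rp k y *\<^sub>R gauss s y) \<partial>distr lborel borel (\<lambda>x. 0 + c *\<^sub>R x))"
    by (rule integral_density) auto
  also have "\<dots> = (\<integral>y. (\<bar>c\<bar> ^ CARD('n)) *\<^sub>R (dunkl_weight Rp k (c *\<^sub>R y) *\<^sub>R gauss s (c *\<^sub>R y)) \<partial>lborel)"
    by (subst integral_distr) auto
  also have "\<dots> = (\<integral>y. (c ^ CARD('n) * c powr (2 * gam)) * (dunkl_weight Rp k y *\<^sub>R gauss 1 y) \<partial>lborel)"
  proof (rule Bochner_Integration.integral_cong[OF refl])
    fix y :: "real^'n"
    have "s * (norm (c *\<^sub>R y))\<^sup>2 = (norm y)\<^sup>2"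
      using c c2 by (simp add: power_mult_distrib mult.assoc[symmetric])
    then show "(\<bar>c\<bar> ^ CARD('n)) *\<^sub>R (dunkl_weight Rp k (c *\<^sub>R y) *\<^sub>R gauss s (c *\<^sub>R y))
       = (c ^ CARD('n) * c powr (2 * gam)) * (dunkl_weight Rp k y *\<^sub>R gauss 1 y)"
      using c by (simp add: dunkl_weight_scale)
  qed
  also have "\<dots> = (c ^ CARD('n) * c powr (2 * gam)) * ZZ 1"
  proof -
    have "ZZ 1 = (\<integral>y. dunkl_weight Rp k y *\<^sub>R gauss 1 y \<partial>lborel)"
      unfolding ZZ_def by (rule nu_integral) measurable
    then show ?thesis by (simp only: integral_mult_right_zero)
  qed
  also have "c ^ CARD('n) * c powr (2 * gam) = c powr (real CARD('n) + 2 * gam)"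
    using c by (simp add: powr_add powr_realpow)
  also have "\<dots> = s powr (- (gam + real CARD('n) / 2))"
    unfolding c_def powr_powr by (simp add: algebra_simps)
  finally show ?thesis .
qed

lemma ZZ_pos: "0 < s \<Longrightarrow> 0 < ZZ s"
proof -
  assume s: "0 < s"
  have int: "integrable lborel (\<lambda>y. dunkl_weight Rp k y *\<^sub>R gauss s y)"
    using integrable_gauss[OF s] by (simp add: nu_integral)
  have Z: "ZZ s = (\<integral>y. dunkl_weight Rp k y *\<^sub>R gauss s y \<partial>lborel)"
    unfolding ZZ_def by (rule nu_integral) measurable
  have w0: "0 \<le> dunkl_weight Rp k y" for y by (simp add: dunkl_weight_def prod_nonneg)
  have "ZZ s \<noteq> 0"
  proof
    assume "ZZ s = 0"
    then have "AE y in lborel. dunkl_weight Rp k y *\<^sub>R gauss s y = 0"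
      using integral_nonneg_eq_0_iff_AE[OF int] w0 Z by simp
    then have "AE y in lborel. dunkl_weight Rp k y = 0" by simp
    with AE_off_hyperplanes have "AE y in (lborel :: (real^'n) measure). False"
      by eventually_elim (auto simp: dunkl_weight_def)
    then show False using emeasure_lborel_UNIV[where 'a = "real^'n"] by (simp add: AE_iff_null null_sets_def)
  qed
  moreover have "0 \<le> ZZ s" unfolding Z using w0 by (intro Bochner_Integration.integral_nonneg) simp
  ultimately show ?thesis by simp
qed

text \<open>The closed form of the translated Gaussian, as \<open>dunkl_translation_gaussian\<close>
  will show; for \<open>k = 0\<close> it is
  \<open>exp (- s * (norm (x - y))\<^sup>2)\<close>.\<close>

definition heat :: "real \<Rightarrow> real^'n \<Rightarrow> real^'n \<Rightarrow> real" where
  "heat s x y = exp (- s * ((norm x)\<^sup>2 + (norm y)\<^sup>2)) * Re (EE (complex_vec y) (complex_vec ((2 * s) *\<^sub>R x)))"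

lemma heat_nonneg: "0 \<le> heat s x y"
  unfolding heat_def by (intro mult_nonneg_nonneg EE_nonneg) simp

text \<open>The factor \<open>EE (complex_vec y) 0\<close> equals 1 and is kept to match the
  integrand of \<open>gauss_int\<close>.\<close>

lemma heat_complex: "complex_of_real (heat s x y) = exp (- s * (norm x)\<^sup>2) *\<^sub>R (gauss s y *\<^sub>R (EE (complex_vec y) (complex_vec ((2 * s) *\<^sub>R x)) * EE (complex_vec y) 0))"
proof -
  have "complex_of_real (heat s x y) = of_real (exp (- s * ((norm x)\<^sup>2 + (norm y)\<^sup>2))) * EE (complex_vec y) (complex_vec ((2 * s) *\<^sub>R x))"
    unfolding heat_def of_real_mult by (subst (2) EE_real) (rule refl)
  then show ?thesis by (simp add: scaleR_conv_of_real distrib_left exp_add[symmetric] mult.assoc[symmetric] exp_of_real[symmetric])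
qed

lemma heat_le: assumes "0 < s" shows "heat s x y \<le> exp (- s * (norm x - norm y)\<^sup>2)"
proof -
  have "Re (EE (complex_vec y) (complex_vec ((2 * s) *\<^sub>R x))) \<le> norm (EE (complex_vec y) (complex_vec ((2 * s) *\<^sub>R x)))"
    by (rule complex_Re_le_cmod)
  also have "\<dots> \<le> exp (norm (complex_vec ((2 * s) *\<^sub>R x)) * norm y)" by (rule norm_EE_real_le)
  also have "norm (complex_vec ((2 * s) *\<^sub>R x)) * norm y = 2 * s * norm x * norm y"
    unfolding norm_complex_vec using assms by simp
  finally have "heat s x y \<le> exp (- s * ((norm x)\<^sup>2 + (norm y)\<^sup>2)) * exp (2 * s * norm x * norm y)"
    unfolding heat_def by (intro mult_left_mono) auto
  also have "\<dots> = exp (- s * (norm x - norm y)\<^sup>2)"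
    unfolding exp_add[symmetric] by (simp add: power2_eq_square algebra_simps)
  finally show ?thesis .
qed

lemma heat_le_1: "0 < s \<Longrightarrow> heat s x y \<le> 1"
  using heat_le[of s x y] by (rule order_trans) simp_all

text \<open>\<open>gauss_int_eq\<close> with second argument 0 yields
  \<open>exp (s * (norm x)\<^sup>2)\<close>, which the prefactor of \<open>heat\<close> cancels; so
  the mass does not depend on \<open>x\<close>.\<close>

lemma integral_heat:
  assumes s: "0 < s"
  shows "integrable nu (heat s x)" "(\<integral>y. heat s x y \<partial>nu) = ZZ s"
proof -
  have "integrable nu (\<lambda>y. complex_of_real (heat s x y))"
    unfolding heat_complex by (intro integrable_scaleR_right gauss_int_integrable s)
  then show i: "integrable nu (heat s x)" by (simp add: complex_of_real_integrable_eq)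
  have "complex_of_real (\<integral>y. heat s x y \<partial>nu) = (\<integral>y. complex_of_real (heat s x y) \<partial>nu)"
    by simp
  also have "\<dots> = exp (- s * (norm x)\<^sup>2) *\<^sub>R gauss_int s (of_real (2 * s) *s complex_vec x) (0 *s complex_vec 0)"
    unfolding heat_complex integral_scaleR_right gauss_int_def by (simp add: scaleR_eq_smult)
  also have "\<dots> = of_real (ZZ s)"
  proof -
    have "(of_real (2 * s))\<^sup>2 * of_real (x \<bullet> x) / of_real (4 * s) = (of_real (s * (norm x)\<^sup>2) :: complex)"
      using s by (simp add: power2_norm_eq_inner[symmetric] power2_eq_square[of "of_real s"] power2_eq_square[of s])
    then show ?thesis
      unfolding gauss_int_eq[OF s] by (simp add: scaleR_conv_of_real exp_of_real[symmetric] exp_minus)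
  qed
  finally show "(\<integral>y. heat s x y \<partial>nu) = ZZ s" by (simp only: of_real_eq_iff)
qed

end

lemma power2_norm_le_exp:
  fixes y :: "'a::real_normed_vector"
  shows "(norm y)\<^sup>2 \<le> exp (2 * norm y)"
proof -
  have "norm y \<le> exp (norm y)" using exp_ge_add_one_self[of "norm y"] by linarith
  then have "(norm y)\<^sup>2 \<le> (exp (norm y))\<^sup>2" by (intro power_mono) auto
  then show ?thesis by (simp add: exp_of_nat_mult[of 2, symmetric, simplified])
qed

section \<open>Moments of the heat kernel\<close>

context dunkl
begin

abbreviation "lam \<equiv> 2 * gam + real CARD('n)"

lemma heat_eq_gauss: "complex_of_real (heat s x y) = exp (- s * (norm x)\<^sup>2) *\<^sub>R (gauss s y *\<^sub>R EE (complex_vec y) (complex_vec ((2 * s) *\<^sub>R x)))"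
  unfolding heat_complex by simp

lemma measurable_heat [measurable]: "heat s x \<in> borel_measurable borel"
  unfolding heat_def[abs_def] by measurable

text \<open>\<open>gauss_int_by_parts\<close> in direction \<open>x\<close> with second kernel
  argument 0.\<close>

lemma heat_first_moment:
  assumes s: "0 < s"
  shows "integrable nu (\<lambda>y. (y \<bullet> x) * heat s x y)" "(\<integral>y. (y \<bullet> x) * heat s x y \<partial>nu) = (norm x)\<^sup>2 * ZZ s"
proof -
  let ?z = "complex_vec ((2 * s) *\<^sub>R x)"
  have eq: "complex_of_real ((y \<bullet> x) * heat s x y)
     = exp (- s * (norm x)\<^sup>2) *\<^sub>R (gauss s y *\<^sub>R (of_real (y \<bullet> x) * (EE (complex_vec y) ?z * EE (complex_vec y) 0)))" for y
    unfolding of_real_mult heat_complex by (simp add: mult_ac)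
  have "integrable nu (\<lambda>y. complex_of_real ((y \<bullet> x) * heat s x y))"
    unfolding eq by (intro integrable_scaleR_right gauss_int_inner_integrable s)
  then show "integrable nu (\<lambda>y. (y \<bullet> x) * heat s x y)" by (simp only: complex_of_real_integrable_eq)
  have ZZ: "exp (- s * (norm x)\<^sup>2) *\<^sub>R gauss_int s ?z 0 = of_real (ZZ s)"
  proof -
    have "of_real (ZZ s) = (\<integral>y. complex_of_real (heat s x y) \<partial>nu)"
      using integral_heat(2)[OF s, of x] by simp
    then show ?thesis unfolding heat_complex integral_scaleR_right gauss_int_def by simp
  qed
  have "complex_of_real (\<integral>y. (y \<bullet> x) * heat s x y \<partial>nu) = (\<integral>y. complex_of_real ((y \<bullet> x) * heat s x y) \<partial>nu)"
    by (rule integral_complex_of_real[symmetric])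
  also have "\<dots> = exp (- s * (norm x)\<^sup>2) *\<^sub>R (\<integral>y. gauss s y *\<^sub>R (of_real (y \<bullet> x) * (EE (complex_vec y) ?z * EE (complex_vec y) 0)) \<partial>nu)"
    unfolding eq integral_scaleR_right ..
  also have "(\<integral>y. gauss s y *\<^sub>R (of_real (y \<bullet> x) * (EE (complex_vec y) ?z * EE (complex_vec y) 0)) \<partial>nu)
      = of_real ((norm x)\<^sup>2) * gauss_int s ?z 0"
  proof -
    have "cinner (complex_vec x) ?z = of_real (2 * s) * of_real ((norm x)\<^sup>2)"
      by (simp only: cinner_complex_vec inner_scaleR_right power2_norm_eq_inner of_real_mult)
    then have "of_real (2 * s) * (\<integral>y. gauss s y *\<^sub>R (of_real (y \<bullet> x) * (EE (complex_vec y) ?z * EE (complex_vec y) 0)) \<partial>nu)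
      = of_real (2 * s) * (of_real ((norm x)\<^sup>2) * gauss_int s ?z 0)"
      unfolding gauss_int_by_parts[OF s] cinner_simps(8) by simp
    then show ?thesis using s by (subst (asm) mult_cancel_left) simp
  qed
  also have "exp (- s * (norm x)\<^sup>2) *\<^sub>R (of_real ((norm x)\<^sup>2) * gauss_int s ?z 0) = of_real ((norm x)\<^sup>2) * of_real (ZZ s)"
    unfolding ZZ[symmetric] by (rule mult_scaleR_right[symmetric])
  finally show "(\<integral>y. (y \<bullet> x) * heat s x y \<partial>nu) = (norm x)\<^sup>2 * ZZ s"
    by (simp only: of_real_mult[symmetric] of_real_eq_iff)
qed

lemma gauss_int_real:
  assumes "0 < s"
  shows "gauss_int s (complex_vec u) 0 = of_real (ZZ s * exp ((norm u)\<^sup>2 / (4 * s)))"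
  using gauss_int_eq[OF assms, of 1 u 0 0]
  by (simp add: power2_norm_eq_inner flip: exp_of_real)

text \<open>A derivative in the Gaussian parameter brings down \<open>- (norm y)\<^sup>2\<close>. So
  the closed form of the integral is differentiated in \<open>\<sigma>\<close> at \<open>s\<close>,
  with the kernel argument \<open>u = 2 s x\<close> held fixed.\<close>

lemma heat_second_moment:
  assumes s: "0 < s"
  shows "integrable nu (\<lambda>y. (norm y)\<^sup>2 * heat s x y)"
    "(\<integral>y. (norm y)\<^sup>2 * heat s x y \<partial>nu) = (lam / (2 * s) + (norm x)\<^sup>2) * ZZ s"
proof -
  define u where "u = (2 * s) *\<^sub>R x"
  define E where "E y = EE (complex_vec y) (complex_vec u)" for y
  define f where "f \<sigma> y = gauss \<sigma> y *\<^sub>R E y" for \<sigma> y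
  define f' where "f' \<sigma> y = (- (norm y)\<^sup>2 * gauss \<sigma> y) *\<^sub>R E y" for \<sigma> y
  have [measurable]: "E \<in> borel_measurable borel" unfolding E_def[abs_def] by measurable
  have E: "norm (E y) \<le> exp (norm u * norm y)" for y
    unfolding E_def using norm_EE_real_le[of y "complex_vec u"] by simp
  have fint: "integrable nu (f \<sigma>)" if "0 < \<sigma>" for \<sigma>
    unfolding f_def by (rule integrable_gauss_scaleR[OF that, where B = 1 and d = "norm u"]) (use E in auto)
  have fI: "integral\<^sup>L nu (f \<sigma>) = of_real (ZZ \<sigma> * exp ((norm u)\<^sup>2 / (4 * \<sigma>)))" if "0 < \<sigma>" for \<sigma>
    using gauss_int_real[OF that, of u] by (simp add: gauss_int_def f_def[abs_def] E_def)
  have der: "((\<lambda>\<sigma>. f \<sigma> y) has_vector_derivative f' \<sigma> y) (at \<sigma>)" for \<sigma> y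
  proof -
    have "((\<lambda>\<sigma>. gauss \<sigma> y) has_real_derivative - (norm y)\<^sup>2 * gauss \<sigma> y) (at \<sigma>)"
      by (auto intro!: derivative_eq_intros)
    from has_vector_derivative_scaleR[OF this has_vector_derivative_const[of "E y"]]
    show ?thesis by (simp add: f_def f'_def)
  qed
  \<comment> \<open>The radius \<open>s / 2\<close> keeps the parameter away from 0 and leaves
    \<open>gauss (s / 2)\<close> as a common majorant.\<close>
  have bound: "norm (f' \<sigma> y) \<le> gauss (s / 2) y * (1 * exp ((norm u + 2) * norm y))" if "\<bar>\<sigma> - s\<bar> < s / 2" for \<sigma> y
  proof -
    have "s / 2 \<le> \<sigma>" using that unfolding abs_less_iff by linarith
    then have g: "gauss \<sigma> y \<le> gauss (s / 2) y" by (simp add: mult_right_mono del: times_divide_eq_left)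
    have "norm (f' \<sigma> y) = (norm y)\<^sup>2 * gauss \<sigma> y * norm (E y)" by (simp add: f'_def abs_mult)
    also have "\<dots> \<le> exp (2 * norm y) * gauss (s / 2) y * exp (norm u * norm y)"
      by (intro mult_mono power2_norm_le_exp g E) auto
    also have "\<dots> = gauss (s / 2) y * (1 * exp ((norm u + 2) * norm y))"
      by (simp add: distrib_right exp_add)
    finally show ?thesis .
  qed
  have Dint: "integrable nu (\<lambda>y. gauss (s / 2) y * (1 * exp ((norm u + 2) * norm y)))"
  proof (rule integrable_nu_gauss_real)
    show "0 < s / 2" using s by simp
    show "\<bar>gauss (s / 2) y * (1 * exp ((norm u + 2) * norm y))\<bar> \<le> 1 * exp ((norm u + 2) * norm y - s / 2 * (norm y)\<^sup>2)" for y
      using gauss_mult_exp[of "s / 2" y 1 "norm u + 2"] by simp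
  qed measurable
  have meas': "f' s \<in> borel_measurable nu" unfolding f'_def[abs_def] by measurable
  have f'int: "integrable nu (f' s)"
    by (rule Bochner_Integration.integrable_bound[OF Dint meas']) (use bound[of s] s in \<open>auto intro!: AE_I2\<close>)
  have D1: "((\<lambda>\<sigma>. integral\<^sup>L nu (f \<sigma>)) has_vector_derivative integral\<^sup>L nu (f' s)) (at s)"
  proof (rule has_vector_derivative_integral[where r = "s / 2", OF _ fint der bound Dint meas'])
    show "0 < \<sigma>" if "\<bar>\<sigma> - s\<bar> < s / 2" for \<sigma> using that unfolding abs_less_iff by linarith
  qed (use s in auto)
  define a where "a = gam + real CARD('n) / 2"
  define d where "d = - ((a / s + (norm u)\<^sup>2 / (4 * s\<^sup>2)) * (ZZ s * exp ((norm u)\<^sup>2 / (4 * s))))"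
  have "((\<lambda>\<sigma>. \<sigma> powr (- a) * ZZ 1 * exp ((norm u)\<^sup>2 / (4 * \<sigma>))) has_real_derivative d) (at s)"
  proof -
    define c where "c = (norm u)\<^sup>2 / 4"
    have p: "((\<lambda>\<sigma>. \<sigma> powr (- a)) has_real_derivative - (a / s) * s powr (- a)) (at s)"
      using has_real_derivative_powr[OF s, of "- a"] s by (simp add: powr_diff)
    have "((\<lambda>\<sigma>. c / \<sigma>) has_real_derivative - (c / s\<^sup>2)) (at s)"
      using s by (auto intro!: derivative_eq_intros simp: power2_eq_square)
    then have e: "((\<lambda>\<sigma>. exp (c / \<sigma>)) has_real_derivative exp (c / s) * - (c / s\<^sup>2)) (at s)"
      by (rule DERIV_fun_exp)
    have c: "(norm u)\<^sup>2 / (4 * \<sigma>) = c / \<sigma>" "(norm u)\<^sup>2 / (4 * s\<^sup>2) = c / s\<^sup>2" for \<sigma>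
      by (simp_all add: c_def)
    have "((\<lambda>\<sigma>. \<sigma> powr (- a) * ZZ 1 * exp (c / \<sigma>)) has_real_derivative
        (- (a / s) * s powr (- a) * ZZ 1) * exp (c / s) + (exp (c / s) * - (c / s\<^sup>2)) * (s powr (- a) * ZZ 1)) (at s)"
      by (intro DERIV_mult DERIV_cmult_right p e)
    also have "(- (a / s) * s powr (- a) * ZZ 1) * exp (c / s) + (exp (c / s) * - (c / s\<^sup>2)) * (s powr (- a) * ZZ 1) = d"
      unfolding d_def c ZZ_scale[OF s, folded a_def] by (simp add: algebra_simps)
    finally show ?thesis unfolding c .
  qed
  then have "((\<lambda>\<sigma>. complex_of_real (\<sigma> powr (- a) * ZZ 1 * exp ((norm u)\<^sup>2 / (4 * \<sigma>)))) has_vector_derivative of_real d) (at s)"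
    by (intro has_vector_derivative_of_real) (simp add: has_real_derivative_iff_has_vector_derivative)
  then have "((\<lambda>\<sigma>. integral\<^sup>L nu (f \<sigma>)) has_vector_derivative of_real d) (at s)"
  proof (rule has_vector_derivative_transform_within_open[of _ _ _ "{0<..}"])
    fix \<sigma> :: real assume "\<sigma> \<in> {0<..}"
    then have \<sigma>: "0 < \<sigma>" by simp
    show "of_real (\<sigma> powr (- a) * ZZ 1 * exp ((norm u)\<^sup>2 / (4 * \<sigma>))) = integral\<^sup>L nu (f \<sigma>)"
      unfolding fI[OF \<sigma>] ZZ_scale[OF \<sigma>, folded a_def] ..
  qed (use s in auto)
  then have I': "integral\<^sup>L nu (f' s) = of_real d"
    using D1 vector_derivative_unique_at by blast
  have eq: "complex_of_real ((norm y)\<^sup>2 * heat s x y) = - (exp (- s * (norm x)\<^sup>2) *\<^sub>R f' s y)" for y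
    unfolding of_real_mult heat_eq_gauss f'_def E_def u_def by (simp add: scaleR_conv_of_real mult_ac)
  have "integrable nu (\<lambda>y. complex_of_real ((norm y)\<^sup>2 * heat s x y))"
    unfolding eq by (intro Bochner_Integration.integrable_minus integrable_scaleR_right f'int)
  then show "integrable nu (\<lambda>y. (norm y)\<^sup>2 * heat s x y)" by (simp only: complex_of_real_integrable_eq)
  have "complex_of_real (\<integral>y. (norm y)\<^sup>2 * heat s x y \<partial>nu) = (\<integral>y. complex_of_real ((norm y)\<^sup>2 * heat s x y) \<partial>nu)"
    by (rule integral_complex_of_real[symmetric])
  also have "\<dots> = - (exp (- s * (norm x)\<^sup>2) *\<^sub>R of_real d)"
    unfolding eq Bochner_Integration.integral_minus integral_scaleR_right I' ..
  also have "\<dots> = of_real (- (exp (- s * (norm x)\<^sup>2) * d))" by (simp add: scaleR_conv_of_real)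
  finally have "(\<integral>y. (norm y)\<^sup>2 * heat s x y \<partial>nu) = - (exp (- s * (norm x)\<^sup>2) * d)"
    by (simp only: of_real_eq_iff)
  also have "\<dots> = (lam / (2 * s) + (norm x)\<^sup>2) * ZZ s"
  proof -
    have u: "(norm u)\<^sup>2 / (4 * s\<^sup>2) = (norm x)\<^sup>2" "(norm u)\<^sup>2 / (4 * s) = s * (norm x)\<^sup>2"
      using s by (auto simp: u_def power_mult_distrib power2_eq_square)
    have "a / s = lam / (2 * s)" using s by (simp add: a_def field_simps)
    then show ?thesis unfolding d_def u by (simp add: exp_minus)
  qed
  finally show "(\<integral>y. (norm y)\<^sup>2 * heat s x y \<partial>nu) = (lam / (2 * s) + (norm x)\<^sup>2) * ZZ s" .
qed

text \<open>When the square is expanded, the terms in \<open>norm x\<close> cancel and only the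
  contribution \<open>lam / (2 * s)\<close> of the second moment survives.\<close>

lemma heat_variance:
  assumes s: "0 < s"
  shows "integrable nu (\<lambda>y. (norm (y - x))\<^sup>2 * heat s x y)"
    "(\<integral>y. (norm (y - x))\<^sup>2 * heat s x y \<partial>nu) = lam / (2 * s) * ZZ s"
proof -
  have eq: "(norm (y - x))\<^sup>2 * heat s x y = (norm y)\<^sup>2 * heat s x y - 2 * ((y \<bullet> x) * heat s x y) + (norm x)\<^sup>2 * heat s x y" for y
    by (simp add: power2_norm_eq_inner inner_diff inner_commute algebra_simps)
  note m = heat_second_moment[OF s, of x] heat_first_moment[OF s, of x] integral_heat[OF s, of x]
  show "integrable nu (\<lambda>y. (norm (y - x))\<^sup>2 * heat s x y)"
    unfolding eq using m by (intro Bochner_Integration.integrable_add Bochner_Integration.integrable_diff integrable_mult_right) auto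
  have "(\<integral>y. (norm (y - x))\<^sup>2 * heat s x y \<partial>nu)
     = (\<integral>y. (norm y)\<^sup>2 * heat s x y \<partial>nu) - 2 * (\<integral>y. (y \<bullet> x) * heat s x y \<partial>nu) + (norm x)\<^sup>2 * (\<integral>y. heat s x y \<partial>nu)"
    unfolding eq using m by simp
  then show "(\<integral>y. (norm (y - x))\<^sup>2 * heat s x y \<partial>nu) = lam / (2 * s) * ZZ s"
    unfolding m by (simp add: algebra_simps)
qed

section \<open>The Dunkl transform: smoothing by the heat kernel and injectivity\<close>

lemma sigma_finite_nu: "sigma_finite_measure nu"
  unfolding dunkl_measure_def by (subst sigma_finite_measure.sigma_finite_iff_density_finite[OF sigma_finite_lborel]) auto

lemma measurable_EE_pair [measurable]:
  "(\<lambda>p. EE (complex_vec (fst p)) (a *s complex_vec (snd p))) \<in> borel_measurable (borel \<Otimes>\<^sub>M borel)"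
  unfolding borel_prod
  by (intro borel_measurable_continuous_onI continuous_EE continuous_intros
      continuous_on_compose2[OF continuous_smult_const[of UNIV]]) auto

lemma dunkl_const_eq: "dunkl_const Rp k = inverse (ZZ (1 / 2))"
  by (simp add: dunkl_const_def ZZ_def)

lemma dunkl_const_pos: "0 < dunkl_const Rp k"
  unfolding dunkl_const_eq using ZZ_pos[of "1 / 2"] by simp

lemma dunkl_transform_eq:
  "dunkl_transform Rp k h \<xi> = of_real (dunkl_const Rp k) * (\<integral>y. h y * EE (complex_vec \<xi>) ((- \<i>) *s complex_vec y) \<partial>nu)"
  unfolding dunkl_transform_def dunkl_kernel_eq EE_smult ..

text \<open>For imaginary arguments the exponential in \<open>gauss_int_eq\<close> decays, while
  \<open>\<i>\<close> and \<open>- \<i>\<close> cancel inside the kernel. The parameter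
  \<open>1 / (4 * s)\<close> is chosen so that the decay rate is \<open>s\<close>.\<close>

lemma gauss_int_heat:
  assumes s: "0 < s"
  shows "gauss_int (1 / (4 * s)) (\<i> *s complex_vec x) ((- \<i>) *s complex_vec y) = of_real (ZZ (1 / (4 * s)) * heat s x y)"
proof -
  have "EE (\<i> *s complex_vec x) (of_real (2 * s) *s ((- \<i>) *s complex_vec y)) = EE (complex_vec x) (\<i> *s (of_real (2 * s) *s ((- \<i>) *s complex_vec y)))"
    by (rule EE_smult)
  also have "\<i> *s (of_real (2 * s) *s ((- \<i>) *s complex_vec y)) = complex_vec ((2 * s) *\<^sub>R y)"
  proof -
    have "\<i> * (of_real (2 * s) * - \<i>) = of_real (2 * s)" by (simp add: algebra_simps)
    then show ?thesis unfolding vector_smult_assoc complex_vec_simps(3) scaleR_eq_smult by (simp only:)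
  qed
  also have "EE (complex_vec x) (complex_vec ((2 * s) *\<^sub>R y)) = EE (complex_vec ((2 * s) *\<^sub>R x)) (complex_vec y)"
    using EE_smult[of "of_real (2 * s)" "complex_vec x" "complex_vec y"] by (simp add: scaleR_eq_smult)
  also have "\<dots> = EE (complex_vec y) (complex_vec ((2 * s) *\<^sub>R x))" by (rule EE_commute)
  finally have E: "EE (\<i> *s complex_vec x) (of_real (2 * s) *s ((- \<i>) *s complex_vec y)) = EE (complex_vec y) (complex_vec ((2 * s) *\<^sub>R x))" .
  have expo: "exp ((\<i>\<^sup>2 * of_real (x \<bullet> x) + (- \<i>)\<^sup>2 * of_real (y \<bullet> y)) / of_real (4 * (1 / (4 * s)))) = complex_of_real (exp (- s * ((norm x)\<^sup>2 + (norm y)\<^sup>2)))"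
  proof -
    have "(\<i>\<^sup>2 * of_real (x \<bullet> x) + (- \<i>)\<^sup>2 * of_real (y \<bullet> y)) / of_real (4 * (1 / (4 * s))) = complex_of_real (- s * ((norm x)\<^sup>2 + (norm y)\<^sup>2))"
      using s by (simp add: power2_norm_eq_inner field_simps)
    then show ?thesis by (simp only: exp_of_real)
  qed
  have half: "1 / (2 * (1 / (4 * s))) = 2 * s" using s by simp
  have pos: "0 < 1 / (4 * s)" using s by simp
  have "complex_of_real (ZZ (1 / (4 * s)) * heat s x y) = of_real (ZZ (1 / (4 * s))) * of_real (exp (- s * ((norm x)\<^sup>2 + (norm y)\<^sup>2)))
      * EE (complex_vec y) (complex_vec ((2 * s) *\<^sub>R x))"
    unfolding heat_def of_real_mult by (subst (2) EE_real) (simp only: mult.assoc)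
  then show ?thesis
    unfolding gauss_int_eq[OF pos] half E expo by (rule sym)
qed

text \<open>An inversion formula with Gaussian damping: \<open>gauss_int_heat\<close> writes the
  heat kernel as a superposition of imaginary kernels, and Fubini turns the
  \<open>y\<close>-integral into the Dunkl transform. The uniform bound
  \<open>norm_EE_imag_le\<close> makes the double integral absolutely convergent.\<close>

lemma heat_fubini:
  assumes s: "0 < s" and h: "integrable nu h"
  shows "(\<integral>y. h y * of_real (heat s x y) \<partial>nu) = inverse (of_real (ZZ (1 / (4 * s)) * dunkl_const Rp k)) *
    (\<integral>\<xi>. gauss (1 / (4 * s)) \<xi> *\<^sub>R (EE (complex_vec \<xi>) (\<i> *s complex_vec x) * dunkl_transform Rp k h \<xi>) \<partial>nu)"
proof -
  define \<sigma> where "\<sigma> = 1 / (4 * s)"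
  have \<sigma>: "0 < \<sigma>" using s by (simp add: \<sigma>_def)
  interpret nu: sigma_finite_measure nu by (rule sigma_finite_nu)
  interpret nn: pair_sigma_finite nu nu ..
  have [measurable]: "h \<in> borel_measurable borel" using h by auto
  define A where "A \<xi> = gauss \<sigma> \<xi> *\<^sub>R EE (complex_vec \<xi>) (\<i> *s complex_vec x)" for \<xi>
  have [measurable]: "A \<in> borel_measurable borel" unfolding A_def[abs_def] by measurable
  let ?B = "\<lambda>\<xi> y. EE (complex_vec \<xi>) ((- \<i>) *s complex_vec y)"
  have Bnd: "norm (?B \<xi> y) \<le> sqrt (card G)" for \<xi> y
    using norm_EE_imag_le[of "- \<xi>" y] EE_smult[of "- \<i>" "complex_vec \<xi>" "complex_vec y"]
    by (simp add: vector_smult_lneg vector_smult_rneg)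
  have Abnd: "norm (A \<xi>) \<le> sqrt (card G) * gauss \<sigma> \<xi>" for \<xi>
    using norm_EE_imag_le[of x \<xi>] unfolding A_def
    by (simp add: EE_commute[of "complex_vec \<xi>"] mult.commute[of "sqrt _"] mult_left_mono)
  have Aint: "integrable nu A"
    by (rule Bochner_Integration.integrable_bound[OF integrable_mult_right[OF integrable_gauss[OF \<sigma>], of "sqrt (card G)"]])
      (use Abnd in \<open>auto intro!: AE_I2\<close>)
  have Bint: "integrable nu (\<lambda>y. h y * ?B \<xi> y)" for \<xi>
  proof (rule Bochner_Integration.integrable_bound[OF integrable_mult_right[OF h, of "of_real (sqrt (card G))"]])
    have "(\<lambda>y. ?B \<xi> y) \<in> borel_measurable borel"
      by (intro borel_measurable_continuous_onI continuous_EE continuous_intros continuous_smult_const)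
    then show "(\<lambda>y. h y * ?B \<xi> y) \<in> borel_measurable nu" by measurable
    show "AE y in nu. norm (h y * ?B \<xi> y) \<le> norm (of_real (sqrt (card G)) * h y)"
      using Bnd[of \<xi>] by (intro AE_I2) (simp add: norm_mult mult.commute[of "norm (h _)"] mult_right_mono)
  qed
  have int: "integrable (nu \<Otimes>\<^sub>M nu) (\<lambda>(\<xi>, y). A \<xi> * (h y * ?B \<xi> y))"
  proof (rule nn.Fubini_integrable)
    show meas: "(\<lambda>(\<xi>, y). A \<xi> * (h y * ?B \<xi> y)) \<in> borel_measurable (nu \<Otimes>\<^sub>M nu)"
      unfolding case_prod_unfold by measurable
    show "AE \<xi> in nu. integrable nu (\<lambda>y. case (\<xi>, y) of (\<xi>, y) \<Rightarrow> A \<xi> * (h y * ?B \<xi> y))"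
      using Bint by (intro AE_I2) simp
    show "integrable nu (\<lambda>\<xi>. \<integral>y. norm (case (\<xi>, y) of (\<xi>, y) \<Rightarrow> A \<xi> * (h y * ?B \<xi> y)) \<partial>nu)"
    proof (rule Bochner_Integration.integrable_bound[OF integrable_mult_left[OF Aint, of "of_real (sqrt (card G) * (\<integral>y. norm (h y) \<partial>nu))"]])
      show "(\<lambda>\<xi>. \<integral>y. norm (case (\<xi>, y) of (\<xi>, y) \<Rightarrow> A \<xi> * (h y * ?B \<xi> y)) \<partial>nu) \<in> borel_measurable nu"
        by (rule nu.borel_measurable_lebesgue_integral)
          (use measurable_compose[OF meas borel_measurable_norm] in \<open>simp add: case_prod_unfold\<close>)
      show "AE \<xi> in nu. norm (\<integral>y. norm (case (\<xi>, y) of (\<xi>, y) \<Rightarrow> A \<xi> * (h y * ?B \<xi> y)) \<partial>nu)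
         \<le> norm (A \<xi> * of_real (sqrt (card G) * (\<integral>y. norm (h y) \<partial>nu)))"
      proof (rule AE_I2)
        fix \<xi>
        have "(\<integral>y. norm (A \<xi> * (h y * ?B \<xi> y)) \<partial>nu) \<le> (\<integral>y. norm (A \<xi>) * (norm (h y) * sqrt (card G)) \<partial>nu)"
        proof (rule integral_mono)
          show "integrable nu (\<lambda>y. norm (A \<xi> * (h y * ?B \<xi> y)))" using Bint by (intro integrable_norm integrable_mult_right)
          show "integrable nu (\<lambda>y. norm (A \<xi>) * (norm (h y) * sqrt (card G)))" using h by simp
          show "norm (A \<xi> * (h y * ?B \<xi> y)) \<le> norm (A \<xi>) * (norm (h y) * sqrt (card G))" for y
            unfolding norm_mult by (intro mult_left_mono Bnd) auto
        qed
        then show "norm (\<integral>y. norm (case (\<xi>, y) of (\<xi>, y) \<Rightarrow> A \<xi> * (h y * ?B \<xi> y)) \<partial>nu)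
         \<le> norm (A \<xi> * of_real (sqrt (card G) * (\<integral>y. norm (h y) \<partial>nu)))"
          by (simp add: norm_mult abs_mult mult_ac)
      qed
    qed
  qed
  have "(\<integral>y. (\<integral>\<xi>. A \<xi> * (h y * ?B \<xi> y) \<partial>nu) \<partial>nu) = (\<integral>\<xi>. (\<integral>y. A \<xi> * (h y * ?B \<xi> y) \<partial>nu) \<partial>nu)"
    by (rule nn.Fubini_integral) (use int in simp)
  moreover have "(\<integral>\<xi>. A \<xi> * (h y * ?B \<xi> y) \<partial>nu) = of_real (ZZ \<sigma>) * (h y * of_real (heat s x y))" for y
  proof -
    have "(\<integral>\<xi>. A \<xi> * (h y * ?B \<xi> y) \<partial>nu) = h y * gauss_int \<sigma> (\<i> *s complex_vec x) ((- \<i>) *s complex_vec y)"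
      unfolding gauss_int_def A_def integral_mult_right_zero[symmetric]
      by (rule Bochner_Integration.integral_cong) (auto simp: mult_ac)
    then show ?thesis unfolding \<sigma>_def gauss_int_heat[OF s] by (simp add: mult_ac)
  qed
  moreover have "(\<integral>y. A \<xi> * (h y * ?B \<xi> y) \<partial>nu) = inverse (of_real (dunkl_const Rp k)) *
     (gauss \<sigma> \<xi> *\<^sub>R (EE (complex_vec \<xi>) (\<i> *s complex_vec x) * dunkl_transform Rp k h \<xi>))" for \<xi>
    unfolding dunkl_transform_eq integral_mult_right_zero A_def using dunkl_const_pos by simp
  ultimately have "of_real (ZZ \<sigma>) * (\<integral>y. h y * of_real (heat s x y) \<partial>nu) = inverse (of_real (dunkl_const Rp k)) *
    (\<integral>\<xi>. gauss \<sigma> \<xi> *\<^sub>R (EE (complex_vec \<xi>) (\<i> *s complex_vec x) * dunkl_transform Rp k h \<xi>) \<partial>nu)"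
    by (simp only: integral_mult_right_zero)
  moreover have "X = inverse (of_real (ZZ \<sigma> * dunkl_const Rp k)) * Y"
    if "of_real (ZZ \<sigma>) * X = inverse (of_real (dunkl_const Rp k)) * Y" for X Y :: complex
  proof -
    have "X = inverse (of_real (ZZ \<sigma>)) * (of_real (ZZ \<sigma>) * X)" using ZZ_pos[OF \<sigma>] by simp
    then show ?thesis unfolding that by (simp add: inverse_mult_distrib mult.assoc)
  qed
  ultimately show ?thesis unfolding \<sigma>_def[symmetric] by blast
qed

text \<open>As \<open>s \<rightarrow> \<infinity>\<close> the probability density \<open>heat s x / ZZ s\<close> concentrates at \<open>x\<close>, since its
  variance is \<open>lam / (2 * s)\<close>.\<close>

lemma dunkl_transform_injective:
  assumes cont: "continuous_on UNIV h" and bnd: "\<And>y. norm (h y) \<le> M" and int: "integrable nu h"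
    and zero: "\<And>\<xi>. dunkl_transform Rp k h \<xi> = 0"
  shows "h x = 0"
proof -
  have M: "0 \<le> M" using bnd[of 0] norm_ge_zero[of "h 0"] by linarith
  have lam: "0 < lam" using gam_nonneg by (simp add: add_nonneg_pos)
  have [measurable]: "h \<in> borel_measurable borel" using cont by (rule borel_measurable_continuous_onI)
  have small: "norm (h x) \<le> e" if e: "0 < e" for e
  proof -
    obtain \<delta> where \<delta>: "0 < \<delta>" "\<And>y. dist y x < \<delta> \<Longrightarrow> dist (h y) (h x) < e / 2"
      using cont e by (meson UNIV_I continuous_on_iff half_gt_zero)
    \<comment> \<open>Large enough that the contribution
      \<open>M * lam / (\<delta>\<^sup>2 * s)\<close> of the points away from \<open>x\<close> is at
      most \<open>e / 2\<close>; the summand 1 keeps \<open>s\<close> positive when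
      \<open>M = 0\<close>.\<close>
    define s where "s = 2 * M * lam / (\<delta>\<^sup>2 * e) + 1"
    have s: "0 < s" using M lam \<delta> e by (auto simp: s_def intro!: add_nonneg_pos)
    have hint: "integrable nu (\<lambda>y. h y * of_real (heat s x y))"
    proof (rule Bochner_Integration.integrable_bound[OF int])
      show "AE y in nu. norm (h y * of_real (heat s x y)) \<le> norm (h y)"
        using heat_le_1[OF s] heat_nonneg by (intro AE_I2) (simp add: norm_mult mult_left_le)
    qed measurable
    have H: "integrable nu (\<lambda>y. of_real (heat s x y) :: complex)"
      using integral_heat(1)[OF s] by (simp add: complex_of_real_integrable_eq)
    have "h x * of_real (ZZ s) = (\<integral>y. (h x - h y) * of_real (heat s x y) \<partial>nu)"
    proof -
      have "(\<integral>y. h y * of_real (heat s x y) \<partial>nu) = 0"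
        unfolding heat_fubini[OF s int] zero by simp
      moreover have "(\<integral>y. h x * complex_of_real (heat s x y) \<partial>nu) = h x * of_real (ZZ s)"
        using integral_heat(2)[OF s, of x] by simp
      ultimately show ?thesis
        unfolding left_diff_distrib Bochner_Integration.integral_diff[OF integrable_mult_right[OF H] hint] by (simp only: diff_zero)
    qed
    then have "norm (h x) * ZZ s = norm (\<integral>y. (h x - h y) * of_real (heat s x y) \<partial>nu)"
      using ZZ_pos[OF s] by (metis norm_mult norm_of_real abs_of_pos)
    also have "\<dots> \<le> (\<integral>y. e / 2 * heat s x y + 2 * M / \<delta>\<^sup>2 * ((norm (y - x))\<^sup>2 * heat s x y) \<partial>nu)"
    proof (rule Bochner_Integration.integral_norm_bound_integral)
      show "integrable nu (\<lambda>y. (h x - h y) * of_real (heat s x y))"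
        unfolding left_diff_distrib by (intro Bochner_Integration.integrable_diff integrable_mult_right H hint)
      show "integrable nu (\<lambda>y. e / 2 * heat s x y + 2 * M / \<delta>\<^sup>2 * ((norm (y - x))\<^sup>2 * heat s x y))"
        by (intro Bochner_Integration.integrable_add integrable_mult_right integral_heat heat_variance s)
      fix y
      \<comment> \<open>As in Chebyshev's inequality: away from \<open>x\<close> the crude bound
        \<open>2 * M\<close> is multiplied by
        \<open>(norm (y - x))\<^sup>2 / \<delta>\<^sup>2\<close>, which is at least 1 there.\<close>
      have "norm (h x - h y) \<le> e / 2 + 2 * M / \<delta>\<^sup>2 * (norm (y - x))\<^sup>2"
      proof (cases "dist y x < \<delta>")
        case True
        then have "norm (h x - h y) \<le> e / 2" using \<delta>(2)[of y] by (simp add: dist_norm norm_minus_commute)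
        also have "\<dots> \<le> e / 2 + 2 * M / \<delta>\<^sup>2 * (norm (y - x))\<^sup>2" using M by simp
        finally show ?thesis .
      next
        case False
        then have "\<delta>\<^sup>2 \<le> (norm (y - x))\<^sup>2" using \<delta>(1) by (intro power_mono) (auto simp: dist_norm)
        then have "1 \<le> (norm (y - x))\<^sup>2 / \<delta>\<^sup>2" using \<delta>(1) by simp
        then have "2 * M * 1 \<le> 2 * M * ((norm (y - x))\<^sup>2 / \<delta>\<^sup>2)" using M by (intro mult_left_mono) auto
        moreover have "norm (h x - h y) \<le> 2 * M"
          using norm_triangle_ineq4[of "h x" "h y"] bnd[of x] bnd[of y] by linarith
        ultimately show ?thesis using e by simp
      qed
      then have "norm (h x - h y) * heat s x y \<le> (e / 2 + 2 * M / \<delta>\<^sup>2 * (norm (y - x))\<^sup>2) * heat s x y"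
        by (intro mult_right_mono heat_nonneg)
      then show "norm ((h x - h y) * of_real (heat s x y)) \<le> e / 2 * heat s x y + 2 * M / \<delta>\<^sup>2 * ((norm (y - x))\<^sup>2 * heat s x y)"
        unfolding norm_mult norm_of_real abs_of_nonneg[OF heat_nonneg] by (simp add: distrib_right mult.assoc)
    qed
    also have "\<dots> = e / 2 * ZZ s + 2 * M / \<delta>\<^sup>2 * (lam / (2 * s) * ZZ s)"
      using integral_heat[OF s, of x] heat_variance[OF s, of x]
      by (subst Bochner_Integration.integral_add) (auto simp only: integral_mult_right_zero integrable_mult_right)
    also have "\<dots> = (e / 2 + M * lam / (\<delta>\<^sup>2 * s)) * ZZ s"
    proof -
      have "2 * M / D * (L / (2 * s) * Z) = M * L / (D * s) * Z" for L D Z :: real by simp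
      then show ?thesis unfolding distrib_right by (rule arg_cong)
    qed
    finally have "norm (h x) \<le> e / 2 + M * lam / (\<delta>\<^sup>2 * s)"
      using ZZ_pos[OF s] by simp
    also have "M * lam / (\<delta>\<^sup>2 * s) \<le> e / 2"
    proof -
      have "2 * M * lam / (\<delta>\<^sup>2 * e) \<le> s" by (simp add: s_def)
      then have "2 * M * lam \<le> s * (\<delta>\<^sup>2 * e)" using \<delta> e by (simp add: pos_divide_le_eq)
      then show ?thesis using \<delta> s by (simp add: divide_le_eq mult_ac)
    qed
    finally show ?thesis by simp
  qed
  have "norm (h x) \<le> 0"
  proof (rule field_le_epsilon)
    show "norm (h x) \<le> 0 + e" if "0 < e" for e using small[OF that] by simp
  qed
  then show ?thesis by simp
qed

text \<open>Partial derivatives of a Gaussian times a member of this class are again of this form; this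
  makes the heat kernel a Schwartz function.\<close>

inductive_set exp_class :: "complex^'n \<Rightarrow> (real^'n \<Rightarrow> complex) set" for w where
  DLE: "DLE w as \<in> exp_class w"
| add: "V \<in> exp_class w \<Longrightarrow> V' \<in> exp_class w \<Longrightarrow> (\<lambda>y. V y + V' y) \<in> exp_class w"
| scale: "V \<in> exp_class w \<Longrightarrow> (\<lambda>y. c * V y) \<in> exp_class w"
| coord: "V \<in> exp_class w \<Longrightarrow> (\<lambda>y. of_real (y $ j) * V y) \<in> exp_class w"

lemma exp_class_derivative:
  assumes "V \<in> exp_class w"
  shows "\<exists>V'. (\<forall>y. (V has_derivative V' y) (at y)) \<and> (\<forall>v. (\<lambda>y. V' y v) \<in> exp_class w)"
  using assms
proof induction
  case (DLE as)
  show ?case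
    by (rule exI[of _ "\<lambda>y h. DLE w (h # as) y"])
      (auto intro: DLE_has_derivative exp_class.DLE[of w "_ # as", unfolded])
next
  case (add V1 V2)
  then obtain V1' V2' where 1: "\<And>y. (V1 has_derivative V1' y) (at y)" "\<And>v. (\<lambda>y. V1' y v) \<in> exp_class w"
    and 2: "\<And>y. (V2 has_derivative V2' y) (at y)" "\<And>v. (\<lambda>y. V2' y v) \<in> exp_class w" by blast
  show ?case
    by (rule exI[of _ "\<lambda>y h. V1' y h + V2' y h"])
      (auto intro!: has_derivative_add 1 2 exp_class.add)
next
  case (scale V c)
  then obtain V' where 1: "\<And>y. (V has_derivative V' y) (at y)" "\<And>v. (\<lambda>y. V' y v) \<in> exp_class w" by blast
  show ?case
    by (rule exI[of _ "\<lambda>y h. c * V' y h"])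
      (auto intro!: has_derivative_mult_right 1 exp_class.scale)
next
  case (coord V j)
  then obtain V' where 1: "\<And>y. (V has_derivative V' y) (at y)" "\<And>v. (\<lambda>y. V' y v) \<in> exp_class w" by blast
  have c: "((\<lambda>y. complex_of_real (y $ j)) has_derivative (\<lambda>h. of_real (h $ j))) (at y)" for y :: "real^'n"
    by (intro bounded_linear_imp_has_derivative bounded_linear_of_real[THEN bounded_linear_compose] bounded_linear_vec_nth)
  show ?case
    by (rule exI[of _ "\<lambda>y h. of_real (y $ j) * V' y h + of_real (h $ j) * V y"])
      (auto intro!: has_derivative_mult c 1 exp_class.add exp_class.coord exp_class.scale coord)
qed

lemma exp_class_bound:
  assumes "V \<in> exp_class w"
  shows "\<exists>C c. 0 \<le> C \<and> 0 \<le> c \<and> (\<forall>y. norm (V y) \<le> C * exp (c * norm y))"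
  using assms
proof induction
  case (DLE as)
  have A0: "0 \<le> prod_list (map norm as)" by (induction as) auto
  show ?case
  proof (intro exI conjI allI)
    show "norm (DLE w as y) \<le> (prod_list (map norm as) * exp (norm w * length as)) * exp (norm w * norm y)" for y
      using DLE_bound[of w as y] by (simp add: distrib_left exp_add mult_ac)
  qed (use A0 in auto)
next
  case (add V1 V2)
  then obtain C1 c1 C2 c2 where 1: "0 \<le> C1" "0 \<le> c1" "\<And>y. norm (V1 y) \<le> C1 * exp (c1 * norm y)"
    and 2: "0 \<le> C2" "0 \<le> c2" "\<And>y. norm (V2 y) \<le> C2 * exp (c2 * norm y)" by blast
  show ?case
  proof (intro exI conjI allI)
    fix y
    have "norm (V1 y + V2 y) \<le> C1 * exp (c1 * norm y) + C2 * exp (c2 * norm y)"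
      by (intro norm_triangle_mono 1 2)
    also have "\<dots> \<le> C1 * exp ((c1 + c2) * norm y) + C2 * exp ((c1 + c2) * norm y)"
      using 1 2 by (intro add_mono mult_left_mono) (auto simp: distrib_right)
    finally show "norm (V1 y + V2 y) \<le> (C1 + C2) * exp ((c1 + c2) * norm y)" by (simp add: distrib_right)
  qed (use 1 2 in auto)
next
  case (scale V c)
  then obtain C1 c1 where 1: "0 \<le> C1" "0 \<le> c1" "\<And>y. norm (V y) \<le> C1 * exp (c1 * norm y)" by blast
  show ?case
  proof (intro exI conjI allI)
    show "norm (c * V y) \<le> (norm c * C1) * exp (c1 * norm y)" for y
      unfolding norm_mult mult.assoc using 1(3) by (intro mult_left_mono) auto
  qed (use 1 in auto)
next
  case (coord V j)
  then obtain C1 c1 where 1: "0 \<le> C1" "0 \<le> c1" "\<And>y. norm (V y) \<le> C1 * exp (c1 * norm y)" by blast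
  show ?case
  proof (intro exI conjI allI)
    fix y
    have "norm (complex_of_real (y $ j) * V y) \<le> exp (norm y) * (C1 * exp (c1 * norm y))"
      unfolding norm_mult norm_of_real using component_le_norm_cart[of y j] norm_le_exp[of y]
      by (intro mult_mono 1) auto
    also have "\<dots> = C1 * exp ((c1 + 1) * norm y)" by (simp add: distrib_right exp_add)
    finally show "norm (complex_of_real (y $ j) * V y) \<le> C1 * exp ((c1 + 1) * norm y)" .
  qed (use 1 in auto)
qed

lemma gauss_exp_class_derivative:
  assumes "V \<in> exp_class w"
  obtains W' where "\<And>y. ((\<lambda>y. gauss s y *\<^sub>R V y) has_derivative W' y) (at y)"
    "\<And>j. \<exists>W\<in>exp_class w. \<forall>y. W' y (axis j 1) = gauss s y *\<^sub>R W y"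
proof -
  obtain V' where V': "\<And>y. (V has_derivative V' y) (at y)" "\<And>v. (\<lambda>y. V' y v) \<in> exp_class w"
    using exp_class_derivative[OF assms] by blast
  define W' where "W' y h = gauss s y *\<^sub>R V' y h + (gauss s y * (- 2 * s * (y \<bullet> h))) *\<^sub>R V y" for y h
  have g: "(gauss s has_derivative (\<lambda>h. gauss s y * (- 2 * s * (y \<bullet> h)))) (at y)" for y
    unfolding power2_norm_eq_inner
    by (auto intro!: derivative_eq_intros simp: fun_eq_iff inner_commute algebra_simps)
  show thesis
  proof (rule that)
    show "((\<lambda>y. gauss s y *\<^sub>R V y) has_derivative W' y) (at y)" for y
      unfolding W'_def by (rule has_derivative_scaleR[OF g V'(1)])
    fix j
    have "(\<lambda>y. V' y (axis j 1) + of_real (- 2 * s) * (of_real (y $ j) * V y)) \<in> exp_class w"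
      by (intro exp_class.add exp_class.scale exp_class.coord V' assms)
    moreover have "W' y (axis j 1) = gauss s y *\<^sub>R (V' y (axis j 1) + of_real (- 2 * s) * (of_real (y $ j) * V y))" for y
      by (simp add: W'_def inner_axis scaleR_conv_of_real algebra_simps)
    ultimately show "\<exists>W\<in>exp_class w. \<forall>y. W' y (axis j 1) = gauss s y *\<^sub>R W y" by (intro bexI allI)
  qed
qed

lemma gauss_exp_class_iter:
  "V \<in> exp_class w \<Longrightarrow> \<exists>W\<in>exp_class w. iter_partial js (\<lambda>y. gauss s y *\<^sub>R V y) = (\<lambda>y. gauss s y *\<^sub>R W y)"
proof (induction js)
  case (Cons j js)
  then obtain W where W: "W \<in> exp_class w" "iter_partial js (\<lambda>y. gauss s y *\<^sub>R V y) = (\<lambda>y. gauss s y *\<^sub>R W y)" by blast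
  obtain W' where W': "\<And>y. ((\<lambda>y. gauss s y *\<^sub>R W y) has_derivative W' y) (at y)"
    "\<And>j. \<exists>X\<in>exp_class w. \<forall>y. W' y (axis j 1) = gauss s y *\<^sub>R X y"
    using gauss_exp_class_derivative[OF W(1)] by blast
  obtain X where X: "X \<in> exp_class w" "\<And>y. W' y (axis j 1) = gauss s y *\<^sub>R X y"
    using W'(2)[of j] by blast
  have "iter_partial (j # js) (\<lambda>y. gauss s y *\<^sub>R V y) = (\<lambda>y. gauss s y *\<^sub>R X y)"
    unfolding iter_partial.simps W(2) X(2)[symmetric] by (rule ext) (rule dir_deriv_eq[OF W'(1)])
  with X(1) show ?case by (intro bexI[where x = X])
qed auto

lemma gauss_exp_class_schwartz:
  assumes s: "0 < s" and V: "V \<in> exp_class w"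
  shows "(\<lambda>y. gauss s y *\<^sub>R V y) \<in> schwartz"
  unfolding schwartz_def
proof (intro CollectI allI conjI)
  fix js :: "'n list"
  obtain W where W: "W \<in> exp_class w" "iter_partial js (\<lambda>y. gauss s y *\<^sub>R V y) = (\<lambda>y. gauss s y *\<^sub>R W y)"
    using gauss_exp_class_iter[OF V] by blast
  show "iter_partial js (\<lambda>y. gauss s y *\<^sub>R V y) differentiable (at x)" for x
    unfolding W(2) differentiable_def
    by (rule gauss_exp_class_derivative[OF W(1), of s]) blast
  fix N :: nat
  obtain C c where C: "0 \<le> C" "\<And>y. norm (W y) \<le> C * exp (c * norm y)"
    using exp_class_bound[OF W(1)] by blast
  have "norm ((1 + norm y) ^ N *\<^sub>R (gauss s y *\<^sub>R W y)) \<le> C * exp ((real N + c)\<^sup>2 / (4 * s))" for y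
  proof -
    have "norm ((1 + norm y) ^ N *\<^sub>R (gauss s y *\<^sub>R W y)) = (1 + norm y) ^ N * (gauss s y * norm (W y))"
      by simp
    also have "\<dots> \<le> (1 + norm y) ^ N * (gauss s y * (C * exp (c * norm y)))"
      by (intro mult_left_mono C) auto
    also have "\<dots> = C * (exp (c * norm y - s * (norm y)\<^sup>2) * (1 + norm y) ^ N)"
      unfolding gauss_mult_exp by (simp add: mult_ac)
    also have "\<dots> \<le> C * exp ((real N + c)\<^sup>2 / (4 * s))"
      by (intro mult_left_mono gauss_decay s C) auto
    finally show ?thesis .
  qed
  then show "bounded (range (\<lambda>x. (1 + norm x) ^ N *\<^sub>R iter_partial js (\<lambda>y. gauss s y *\<^sub>R V y) x))"
    unfolding W(2) bounded_iff by blast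
qed

section \<open>Identification of the translated Gaussian\<close>

lemma heat_schwartz:
  assumes "0 < s" shows "(\<lambda>y. complex_of_real (heat s x y)) \<in> schwartz"
proof -
  let ?w = "complex_vec ((2 * s) *\<^sub>R x)"
  have "(\<lambda>y. of_real (exp (- s * (norm x)\<^sup>2)) * DLE ?w [] y) \<in> exp_class ?w"
    by (intro exp_class.scale exp_class.DLE)
  from gauss_exp_class_schwartz[OF assms this]
  show ?thesis unfolding heat_eq_gauss DLE_Nil by (simp add: scaleR_conv_of_real mult_ac)
qed

lemma schwartz_props:
  assumes "h \<in> schwartz"
  shows "continuous_on UNIV h" "\<exists>M. \<forall>y. norm (h y) \<le> M" "integrable nu h"
proof -
  have d: "h differentiable (at y)" for y using assms by (force simp: schwartz_def dest: spec[of _ "[]"])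
  show cont: "continuous_on UNIV h"
    by (intro continuous_at_imp_continuous_on ballI differentiable_imp_continuous_within d)
  have B: "\<exists>M. \<forall>y. norm ((1 + norm y) ^ N *\<^sub>R h y) \<le> M" for N
  proof -
    have "\<forall>js. \<forall>N::nat. bounded (range (\<lambda>x. (1 + norm x) ^ N *\<^sub>R iter_partial js h x))"
      using assms by (simp add: schwartz_def)
    from spec[OF spec[OF this, of "[]"], of N] show ?thesis by (auto simp: bounded_iff)
  qed
  from B[of 0] show "\<exists>M. \<forall>y. norm (h y) \<le> M" by simp
  obtain W M where W: "0 \<le> W" "\<And>\<epsilon> x. 0 \<le> \<epsilon> \<Longrightarrow> \<epsilon> \<le> 1 \<Longrightarrow> weps \<epsilon> x \<le> W * (1 + norm x) ^ M"
    using weps_bound by blast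
  \<comment> \<open>The exponent beats the growth \<open>M\<close> of the weight and still leaves
    the decay of \<open>integrable_lborel_decay\<close>.\<close>
  obtain K where K: "\<And>y. norm ((1 + norm y) ^ (M + (CARD('n) + 2)) *\<^sub>R h y) \<le> K" using B by blast
  have [measurable]: "h \<in> borel_measurable borel" using cont by (rule borel_measurable_continuous_onI)
  have "integrable lborel (\<lambda>y. dunkl_weight Rp k y *\<^sub>R h y)"
  proof (rule Bochner_Integration.integrable_bound[OF integrable_mult_right[OF integrable_lborel_decay, of "W * K"]])
    show "AE y in lborel. norm (dunkl_weight Rp k y *\<^sub>R h y) \<le> norm (W * K * inverse ((1 + norm y) ^ (CARD('n) + 2)))"
    proof (rule AE_I2)
      fix y :: "real^'n"
      have pos: "0 < (1 + norm y) ^ (CARD('n) + 2)" by (simp add: add_pos_nonneg)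
      have "(1 + norm y) ^ M * norm (h y) * (1 + norm y) ^ (CARD('n) + 2) \<le> K"
        using K[of y] by (simp add: power_add abs_mult mult_ac)
      then have "(1 + norm y) ^ M * norm (h y) \<le> K * inverse ((1 + norm y) ^ (CARD('n) + 2))"
        using pos by (simp add: field_simps)
      then have "W * ((1 + norm y) ^ M * norm (h y)) \<le> W * (K * inverse ((1 + norm y) ^ (CARD('n) + 2)))"
        using W(1) by (rule mult_left_mono)
      moreover have "norm (dunkl_weight Rp k y *\<^sub>R h y) \<le> (W * (1 + norm y) ^ M) * norm (h y)"
        unfolding norm_scaleR using W(2)[of 0 y] weps_nonneg[of 0 y] by (intro mult_right_mono) (auto simp: weps_0)
      ultimately show "norm (dunkl_weight Rp k y *\<^sub>R h y) \<le> norm (W * K * inverse ((1 + norm y) ^ (CARD('n) + 2)))"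
        by (simp add: mult.assoc)
    qed
  qed measurable
  then show "integrable nu h" by (simp add: nu_integral)
qed

lemma schwartz_eqI:
  assumes "h1 \<in> schwartz" "h2 \<in> schwartz" and eq: "\<And>\<xi>. dunkl_transform Rp k h1 \<xi> = dunkl_transform Rp k h2 \<xi>"
  shows "h1 = h2"
proof
  fix x
  obtain M1 M2 where M: "\<And>y. norm (h1 y) \<le> M1" "\<And>y. norm (h2 y) \<le> M2"
    using schwartz_props(2) assms by meson
  have i: "integrable nu (\<lambda>y. h y * EE (complex_vec \<xi>) ((- \<i>) *s complex_vec y))" if h: "h \<in> schwartz" for h \<xi>
  proof (rule Bochner_Integration.integrable_bound[OF integrable_mult_right[OF schwartz_props(3)[OF h], of "of_real (sqrt (card G))"]])
    have [measurable]: "h \<in> borel_measurable borel" using schwartz_props(1)[OF h] by (rule borel_measurable_continuous_onI)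
    have "(\<lambda>y. EE (complex_vec \<xi>) ((- \<i>) *s complex_vec y)) \<in> borel_measurable borel"
      by (intro borel_measurable_continuous_onI continuous_EE continuous_intros continuous_smult_const)
    then show "(\<lambda>y. h y * EE (complex_vec \<xi>) ((- \<i>) *s complex_vec y)) \<in> borel_measurable nu" by measurable
    have "norm (EE (complex_vec \<xi>) ((- \<i>) *s complex_vec y)) \<le> sqrt (card G)" for y
      using norm_EE_imag_le[of "- \<xi>" y] EE_smult[of "- \<i>" "complex_vec \<xi>" "complex_vec y"]
      by (simp add: vector_smult_lneg vector_smult_rneg)
    then show "AE y in nu. norm (h y * EE (complex_vec \<xi>) ((- \<i>) *s complex_vec y)) \<le> norm (of_real (sqrt (card G)) * h y)"
      by (intro AE_I2) (simp add: norm_mult mult.commute[of "norm (h _)"] mult_right_mono)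
  qed
  have "(\<lambda>y. h1 y - h2 y) x = 0"
  proof (rule dunkl_transform_injective)
    show "continuous_on UNIV (\<lambda>y. h1 y - h2 y)" by (intro continuous_intros schwartz_props assms)
    show "norm (h1 y - h2 y) \<le> M1 + M2" for y
      using norm_triangle_ineq4[of "h1 y" "h2 y"] M[of y] by linarith
    show "integrable nu (\<lambda>y. h1 y - h2 y)" by (intro Bochner_Integration.integrable_diff schwartz_props assms)
    show "dunkl_transform Rp k (\<lambda>y. h1 y - h2 y) \<xi> = 0" for \<xi>
      using eq[of \<xi>] i[OF assms(1)] i[OF assms(2)] dunkl_const_pos
      unfolding dunkl_transform_eq left_diff_distrib by simp
  qed
  then show "h1 x = h2 x" by simp
qed

lemma dunkl_transform_gauss_int:
  "dunkl_transform Rp k (\<lambda>y. gauss s y *\<^sub>R EE (complex_vec y) z) \<xi> = of_real (dunkl_const Rp k) * gauss_int s z ((- \<i>) *s complex_vec \<xi>)"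
proof -
  have "EE (complex_vec \<xi>) ((- \<i>) *s complex_vec y) = EE (complex_vec y) ((- \<i>) *s complex_vec \<xi>)" for y
    by (metis EE_commute EE_smult)
  then show ?thesis unfolding dunkl_transform_eq gauss_int_def by simp
qed

text \<open>\<open>gauss_int_eq\<close> computes the transform of the heat kernel: the real argument
  \<open>2 s x\<close> produces \<open>exp (s * (norm x)\<^sup>2)\<close>, which the prefactor of
  \<open>heat\<close> cancels, and what is left is the kernel at \<open>- \<i> x\<close> times the
  transform of the Gaussian. \<open>schwartz_eqI\<close> gives the uniqueness that the definite
  description requires.\<close>

lemma dunkl_translation_gaussian:
  assumes s: "0 < s"
  shows "dunkl_translation Rp k x (gaussian s) = (\<lambda>y. complex_of_real (heat s x y))"
  unfolding dunkl_translation_def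
proof (rule the_equality)
  have tr: "dunkl_transform Rp k (\<lambda>y. complex_of_real (heat s x y)) \<xi>
     = dunkl_kernel Rp k ((- \<i>) *s complex_vec x) (complex_vec \<xi>) * dunkl_transform Rp k (gaussian s) \<xi>" for \<xi>
  proof -
    have "dunkl_transform Rp k (gaussian s) \<xi> = of_real (dunkl_const Rp k) * gauss_int s 0 ((- \<i>) *s complex_vec \<xi>)"
      using dunkl_transform_gauss_int[of s 0 \<xi>] by (simp add: gaussian_def[abs_def] scaleR_conv_of_real)
    also have "gauss_int s 0 ((- \<i>) *s complex_vec \<xi>) = of_real (ZZ s) * exp (- of_real (\<xi> \<bullet> \<xi>) / of_real (4 * s))"
      using gauss_int_eq[OF s, of 0 0 "- \<i>" \<xi>] by simp
    finally have g: "dunkl_transform Rp k (gaussian s) \<xi> = of_real (dunkl_const Rp k) * (of_real (ZZ s) * exp (- of_real (\<xi> \<bullet> \<xi>) / of_real (4 * s)))" .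
    let ?z = "complex_vec ((2 * s) *\<^sub>R x)"
    have "dunkl_transform Rp k (\<lambda>y. complex_of_real (heat s x y)) \<xi>
      = of_real (exp (- s * (norm x)\<^sup>2)) * dunkl_transform Rp k (\<lambda>y. gauss s y *\<^sub>R EE (complex_vec y) ?z) \<xi>"
      unfolding heat_eq_gauss dunkl_transform_eq by (simp add: scaleR_conv_of_real mult.assoc)
    also have "\<dots> = of_real (exp (- s * (norm x)\<^sup>2)) * (of_real (dunkl_const Rp k) * gauss_int s (of_real (2 * s) *s complex_vec x) ((- \<i>) *s complex_vec \<xi>))"
      unfolding dunkl_transform_gauss_int by (simp add: scaleR_eq_smult)
    also have "gauss_int s (of_real (2 * s) *s complex_vec x) ((- \<i>) *s complex_vec \<xi>)
       = of_real (ZZ s) * exp (of_real (s * (norm x)\<^sup>2) - of_real (\<xi> \<bullet> \<xi>) / of_real (4 * s))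
          * EE ((- \<i>) *s complex_vec x) (complex_vec \<xi>)"
    proof -
      have 1: "((of_real (2 * s))\<^sup>2 * of_real (x \<bullet> x) + (- \<i>)\<^sup>2 * of_real (\<xi> \<bullet> \<xi>)) / of_real (4 * s)
         = (of_real (s * (norm x)\<^sup>2) - of_real (\<xi> \<bullet> \<xi>) / of_real (4 * s) :: complex)"
        using s by (simp add: dot_square_norm[of x] power2_eq_square field_simps)
      have 2: "EE (of_real (2 * s) *s complex_vec x) (of_real (1 / (2 * s)) *s ((- \<i>) *s complex_vec \<xi>)) = EE ((- \<i>) *s complex_vec x) (complex_vec \<xi>)"
      proof -
        have "of_real (2 * s) *s (of_real (1 / (2 * s)) *s ((- \<i>) *s complex_vec \<xi>)) = (- \<i>) *s complex_vec \<xi>"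
          using s by (simp add: vec_eq_iff)
        then show ?thesis by (metis EE_smult)
      qed
      show ?thesis unfolding gauss_int_eq[OF s] 1 2 ..
    qed
    finally have "dunkl_transform Rp k (\<lambda>y. complex_of_real (heat s x y)) \<xi> = EE ((- \<i>) *s complex_vec x) (complex_vec \<xi>)
        * (of_real (dunkl_const Rp k) * (of_real (ZZ s) * (of_real (exp (- s * (norm x)\<^sup>2))
        * exp (of_real (s * (norm x)\<^sup>2) - of_real (\<xi> \<bullet> \<xi>) / of_real (4 * s)))))"
      by (simp only: mult_ac)
    also have "of_real (exp (- s * (norm x)\<^sup>2)) * exp (of_real (s * (norm x)\<^sup>2) - of_real (\<xi> \<bullet> \<xi>) / of_real (4 * s))
        = exp (- of_real (\<xi> \<bullet> \<xi>) / of_real (4 * s) :: complex)"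
      unfolding exp_of_real[symmetric] exp_add[symmetric] by simp
    finally show ?thesis unfolding g dunkl_kernel_eq .
  qed
  show "(\<lambda>y. complex_of_real (heat s x y)) \<in> schwartz \<and> (\<forall>\<xi>. dunkl_transform Rp k (\<lambda>y. complex_of_real (heat s x y)) \<xi>
     = dunkl_kernel Rp k ((- \<i>) *s complex_vec x) (complex_vec \<xi>) * dunkl_transform Rp k (gaussian s) \<xi>)"
    using heat_schwartz[OF s] tr by blast
  fix h
  assume "h \<in> schwartz \<and> (\<forall>\<xi>. dunkl_transform Rp k h \<xi>
     = dunkl_kernel Rp k ((- \<i>) *s complex_vec x) (complex_vec \<xi>) * dunkl_transform Rp k (gaussian s) \<xi>)"
  then show "h = (\<lambda>y. complex_of_real (heat s x y))"
    using heat_schwartz[OF s] tr by (intro schwartz_eqI) auto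
qed

lemma continuous_heat: "continuous_on UNIV (\<lambda>p. heat (fst p) x (snd p))"
  unfolding heat_def by (intro continuous_intros continuous_EE)

lemma measurable_heat_pair [measurable]: "(\<lambda>p. heat (fst p) x (snd p)) \<in> borel_measurable (borel \<Otimes>\<^sub>M borel)"
  unfolding borel_prod by (intro borel_measurable_continuous_onI continuous_heat)

text \<open>On the transform side of \<open>heat_fubini\<close> the Gaussian is at most 1 and the
  kernel is bounded. Only the prefactor still depends on \<open>s\<close>, and by
  \<open>ZZ_scale\<close> it is of order \<open>s powr (- lam / 2)\<close>.\<close>

lemma heat_integral_bound:
  assumes s: "0 < s" and f: "integrable nu f" and Ff: "integrable nu (dunkl_transform Rp k f)"
  shows "norm (\<integral>y. f y * of_real (heat s x y) \<partial>nu) \<le>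
    sqrt (card G) * (\<integral>\<xi>. norm (dunkl_transform Rp k f \<xi>) \<partial>nu) * 4 powr (- lam / 2) / (ZZ 1 * dunkl_const Rp k) * s powr (- lam / 2)"
proof -
  define \<sigma> where "\<sigma> = 1 / (4 * s)"
  have \<sigma>: "0 < \<sigma>" using s by (simp add: \<sigma>_def)
  define I where "I = (\<integral>\<xi>. gauss \<sigma> \<xi> *\<^sub>R (EE (complex_vec \<xi>) (\<i> *s complex_vec x) * dunkl_transform Rp k f \<xi>) \<partial>nu)"
  define B where "B = sqrt (card G) * (\<integral>\<xi>. norm (dunkl_transform Rp k f \<xi>) \<partial>nu)"
  have "norm I \<le> (\<integral>\<xi>. norm (gauss \<sigma> \<xi> *\<^sub>R (EE (complex_vec \<xi>) (\<i> *s complex_vec x) * dunkl_transform Rp k f \<xi>)) \<partial>nu)"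
    unfolding I_def by (rule integral_norm_bound)
  also have "\<dots> \<le> (\<integral>\<xi>. sqrt (card G) * norm (dunkl_transform Rp k f \<xi>) \<partial>nu)"
  proof (rule integral_mono_AE')
    show "integrable nu (\<lambda>\<xi>. sqrt (card G) * norm (dunkl_transform Rp k f \<xi>))" using Ff by simp
    show "AE \<xi> in nu. norm (gauss \<sigma> \<xi> *\<^sub>R (EE (complex_vec \<xi>) (\<i> *s complex_vec x) * dunkl_transform Rp k f \<xi>))
      \<le> sqrt (card G) * norm (dunkl_transform Rp k f \<xi>)"
    proof (rule AE_I2)
      fix \<xi>
      have "gauss \<sigma> \<xi> \<le> 1" using \<sigma> by simp
      moreover have "norm (EE (complex_vec \<xi>) (\<i> *s complex_vec x)) \<le> sqrt (card G)"
        using norm_EE_imag_le[of x \<xi>] by (simp add: EE_commute[of "complex_vec \<xi>"])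
      ultimately have "gauss \<sigma> \<xi> * (norm (EE (complex_vec \<xi>) (\<i> *s complex_vec x)) * norm (dunkl_transform Rp k f \<xi>))
          \<le> 1 * (sqrt (card G) * norm (dunkl_transform Rp k f \<xi>))"
        by (intro mult_mono) auto
      then show "norm (gauss \<sigma> \<xi> *\<^sub>R (EE (complex_vec \<xi>) (\<i> *s complex_vec x) * dunkl_transform Rp k f \<xi>))
          \<le> sqrt (card G) * norm (dunkl_transform Rp k f \<xi>)"
        by (simp add: norm_mult)
    qed
  qed auto
  also have "\<dots> = B" by (simp add: B_def)
  finally have I: "norm I \<le> B" .
  have \<sigma>': "\<sigma> = inverse (4 * s)" by (simp add: \<sigma>_def inverse_eq_divide)
  have "ZZ \<sigma> = (4 * s) powr (lam / 2) * ZZ 1"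
  proof -
    have "ZZ \<sigma> = \<sigma> powr (- (lam / 2)) * ZZ 1" by (subst ZZ_scale[OF \<sigma>]) (simp add: add_divide_distrib)
    moreover have "\<sigma> powr (- (lam / 2)) = (4 * s) powr (lam / 2)"
      unfolding \<sigma>' powr_minus inverse_powr using s by simp
    ultimately show ?thesis by simp
  qed
  moreover have "(4 * s) powr (lam / 2) = inverse (4 powr (- lam / 2) * s powr (- lam / 2))"
    unfolding minus_divide_left[symmetric] powr_minus powr_mult by simp
  ultimately have Z: "inverse (ZZ \<sigma> * dunkl_const Rp k) = 4 powr (- lam / 2) * s powr (- lam / 2) / (ZZ 1 * dunkl_const Rp k)"
  proof -
    have "inverse (inverse p * z * c) = p / (z * c)" for p z c :: real
      by (simp add: divide_inverse mult.assoc)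
    then show "ZZ \<sigma> = (4 * s) powr (lam / 2) * ZZ 1 \<Longrightarrow>
      (4 * s) powr (lam / 2) = inverse (4 powr (- lam / 2) * s powr (- lam / 2)) \<Longrightarrow>
      inverse (ZZ \<sigma> * dunkl_const Rp k) = 4 powr (- lam / 2) * s powr (- lam / 2) / (ZZ 1 * dunkl_const Rp k)"
      by (simp only:)
  qed
  have pos: "0 < ZZ \<sigma> * dunkl_const Rp k" using ZZ_pos[OF \<sigma>] dunkl_const_pos by simp
  have "norm (\<integral>y. f y * of_real (heat s x y) \<partial>nu) = inverse (ZZ \<sigma> * dunkl_const Rp k) * norm I"
    unfolding heat_fubini[OF s f] \<sigma>_def[symmetric] I_def[symmetric] norm_mult norm_inverse norm_of_real
    using pos by simp
  also have "\<dots> \<le> inverse (ZZ \<sigma> * dunkl_const Rp k) * B"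
    by (rule mult_left_mono[OF I]) (rule less_imp_le[OF positive_imp_inverse_positive[OF pos]])
  finally show ?thesis unfolding Z B_def by (simp add: mult_ac)
qed

end

section \<open>The Riesz potential\<close>

locale dunkl_riesz = dunkl R Rp k for R Rp :: "(real^'n) set" and k +
  fixes \<alpha> :: real and f :: "real^'n \<Rightarrow> real"
  assumes alpha_pos: "0 < \<alpha>" and alpha_less: "\<alpha> < 2 * dunkl_gamma Rp k + real CARD('n)"
    and f_A: "(\<lambda>x. complex_of_real (f x)) \<in> dunkl_A Rp k"
    and f_nonneg: "AE x in dunkl_measure Rp k. f x \<ge> 0"
begin

text \<open>\<open>- kap\<close> is the decay exponent of the theorem and \<open>kap / 2 - 1\<close>
  the power of \<open>s\<close> in both of its integrals.\<close>

definition "kap = lam - \<alpha>"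

lemma kap_pos: "0 < kap"
  using alpha_less by (simp add: kap_def)

lemma f_complex_integrable: "integrable nu (\<lambda>x. complex_of_real (f x))"
  and transform_integrable: "integrable nu (dunkl_transform Rp k (\<lambda>x. complex_of_real (f x)))"
  using f_A by (auto simp: dunkl_A_def)

lemma f_integrable: "integrable nu f"
  using f_complex_integrable by (simp add: complex_of_real_integrable_eq)

lemma f_measurable [measurable]: "f \<in> borel_measurable borel"
  using borel_measurable_integrable[OF f_integrable] by simp

definition "F1 = (\<integral>y. f y \<partial>nu)"

lemma F1: "(\<integral>\<^sup>+y. ennreal (f y) \<partial>nu) = ennreal F1" "0 \<le> F1"
  unfolding F1_def by (auto intro: nn_integral_eq_integral f_integrable f_nonneg integral_nonneg_AE)

definition smoothed :: "real \<Rightarrow> real^'n \<Rightarrow> real" where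
  "smoothed s x = (\<integral>y. f y * heat s x y \<partial>nu)"

lemma f_heat_integrable: "0 < s \<Longrightarrow> integrable nu (\<lambda>y. f y * heat s x y)"
  by (rule Bochner_Integration.integrable_bound[OF f_integrable])
    (use heat_le_1 heat_nonneg in \<open>auto intro!: AE_I2 simp: abs_mult mult_left_le\<close>)

lemma f_heat_nonneg: "AE y in nu. 0 \<le> f y * heat s x y"
  using f_nonneg by eventually_elim (simp add: heat_nonneg)

lemma smoothed_nn_integral:
  assumes "0 < s" shows "(\<integral>\<^sup>+y. ennreal (f y * heat s x y) \<partial>nu) = ennreal (smoothed s x)" "0 \<le> smoothed s x"
  unfolding smoothed_def
  by (rule nn_integral_eq_integral[OF f_heat_integrable[OF assms] f_heat_nonneg])
    (rule integral_nonneg_AE[OF f_heat_nonneg])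

lemma smoothed_le_F1: "0 < s \<Longrightarrow> smoothed s x \<le> F1"
  unfolding smoothed_def F1_def
proof (rule integral_mono_AE)
  assume s: "0 < s"
  show "integrable nu (\<lambda>y. f y * heat s x y)" by (rule f_heat_integrable[OF s])
  show "AE y in nu. f y * heat s x y \<le> f y"
    using f_nonneg by eventually_elim (use heat_le_1[OF s] in \<open>simp add: mult_left_le\<close>)
qed (rule f_integrable)

definition "F2 = sqrt (card G) * (\<integral>\<xi>. norm (dunkl_transform Rp k (\<lambda>x. complex_of_real (f x)) \<xi>) \<partial>nu)
    * 4 powr (- lam / 2) / (ZZ 1 * dunkl_const Rp k)"

lemma smoothed_le_F2: "0 < s \<Longrightarrow> smoothed s x \<le> F2 * s powr (- lam / 2)"
proof -
  assume s: "0 < s"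
  have "complex_of_real (smoothed s x) = (\<integral>y. complex_of_real (f y * heat s x y) \<partial>nu)"
    unfolding smoothed_def by (rule integral_complex_of_real[symmetric])
  then have "(\<integral>y. complex_of_real (f y) * of_real (heat s x y) \<partial>nu) = complex_of_real (smoothed s x)"
    by (simp only: of_real_mult)
  then have "smoothed s x \<le> norm (\<integral>y. complex_of_real (f y) * of_real (heat s x y) \<partial>nu)"
    by (simp only: norm_of_real abs_ge_self)
  also have "\<dots> \<le> F2 * s powr (- lam / 2)"
    unfolding F2_def by (rule heat_integral_bound[OF s f_complex_integrable transform_integrable])
  finally show ?thesis .
qed

lemma F2_nonneg: "0 \<le> F2"
  using smoothed_le_F2[of 1 0] smoothed_nn_integral(2)[of 1 0] by simp

definition BB :: real where "BB = Gamma (kap / 2)"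

lemma BB_nonneg: "0 \<le> BB"
  unfolding BB_def using Gamma_real_nonneg kap_pos by simp

lemma BB: "(\<integral>\<^sup>+s\<in>{0<..}. ennreal (s powr (kap / 2 - 1) * exp (- s)) \<partial>lborel) = ennreal BB"
proof -
  have "(\<integral>\<^sup>+s. ennreal (s powr (kap / 2 - 1) / exp s) * indicator {0..} s \<partial>lborel) = ennreal BB"
    unfolding BB_def
    by (rule nn_integral_has_integral_lebesgue'[OF _ Gamma_integral_real]) (use kap_pos in auto)
  also have "(\<integral>\<^sup>+s. ennreal (s powr (kap / 2 - 1) / exp s) * indicator {0..} s \<partial>lborel)
     = (\<integral>\<^sup>+s\<in>{0<..}. ennreal (s powr (kap / 2 - 1) * exp (- s)) \<partial>lborel)"
  proof (rule nn_integral_cong)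
    fix s :: real
    have "s powr (kap / 2 - 1) / exp s = s powr (kap / 2 - 1) * exp (- s)"
      by (simp only: exp_minus divide_inverse)
    \<comment> \<open>At \<open>s = 0\<close> the convention \<open>0 powr _ = 0\<close> makes both
      integrands vanish, so the closed and the open half line agree pointwise.\<close>
    then show "ennreal (s powr (kap / 2 - 1) / exp s) * indicator {0..} s
      = ennreal (s powr (kap / 2 - 1) * exp (- s)) * indicator {0<..} s"
      by (cases "s = 0") (auto simp: indicator_def)
  qed
  finally show ?thesis .
qed

text \<open>The Gamma integral after rescaling \<open>s\<close> by \<open>r\<^sup>2\<close>; this is
  the integral over \<open>s\<close> of the bound in \<open>heat_le\<close> when the norms of
  \<open>x\<close> and \<open>y\<close> differ by \<open>r\<close>.\<close>

lemma BB_scale: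
  assumes r: "0 < r"
  shows "(\<integral>\<^sup>+s\<in>{0<..}. ennreal (s powr (kap / 2 - 1) * exp (- s * r\<^sup>2)) \<partial>lborel) = ennreal (r powr (- kap) * BB)"
proof -
  define c where "c = r\<^sup>2"
  have c: "0 < c" using r by (simp add: c_def)
  let ?g = "\<lambda>s::real. ennreal (s powr (kap / 2 - 1) * exp (- s)) * indicator {0<..} s"
  have "ennreal BB = (\<integral>\<^sup>+s. ?g s \<partial>lborel)" by (rule BB[symmetric])
  also have "\<dots> = ennreal \<bar>c\<bar> * (\<integral>\<^sup>+s. ?g (0 + c * s) \<partial>lborel)"
    by (rule nn_integral_real_affine) (use c in auto)
  also have "(\<integral>\<^sup>+s. ?g (0 + c * s) \<partial>lborel)
    = (\<integral>\<^sup>+s. ennreal (c powr (kap / 2 - 1)) * (ennreal (s powr (kap / 2 - 1) * exp (- s * r\<^sup>2)) * indicator {0<..} s) \<partial>lborel)"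
  proof (rule nn_integral_cong)
    fix s :: real
    show "?g (0 + c * s) = ennreal (c powr (kap / 2 - 1)) * (ennreal (s powr (kap / 2 - 1) * exp (- s * r\<^sup>2)) * indicator {0<..} s)"
      using c by (cases "0 < s") (auto simp: zero_less_mult_iff powr_mult ennreal_mult[symmetric] c_def mult_ac)
  qed
  also have "\<dots> = ennreal (c powr (kap / 2 - 1)) * (\<integral>\<^sup>+s\<in>{0<..}. ennreal (s powr (kap / 2 - 1) * exp (- s * r\<^sup>2)) \<partial>lborel)"
    by (rule nn_integral_cmult) measurable
  finally have "ennreal BB = ennreal (\<bar>c\<bar> * c powr (kap / 2 - 1)) * (\<integral>\<^sup>+s\<in>{0<..}. ennreal (s powr (kap / 2 - 1) * exp (- s * r\<^sup>2)) \<partial>lborel)"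
    using c by (simp add: ennreal_mult mult.assoc)
  also have "\<bar>c\<bar> * c powr (kap / 2 - 1) = r powr kap"
  proof -
    have "\<bar>c\<bar> * c powr (kap / 2 - 1) = c powr (kap / 2)" using c by (simp add: powr_diff)
    also have "\<dots> = (r powr 2) powr (kap / 2)" using r by (simp add: c_def)
    finally show ?thesis by (simp add: powr_powr)
  qed
  finally have "ennreal (r powr (- kap)) * ennreal BB = (ennreal (r powr (- kap)) * ennreal (r powr kap)) * (\<integral>\<^sup>+s\<in>{0<..}. ennreal (s powr (kap / 2 - 1) * exp (- s * r\<^sup>2)) \<partial>lborel)"
    by (simp add: mult.assoc)
  also have "ennreal (r powr (- kap)) * ennreal (r powr kap) = 1"
    using r by (simp add: ennreal_mult[symmetric] powr_add[symmetric])
  finally show ?thesis by (simp add: ennreal_mult BB_nonneg)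
qed

text \<open>Integrating in \<open>s\<close> first reduces both quantities of the theorem to
  integrals of \<open>f\<close> against this one kernel, with and without the factor
  \<open>(1 + norm y) powr kap\<close>; they can then be compared pointwise in
  \<open>y\<close>.\<close>

definition riesz_kernel :: "real^'n \<Rightarrow> real^'n \<Rightarrow> ennreal" where
  "riesz_kernel x y = (\<integral>\<^sup>+s\<in>{0<..}. ennreal (s powr (kap / 2 - 1) * heat s x y) \<partial>lborel)"

lemma riesz_kernel_le:
  assumes r: "0 < r" "r \<le> \<bar>norm x - norm y\<bar>"
  shows "riesz_kernel x y \<le> ennreal (r powr (- kap) * BB)"
  unfolding riesz_kernel_def BB_scale[OF r(1), symmetric]
proof (rule nn_integral_mono)
  fix s :: real
  show "ennreal (s powr (kap / 2 - 1) * heat s x y) * indicator {0<..} s \<le> ennreal (s powr (kap / 2 - 1) * exp (- s * r\<^sup>2)) * indicator {0<..} s"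
  proof (cases "0 < s")
    case True
    have "r\<^sup>2 \<le> (norm x - norm y)\<^sup>2"
      using power_mono[OF r(2), of 2] r(1) by simp
    then have "heat s x y \<le> exp (- s * r\<^sup>2)"
      using heat_le[OF True, of x y] True by (smt (verit) exp_le_cancel_iff minus_mult_left mult_left_mono neg_le_iff_le)
    then show ?thesis using True by (simp add: mult_left_mono ennreal_leI)
  qed simp
qed

text \<open>The potential without its constant, taken in the extended nonnegative reals so that
  Tonelli applies before finiteness is known.\<close>

definition NN :: "real^'n \<Rightarrow> ennreal" where
  "NN x = (\<integral>\<^sup>+s\<in>{0<..}. ennreal (s powr (kap / 2 - 1) * smoothed s x) \<partial>lborel)"

lemma measurable_heat_s [measurable]: "(\<lambda>s. heat s x y) \<in> borel_measurable borel"
  unfolding heat_def by (intro borel_measurable_continuous_onI continuous_intros continuous_EE)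

lemma riesz_tonelli:
  assumes [measurable]: "p \<in> borel_measurable borel" and p: "\<And>y. 0 \<le> p y"
  shows "(\<integral>\<^sup>+s\<in>{0<..}. ennreal (s powr (kap / 2 - 1)) * (\<integral>\<^sup>+y. ennreal (f y * heat s x y * p y) \<partial>nu) \<partial>lborel)
    = (\<integral>\<^sup>+y. ennreal (f y) * ennreal (p y) * riesz_kernel x y \<partial>nu)"
proof -
  interpret nu: sigma_finite_measure nu by (rule sigma_finite_nu)
  interpret P: pair_sigma_finite "lborel :: real measure" nu ..
  have "(\<integral>\<^sup>+s\<in>{0<..}. ennreal (s powr (kap / 2 - 1)) * (\<integral>\<^sup>+y. ennreal (f y * heat s x y * p y) \<partial>nu) \<partial>lborel)
    = (\<integral>\<^sup>+s. (\<integral>\<^sup>+y. ennreal (f y) * ennreal (p y) * (ennreal (s powr (kap / 2 - 1) * heat s x y) * indicator {0<..} s) \<partial>nu) \<partial>lborel)"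
  proof (rule nn_integral_cong)
    fix s :: real
    \<comment> \<open>\<open>f\<close> is nonnegative only almost everywhere; where it is negative
      both sides are 0, since \<open>ennreal\<close> truncates.\<close>
    have m: "ennreal (f y * heat s x y * p y) = ennreal (f y) * ennreal (p y) * ennreal (heat s x y)" for y
    proof (cases "0 \<le> f y")
      case True then show ?thesis using p[of y] heat_nonneg[of s x y] by (simp add: ennreal_mult mult_ac)
    next
      case False
      then have "f y * (heat s x y * p y) \<le> 0" using p[of y] heat_nonneg[of s x y] by (simp add: mult_le_0_iff)
      then show ?thesis using False by (simp add: ennreal_neg mult.assoc)
    qed
    show "ennreal (s powr (kap / 2 - 1)) * (\<integral>\<^sup>+y. ennreal (f y * heat s x y * p y) \<partial>nu) * indicator {0<..} s
      = (\<integral>\<^sup>+y. ennreal (f y) * ennreal (p y) * (ennreal (s powr (kap / 2 - 1) * heat s x y) * indicator {0<..} s) \<partial>nu)"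
      unfolding m
      by (subst nn_integral_cmult[symmetric], measurable, subst nn_integral_multc[symmetric], measurable)
        (simp add: ennreal_mult heat_nonneg mult_ac)
  qed
  also have "\<dots> = (\<integral>\<^sup>+y. (\<integral>\<^sup>+s. ennreal (f y) * ennreal (p y) * (ennreal (s powr (kap / 2 - 1) * heat s x y) * indicator {0<..} s) \<partial>lborel) \<partial>nu)"
    by (rule P.Fubini'[symmetric]) measurable
  also have "\<dots> = (\<integral>\<^sup>+y. ennreal (f y) * ennreal (p y) * riesz_kernel x y \<partial>nu)"
    unfolding riesz_kernel_def by (intro nn_integral_cong nn_integral_cmult) measurable
  finally show ?thesis .
qed

lemma NN_eq: "NN x = (\<integral>\<^sup>+y. ennreal (f y) * riesz_kernel x y \<partial>nu)"
proof -
  have "NN x = (\<integral>\<^sup>+s\<in>{0<..}. ennreal (s powr (kap / 2 - 1)) * (\<integral>\<^sup>+y. ennreal (f y * heat s x y * 1) \<partial>nu) \<partial>lborel)"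
    unfolding NN_def
    by (intro nn_integral_cong) (auto simp: indicator_def smoothed_nn_integral ennreal_mult)
  then show ?thesis using riesz_tonelli[of "\<lambda>_. 1" x] by simp
qed

lemma riesz_Psi_eq:
  "riesz_Psi Rp k \<alpha> f x = (\<integral>\<^sup>+y. ennreal (f y) * ennreal ((1 + norm y) powr kap) * riesz_kernel x y \<partial>nu)"
proof -
  have e: "gam + (real CARD('n) - \<alpha>) / 2 - 1 = kap / 2 - 1" by (simp add: kap_def field_simps)
  have "riesz_Psi Rp k \<alpha> f x = (\<integral>\<^sup>+s\<in>{0<..}. ennreal (s powr (kap / 2 - 1)) * (\<integral>\<^sup>+y. ennreal (f y * heat s x y * (1 + norm y) powr kap) \<partial>nu) \<partial>lborel)"
    unfolding riesz_Psi_def e kap_def[symmetric]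
    by (intro nn_integral_cong) (auto simp: indicator_def dunkl_translation_gaussian)
  also have "\<dots> = (\<integral>\<^sup>+y. ennreal (f y) * ennreal ((1 + norm y) powr kap) * riesz_kernel x y \<partial>nu)"
    by (rule riesz_tonelli) auto
  finally show ?thesis .
qed

text \<open>The first summand covers \<open>s < 1\<close>, where \<open>exp 1 * exp (- s)\<close> is
  at least 1 and the Gamma integral can be reused. The second covers \<open>s \<ge> 1\<close>, where
  \<open>s powr (- \<alpha> / 2 - 1)\<close> integrates to \<open>2 / \<alpha>\<close>.\<close>

definition "M0 = exp 1 * BB * F1 + F2 * (2 / \<alpha>)"

lemma M0_nonneg: "0 \<le> M0"
  using BB_nonneg F1 F2_nonneg alpha_pos by (simp add: M0_def)

lemma NN_le_M0: "NN x \<le> ennreal M0"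
proof -
  have "NN x \<le> (\<integral>\<^sup>+s. ennreal (exp 1 * F1) * (ennreal (s powr (kap / 2 - 1) * exp (- s)) * indicator {0<..} s)
      + ennreal F2 * (ennreal (s powr (- \<alpha> / 2 - 1)) * indicator {1..} s) \<partial>lborel)"
    unfolding NN_def
  proof (rule nn_integral_mono)
    fix s :: real
    consider "s \<le> 0" | "0 < s" "s < 1" | "1 \<le> s" by linarith
    then show "ennreal (s powr (kap / 2 - 1) * smoothed s x) * indicator {0<..} s
      \<le> ennreal (exp 1 * F1) * (ennreal (s powr (kap / 2 - 1) * exp (- s)) * indicator {0<..} s)
      + ennreal F2 * (ennreal (s powr (- \<alpha> / 2 - 1)) * indicator {1..} s)"
    proof cases
      case 2
      have "1 \<le> exp 1 * exp (- s)" using 2 by (simp add: exp_add[symmetric])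
      then have "smoothed s x * 1 \<le> F1 * (exp 1 * exp (- s))"
        using smoothed_le_F1[OF 2(1), of x] F1(2) by (intro mult_mono) auto
      then have "s powr (kap / 2 - 1) * smoothed s x \<le> (exp 1 * F1) * (s powr (kap / 2 - 1) * exp (- s))"
        using mult_left_mono[of "smoothed s x" "F1 * (exp 1 * exp (- s))" "s powr (kap / 2 - 1)"] by (simp add: mult_ac)
      then have "ennreal (s powr (kap / 2 - 1) * smoothed s x) \<le> ennreal (exp 1 * F1) * ennreal (s powr (kap / 2 - 1) * exp (- s))"
        by (subst ennreal_mult[symmetric]) (auto simp: F1 intro: ennreal_leI)
      then show ?thesis using 2 by simp
    next
      case 3
      then have s: "0 < s" by simp
      have "s powr (kap / 2 - 1) * smoothed s x \<le> s powr (kap / 2 - 1) * (F2 * s powr (- lam / 2))"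
        using smoothed_le_F2[OF s] by (intro mult_left_mono) auto
      also have "\<dots> = F2 * s powr (- \<alpha> / 2 - 1)"
      proof -
        have "s powr (kap / 2 - 1) * s powr (- lam / 2) = s powr (- \<alpha> / 2 - 1)"
          unfolding powr_add[symmetric] by (rule arg_cong2[where f = "(powr)"]) (simp_all add: kap_def field_simps)
        then show ?thesis by (simp add: mult.left_commute)
      qed
      finally have "ennreal (s powr (kap / 2 - 1) * smoothed s x) \<le> ennreal F2 * ennreal (s powr (- \<alpha> / 2 - 1))"
        by (subst ennreal_mult[symmetric]) (auto simp: F2_nonneg intro: ennreal_leI)
      then show ?thesis using 3 by (auto intro: add_increasing)
    qed simp
  qed
  also have "\<dots> = ennreal (exp 1 * F1) * (\<integral>\<^sup>+s\<in>{0<..}. ennreal (s powr (kap / 2 - 1) * exp (- s)) \<partial>lborel)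
      + ennreal F2 * (\<integral>\<^sup>+s. ennreal (s powr (- \<alpha> / 2 - 1)) * indicator {1..} s \<partial>lborel)"
    by (subst nn_integral_add; (subst nn_integral_cmult)?; (subst nn_integral_cmult)?; measurable)
  also have "(\<integral>\<^sup>+s. ennreal (s powr (- \<alpha> / 2 - 1)) * indicator {1..} s \<partial>lborel) = ennreal (0 - (- (2 / \<alpha>) * 1 powr (- \<alpha> / 2)))"
  proof (rule nn_integral_FTC_atLeast)
    fix s :: real assume "1 \<le> s"
    then have "((\<lambda>s. s powr (- \<alpha> / 2)) has_real_derivative (- \<alpha> / 2) * s powr (- \<alpha> / 2 - 1)) (at s)"
      by (intro has_real_derivative_powr) simp
    from DERIV_cmult[OF this, of "- (2 / \<alpha>)"]
    show "((\<lambda>s. - (2 / \<alpha>) * s powr (- \<alpha> / 2)) has_real_derivative s powr (- \<alpha> / 2 - 1)) (at s)"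
      using alpha_pos by simp
    show "0 \<le> s powr (- \<alpha> / 2 - 1)" by simp
  next
    have "((\<lambda>s. s powr (- \<alpha> / 2)) \<longlongrightarrow> 0) at_top"
      by (rule tendsto_neg_powr) (use alpha_pos filterlim_ident in auto)
    from tendsto_mult_left[OF this, of "- (2 / \<alpha>)"]
    show "((\<lambda>s. - (2 / \<alpha>) * s powr (- \<alpha> / 2)) \<longlongrightarrow> 0) at_top" by simp
  qed measurable
  also have "ennreal (exp 1 * F1) * (\<integral>\<^sup>+s\<in>{0<..}. ennreal (s powr (kap / 2 - 1) * exp (- s)) \<partial>lborel)
      + ennreal F2 * ennreal (0 - (- (2 / \<alpha>) * 1 powr (- \<alpha> / 2))) = ennreal M0"
    unfolding BB M0_def using F1(2) BB_nonneg F2_nonneg alpha_pos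
    by (simp add: ennreal_mult[symmetric] ennreal_plus[symmetric] mult_ac del: ennreal_plus)
  finally show ?thesis .
qed

text \<open>For a divergent integral \<open>enn2real\<close> and the Bochner integral would both
  return 0, so the identity holds without finiteness; \<open>NN_real\<close> later excludes this
  degenerate case.\<close>

lemma riesz_potential_eq:
  "riesz_potential Rp k \<alpha> (\<lambda>x. complex_of_real (f x)) x
    = of_real (2 powr (gam + real CARD('n) / 2 - \<alpha>) / Gamma (\<alpha> / 2) * enn2real (NN x))"
proof -
  interpret nu: sigma_finite_measure nu by (rule sigma_finite_nu)
  have e: "gam + (real CARD('n) - \<alpha>) / 2 - 1 = kap / 2 - 1" by (simp add: kap_def field_simps)
  let ?J = "\<lambda>s. indicator {0<..} s * (s powr (kap / 2 - 1) * smoothed s x)"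
  have J0: "0 \<le> ?J s" for s
    by (cases "0 < s") (auto simp: smoothed_nn_integral)
  have meas: "?J \<in> borel_measurable borel"
  proof -
    have "(\<lambda>s. \<integral>y. f y * heat s x y \<partial>nu) \<in> borel_measurable borel"
      by (rule nu.borel_measurable_lebesgue_integral) (simp add: case_prod_unfold, measurable)
    then have [measurable]: "(\<lambda>s. smoothed s x) \<in> borel_measurable borel" by (simp add: smoothed_def)
    show ?thesis by measurable
  qed
  have "(LINT s:{0<..}|lborel. s powr (gam + (real CARD('n) - \<alpha>) / 2 - 1) *\<^sub>R
        (LINT y|nu. complex_of_real (f y) * dunkl_translation Rp k x (gaussian s) y))
     = (\<integral>s. complex_of_real (?J s) \<partial>lborel)"
    unfolding set_lebesgue_integral_def e
  proof (rule Bochner_Integration.integral_cong[OF refl])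
    fix s :: real
    show "indicator {0<..} s *\<^sub>R s powr (kap / 2 - 1) *\<^sub>R (LINT y|nu. complex_of_real (f y) * dunkl_translation Rp k x (gaussian s) y)
      = complex_of_real (?J s)"
    proof (cases "0 < s")
      case True
      have "(LINT y|nu. complex_of_real (f y) * dunkl_translation Rp k x (gaussian s) y) = of_real (smoothed s x)"
        unfolding dunkl_translation_gaussian[OF True] smoothed_def of_real_mult[symmetric] by (rule integral_complex_of_real)
      then show ?thesis using True by (simp add: scaleR_conv_of_real)
    qed simp
  qed
  also have "\<dots> = of_real (\<integral>s. ?J s \<partial>lborel)" by (rule integral_complex_of_real)
  also have "(\<integral>s. ?J s \<partial>lborel) = enn2real (\<integral>\<^sup>+s. ennreal (?J s) \<partial>lborel)"
    by (rule integral_eq_nn_integral) (use meas J0 in auto)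
  also have "(\<integral>\<^sup>+s. ennreal (?J s) \<partial>lborel) = NN x"
    unfolding NN_def by (intro nn_integral_cong) (auto simp: indicator_def)
  finally show ?thesis unfolding riesz_potential_def by simp
qed

lemma measurable_riesz_kernel [measurable]: "riesz_kernel x \<in> borel_measurable borel"
proof -
  have [measurable]: "(\<lambda>p. heat (snd p) x (fst p)) \<in> borel_measurable (borel \<Otimes>\<^sub>M borel)"
    unfolding borel_prod heat_def by (intro borel_measurable_continuous_onI continuous_intros continuous_EE)
  have "(\<lambda>p. ennreal (snd p powr (kap / 2 - 1) * heat (snd p) x (fst p)) * indicator {0<..} (snd p))
    \<in> borel_measurable (borel \<Otimes>\<^sub>M borel)"
    by measurable
  also have "borel_measurable (borel \<Otimes>\<^sub>M borel) = borel_measurable ((borel :: (real^'n) measure) \<Otimes>\<^sub>M (lborel :: real measure))"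
    by (intro measurable_cong_sets sets_pair_measure_cong) auto
  finally have "(\<lambda>y. \<integral>\<^sup>+s. ennreal (s powr (kap / 2 - 1) * heat s x y) * indicator {0<..} s \<partial>lborel) \<in> borel_measurable borel"
    by (intro lborel.borel_measurable_nn_integral) (simp only: case_prod_unfold)
  then show ?thesis by (simp add: riesz_kernel_def[abs_def])
qed

section \<open>Two-sided comparison and the equivalence\<close>

lemma powr_NN_le:
  assumes "x \<noteq> 0"
  shows "ennreal (norm x powr kap) * NN x \<le> ennreal (2 powr kap) * riesz_Psi Rp k \<alpha> f x + ennreal (2 powr kap * BB * F1)"
proof -
  have pt: "ennreal (norm x powr kap) * riesz_kernel x y
     \<le> ennreal (2 powr kap) * (ennreal ((1 + norm y) powr kap) * riesz_kernel x y) + ennreal (2 powr kap * BB)" for y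
  proof (cases "norm x \<le> 2 * norm y")
    case True
    have "norm x powr kap \<le> (2 * (1 + norm y)) powr kap"
      using True kap_pos by (intro powr_mono2) auto
    then have "ennreal (norm x powr kap) \<le> ennreal (2 powr kap) * ennreal ((1 + norm y) powr kap)"
      unfolding powr_mult by (subst ennreal_mult[symmetric]) (auto intro: ennreal_leI)
    then have "ennreal (norm x powr kap) * riesz_kernel x y \<le> (ennreal (2 powr kap) * ennreal ((1 + norm y) powr kap)) * riesz_kernel x y"
      by (rule mult_right_mono) simp
    then show ?thesis by (simp add: mult.assoc add_increasing2)
  next
    case False
    \<comment> \<open>Here \<open>norm y < norm x / 2\<close>, so the norms differ by at least
      \<open>norm x / 2\<close>, which is positive because \<open>x\<close> is nonzero.\<close>
    have "riesz_kernel x y \<le> ennreal ((norm x / 2) powr (- kap) * BB)"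
    proof (rule riesz_kernel_le)
      show "0 < norm x / 2" using assms by simp
      show "norm x / 2 \<le> \<bar>norm x - norm y\<bar>" using False by linarith
    qed
    then have "ennreal (norm x powr kap) * riesz_kernel x y \<le> ennreal (norm x powr kap) * ennreal ((norm x / 2) powr (- kap) * BB)"
      by (rule mult_left_mono) simp
    also have "\<dots> = ennreal (2 powr kap * BB)"
      using assms by (simp add: ennreal_mult[symmetric] BB_nonneg powr_minus powr_divide field_simps)
    finally show ?thesis by (rule add_increasing[rotated]) simp
  qed
  have "ennreal (norm x powr kap) * NN x = (\<integral>\<^sup>+y. ennreal (f y) * (ennreal (norm x powr kap) * riesz_kernel x y) \<partial>nu)"
    unfolding NN_eq by (subst nn_integral_cmult[symmetric]) (auto simp: mult_ac)
  also have "\<dots> \<le> (\<integral>\<^sup>+y. ennreal (f y) * (ennreal (2 powr kap) * (ennreal ((1 + norm y) powr kap) * riesz_kernel x y) + ennreal (2 powr kap * BB)) \<partial>nu)"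
    by (intro nn_integral_mono mult_left_mono pt) simp
  also have "\<dots> = (\<integral>\<^sup>+y. ennreal (2 powr kap) * (ennreal (f y) * ennreal ((1 + norm y) powr kap) * riesz_kernel x y) + ennreal (2 powr kap * BB) * ennreal (f y) \<partial>nu)"
    by (simp add: distrib_left mult_ac)
  also have "\<dots> = ennreal (2 powr kap) * riesz_Psi Rp k \<alpha> f x + ennreal (2 powr kap * BB) * ennreal F1"
    unfolding riesz_Psi_eq F1(1)[symmetric]
    by (subst nn_integral_add; (subst nn_integral_cmult)?; (subst nn_integral_cmult)?; measurable)
  finally show ?thesis using BB_nonneg F1(2) by (simp add: ennreal_mult)
qed

lemma riesz_Psi_le:
  "riesz_Psi Rp k \<alpha> f x \<le> ennreal ((2 + 2 * norm x) powr kap) * NN x + ennreal (4 powr kap * BB * F1)"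
proof -
  have pt: "ennreal ((1 + norm y) powr kap) * riesz_kernel x y
     \<le> ennreal ((2 + 2 * norm x) powr kap) * riesz_kernel x y + ennreal (4 powr kap * BB)" for y
  \<comment> \<open>If this threshold fails, then \<open>norm y > 1\<close> and
    \<open>norm x < norm y / 2\<close>. The former gives
    \<open>1 + norm y \<le> 4 * (norm y / 2)\<close>, the origin of \<open>4 powr kap\<close>; the
    latter gives a gap of at least \<open>norm y / 2\<close>.\<close>
  proof (cases "1 + norm y \<le> 2 + 2 * norm x")
    case True
    have "(1 + norm y) powr kap \<le> (2 + 2 * norm x) powr kap"
      using True kap_pos by (intro powr_mono2) auto
    then have "ennreal ((1 + norm y) powr kap) * riesz_kernel x y \<le> ennreal ((2 + 2 * norm x) powr kap) * riesz_kernel x y"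
      by (intro mult_right_mono ennreal_leI) auto
    then show ?thesis by (simp add: add_increasing2)
  next
    case False
    then have y: "1 < norm y" "norm x < norm y / 2" using norm_ge_zero[of x] by linarith+
    have "riesz_kernel x y \<le> ennreal ((norm y / 2) powr (- kap) * BB)"
      by (rule riesz_kernel_le) (use y in auto)
    then have "ennreal ((1 + norm y) powr kap) * riesz_kernel x y \<le> ennreal ((1 + norm y) powr kap) * ennreal ((norm y / 2) powr (- kap) * BB)"
      by (rule mult_left_mono) simp
    also have "\<dots> \<le> ennreal (4 powr kap * BB)"
    proof -
      have "(1 + norm y) powr kap \<le> (4 * (norm y / 2)) powr kap" using y kap_pos by (intro powr_mono2) auto
      also have "\<dots> = 4 powr kap * (norm y / 2) powr kap" by (rule powr_mult)
      finally have "(1 + norm y) powr kap * (norm y / 2) powr (- kap) \<le> 4 powr kap * (norm y / 2) powr kap * (norm y / 2) powr (- kap)"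
        by (rule mult_right_mono) simp
      also have "\<dots> = 4 powr kap"
        using y by (auto simp: mult.assoc powr_add[symmetric])
      finally have "(1 + norm y) powr kap * (norm y / 2) powr (- kap) * BB \<le> 4 powr kap * BB"
        by (rule mult_right_mono) (rule BB_nonneg)
      then show ?thesis
        by (subst ennreal_mult[symmetric]) (auto simp: BB_nonneg mult.assoc intro: ennreal_leI)
    qed
    finally show ?thesis by (rule add_increasing[rotated]) simp
  qed
  have "riesz_Psi Rp k \<alpha> f x = (\<integral>\<^sup>+y. ennreal (f y) * (ennreal ((1 + norm y) powr kap) * riesz_kernel x y) \<partial>nu)"
    unfolding riesz_Psi_eq by (simp add: mult.assoc)
  also have "\<dots> \<le> (\<integral>\<^sup>+y. ennreal (f y) * (ennreal ((2 + 2 * norm x) powr kap) * riesz_kernel x y + ennreal (4 powr kap * BB)) \<partial>nu)"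
    by (intro nn_integral_mono mult_left_mono pt) simp
  also have "\<dots> = (\<integral>\<^sup>+y. ennreal ((2 + 2 * norm x) powr kap) * (ennreal (f y) * riesz_kernel x y) + ennreal (4 powr kap * BB) * ennreal (f y) \<partial>nu)"
    by (simp add: distrib_left mult_ac)
  also have "\<dots> = ennreal ((2 + 2 * norm x) powr kap) * NN x + ennreal (4 powr kap * BB) * ennreal F1"
    unfolding NN_eq F1(1)[symmetric]
    by (subst nn_integral_add; (subst nn_integral_cmult)?; (subst nn_integral_cmult)?; measurable)
  finally show ?thesis using BB_nonneg F1(2) by (simp add: ennreal_mult)
qed

lemma NN_real: "NN x = ennreal (enn2real (NN x))"
  using NN_le_M0[of x] by (simp add: ennreal_enn2real le_less_trans[of _ "ennreal M0"])

text \<open>The two comparison inequalities yield the two directions. Decay says something about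
  large \<open>x\<close> only, while \<open>riesz_Psi\<close> has to be bounded everywhere; on the
  remaining ball the uniform bound \<open>M0\<close> is used.\<close>

lemma riesz_decay_iff:
  "riesz_potential Rp k \<alpha> (\<lambda>x. complex_of_real (f x))
      \<in> O[at_infinity](\<lambda>x. complex_of_real (norm x powr (\<alpha> - (2 * gam + real CARD('n)))))
    \<longleftrightarrow> (\<exists>C::real. \<forall>x. riesz_Psi Rp k \<alpha> f x \<le> ennreal C)"
    (is "?L \<longleftrightarrow> ?R")
proof -
  define A where "A = 2 powr (gam + real CARD('n) / 2 - \<alpha>) / Gamma (\<alpha> / 2)"
  have A: "0 < A" using alpha_pos by (simp add: A_def Gamma_real_pos)
  define n where "n x = enn2real (NN x)" for x
  have n: "NN x = ennreal (n x)" "0 \<le> n x" "n x \<le> M0" for x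
    using NN_real[of x] NN_le_M0[of x] M0_nonneg by (auto simp: n_def enn2real_leI)
  have e: "\<alpha> - (2 * gam + real CARD('n)) = - kap" by (simp add: kap_def)
  have norm_riesz: "norm (riesz_potential Rp k \<alpha> (\<lambda>x. complex_of_real (f x)) x) = A * n x" for x
    unfolding riesz_potential_eq norm_of_real A_def[symmetric] n_def[symmetric] using A n(2)[of x] by simp
  show ?thesis
  proof
    assume ?L
    then obtain c where c: "0 < c" "\<forall>\<^sub>F x in at_infinity. A * n x \<le> c * norm x powr (- kap)"
      unfolding e by (elim landau_o.bigE) (auto simp: norm_riesz)
    then obtain b where b: "\<And>x. b \<le> norm x \<Longrightarrow> A * n x \<le> c * norm x powr (- kap)"
      by (auto simp: eventually_at_infinity)
    \<comment> \<open>A radius of at least 1 gives \<open>2 + 2 * norm x \<le> 4 * norm x\<close>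
      outside the ball.\<close>
    define b' where "b' = max b 1"
    define C where "C = max (4 powr kap * (c / A)) ((2 + 2 * b') powr kap * M0) + 4 powr kap * BB * F1"
    have "riesz_Psi Rp k \<alpha> f x \<le> ennreal C" for x
    proof -
      have le: "(2 + 2 * norm x) powr kap * n x \<le> max (4 powr kap * (c / A)) ((2 + 2 * b') powr kap * M0)"
      proof (cases "b' \<le> norm x")
        case True
        then have x: "1 \<le> norm x" "b \<le> norm x" by (auto simp: b'_def)
        have "(2 + 2 * norm x) powr kap * n x \<le> (4 * norm x) powr kap * (c / A * norm x powr (- kap))"
          using x b[OF x(2)] n(2)[of x] A kap_pos
          by (intro mult_mono powr_mono2) (auto simp: field_simps)
        also have "(4 * norm x) powr kap = 4 powr kap * norm x powr kap" by (rule powr_mult)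
        also have "4 powr kap * norm x powr kap * (c / A * norm x powr (- kap)) = 4 powr kap * (c / A) * (norm x powr kap * norm x powr (- kap))"
          by (simp only: mult_ac)
        also have "norm x powr kap * norm x powr (- kap) = 1" using x by (auto simp: powr_add[symmetric])
        finally show ?thesis by simp
      next
        case False
        then have "(2 + 2 * norm x) powr kap * n x \<le> (2 + 2 * b') powr kap * M0"
          using n[of x] kap_pos by (intro mult_mono powr_mono2) auto
        then show ?thesis by simp
      qed
      have "riesz_Psi Rp k \<alpha> f x \<le> ennreal ((2 + 2 * norm x) powr kap) * ennreal (n x) + ennreal (4 powr kap * BB * F1)"
        using riesz_Psi_le[of x] by (simp add: n(1))
      also have "\<dots> = ennreal ((2 + 2 * norm x) powr kap * n x + 4 powr kap * BB * F1)"
        using n(2)[of x] BB_nonneg F1(2) by (simp add: ennreal_mult)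
      also have "\<dots> \<le> ennreal C" unfolding C_def by (intro ennreal_leI add_right_mono le)
      finally show ?thesis .
    qed
    then show ?R by blast
  next
    assume ?R
    then obtain C where C: "\<And>x. riesz_Psi Rp k \<alpha> f x \<le> ennreal C" by blast
    \<comment> \<open>The given \<open>C\<close> may be negative; \<open>max C 0\<close> keeps the
      bound valid and makes \<open>ennreal\<close> multiplicative on it.\<close>
    define D where "D = 2 powr kap * max C 0 + 2 powr kap * BB * F1"
    have D0: "0 \<le> D" using BB_nonneg F1(2) by (simp add: D_def)
    have bound: "A * n x \<le> A * D * norm x powr (- kap)" if x: "1 \<le> norm x" for x
    proof -
      have "ennreal (norm x powr kap * n x) = ennreal (norm x powr kap) * NN x"
        using n(2)[of x] by (simp add: n(1) ennreal_mult)
      also have "\<dots> \<le> ennreal (2 powr kap) * riesz_Psi Rp k \<alpha> f x + ennreal (2 powr kap * BB * F1)"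
        by (rule powr_NN_le) (use x in auto)
      also have "\<dots> \<le> ennreal (2 powr kap) * ennreal (max C 0) + ennreal (2 powr kap * BB * F1)"
        using C[of x] by (intro add_right_mono mult_left_mono) (auto intro: order_trans ennreal_leI)
      also have "\<dots> = ennreal D"
        unfolding D_def using BB_nonneg F1(2) by (simp add: ennreal_mult)
      finally have "norm x powr kap * n x \<le> D" using D0 by simp
      then have "norm x powr (- kap) * (norm x powr kap * n x) \<le> norm x powr (- kap) * D"
        by (rule mult_left_mono) simp
      moreover have "norm x powr (- kap) * (norm x powr kap * n x) = n x"
        using x by (auto simp: mult.assoc[symmetric] powr_add[symmetric])
      ultimately have "n x \<le> norm x powr (- kap) * D" by (simp only:)
      from mult_left_mono[OF this, of A] show ?thesis using A by (simp add: mult_ac)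
    qed
    show ?L unfolding e
    proof (rule bigoI)
      show "\<forall>\<^sub>F x in at_infinity. norm (riesz_potential Rp k \<alpha> (\<lambda>x. complex_of_real (f x)) x)
          \<le> A * D * norm (complex_of_real (norm x powr (- kap)))"
        by (rule eventually_at_infinityI[of 1]) (use bound in \<open>simp add: norm_riesz\<close>)
    qed
  qed
qed

end

theorem theorem3p1:
  fixes R Rp :: "(real^'n) set" and k :: "real^'n \<Rightarrow> real"
    and \<alpha> :: real and f :: "real^'n \<Rightarrow> real"
  assumes "root_system R" and "positive_subsystem R Rp" and "multiplicity_function R k"
    and "0 < \<alpha>" and "\<alpha> < 2 * dunkl_gamma Rp k + real CARD('n)"
    and "(\<lambda>x. complex_of_real (f x)) \<in> dunkl_A Rp k"
    and "AE x in dunkl_measure Rp k. f x \<ge> 0"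
  shows "riesz_potential Rp k \<alpha> (\<lambda>x. complex_of_real (f x))
           \<in> O[at_infinity](\<lambda>x. complex_of_real
               (norm x powr (\<alpha> - (2 * dunkl_gamma Rp k + real CARD('n)))))
         \<longleftrightarrow> (\<exists>C::real. \<forall>x. riesz_Psi Rp k \<alpha> f x \<le> ennreal C)"
proof -
  interpret dunkl_riesz R Rp k \<alpha> f
    using assms by unfold_locales
  show ?thesis by (rule riesz_decay_iff)
qed

end
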